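(* Let $B$ be a finite right hereditary left regular band monoid and $\Bbbk$ a field. Then $\Bbbk B$ is hereditary. Its quiver has vertex set $\Lambda(B)$. The number of arrows from $X$ to $Y$ is zero if $X\not<Y$; otherwise it is one less than the number of children of $y$ whose support is greater than or equal to $X$, for any $y\in B$ with $\sigma(y)=Y$.
   Context: A left regular band is a semigroup $B$ with $x^2=x$ and $xyx=xy$ for all $x,y$; here $B$ is finite with identity. The $\mathcal R$-order is $a\leq b$ iff $ba=a$. $B$ is right hereditary if the Hasse diagram of the $\mathcal R$-order is a tree (rooted at $1$); the children of $y$ are the elements covered by $y$ in this order. $\Lambda(B)=\{Ba:a\in B\}$ ordered by inclusion, with support map $\sigma(a)=Ba$; vertices of the quiver of $\Bbbk B$ are identified with $\Lambda(B)$ via the simple modules $\Bbbk_X$, on which $b$ acts by $1$ if $\sigma(b)\ge X$ and by $0$ otherwise. An algebra is hereditary if its global dimension is at most $1$. *)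

theory Defs
  imports "HOL-Algebra.Algebra" "HOL-Library.Extended_Nat"
    "Jordan_Normal_Form.Missing_VectorSpace"
begin

text \<open>The locale \<^locale>\<open>module\<close> requires a commutative ring of scalars; its record type is
  reused here.  As usual for this record, the ring multiplication and unit of a module are
  irrelevant.\<close>

locale left_module = R?: ring R + M?: abelian_group M
  for R :: "('a, 'c) ring_scheme" (structure) and M :: "('a, 'm, 'e) module_scheme" (structure) +
  assumes lm_smult_closed:
      "\<lbrakk>a \<in> carrier R; x \<in> carrier M\<rbrakk> \<Longrightarrow> a \<odot>\<^bsub>M\<^esub> x \<in> carrier M"
    and lm_smult_l_distr:
      "\<lbrakk>a \<in> carrier R; b \<in> carrier R; x \<in> carrier M\<rbrakk> \<Longrightarrow>
        (a \<oplus>\<^bsub>R\<^esub> b) \<odot>\<^bsub>M\<^esub> x = a \<odot>\<^bsub>M\<^esub> x \<oplus>\<^bsub>M\<^esub> b \<odot>\<^bsub>M\<^esub> x"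
    and lm_smult_r_distr:
      "\<lbrakk>a \<in> carrier R; x \<in> carrier M; y \<in> carrier M\<rbrakk> \<Longrightarrow>
        a \<odot>\<^bsub>M\<^esub> (x \<oplus>\<^bsub>M\<^esub> y) = a \<odot>\<^bsub>M\<^esub> x \<oplus>\<^bsub>M\<^esub> a \<odot>\<^bsub>M\<^esub> y"
    and lm_smult_assoc:
      "\<lbrakk>a \<in> carrier R; b \<in> carrier R; x \<in> carrier M\<rbrakk> \<Longrightarrow>
        (a \<otimes>\<^bsub>R\<^esub> b) \<odot>\<^bsub>M\<^esub> x = a \<odot>\<^bsub>M\<^esub> (b \<odot>\<^bsub>M\<^esub> x)"
    and lm_smult_one:
      "x \<in> carrier M \<Longrightarrow> \<one>\<^bsub>R\<^esub> \<odot>\<^bsub>M\<^esub> x = x"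

text \<open>Homomorphisms are extensional, so that they are determined by their values on the carrier.\<close>

definition lmod_hom ::
  "('a, 'c) ring_scheme \<Rightarrow> ('a, 'm) module \<Rightarrow> ('a, 'n) module \<Rightarrow> ('m \<Rightarrow> 'n) set" where
  "lmod_hom R M N = {f \<in> carrier M \<rightarrow>\<^sub>E carrier N.
     (\<forall>x\<in>carrier M. \<forall>y\<in>carrier M. f (x \<oplus>\<^bsub>M\<^esub> y) = f x \<oplus>\<^bsub>N\<^esub> f y) \<and>
     (\<forall>a\<in>carrier R. \<forall>x\<in>carrier M. f (a \<odot>\<^bsub>M\<^esub> x) = a \<odot>\<^bsub>N\<^esub> f x)}"

definition lmod_iso ::
  "('a, 'c) ring_scheme \<Rightarrow> ('a, 'm) module \<Rightarrow> ('a, 'n) module \<Rightarrow> bool" where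
  "lmod_iso R M N \<longleftrightarrow> (\<exists>f\<in>lmod_hom R M N. bij_betw f (carrier M) (carrier N))"

definition left_submodule ::
  "('a, 'c) ring_scheme \<Rightarrow> 'm set \<Rightarrow> ('a, 'm) module \<Rightarrow> bool" where
  "left_submodule R N M \<longleftrightarrow> additive_subgroup N M \<and>
     (\<forall>a\<in>carrier R. \<forall>x\<in>N. a \<odot>\<^bsub>M\<^esub> x \<in> N)"

definition simple_module :: "('a, 'c) ring_scheme \<Rightarrow> ('a, 'm) module \<Rightarrow> bool" where
  "simple_module R M \<longleftrightarrow> left_module R M \<and> carrier M \<noteq> {\<zero>\<^bsub>M\<^esub>} \<and>
     (\<forall>N. left_submodule R N M \<longrightarrow> N = {\<zero>\<^bsub>M\<^esub>} \<or> N = carrier M)"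

definition free_module :: "('a, 'c) ring_scheme \<Rightarrow> 'i set \<Rightarrow> ('a, 'i \<Rightarrow> 'a) module" where
  "free_module R I =
     \<lparr>carrier = {f \<in> I \<rightarrow>\<^sub>E carrier R. finite {i \<in> I. f i \<noteq> \<zero>\<^bsub>R\<^esub>}},
      monoid.mult = (\<lambda>_ _. \<lambda>i\<in>I. \<zero>\<^bsub>R\<^esub>), one = (\<lambda>i\<in>I. \<zero>\<^bsub>R\<^esub>),
      ring.zero = (\<lambda>i\<in>I. \<zero>\<^bsub>R\<^esub>),
      add = (\<lambda>f g. \<lambda>i\<in>I. f i \<oplus>\<^bsub>R\<^esub> g i),
      smult = (\<lambda>a f. \<lambda>i\<in>I. a \<otimes>\<^bsub>R\<^esub> f i)\<rparr>"

text \<open>Projective means: direct summand of a free module.  Index sets inside the type of the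
  elements of \<open>P\<close> suffice, because a direct summand of some free module is also a direct summand
  of the free module on its own carrier.\<close>

definition projective_module :: "('a, 'c) ring_scheme \<Rightarrow> ('a, 'p) module \<Rightarrow> bool" where
  "projective_module R P \<longleftrightarrow> left_module R P \<and>
     (\<exists>(I :: 'p set) s r. s \<in> lmod_hom R P (free_module R I) \<and>
        r \<in> lmod_hom R (free_module R I) P \<and> (\<forall>x\<in>carrier P. r (s x) = x))"

text \<open>The exact sequence \<open>\<dots> \<rightarrow> P 2 \<rightarrow> P 1 \<rightarrow> P 0 \<rightarrow> M \<rightarrow> 0\<close> with differentials
  \<open>d n : P (n + 1) \<rightarrow> P n\<close> and augmentation \<open>e : P 0 \<rightarrow> M\<close>.\<close>

definition projective_resolution ::
  "('a, 'c) ring_scheme \<Rightarrow> ('a, 'm) module \<Rightarrow> (nat \<Rightarrow> ('a, 'p) module) \<Rightarrow> (nat \<Rightarrow> 'p \<Rightarrow> 'p) \<Rightarrow>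
   ('p \<Rightarrow> 'm) \<Rightarrow> bool" where
  "projective_resolution R M P d e \<longleftrightarrow>
     (\<forall>n. projective_module R (P n)) \<and>
     e \<in> lmod_hom R (P 0) M \<and> (\<forall>n. d n \<in> lmod_hom R (P (Suc n)) (P n)) \<and>
     e ` carrier (P 0) = carrier M \<and>
     d 0 ` carrier (P 1) = {x \<in> carrier (P 0). e x = \<zero>\<^bsub>M\<^esub>} \<and>
     (\<forall>n. d (Suc n) ` carrier (P (Suc (Suc n))) =
            {x \<in> carrier (P (Suc n)). d n x = \<zero>\<^bsub>P n\<^esub>})"

text \<open>The modules of a resolution are taken with elements in the type of lists over \<open>'m \<times> 'a\<close>.
  This type is infinite and at least as large as \<open>'m\<close> and \<open>'a\<close>, so it has room for
  an isomorphic copy of the free module on any of its subsets, and hence of every stage of a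
  resolution: restricting to it affects neither existence nor minimal length of resolutions.\<close>

definition proj_dim :: "('a, 'c) ring_scheme \<Rightarrow> ('a, 'm) module \<Rightarrow> enat" where
  "proj_dim R M = Inf {enat n | n.
     \<exists>(P :: nat \<Rightarrow> ('a, ('m \<times> 'a) list) module) d e.
        projective_resolution R M P d e \<and> (\<forall>i>n. carrier (P i) = {\<zero>\<^bsub>P i\<^esub>})}"

text \<open>A supremum over all modules needs a type for their elements; statements about
  \<open>gl_dim TYPE('m) R\<close> are meant for arbitrary \<open>'m\<close>.\<close>

definition gl_dim :: "'m itself \<Rightarrow> ('a, 'c) ring_scheme \<Rightarrow> enat" where
  "gl_dim _ R = (SUP M \<in> {M :: ('a, 'm) module. left_module R M}. proj_dim R M)"

definition hereditary :: "'m itself \<Rightarrow> ('a, 'c) ring_scheme \<Rightarrow> bool" where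
  "hereditary T R \<longleftrightarrow> gl_dim T R \<le> 1"

text \<open>A \<open>K\<close>-algebra \<open>A\<close> is given by a module record whose ring part is the ring \<open>A\<close>; its scalar
  multiplication makes each \<open>A\<close>-module a \<open>K\<close>-vector space via \<open>c \<mapsto> c \<odot> 1\<close>.\<close>

definition hom_space ::
  "('k, 'a) module \<Rightarrow> ('a, 'm) module \<Rightarrow> ('a, 'n) module \<Rightarrow> ('k, 'm \<Rightarrow> 'n) module" where
  "hom_space A M N =
     \<lparr>carrier = lmod_hom A M N,
      monoid.mult = (\<lambda>_ _. \<lambda>x\<in>carrier M. \<zero>\<^bsub>N\<^esub>), one = (\<lambda>x\<in>carrier M. \<zero>\<^bsub>N\<^esub>),
      ring.zero = (\<lambda>x\<in>carrier M. \<zero>\<^bsub>N\<^esub>),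
      add = (\<lambda>f g. \<lambda>x\<in>carrier M. f x \<oplus>\<^bsub>N\<^esub> g x),
      smult = (\<lambda>c f. \<lambda>x\<in>carrier M. (c \<odot>\<^bsub>A\<^esub> \<one>\<^bsub>A\<^esub>) \<odot>\<^bsub>N\<^esub> f x)\<rparr>"

definition quotient_space :: "('k, 'v) module \<Rightarrow> 'v set \<Rightarrow> ('k, 'v set) module" where
  "quotient_space V W =
     \<lparr>carrier = a_rcosets\<^bsub>V\<^esub> W, monoid.mult = (\<lambda>_ _. W), one = W, ring.zero = W,
      add = (\<lambda>S T. S <+>\<^bsub>V\<^esub> T),
      smult = (\<lambda>c S. \<Union>x\<in>S. W +>\<^bsub>V\<^esub> (c \<odot>\<^bsub>V\<^esub> x))\<rparr>"

definition cocycles ::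
  "('k, 'a) module \<Rightarrow> (nat \<Rightarrow> ('a, 'p) module) \<Rightarrow> (nat \<Rightarrow> 'p \<Rightarrow> 'p) \<Rightarrow> ('a, 'n) module \<Rightarrow> nat \<Rightarrow>
   ('p \<Rightarrow> 'n) set" where
  "cocycles A P d N n = {f \<in> lmod_hom A (P n) N.
     compose (carrier (P (Suc n))) f (d n) = \<zero>\<^bsub>hom_space A (P (Suc n)) N\<^esub>}"

fun coboundaries ::
  "('k, 'a) module \<Rightarrow> (nat \<Rightarrow> ('a, 'p) module) \<Rightarrow> (nat \<Rightarrow> 'p \<Rightarrow> 'p) \<Rightarrow> ('a, 'n) module \<Rightarrow> nat \<Rightarrow>
   ('p \<Rightarrow> 'n) set" where
  "coboundaries A P d N 0 = {\<zero>\<^bsub>hom_space A (P 0) N\<^esub>}"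
| "coboundaries A P d N (Suc n) =
     (\<lambda>f. compose (carrier (P (Suc n))) f (d n)) ` lmod_hom A (P n) N"

definition cohomology ::
  "('k, 'a) module \<Rightarrow> (nat \<Rightarrow> ('a, 'p) module) \<Rightarrow> (nat \<Rightarrow> 'p \<Rightarrow> 'p) \<Rightarrow> ('a, 'n) module \<Rightarrow> nat \<Rightarrow>
   ('k, ('p \<Rightarrow> 'n) set) module" where
  "cohomology A P d N n =
     quotient_space ((hom_space A (P n) N)\<lparr>carrier := cocycles A P d N n\<rparr>)
       (coboundaries A P d N n)"

text \<open>\<open>Ext_space A n M N\<close> is the \<open>n\<close>-th cohomology of \<open>Hom(P, N)\<close>, where \<open>P\<close> is a chosen projective
  resolution of \<open>M\<close>; another choice yields an isomorphic space.\<close>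

definition Ext_space ::
  "('k, 'a) module \<Rightarrow> nat \<Rightarrow> ('a, 'm) module \<Rightarrow> ('a, 'n) module \<Rightarrow>
   ('k, (('m \<times> 'a) list \<Rightarrow> 'n) set) module" where
  "Ext_space A n M N =
     (let (P, d, e) = (SOME (P, d, e). projective_resolution A M P d e) in cohomology A P d N n)"

text \<open>The vertices \<open>V\<close>, labelled by \<open>S\<close>, are the isomorphism classes of simple \<open>A\<close>-modules, and the
  number \<open>q v w\<close> of arrows from \<open>v\<close> to \<open>w\<close> is the dimension of \<open>Ext\<^sup>1(S v, S w)\<close>.  Finite
  dimensionality is demanded separately because \<^const>\<open>vectorspace.dim\<close> is meaningless without it.\<close>

definition is_quiver ::
  "'m itself \<Rightarrow> ('k, 'c) ring_scheme \<Rightarrow> ('k, 'a) module \<Rightarrow> 'v set \<Rightarrow> ('v \<Rightarrow> ('a, 's) module) \<Rightarrow>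
   ('v \<Rightarrow> 'v \<Rightarrow> nat) \<Rightarrow> bool" where
  "is_quiver _ K A V S q \<longleftrightarrow>
     (\<forall>v\<in>V. simple_module A (S v)) \<and>
     (\<forall>v\<in>V. \<forall>w\<in>V. lmod_iso A (S v) (S w) \<longrightarrow> v = w) \<and>
     (\<forall>M :: ('a, 'm) module. simple_module A M \<longrightarrow> (\<exists>v\<in>V. lmod_iso A M (S v))) \<and>
     (\<forall>v\<in>V. \<forall>w\<in>V. let E = Ext_space A 1 (S v) (S w) in
        vectorspace K E \<and> vectorspace.fin_dim K E \<and> vectorspace.dim K E = q v w)"

locale left_regular_band_monoid = monoid B for B (structure) +
  assumes idem: "x \<in> carrier B \<Longrightarrow> x \<otimes> x = x"
    and left_regular: "\<lbrakk>x \<in> carrier B; y \<in> carrier B\<rbrakk> \<Longrightarrow> x \<otimes> y \<otimes> x = x \<otimes> y"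

definition R_le :: "('b, 'c) monoid_scheme \<Rightarrow> 'b \<Rightarrow> 'b \<Rightarrow> bool" where
  "R_le B a b \<longleftrightarrow> b \<otimes>\<^bsub>B\<^esub> a = a"

definition R_less :: "('b, 'c) monoid_scheme \<Rightarrow> 'b \<Rightarrow> 'b \<Rightarrow> bool" where
  "R_less B a b \<longleftrightarrow> R_le B a b \<and> a \<noteq> b"

definition children :: "('b, 'c) monoid_scheme \<Rightarrow> 'b \<Rightarrow> 'b set" where
  "children B y = {z \<in> carrier B. R_less B z y \<and>
     \<not> (\<exists>w\<in>carrier B. R_less B z w \<and> R_less B w y)}"

definition hasse_edges :: "('b, 'c) monoid_scheme \<Rightarrow> ('b \<times> 'b) set" where
  "hasse_edges B = {(x, y). x \<in> carrier B \<and> y \<in> carrier B \<and>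
     (x \<in> children B y \<or> y \<in> children B x)}"

text \<open>An undirected simple graph is a symmetric irreflexive relation \<open>E\<close> on a vertex set \<open>V\<close>.  A
  cycle is listed by its at least three distinct vertices.\<close>

definition is_tree :: "'v set \<Rightarrow> ('v \<times> 'v) set \<Rightarrow> bool" where
  "is_tree V E \<longleftrightarrow> V \<noteq> {} \<and> (\<forall>u\<in>V. \<forall>v\<in>V. (u, v) \<in> E\<^sup>*) \<and>
     \<not> (\<exists>vs. 3 \<le> length vs \<and> distinct vs \<and> set vs \<subseteq> V \<and>
           (\<forall>i<length vs. (vs ! i, vs ! (Suc i mod length vs)) \<in> E))"

text \<open>No condition is needed for the root: \<open>\<one>\<close> is the greatest element of the order.\<close>

definition right_hereditary :: "('b, 'c) monoid_scheme \<Rightarrow> bool" where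
  "right_hereditary B \<longleftrightarrow> is_tree (carrier B) (hasse_edges B)"

definition supp :: "('b, 'c) monoid_scheme \<Rightarrow> 'b \<Rightarrow> 'b set" where
  "supp B a = (\<lambda>b. b \<otimes>\<^bsub>B\<^esub> a) ` carrier B"

definition support_lattice :: "('b, 'c) monoid_scheme \<Rightarrow> 'b set set" where
  "support_lattice B = supp B ` carrier B"

text \<open>For finite \<open>B\<close> the formal linear combinations are all functions \<open>B \<rightarrow> K\<close>.\<close>

definition monoid_algebra ::
  "('k, 'c) ring_scheme \<Rightarrow> ('b, 'd) monoid_scheme \<Rightarrow> ('k, 'b \<Rightarrow> 'k) module" where
  "monoid_algebra K B =
     \<lparr>carrier = carrier B \<rightarrow>\<^sub>E carrier K,
      monoid.mult = (\<lambda>f g. \<lambda>c\<in>carrier B.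
        \<Oplus>\<^bsub>K\<^esub>p\<in>{p \<in> carrier B \<times> carrier B. fst p \<otimes>\<^bsub>B\<^esub> snd p = c}.
          f (fst p) \<otimes>\<^bsub>K\<^esub> g (snd p)),
      one = (\<lambda>b\<in>carrier B. if b = \<one>\<^bsub>B\<^esub> then \<one>\<^bsub>K\<^esub> else \<zero>\<^bsub>K\<^esub>),
      ring.zero = (\<lambda>b\<in>carrier B. \<zero>\<^bsub>K\<^esub>),
      add = (\<lambda>f g. \<lambda>b\<in>carrier B. f b \<oplus>\<^bsub>K\<^esub> g b),
      smult = (\<lambda>k f. \<lambda>b\<in>carrier B. k \<otimes>\<^bsub>K\<^esub> f b)\<rparr>"

text \<open>The field \<open>K\<close> with \<open>b\<close> acting by 1 if \<open>supp B b \<supseteq> S\<close> and by 0 otherwise, extended linearly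
  from \<open>B\<close> to the monoid algebra.\<close>

definition support_module ::
  "('k, 'c) ring_scheme \<Rightarrow> ('b, 'd) monoid_scheme \<Rightarrow> 'b set \<Rightarrow> ('b \<Rightarrow> 'k, 'k) module" where
  "support_module K B S =
     \<lparr>carrier = carrier K, monoid.mult = monoid.mult K, one = \<one>\<^bsub>K\<^esub>, ring.zero = \<zero>\<^bsub>K\<^esub>, add = add K,
      smult = (\<lambda>f v. (\<Oplus>\<^bsub>K\<^esub>b\<in>carrier B.
        f b \<otimes>\<^bsub>K\<^esub> (if S \<subseteq> supp B b then \<one>\<^bsub>K\<^esub> else \<zero>\<^bsub>K\<^esub>)) \<otimes>\<^bsub>K\<^esub> v)\<rparr>"

end

theory Submission
  imports Defs
begin

text \<open>Let \<open>M\<close> be a module.  The direct sum \<open>G\<close> of the spaces \<open>b M\<close>, \<open>b \<in> B\<close>, is a module that maps onto \<open>M\<close> by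
  summation.  As the Hasse diagram is a tree, the kernel \<open>E\<close> is the direct sum, over the edges from \<open>z\<close> to its parent
  \<open>p\<close>, of the spaces of differences \<open>(m at z) - (m at p)\<close> with \<open>m \<in> z M\<close>.  On both modules \<open>B\<close> acts triangularly with respect to
  supports, and this allows a section of the multiplication map \<open>A \<otimes>\<^sub>K N \<rightarrow> N\<close> to be constructed by recursion on
  the rank of the support.  So \<open>0 \<rightarrow> E \<rightarrow> G \<rightarrow> M \<rightarrow> 0\<close> is a projective resolution and \<open>A\<close> is hereditary.

  A simple module is one-dimensional, because a monoid element of minimal support among those acting nontrivially acts
  as the identity.  \<open>Ext\<^sup>1\<close> of the simple modules of \<open>U\<close> and \<open>W\<close> is computed from an arbitrary projective resolution as the space of maps
  \<open>\<delta> : B \<rightarrow> K\<close> with \<open>\<delta>(a b) = \<chi>\<^sub>W(a) \<delta>(b) + \<delta>(a) \<chi>\<^sub>U(b)\<close> modulo the multiples of \<open>\<chi>\<^sub>W - \<chi>\<^sub>U\<close>.  If \<open>U \<subset> W\<close>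
  and \<open>y\<close> has support \<open>W\<close>, such a map is determined by its values on the children of \<open>y\<close> with support above \<open>U\<close>,
  where the values are arbitrary and the multiples of \<open>\<chi>\<^sub>W - \<chi>\<^sub>U\<close> are the constants.  If \<open>U \<subset> W\<close> fails, every such map is
  a multiple of \<open>\<chi>\<^sub>W - \<chi>\<^sub>U\<close>.\<close>

section \<open>Left modules\<close>

text \<open>\<open>M\<close> is an arbitrary module, so dimension counts are of no use and
  projectivity is shown by an explicit splitting. One criterion serves \<open>G\<close> and
  \<open>E\<close>. Each piece of the module is labelled by a monoid element, an edge by its upper
  end \<open>p\<close>. The label has to be \<open>p\<close>: if the support of \<open>a\<close>
  contains that of \<open>p\<close>, then \<open>w \<mapsto> a w\<close> is an order isomorphism
  from the elements below \<open>p\<close> onto those below \<open>a p\<close>, with inverse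
  \<open>w \<mapsto> p w\<close>, so edges under \<open>p\<close> go to edges. For other
  \<open>a\<close> an edge may become a path of several edges or collapse, but all upper ends of the
  path lie below \<open>a p\<close>.

  The tree property is used in two forms: the elements above a given one form a chain, which yields
  the edge decomposition and its triangularity; and an element strictly below \<open>y\<close> lies
  under just one child of \<open>y\<close>, which yields derivations with prescribed values on the
  children.

  \<open>Ext_space\<close> picks its resolution by Hilbert choice. The explicit resolution therefore
  only ensures that there is one in the required type, and the computation of the cohomology must
  work for every resolution.\<close>

lemma (in abelian_monoid) finsum_swap:
  assumes "finite S" "finite T" "\<And>x y. x \<in> S \<Longrightarrow> y \<in> T \<Longrightarrow> f x y \<in> carrier G"
  shows "(\<Oplus>x\<in>S. \<Oplus>y\<in>T. f x y) = (\<Oplus>y\<in>T. \<Oplus>x\<in>S. f x y)"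
  using assms(1,3)
proof (induction S rule: finite_induct)
  case empty
  then show ?case by simp
next
  case (insert a S)
  have "(\<Oplus>x\<in>insert a S. \<Oplus>y\<in>T. f x y) = (\<Oplus>y\<in>T. f a y) \<oplus> (\<Oplus>x\<in>S. \<Oplus>y\<in>T. f x y)"
    using insert by (subst finsum_insert) (auto intro!: finsum_closed)
  also have "\<dots> = (\<Oplus>y\<in>T. f a y) \<oplus> (\<Oplus>y\<in>T. \<Oplus>x\<in>S. f x y)"
    using insert by simp
  also have "\<dots> = (\<Oplus>y\<in>T. f a y \<oplus> (\<Oplus>x\<in>S. f x y))"
    using insert by (subst finsum_addf) (auto intro!: finsum_closed)
  also have "\<dots> = (\<Oplus>y\<in>T. \<Oplus>x\<in>insert a S. f x y)"
    using insert by (intro finsum_cong') (auto simp: finsum_insert intro!: finsum_closed)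
  finally show ?case .
qed

lemma (in abelian_monoid) finsum_delta:
  assumes "finite S" "c \<in> S" "f c \<in> carrier G" "\<And>b. b \<in> S \<Longrightarrow> b \<noteq> c \<Longrightarrow> f b = \<zero>"
  shows "finsum G f S = f c"
proof -
  have "finsum G f {c} = finsum G f S"
    by (rule add.finprod_mono_neutral_cong_left) (use assms in \<open>auto simp: Pi_iff, metis zero_closed\<close>)
  then show ?thesis using assms(3) by simp
qed

text \<open>Stated for bare additive maps, so that it also covers evaluation at a point, scalar
  multiplication, and the identity between two records with the same addition.\<close>

lemma finsum_additive:
  assumes "abelian_group G" "abelian_group H" "finite S"
    and "\<And>x. x \<in> S \<Longrightarrow> f x \<in> carrier G"
    and "\<And>x. x \<in> carrier G \<Longrightarrow> h x \<in> carrier H"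
    and "\<And>x y. x \<in> carrier G \<Longrightarrow> y \<in> carrier G \<Longrightarrow> h (x \<oplus>\<^bsub>G\<^esub> y) = h x \<oplus>\<^bsub>H\<^esub> h y"
  shows "h (finsum G f S) = finsum H (\<lambda>x. h (f x)) S"
proof -
  interpret G: abelian_group G by fact
  interpret H: abelian_group H by fact
  have z: "h \<zero>\<^bsub>G\<^esub> = \<zero>\<^bsub>H\<^esub>"
    by (metis G.r_zero G.zero_closed H.add.r_cancel_one' assms(5,6))
  show ?thesis using assms(3,4)
  proof (induction S rule: finite_induct)
    case (insert a S)
    then show ?case using assms(5,6)
      by (simp add: G.finsum_insert H.finsum_insert Pi_iff)
  qed (simp add: z)
qed

context left_module
begin

lemma lm_zero_l [simp]: "x \<in> carrier M \<Longrightarrow> \<zero>\<^bsub>R\<^esub> \<odot>\<^bsub>M\<^esub> x = \<zero>\<^bsub>M\<^esub>"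
  by (metis R.r_zero R.zero_closed M.add.r_cancel_one' lm_smult_closed lm_smult_l_distr)

lemma lm_zero_r [simp]: "a \<in> carrier R \<Longrightarrow> a \<odot>\<^bsub>M\<^esub> \<zero>\<^bsub>M\<^esub> = \<zero>\<^bsub>M\<^esub>"
  by (metis M.r_zero M.zero_closed M.add.r_cancel_one' lm_smult_closed lm_smult_r_distr)

lemma lm_minus_r: "a \<in> carrier R \<Longrightarrow> x \<in> carrier M \<Longrightarrow> a \<odot>\<^bsub>M\<^esub> (\<ominus>\<^bsub>M\<^esub> x) = \<ominus>\<^bsub>M\<^esub> (a \<odot>\<^bsub>M\<^esub> x)"
  by (metis M.add.inv_closed M.minus_equality M.l_neg lm_smult_closed lm_smult_r_distr lm_zero_r)

lemma lm_minus_l: "a \<in> carrier R \<Longrightarrow> x \<in> carrier M \<Longrightarrow> (\<ominus>\<^bsub>R\<^esub> a) \<odot>\<^bsub>M\<^esub> x = \<ominus>\<^bsub>M\<^esub> (a \<odot>\<^bsub>M\<^esub> x)"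
  by (metis M.minus_equality R.add.inv_closed R.l_neg lm_smult_closed lm_smult_l_distr lm_zero_l)

lemma lm_diff_r: "a \<in> carrier R \<Longrightarrow> x \<in> carrier M \<Longrightarrow> y \<in> carrier M \<Longrightarrow>
    a \<odot>\<^bsub>M\<^esub> (x \<ominus>\<^bsub>M\<^esub> y) = a \<odot>\<^bsub>M\<^esub> x \<ominus>\<^bsub>M\<^esub> a \<odot>\<^bsub>M\<^esub> y"
  by (simp add: M.minus_eq lm_smult_r_distr lm_minus_r)

lemma lm_diff_l: "a \<in> carrier R \<Longrightarrow> b \<in> carrier R \<Longrightarrow> x \<in> carrier M \<Longrightarrow>
    (a \<ominus>\<^bsub>R\<^esub> b) \<odot>\<^bsub>M\<^esub> x = a \<odot>\<^bsub>M\<^esub> x \<ominus>\<^bsub>M\<^esub> b \<odot>\<^bsub>M\<^esub> x"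
  by (simp add: M.minus_eq R.minus_eq lm_smult_l_distr lm_minus_l)

lemma lm_finsum_r: "finite S \<Longrightarrow> a \<in> carrier R \<Longrightarrow> (\<And>i. i \<in> S \<Longrightarrow> f i \<in> carrier M) \<Longrightarrow>
    a \<odot>\<^bsub>M\<^esub> (\<Oplus>\<^bsub>M\<^esub>i\<in>S. f i) = (\<Oplus>\<^bsub>M\<^esub>i\<in>S. a \<odot>\<^bsub>M\<^esub> f i)"
  by (rule finsum_additive[OF M.abelian_group_axioms M.abelian_group_axioms])
    (auto simp: lm_smult_closed lm_smult_r_distr)

lemma lm_finsum_l: "finite S \<Longrightarrow> x \<in> carrier M \<Longrightarrow> (\<And>i. i \<in> S \<Longrightarrow> f i \<in> carrier R) \<Longrightarrow>
    (\<Oplus>\<^bsub>R\<^esub>i\<in>S. f i) \<odot>\<^bsub>M\<^esub> x = (\<Oplus>\<^bsub>M\<^esub>i\<in>S. f i \<odot>\<^bsub>M\<^esub> x)"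
  by (rule finsum_additive[OF R.is_abelian_group M.abelian_group_axioms])
    (auto simp: lm_smult_closed lm_smult_l_distr)

end

text \<open>The law \<open>s0\<close> takes the place of additive inverses, which then arise as
  \<open>(-1) x\<close>.\<close>

lemma left_moduleI:
  fixes M :: "('a, 'm) module"
  assumes "ring R"
    and z: "\<zero>\<^bsub>M\<^esub> \<in> carrier M"
    and ac: "\<And>x y. x \<in> carrier M \<Longrightarrow> y \<in> carrier M \<Longrightarrow> x \<oplus>\<^bsub>M\<^esub> y \<in> carrier M"
    and as: "\<And>x y z. x \<in> carrier M \<Longrightarrow> y \<in> carrier M \<Longrightarrow> z \<in> carrier M \<Longrightarrow>
      x \<oplus>\<^bsub>M\<^esub> y \<oplus>\<^bsub>M\<^esub> z = x \<oplus>\<^bsub>M\<^esub> (y \<oplus>\<^bsub>M\<^esub> z)"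
    and co: "\<And>x y. x \<in> carrier M \<Longrightarrow> y \<in> carrier M \<Longrightarrow> x \<oplus>\<^bsub>M\<^esub> y = y \<oplus>\<^bsub>M\<^esub> x"
    and zl: "\<And>x. x \<in> carrier M \<Longrightarrow> \<zero>\<^bsub>M\<^esub> \<oplus>\<^bsub>M\<^esub> x = x"
    and sc: "\<And>a x. a \<in> carrier R \<Longrightarrow> x \<in> carrier M \<Longrightarrow> a \<odot>\<^bsub>M\<^esub> x \<in> carrier M"
    and sl: "\<And>a b x. a \<in> carrier R \<Longrightarrow> b \<in> carrier R \<Longrightarrow> x \<in> carrier M \<Longrightarrow>
      (a \<oplus>\<^bsub>R\<^esub> b) \<odot>\<^bsub>M\<^esub> x = a \<odot>\<^bsub>M\<^esub> x \<oplus>\<^bsub>M\<^esub> b \<odot>\<^bsub>M\<^esub> x"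
    and sr: "\<And>a x y. a \<in> carrier R \<Longrightarrow> x \<in> carrier M \<Longrightarrow> y \<in> carrier M \<Longrightarrow>
      a \<odot>\<^bsub>M\<^esub> (x \<oplus>\<^bsub>M\<^esub> y) = a \<odot>\<^bsub>M\<^esub> x \<oplus>\<^bsub>M\<^esub> a \<odot>\<^bsub>M\<^esub> y"
    and sa: "\<And>a b x. a \<in> carrier R \<Longrightarrow> b \<in> carrier R \<Longrightarrow> x \<in> carrier M \<Longrightarrow>
      (a \<otimes>\<^bsub>R\<^esub> b) \<odot>\<^bsub>M\<^esub> x = a \<odot>\<^bsub>M\<^esub> (b \<odot>\<^bsub>M\<^esub> x)"
    and so: "\<And>x. x \<in> carrier M \<Longrightarrow> \<one>\<^bsub>R\<^esub> \<odot>\<^bsub>M\<^esub> x = x"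
    and s0: "\<And>x. x \<in> carrier M \<Longrightarrow> \<zero>\<^bsub>R\<^esub> \<odot>\<^bsub>M\<^esub> x = \<zero>\<^bsub>M\<^esub>"
  shows "left_module R M"
proof -
  interpret ring R by fact
  have "abelian_group M"
  proof (rule abelian_groupI)
    fix x assume x: "x \<in> carrier M"
    have "(\<ominus>\<^bsub>R\<^esub> \<one>\<^bsub>R\<^esub>) \<odot>\<^bsub>M\<^esub> x \<oplus>\<^bsub>M\<^esub> x = (\<ominus>\<^bsub>R\<^esub> \<one>\<^bsub>R\<^esub> \<oplus>\<^bsub>R\<^esub> \<one>\<^bsub>R\<^esub>) \<odot>\<^bsub>M\<^esub> x"
      using x by (subst sl) (auto simp: so)
    then have "(\<ominus>\<^bsub>R\<^esub> \<one>\<^bsub>R\<^esub>) \<odot>\<^bsub>M\<^esub> x \<oplus>\<^bsub>M\<^esub> x = \<zero>\<^bsub>M\<^esub>" using s0 x by (simp add: l_neg)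
    then show "\<exists>y\<in>carrier M. y \<oplus>\<^bsub>M\<^esub> x = \<zero>\<^bsub>M\<^esub>" using sc x by blast
  qed (use assms in auto)
  then show ?thesis using assms by (intro left_module.intro left_module_axioms.intro) auto
qed

lemma lmod_homD:
  assumes "f \<in> lmod_hom R M N"
  shows "\<And>x. x \<in> carrier M \<Longrightarrow> f x \<in> carrier N"
    and "\<And>x y. x \<in> carrier M \<Longrightarrow> y \<in> carrier M \<Longrightarrow> f (x \<oplus>\<^bsub>M\<^esub> y) = f x \<oplus>\<^bsub>N\<^esub> f y"
    and "\<And>a x. a \<in> carrier R \<Longrightarrow> x \<in> carrier M \<Longrightarrow> f (a \<odot>\<^bsub>M\<^esub> x) = a \<odot>\<^bsub>N\<^esub> f x"
    and "f \<in> extensional (carrier M)"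
  using assms unfolding lmod_hom_def by (auto simp: PiE_iff)

lemma lmod_homI:
  assumes "\<And>x. x \<in> carrier M \<Longrightarrow> f x \<in> carrier N"
    and "\<And>x y. x \<in> carrier M \<Longrightarrow> y \<in> carrier M \<Longrightarrow> f (x \<oplus>\<^bsub>M\<^esub> y) = f x \<oplus>\<^bsub>N\<^esub> f y"
    and "\<And>a x. a \<in> carrier R \<Longrightarrow> x \<in> carrier M \<Longrightarrow> f (a \<odot>\<^bsub>M\<^esub> x) = a \<odot>\<^bsub>N\<^esub> f x"
    and "f \<in> extensional (carrier M)"
  shows "f \<in> lmod_hom R M N"
  using assms unfolding lmod_hom_def by (auto simp: PiE_iff)

lemma lmod_hom_restrictI:
  assumes "left_module R M"
    and "\<And>x. x \<in> carrier M \<Longrightarrow> f x \<in> carrier N"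
    and "\<And>x y. x \<in> carrier M \<Longrightarrow> y \<in> carrier M \<Longrightarrow> f (x \<oplus>\<^bsub>M\<^esub> y) = f x \<oplus>\<^bsub>N\<^esub> f y"
    and "\<And>a x. a \<in> carrier R \<Longrightarrow> x \<in> carrier M \<Longrightarrow> f (a \<odot>\<^bsub>M\<^esub> x) = a \<odot>\<^bsub>N\<^esub> f x"
  shows "restrict f (carrier M) \<in> lmod_hom R M N"
proof -
  interpret left_module R M by fact
  show ?thesis using assms by (intro lmod_homI) (auto simp: lm_smult_closed)
qed

lemma lmod_hom_compose:
  assumes "left_module R M" "f \<in> lmod_hom R M N" "g \<in> lmod_hom R N P"
  shows "compose (carrier M) g f \<in> lmod_hom R M P"
  unfolding compose_def
  by (rule lmod_hom_restrictI[OF assms(1)]) (auto simp: lmod_homD[OF assms(2)] lmod_homD[OF assms(3)])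

lemma lmod_hom_zero:
  assumes "left_module R M" "left_module R N" "f \<in> lmod_hom R M N"
  shows "f \<zero>\<^bsub>M\<^esub> = \<zero>\<^bsub>N\<^esub>"
proof -
  interpret M: left_module R M by fact
  interpret N: left_module R N by fact
  show ?thesis
    using lmod_homD(3)[OF assms(3), of "\<zero>\<^bsub>R\<^esub>" "\<zero>\<^bsub>M\<^esub>"] lmod_homD(1)[OF assms(3)] by simp
qed

lemma lmod_hom_minus:
  assumes "left_module R M" "left_module R N" "f \<in> lmod_hom R M N"
    and "x \<in> carrier M" "y \<in> carrier M"
  shows "f (x \<ominus>\<^bsub>M\<^esub> y) = f x \<ominus>\<^bsub>N\<^esub> f y"
proof -
  interpret M: left_module R M by fact
  interpret N: left_module R N by fact
  note f = lmod_homD[OF assms(3)]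
  have "f (\<ominus>\<^bsub>M\<^esub> y) \<oplus>\<^bsub>N\<^esub> f y = \<zero>\<^bsub>N\<^esub>"
    using f(2)[of "\<ominus>\<^bsub>M\<^esub> y" y] assms(5) lmod_hom_zero[OF assms(1-3)] by (simp add: M.M.l_neg)
  then have "f (\<ominus>\<^bsub>M\<^esub> y) = \<ominus>\<^bsub>N\<^esub> f y" using f(1) assms(5)
    by (metis N.M.minus_equality M.M.a_inv_closed)
  then show ?thesis using f(2) assms(4,5) by (simp add: M.M.minus_eq N.M.minus_eq)
qed

lemma lmod_hom_finsum:
  assumes "left_module R M" "left_module R N" "f \<in> lmod_hom R M N" "finite S"
    and "\<And>x. x \<in> S \<Longrightarrow> g x \<in> carrier M"
  shows "f (finsum M g S) = finsum N (\<lambda>x. f (g x)) S"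
proof -
  interpret M: left_module R M by fact
  interpret N: left_module R N by fact
  show ?thesis
    by (rule finsum_additive[OF M.M.abelian_group_axioms N.M.abelian_group_axioms assms(4,5)])
      (auto simp: lmod_homD[OF assms(3)])
qed

lemma left_submodule_left_module:
  assumes "left_module R M" "left_submodule R N M"
  shows "left_module R (M\<lparr>carrier := N\<rparr>)"
proof -
  interpret M: left_module R M by fact
  interpret N: additive_subgroup N M using assms(2) by (simp add: left_submodule_def)
  have sub: "N \<subseteq> carrier M" by (rule N.a_subset)
  have s: "\<And>x. x \<in> N \<Longrightarrow> x \<in> carrier M" using sub by blast
  show ?thesis
    using assms(2)
    by (intro left_moduleI)
      (auto simp: left_submodule_def M.R.ring_axioms M.lm_smult_l_distr M.lm_smult_r_distr M.M.a_ac
        M.lm_smult_assoc M.lm_smult_one s)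
qed

lemma left_submoduleI:
  assumes "left_module R M" "N \<subseteq> carrier M" "\<zero>\<^bsub>M\<^esub> \<in> N"
    and "\<And>x y. x \<in> N \<Longrightarrow> y \<in> N \<Longrightarrow> x \<oplus>\<^bsub>M\<^esub> y \<in> N"
    and "\<And>a x. a \<in> carrier R \<Longrightarrow> x \<in> N \<Longrightarrow> a \<odot>\<^bsub>M\<^esub> x \<in> N"
  shows "left_submodule R N M"
proof -
  interpret M: left_module R M by fact
  have "\<ominus>\<^bsub>M\<^esub> x \<in> N" if "x \<in> N" for x
  proof -
    have "\<ominus>\<^bsub>M\<^esub> x = (\<ominus>\<^bsub>R\<^esub> \<one>\<^bsub>R\<^esub>) \<odot>\<^bsub>M\<^esub> x"
      using that assms(2) by (subst M.lm_minus_l) (auto simp: M.lm_smult_one)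
    then show ?thesis using assms(5) that by simp
  qed
  then show ?thesis using assms
    by (auto simp: left_submodule_def additive_subgroup_def subgroup_def a_inv_def[symmetric])
qed

lemma lmod_hom_kernel:
  assumes "left_module R M" "left_module R N" "f \<in> lmod_hom R M N"
  shows "left_submodule R {x \<in> carrier M. f x = \<zero>\<^bsub>N\<^esub>} M"
proof -
  interpret M: left_module R M by fact
  interpret N: left_module R N by fact
  show ?thesis
    by (rule left_submoduleI[OF assms(1)])
      (auto simp: lmod_homD[OF assms(3)] lmod_hom_zero[OF assms] M.lm_smult_closed)
qed

section \<open>Free and projective modules\<close>

lemma free_module_simps:
  "carrier (free_module R I) = {f \<in> I \<rightarrow>\<^sub>E carrier R. finite {i \<in> I. f i \<noteq> \<zero>\<^bsub>R\<^esub>}}"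
  "\<zero>\<^bsub>free_module R I\<^esub> = (\<lambda>i\<in>I. \<zero>\<^bsub>R\<^esub>)"
  "f \<oplus>\<^bsub>free_module R I\<^esub> g = (\<lambda>i\<in>I. f i \<oplus>\<^bsub>R\<^esub> g i)"
  "a \<odot>\<^bsub>free_module R I\<^esub> f = (\<lambda>i\<in>I. a \<otimes>\<^bsub>R\<^esub> f i)"
  by (simp_all add: free_module_def)

lemma left_module_free_module:
  assumes "ring R"
  shows "left_module R (free_module R I)"
proof -
  interpret ring R by fact
  have fin_add: "finite {i \<in> I. f i \<oplus>\<^bsub>R\<^esub> g i \<noteq> \<zero>\<^bsub>R\<^esub>}"
    if "f \<in> carrier (free_module R I)" "g \<in> carrier (free_module R I)" for f g
  proof -
    have "{i \<in> I. f i \<oplus>\<^bsub>R\<^esub> g i \<noteq> \<zero>\<^bsub>R\<^esub>} \<subseteq> {i \<in> I. f i \<noteq> \<zero>\<^bsub>R\<^esub>} \<union> {i \<in> I. g i \<noteq> \<zero>\<^bsub>R\<^esub>}" by auto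
    moreover have "finite ({i \<in> I. f i \<noteq> \<zero>\<^bsub>R\<^esub>} \<union> {i \<in> I. g i \<noteq> \<zero>\<^bsub>R\<^esub>})"
      using that by (simp add: free_module_simps)
    ultimately show ?thesis by (rule finite_subset)
  qed
  have fin_smult: "finite {i \<in> I. a \<otimes>\<^bsub>R\<^esub> f i \<noteq> \<zero>\<^bsub>R\<^esub>}"
    if "f \<in> carrier (free_module R I)" "a \<in> carrier R" for f a
  proof -
    have "{i \<in> I. a \<otimes>\<^bsub>R\<^esub> f i \<noteq> \<zero>\<^bsub>R\<^esub>} \<subseteq> {i \<in> I. f i \<noteq> \<zero>\<^bsub>R\<^esub>}" using that by auto
    then show ?thesis using that by (auto simp: free_module_simps intro: finite_subset)
  qed
  show ?thesis
  proof (rule left_moduleI)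
    show "\<zero>\<^bsub>free_module R I\<^esub> \<oplus>\<^bsub>free_module R I\<^esub> x = x" "\<one>\<^bsub>R\<^esub> \<odot>\<^bsub>free_module R I\<^esub> x = x"
      if "x \<in> carrier (free_module R I)" for x
      using that by (auto simp: free_module_simps PiE_iff extensional_def fun_eq_iff)
    show "x \<oplus>\<^bsub>free_module R I\<^esub> y \<in> carrier (free_module R I)"
      if "x \<in> carrier (free_module R I)" "y \<in> carrier (free_module R I)" for x y
      using fin_add[OF that] that
      by (auto simp: free_module_simps PiE_iff cong: conj_cong)
    show "a \<odot>\<^bsub>free_module R I\<^esub> x \<in> carrier (free_module R I)"
      if "a \<in> carrier R" "x \<in> carrier (free_module R I)" for a x
      using fin_smult[OF that(2,1)] that
      by (auto simp: free_module_simps PiE_iff cong: conj_cong)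
  qed (auto simp: free_module_simps PiE_iff a_ac m_assoc l_distr r_distr ring_axioms
        intro!: restrict_ext cong: conj_cong)
qed

definition free_gen :: "('a, 'c) ring_scheme \<Rightarrow> 'i set \<Rightarrow> 'i \<Rightarrow> 'i \<Rightarrow> 'a" where
  "free_gen R I i = (\<lambda>j\<in>I. if j = i then \<one>\<^bsub>R\<^esub> else \<zero>\<^bsub>R\<^esub>)"

definition free_ext ::
  "('a, 'c) ring_scheme \<Rightarrow> ('a, 'm) module \<Rightarrow> 'i set \<Rightarrow> ('i \<Rightarrow> 'm) \<Rightarrow> ('i \<Rightarrow> 'a) \<Rightarrow> 'm" where
  "free_ext R M I g = (\<lambda>f\<in>carrier (free_module R I).
     \<Oplus>\<^bsub>M\<^esub>i\<in>{i \<in> I. f i \<noteq> \<zero>\<^bsub>R\<^esub>}. f i \<odot>\<^bsub>M\<^esub> g i)"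

lemma free_gen_closed:
  assumes "ring R"
  shows "free_gen R I i \<in> carrier (free_module R I)"
proof -
  interpret ring R by fact
  have "{j \<in> I. free_gen R I i j \<noteq> \<zero>\<^bsub>R\<^esub>} \<subseteq> {i}" by (auto simp: free_gen_def)
  then have "finite {j \<in> I. free_gen R I i j \<noteq> \<zero>\<^bsub>R\<^esub>}" by (rule finite_subset) simp
  then show ?thesis by (auto simp: free_module_simps free_gen_def)
qed

text \<open>Two functions have different supports; additivity of \<open>free_ext\<close> is checked
  over a common finite superset of both.\<close>

lemma free_ext_superset:
  assumes M: "left_module R M" and f: "f \<in> carrier (free_module R I)" and g: "\<And>i. i \<in> I \<Longrightarrow> g i \<in> carrier M"
    and S: "finite S" "{i \<in> I. f i \<noteq> \<zero>\<^bsub>R\<^esub>} \<subseteq> S" "S \<subseteq> I"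
  shows "free_ext R M I g f = (\<Oplus>\<^bsub>M\<^esub>i\<in>S. f i \<odot>\<^bsub>M\<^esub> g i)"
proof -
  interpret left_module R M by fact
  have c: "\<And>i. i \<in> S \<Longrightarrow> f i \<in> carrier R \<and> g i \<in> carrier M"
    using f g S(3) by (auto simp: free_module_simps)
  have "(\<Oplus>\<^bsub>M\<^esub>i\<in>{i \<in> I. f i \<noteq> \<zero>\<^bsub>R\<^esub>}. f i \<odot>\<^bsub>M\<^esub> g i) = (\<Oplus>\<^bsub>M\<^esub>i\<in>S. f i \<odot>\<^bsub>M\<^esub> g i)"
    by (rule M.add.finprod_mono_neutral_cong_left) (use S c in \<open>auto intro: lm_smult_closed\<close>)
  then show ?thesis using f by (simp add: free_ext_def)
qed

lemma free_ext_hom: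
  assumes M: "left_module R M" and g: "\<And>i. i \<in> I \<Longrightarrow> g i \<in> carrier M"
  shows "free_ext R M I g \<in> lmod_hom R (free_module R I) M"
proof -
  interpret left_module R M by fact
  interpret F: left_module R "free_module R I"
    by (rule left_module_free_module[OF R.ring_axioms])
  let ?s = "\<lambda>f. {i \<in> I. f i \<noteq> \<zero>\<^bsub>R\<^esub>}"
  have fs: "finite (?s f)" if "f \<in> carrier (free_module R I)" for f
    using that by (simp add: free_module_simps)
  have fc: "f i \<in> carrier R" if "f \<in> carrier (free_module R I)" "i \<in> I" for f i
    using that by (auto simp: free_module_simps)
  show ?thesis
  proof (rule lmod_homI)
    fix x assume x: "x \<in> carrier (free_module R I)"
    show "free_ext R M I g x \<in> carrier M"
      using x fc[OF x] g by (auto simp: free_ext_def intro!: M.finsum_closed lm_smult_closed)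
  next
    fix x y assume x: "x \<in> carrier (free_module R I)" and y: "y \<in> carrier (free_module R I)"
    let ?S = "?s x \<union> ?s y"
    have S: "finite ?S" "?S \<subseteq> I" using fs[OF x] fs[OF y] by auto
    have "free_ext R M I g (x \<oplus>\<^bsub>free_module R I\<^esub> y)
        = (\<Oplus>\<^bsub>M\<^esub>i\<in>?S. (x \<oplus>\<^bsub>free_module R I\<^esub> y) i \<odot>\<^bsub>M\<^esub> g i)"
      using S x y by (intro free_ext_superset[OF M] F.M.a_closed g) (auto simp: free_module_simps)
    also have "\<dots> = (\<Oplus>\<^bsub>M\<^esub>i\<in>?S. x i \<odot>\<^bsub>M\<^esub> g i \<oplus>\<^bsub>M\<^esub> y i \<odot>\<^bsub>M\<^esub> g i)"
      using fc x y g
      by (intro M.finsum_cong') (auto simp: free_module_simps lm_smult_l_distr intro!: M.a_closed lm_smult_closed)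
    also have "\<dots> = (\<Oplus>\<^bsub>M\<^esub>i\<in>?S. x i \<odot>\<^bsub>M\<^esub> g i) \<oplus>\<^bsub>M\<^esub> (\<Oplus>\<^bsub>M\<^esub>i\<in>?S. y i \<odot>\<^bsub>M\<^esub> g i)"
      using fc x y g by (intro M.finsum_addf) (auto intro: lm_smult_closed)
    also have "(\<Oplus>\<^bsub>M\<^esub>i\<in>?S. x i \<odot>\<^bsub>M\<^esub> g i) = free_ext R M I g x"
      using S x g by (intro free_ext_superset[OF M, symmetric]) auto
    also have "(\<Oplus>\<^bsub>M\<^esub>i\<in>?S. y i \<odot>\<^bsub>M\<^esub> g i) = free_ext R M I g y"
      using S y g by (intro free_ext_superset[OF M, symmetric]) auto
    finally show "free_ext R M I g (x \<oplus>\<^bsub>free_module R I\<^esub> y)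
        = free_ext R M I g x \<oplus>\<^bsub>M\<^esub> free_ext R M I g y" .
  next
    fix a x assume a: "a \<in> carrier R" and x: "x \<in> carrier (free_module R I)"
    have "free_ext R M I g (a \<odot>\<^bsub>free_module R I\<^esub> x)
        = (\<Oplus>\<^bsub>M\<^esub>i\<in>?s x. (a \<odot>\<^bsub>free_module R I\<^esub> x) i \<odot>\<^bsub>M\<^esub> g i)"
      using fs[OF x] x a by (intro free_ext_superset[OF M] F.lm_smult_closed g) (auto simp: free_module_simps)
    also have "\<dots> = (\<Oplus>\<^bsub>M\<^esub>i\<in>?s x. a \<odot>\<^bsub>M\<^esub> (x i \<odot>\<^bsub>M\<^esub> g i))"
      using fc[OF x] g a
      by (intro M.finsum_cong') (auto simp: free_module_simps lm_smult_assoc intro: lm_smult_closed)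
    also have "\<dots> = a \<odot>\<^bsub>M\<^esub> (\<Oplus>\<^bsub>M\<^esub>i\<in>?s x. x i \<odot>\<^bsub>M\<^esub> g i)"
      using fc[OF x] g a fs[OF x] by (intro lm_finsum_r[symmetric]) (auto intro: lm_smult_closed)
    finally show "free_ext R M I g (a \<odot>\<^bsub>free_module R I\<^esub> x) = a \<odot>\<^bsub>M\<^esub> free_ext R M I g x"
      using x by (simp add: free_ext_def)
  qed (simp add: free_ext_def)
qed

lemma free_ext_gen:
  assumes M: "left_module R M" and g: "\<And>i. i \<in> I \<Longrightarrow> g i \<in> carrier M" and i: "i \<in> I"
  shows "free_ext R M I g (free_gen R I i) = g i"
proof -
  interpret left_module R M by fact
  have "free_ext R M I g (free_gen R I i) = (\<Oplus>\<^bsub>M\<^esub>j\<in>{i}. free_gen R I i j \<odot>\<^bsub>M\<^esub> g j)"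
    using i g by (intro free_ext_superset[OF M] free_gen_closed R.ring_axioms) (auto simp: free_gen_def)
  then show ?thesis using i g by (simp add: free_gen_def lm_smult_one)
qed

lemma free_module_expand:
  assumes R: "ring R" and f: "f \<in> carrier (free_module R I)"
  shows "f = (\<Oplus>\<^bsub>free_module R I\<^esub>i\<in>{i \<in> I. f i \<noteq> \<zero>\<^bsub>R\<^esub>}. f i \<odot>\<^bsub>free_module R I\<^esub> free_gen R I i)"
    (is "f = finsum ?F ?u ?S")
proof -
  interpret R: ring R by fact
  interpret F: left_module R ?F by (rule left_module_free_module[OF R])
  have fin: "finite ?S" and fc: "\<And>i. i \<in> I \<Longrightarrow> f i \<in> carrier R"
    using f by (auto simp: free_module_simps)
  have u: "\<And>i. i \<in> ?S \<Longrightarrow> ?u i \<in> carrier ?F"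
    using f by (intro F.lm_smult_closed free_gen_closed R) (auto simp: free_module_simps)
  have c: "finsum ?F ?u ?S \<in> carrier ?F" using u by (intro F.M.finsum_closed) auto
  have "finsum ?F ?u ?S j = f j" if j: "j \<in> I" for j
  proof -
    have "finsum ?F ?u ?S j = (\<Oplus>\<^bsub>R\<^esub>i\<in>?S. ?u i j)"
      by (rule finsum_additive[OF F.M.abelian_group_axioms R.is_abelian_group fin, where h = "\<lambda>f. f j"])
        (use j u in \<open>auto simp: free_module_simps\<close>)
    also have "\<dots> = f j"
    proof (cases "j \<in> ?S")
      case True
      then have "(\<Oplus>\<^bsub>R\<^esub>i\<in>?S. ?u i j) = ?u j j"
        using fin f j by (intro R.finsum_delta) (auto simp: free_module_simps free_gen_def fc)
      then show ?thesis using fc[OF j] j by (auto simp: free_module_simps free_gen_def)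
    next
      case False
      then have "f j = \<zero>\<^bsub>R\<^esub>" using j by auto
      moreover have "(\<Oplus>\<^bsub>R\<^esub>i\<in>?S. ?u i j) = \<zero>\<^bsub>R\<^esub>"
        using False f j by (intro R.add.finprod_one_eqI) (auto simp: free_module_simps free_gen_def fc)
      ultimately show ?thesis by simp
    qed
    finally show ?thesis .
  qed
  then show ?thesis using f c
    by (intro extensionalityI[of _ I]) (auto simp: free_module_simps PiE_iff)
qed

lemma free_hom_eqI:
  assumes "left_module R M" "f \<in> lmod_hom R (free_module R I) M" "g \<in> lmod_hom R (free_module R I) M"
    and eq: "\<And>i. i \<in> I \<Longrightarrow> f (free_gen R I i) = g (free_gen R I i)"
    and x: "x \<in> carrier (free_module R I)"
  shows "f x = g x"
proof -
  interpret M: left_module R M by fact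
  note R = M.R.ring_axioms
  interpret F: left_module R "free_module R I" by (rule left_module_free_module[OF R])
  let ?S = "{i \<in> I. x i \<noteq> \<zero>\<^bsub>R\<^esub>}"
  have xc: "\<And>i. i \<in> I \<Longrightarrow> x i \<in> carrier R" and fin: "finite ?S"
    using x by (auto simp: free_module_simps)
  have h: "h x = (\<Oplus>\<^bsub>M\<^esub>i\<in>?S. x i \<odot>\<^bsub>M\<^esub> h (free_gen R I i))"
    if "h \<in> lmod_hom R (free_module R I) M" for h
  proof -
    have "h x = h (\<Oplus>\<^bsub>free_module R I\<^esub>i\<in>?S. x i \<odot>\<^bsub>free_module R I\<^esub> free_gen R I i)"
      using free_module_expand[OF R x] by simp
    also have "\<dots> = (\<Oplus>\<^bsub>M\<^esub>i\<in>?S. h (x i \<odot>\<^bsub>free_module R I\<^esub> free_gen R I i))"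
      by (rule lmod_hom_finsum[OF F.left_module_axioms assms(1) that fin])
        (auto intro!: F.lm_smult_closed free_gen_closed R xc)
    also have "\<dots> = (\<Oplus>\<^bsub>M\<^esub>i\<in>?S. x i \<odot>\<^bsub>M\<^esub> h (free_gen R I i))"
      by (rule M.M.finsum_cong')
        (auto simp: lmod_homD[OF that] free_gen_closed[OF R] xc intro!: M.lm_smult_closed)
    finally show ?thesis .
  qed
  show ?thesis unfolding h[OF assms(2)] h[OF assms(3)]
    by (rule M.M.finsum_cong')
      (auto simp: eq lmod_homD[OF assms(3)] free_gen_closed[OF R] xc intro!: M.lm_smult_closed)
qed

text \<open>On the free module, \<open>f\<close> after \<open>r\<close> is lifted by choosing
  preimages of the values at the generators. Composing this lift with \<open>s\<close> gives the
  lift of \<open>f\<close>, because \<open>r\<close> after \<open>s\<close> is the identity.\<close>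

lemma free_retract_lifting:
  assumes P: "left_module R P" and E: "left_module R E" and M: "left_module R M"
    and s: "s \<in> lmod_hom R P (free_module R I)" and r: "r \<in> lmod_hom R (free_module R I) P"
    and rs: "\<And>x. x \<in> carrier P \<Longrightarrow> r (s x) = x"
    and p: "p \<in> lmod_hom R E M" and surj: "p ` carrier E = carrier M"
    and f: "f \<in> lmod_hom R P M"
  obtains h where "h \<in> lmod_hom R P E" "\<And>x. x \<in> carrier P \<Longrightarrow> p (h x) = f x"
proof -
  interpret E: left_module R E by fact
  note R = E.R.ring_axioms
  have F: "left_module R (free_module R I)" by (rule left_module_free_module[OF R])
  define g where "g i = inv_into (carrier E) p (f (r (free_gen R I i)))" for i
  have c: "f (r (free_gen R I i)) \<in> p ` carrier E" for i
    unfolding surj by (intro lmod_homD(1)[OF f] lmod_homD(1)[OF r] free_gen_closed R)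
  have g: "g i \<in> carrier E" "p (g i) = f (r (free_gen R I i))" for i
    using inv_into_into[OF c] f_inv_into_f[OF c] by (auto simp: g_def)
  have gh: "free_ext R E I g \<in> lmod_hom R (free_module R I) E" by (rule free_ext_hom[OF E]) (rule g)
  let ?h = "compose (carrier P) (free_ext R E I g) s"
  show thesis
  proof (rule that)
    show "?h \<in> lmod_hom R P E" by (rule lmod_hom_compose[OF P s gh])
    fix x assume x: "x \<in> carrier P"
    have sx: "s x \<in> carrier (free_module R I)" by (rule lmod_homD(1)[OF s x])
    have "compose (carrier (free_module R I)) p (free_ext R E I g) (s x)
        = compose (carrier (free_module R I)) f r (s x)"
      by (rule free_hom_eqI[OF M _ _ _ sx])
        (auto simp: compose_eq free_gen_closed[OF R] free_ext_gen[OF E] g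
          intro: lmod_hom_compose[OF F gh p] lmod_hom_compose[OF F r f])
    then show "p (?h x) = f x" using x sx rs by (simp add: compose_eq)
  qed
qed

lemma projective_module_lifting:
  fixes P :: "('a, 'p) module"
  assumes "projective_module R P" and E: "left_module R E" and M: "left_module R M"
    and p: "p \<in> lmod_hom R E M" "p ` carrier E = carrier M"
    and f: "f \<in> lmod_hom R P M"
  obtains h where "h \<in> lmod_hom R P E" "\<And>x. x \<in> carrier P \<Longrightarrow> p (h x) = f x"
proof -
  from assms(1) obtain I :: "'p set" and s r where
    "left_module R P" "s \<in> lmod_hom R P (free_module R I)" "r \<in> lmod_hom R (free_module R I) P"
    "\<forall>x\<in>carrier P. r (s x) = x"
    unfolding projective_module_def by blast
  then show thesis using free_retract_lifting[OF _ E M _ _ _ p f, of s I r] that by blast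
qed

text \<open>The index set \<open>I\<close> may have any type here, unlike in \<^const>\<open>projective_module\<close>.\<close>

lemma projective_module_free_retract:
  assumes P: "left_module R P"
    and s: "s \<in> lmod_hom R P (free_module R I)" and r: "r \<in> lmod_hom R (free_module R I) P"
    and rs: "\<And>x. x \<in> carrier P \<Longrightarrow> r (s x) = x"
  shows "projective_module R P"
proof -
  interpret P: left_module R P by fact
  note R = P.R.ring_axioms
  let ?I = "carrier P"
  have F: "left_module R (free_module R ?I)" by (rule left_module_free_module[OF R])
  have p: "free_ext R P ?I (\<lambda>x. x) \<in> lmod_hom R (free_module R ?I) P"
    by (rule free_ext_hom[OF P]) simp
  have "x \<in> free_ext R P ?I (\<lambda>x. x) ` carrier (free_module R ?I)" if "x \<in> ?I" for x
    using free_ext_gen[OF P, of ?I "\<lambda>x. x" x] that free_gen_closed[OF R, of ?I x] by force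
  then have surj: "free_ext R P ?I (\<lambda>x. x) ` carrier (free_module R ?I) = carrier P"
    using lmod_homD(1)[OF p] by blast
  have i: "restrict (\<lambda>x. x) (carrier P) \<in> lmod_hom R P P"
    by (rule lmod_hom_restrictI[OF P]) auto
  \<comment> \<open>Lifting the identity of \<open>P\<close> along the surjection from the free
    module on its own carrier gives the section with an index set of the right type.\<close>
  from free_retract_lifting[OF P F P s r rs p surj i] obtain h where
    "h \<in> lmod_hom R P (free_module R ?I)"
    "\<And>x. x \<in> carrier P \<Longrightarrow> free_ext R P ?I (\<lambda>x. x) (h x) = restrict (\<lambda>x. x) (carrier P) x"
    by blast
  then show ?thesis using P p unfolding projective_module_def by (metis restrict_apply')
qed

lemma projective_module_retract:
  fixes P :: "('a, 'p) module"
  assumes "projective_module R P" and Q: "left_module R Q"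
    and u: "u \<in> lmod_hom R Q P" and v: "v \<in> lmod_hom R P Q"
    and vu: "\<And>x. x \<in> carrier Q \<Longrightarrow> v (u x) = x"
  shows "projective_module R Q"
proof -
  from assms(1) obtain I :: "'p set" and s r where P: "left_module R P"
    and s: "s \<in> lmod_hom R P (free_module R I)" and r: "r \<in> lmod_hom R (free_module R I) P"
    and rs: "\<forall>x\<in>carrier P. r (s x) = x"
    unfolding projective_module_def by blast
  interpret P: left_module R P by fact
  have F: "left_module R (free_module R I)" by (rule left_module_free_module[OF P.R.ring_axioms])
  show ?thesis
  proof (rule projective_module_free_retract[OF Q])
    show "compose (carrier Q) s u \<in> lmod_hom R Q (free_module R I)" by (rule lmod_hom_compose[OF Q u s])
    show "compose (carrier (free_module R I)) v r \<in> lmod_hom R (free_module R I) Q"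
      by (rule lmod_hom_compose[OF F r v])
    show "compose (carrier (free_module R I)) v r (compose (carrier Q) s u x) = x"
      if "x \<in> carrier Q" for x
      using that rs vu lmod_homD(1)[OF u that] lmod_homD(1)[OF s, OF lmod_homD(1)[OF u that]]
      by (simp add: compose_eq)
  qed
qed

lemma projective_module_zero:
  fixes P :: "('a, 'p) module"
  assumes P: "left_module R P" and z: "carrier P = {\<zero>\<^bsub>P\<^esub>}"
  shows "projective_module R P"
proof -
  interpret P: left_module R P by fact
  interpret F: left_module R "free_module R {} :: ('a, 'p \<Rightarrow> 'a) module"
    by (rule left_module_free_module[OF P.R.ring_axioms])
  let ?F = "free_module R ({} :: 'p set)"
  show ?thesis
  proof (rule projective_module_free_retract[OF P, of _ "{} :: 'p set"])
    show "restrict (\<lambda>_. \<zero>\<^bsub>?F\<^esub>) (carrier P) \<in> lmod_hom R P ?F"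
      by (rule lmod_hom_restrictI[OF P]) auto
    show "restrict (\<lambda>_. \<zero>\<^bsub>P\<^esub>) (carrier ?F) \<in> lmod_hom R ?F P"
      by (rule lmod_hom_restrictI[OF F.left_module_axioms]) (auto simp: z)
  qed (auto simp: z)
qed

section \<open>Vector spaces\<close>

lemma (in abelian_group) diff_zero_imp_eq:
  assumes "x \<in> carrier G" "y \<in> carrier G" "x \<ominus> y = \<zero>"
  shows "x = y"
  using assms by (metis a_inv_closed minus_eq minus_equality minus_minus)

lemma left_module_imp_module:
  assumes "left_module R M" "cring R"
  shows "module R M"
proof -
  interpret left_module R M by fact
  show ?thesis using assms(2)
    by (intro module.intro module_axioms.intro M.abelian_group_axioms)
      (auto simp: lm_smult_l_distr lm_smult_r_distr lm_smult_assoc lm_smult_one lm_smult_closed)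
qed

lemma module_imp_left_module:
  assumes "module R M"
  shows "left_module R M"
proof -
  interpret module R M by fact
  show ?thesis
    by (intro left_module.intro left_module_axioms.intro abelian_group_axioms R.ring_axioms)
      (auto simp: smult_l_distr smult_r_distr smult_assoc1 smult_one)
qed

text \<open>Zorn's lemma, as the dimension may be infinite. A linear dependence involves finitely
  many vectors, so the union of a chain of independent sets is independent; a vector outside the
  span of a maximal independent set could be added to it.\<close>

lemma (in vectorspace) maximal_lin_indpt_exists:
  obtains I where "I \<subseteq> carrier V" "lin_indpt I" "span I = carrier V"
proof -
  let ?A = "{I. I \<subseteq> carrier V \<and> lin_indpt I}"
  have "\<exists>I\<in>?A. \<forall>J\<in>?A. I \<subseteq> J \<longrightarrow> J = I"
  proof (rule subset_Zorn')
    fix C assume C: "subset.chain ?A C"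
    have "lin_indpt (\<Union>C)"
    proof
      assume "lin_dep (\<Union>C)"
      then obtain A a v where A: "finite A" "A \<subseteq> \<Union>C" "a \<in> A \<rightarrow> carrier K"
        "lincomb a A = \<zero>\<^bsub>V\<^esub>" "v \<in> A" "a v \<noteq> \<zero>\<^bsub>K\<^esub>"
        unfolding lin_dep_def by blast
      have "C \<noteq> {}" using A by auto
      then obtain S where "S \<in> C" "A \<subseteq> S"
        using finite_subset_Union_chain[OF A(1,2) _ C] by blast
      moreover have "lin_indpt S" using C \<open>S \<in> C\<close> by (auto simp: subset_chain_def)
      ultimately show False using A unfolding lin_dep_def by blast
    qed
    moreover have "\<Union>C \<subseteq> carrier V" using C by (auto simp: subset_chain_def)
    ultimately show "\<Union>C \<in> ?A" by blast
  qed
  then obtain I where I0: "I \<in> ?A" and max0: "\<forall>J\<in>?A. I \<subseteq> J \<longrightarrow> J = I" by (rule bexE)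
  then have I: "I \<subseteq> carrier V" "lin_indpt I" by auto
  have max: "J = I" if "J \<subseteq> carrier V" "lin_indpt J" "I \<subseteq> J" for J using max0 that by auto
  have "v \<in> span I" if v: "v \<in> carrier V" for v
  proof (cases "v \<in> I")
    case True
    then show ?thesis using in_own_span I(1) by blast
  next
    case False
    then have "lin_dep (I \<union> {v})" using max[of "I \<union> {v}"] I(1) v by auto
    then show ?thesis using lin_dep_iff_in_span[OF I v False] by blast
  qed
  then have "span I = carrier V" using span_is_subset2[OF I(1)] by blast
  with I that show thesis by blast
qed

text \<open>The linear extension of the inclusion of a basis is bijective, and its inverse is the
  section. Phrased as projectivity, the fact delivers an index set in the type of the vectors, as
  \<open>free_tensor_exists\<close> requires.\<close>

lemma vectorspace_projective_module:
  fixes W :: "('a, 'v) module"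
  assumes "vectorspace K W"
  shows "projective_module K W"
proof -
  interpret vectorspace K W by fact
  have W: "left_module K W" by (rule module_imp_left_module) (rule module_axioms)
  interpret L: left_module K W by fact
  obtain I where I: "I \<subseteq> carrier W" "lin_indpt I" "span I = carrier W"
    by (rule maximal_lin_indpt_exists)
  let ?F = "free_module K I" and ?r = "free_ext K W I (\<lambda>x. x)"
  have Ic: "\<And>i. i \<in> I \<Longrightarrow> i \<in> carrier W" using I(1) by blast
  interpret F: left_module K ?F by (rule left_module_free_module) (rule R.ring_axioms)
  have r: "?r \<in> lmod_hom K ?F W" by (rule free_ext_hom[OF W]) (rule Ic)
  have inj: "inj_on ?r (carrier ?F)"
  proof (rule inj_onI)
    fix f g assume f: "f \<in> carrier ?F" and g: "g \<in> carrier ?F" and eq: "?r f = ?r g"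
    let ?h = "f \<ominus>\<^bsub>?F\<^esub> g"
    have h: "?h \<in> carrier ?F" using f g by (rule F.M.minus_closed)
    have "?r ?h = \<zero>\<^bsub>W\<^esub>"
      using lmod_hom_minus[OF F.left_module_axioms W r f g] eq lmod_homD(1)[OF r g]
      by simp
    moreover have "?r ?h = lincomb ?h {i \<in> I. ?h i \<noteq> \<zero>\<^bsub>K\<^esub>}"
      using h by (simp add: free_ext_def lincomb_def)
    ultimately have z: "lincomb ?h {i \<in> I. ?h i \<noteq> \<zero>\<^bsub>K\<^esub>} = \<zero>\<^bsub>W\<^esub>" by simp
    have "?h i = \<zero>\<^bsub>K\<^esub>" if "i \<in> I" for i
    proof (rule ccontr)
      assume "?h i \<noteq> \<zero>\<^bsub>K\<^esub>"
      then have "lin_dep I" unfolding lin_dep_def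
        using z h that by (intro exI[of _ "{i \<in> I. ?h i \<noteq> \<zero>\<^bsub>K\<^esub>}"] exI[of _ ?h] exI[of _ i])
          (auto simp: free_module_simps)
      then show False using I by simp
    qed
    then have "?h = \<zero>\<^bsub>?F\<^esub>" using h
      by (intro extensionalityI[of _ I]) (auto simp: free_module_simps PiE_iff)
    then show "f = g" using f g F.M.diff_zero_imp_eq by blast
  qed
  have surj: "?r ` carrier ?F = carrier W"
  proof
    show "?r ` carrier ?F \<subseteq> carrier W" using lmod_homD(1)[OF r] by blast
    show "carrier W \<subseteq> ?r ` carrier ?F"
    proof
      fix v assume v: "v \<in> carrier W"
      then obtain a A where A: "finite A" "A \<subseteq> I" "a \<in> A \<rightarrow> carrier K" "v = lincomb a A"
        using v unfolding I(3)[symmetric] by (auto simp: span_def)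
      let ?f = "\<lambda>i\<in>I. if i \<in> A then a i else \<zero>\<^bsub>K\<^esub>"
      have "{i \<in> I. ?f i \<noteq> \<zero>\<^bsub>K\<^esub>} \<subseteq> A" by auto
      with A have f: "?f \<in> carrier ?F"
        by (auto simp: free_module_simps intro: finite_subset)
      have "?r ?f = (\<Oplus>\<^bsub>W\<^esub>i\<in>A. ?f i \<odot>\<^bsub>W\<^esub> i)"
        by (rule free_ext_superset[OF W f Ic A(1)]) (use A in auto)
      also have "\<dots> = v" unfolding A(4) lincomb_def
        using A(2,3) I(1) by (intro M.finsum_cong') (auto intro!: L.lm_smult_closed)
      finally show "v \<in> ?r ` carrier ?F" using f by blast
    qed
  qed
  let ?s = "restrict (inv_into (carrier ?F) ?r) (carrier W)"
  have s1: "\<And>x. x \<in> carrier W \<Longrightarrow> ?s x \<in> carrier ?F" and s2: "\<And>x. x \<in> carrier W \<Longrightarrow> ?r (?s x) = x"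
    using surj by (simp_all add: inv_into_into f_inv_into_f)
    have s: "?s \<in> lmod_hom K W ?F"
  proof (rule lmod_homI)
    fix x y assume xy: "x \<in> carrier W" "y \<in> carrier W"
    have "?r (?s (x \<oplus>\<^bsub>W\<^esub> y)) = ?r (?s x \<oplus>\<^bsub>?F\<^esub> ?s y)"
      using xy lmod_homD(2)[OF r s1[OF xy(1)] s1[OF xy(2)]] s2 M.a_closed by presburger
    then show "?s (x \<oplus>\<^bsub>W\<^esub> y) = ?s x \<oplus>\<^bsub>?F\<^esub> ?s y"
      by (rule inj_onD[OF inj]) (intro s1 F.M.a_closed M.a_closed xy)+
  next
    fix c x assume c: "c \<in> carrier K" and x: "x \<in> carrier W"
    have "?r (?s (c \<odot>\<^bsub>W\<^esub> x)) = ?r (c \<odot>\<^bsub>?F\<^esub> ?s x)"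
      using c x lmod_homD(3)[OF r c s1[OF x]] s2 L.lm_smult_closed by presburger
    then show "?s (c \<odot>\<^bsub>W\<^esub> x) = c \<odot>\<^bsub>?F\<^esub> ?s x"
      by (rule inj_onD[OF inj]) (intro s1 F.lm_smult_closed L.lm_smult_closed c x)+
  qed (use s1 in auto)
  show ?thesis by (rule projective_module_free_retract[of K W ?s I ?r, OF W s r]) (rule s2)
qed

text \<open>The cosets of the kernel are the fibres of \<open>T\<close>. Hence \<open>fib\<close>
  transports the vector space structure of \<open>free_module K C\<close> to the quotient record,
  and the fibres of the free generators are a basis.\<close>

lemma quotient_space_free_dim:
  assumes K: "field K" and V: "left_module K V" and C: "finite C"
    and T: "T \<in> lmod_hom K V (free_module K C)" and surj: "T ` carrier V = carrier (free_module K C)"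
    and W: "W = {x \<in> carrier V. T x = \<zero>\<^bsub>free_module K C\<^esub>}"
  shows "vectorspace K (quotient_space V W)" "vectorspace.fin_dim K (quotient_space V W)"
    "vectorspace.dim K (quotient_space V W) = card C"
proof -
  interpret K: field K by fact
  interpret V: left_module K V by fact
  let ?U = "free_module K C" and ?Q = "quotient_space V W"
  interpret U: left_module K ?U by (rule left_module_free_module) (rule K.ring_axioms)
  note T' = lmod_homD[OF T] lmod_hom_zero[OF V U.left_module_axioms T]
    lmod_hom_minus[OF V U.left_module_axioms T]
  define fib where "fib u = {x \<in> carrier V. T x = u}" for u
  have coset: "W +>\<^bsub>V\<^esub> x = fib (T x)" if x: "x \<in> carrier V" for x
  proof
    show "W +>\<^bsub>V\<^esub> x \<subseteq> fib (T x)" using x by (auto simp: a_r_coset_def' W fib_def T')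
    show "fib (T x) \<subseteq> W +>\<^bsub>V\<^esub> x"
    proof
      fix y assume y: "y \<in> fib (T x)"
      then have "y \<ominus>\<^bsub>V\<^esub> x \<in> W" "y = (y \<ominus>\<^bsub>V\<^esub> x) \<oplus>\<^bsub>V\<^esub> x"
        using x T'(1)[OF x] by (simp_all add: fib_def W T' V.M.minus_closed)
          (simp_all add: V.M.minus_eq V.M.a_assoc V.M.l_neg)
      then show "y \<in> W +>\<^bsub>V\<^esub> x" by (auto simp: a_r_coset_def')
    qed
  qed
  have ne: "\<exists>x\<in>carrier V. T x = u" if "u \<in> carrier ?U" for u using that unfolding surj[symmetric] by auto
  have Q: "carrier ?Q = fib ` carrier ?U"
  proof -
    have "carrier ?Q = (\<lambda>x. W +>\<^bsub>V\<^esub> x) ` carrier V"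
      by (auto simp: quotient_space_def A_RCOSETS_def')
    also have "\<dots> = (\<lambda>x. fib (T x)) ` carrier V" by (rule image_cong) (auto simp: coset)
    also have "\<dots> = fib ` carrier ?U" by (simp add: surj[symmetric] image_image)
    finally show ?thesis .
  qed
  have Qz: "\<zero>\<^bsub>?Q\<^esub> = fib \<zero>\<^bsub>?U\<^esub>" by (simp add: quotient_space_def fib_def W)
  have Qa: "fib u \<oplus>\<^bsub>?Q\<^esub> fib w = fib (u \<oplus>\<^bsub>?U\<^esub> w)" if u: "u \<in> carrier ?U" and w: "w \<in> carrier ?U" for u w
  proof -
    have "fib u <+>\<^bsub>V\<^esub> fib w = fib (u \<oplus>\<^bsub>?U\<^esub> w)"
    proof
      show "fib u <+>\<^bsub>V\<^esub> fib w \<subseteq> fib (u \<oplus>\<^bsub>?U\<^esub> w)" by (auto simp: set_add_def' fib_def T')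
      show "fib (u \<oplus>\<^bsub>?U\<^esub> w) \<subseteq> fib u <+>\<^bsub>V\<^esub> fib w"
      proof
        fix x assume x: "x \<in> fib (u \<oplus>\<^bsub>?U\<^esub> w)"
        obtain y where y: "y \<in> carrier V" "T y = w" using ne[OF w] by blast
        have "T (x \<ominus>\<^bsub>V\<^esub> y) = u" using x y u w
          by (simp add: fib_def T' U.M.minus_eq U.M.a_assoc U.M.r_neg)
        moreover have "x = (x \<ominus>\<^bsub>V\<^esub> y) \<oplus>\<^bsub>V\<^esub> y"
          using x y by (simp add: fib_def V.M.minus_eq V.M.a_assoc V.M.l_neg)
        ultimately show "x \<in> fib u <+>\<^bsub>V\<^esub> fib w"
          using x y unfolding set_add_def' fib_def by (blast intro: V.M.minus_closed)
      qed
    qed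
    then show ?thesis by (simp add: quotient_space_def)
  qed
  \<comment> \<open>A multiple of a coset is a union over its representatives. All members of this
    union are the same fibre, and the union is not empty because \<open>T\<close> is onto.\<close>
  have Qs: "c \<odot>\<^bsub>?Q\<^esub> fib u = fib (c \<odot>\<^bsub>?U\<^esub> u)" if c: "c \<in> carrier K" and u: "u \<in> carrier ?U" for c u
  proof -
    have "c \<odot>\<^bsub>?Q\<^esub> fib u = (\<Union>x\<in>fib u. W +>\<^bsub>V\<^esub> (c \<odot>\<^bsub>V\<^esub> x))" by (simp add: quotient_space_def)
    also have "\<dots> = (\<Union>x\<in>fib u. fib (c \<odot>\<^bsub>?U\<^esub> u))"
      by (rule SUP_cong) (auto simp: coset V.lm_smult_closed c fib_def T')
    also have "\<dots> = fib (c \<odot>\<^bsub>?U\<^esub> u)" using ne[OF u] by (auto simp: fib_def)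
    finally show ?thesis .
  qed
  have fib_inj: "inj_on fib (carrier ?U)"
    by (rule inj_onI) (use ne in \<open>force simp: fib_def\<close>)
  have LQ: "left_module K ?Q"
    by (rule left_moduleI)
      (auto simp: Q Qz Qa Qs U.lm_smult_closed U.lm_smult_l_distr U.lm_smult_r_distr U.lm_smult_assoc
         U.lm_smult_one U.M.a_ac K.ring_axioms)
  then interpret Q: vectorspace K ?Q
    by (intro vectorspace.intro left_module_imp_module K K.is_cring)
  show "vectorspace K ?Q" by (rule Q.vectorspace_axioms)
  let ?e = "\<lambda>c. fib (free_gen K C c)"
  let ?A = "?e ` C"
  have gen: "free_gen K C c \<in> carrier ?U" for c by (rule free_gen_closed[OF K.ring_axioms])
  have e_inj: "inj_on ?e C"
  proof (rule inj_onI)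
    fix c d assume cd: "c \<in> C" "d \<in> C" "?e c = ?e d"
    then have "free_gen K C c = free_gen K C d" using inj_onD[OF fib_inj _ gen gen] by blast
    then have "free_gen K C c c = free_gen K C d c" by simp
    then show "c = d" using cd by (auto simp: free_gen_def split: if_splits)
  qed
  have A: "finite ?A" "?A \<subseteq> carrier ?Q" using C gen by (auto simp: Q)
  have lc: "Q.lincomb a ?A = fib (\<lambda>c\<in>C. a (?e c))" if a: "a \<in> ?A \<rightarrow> carrier K" for a
  proof -
    let ?f = "\<lambda>c\<in>C. a (?e c)"
    have f: "?f \<in> carrier ?U" using a C by (auto simp: free_module_simps)
    have ac: "\<And>c. c \<in> C \<Longrightarrow> a (?e c) \<in> carrier K" using a by auto
    have "Q.lincomb a ?A = (\<Oplus>\<^bsub>?Q\<^esub>c\<in>C. a (?e c) \<odot>\<^bsub>?Q\<^esub> ?e c)"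
      unfolding Q.lincomb_def using a A(2)
      by (intro Q.M.finsum_reindex e_inj) (auto intro!: Q.smult_closed)
    also have "\<dots> = (\<Oplus>\<^bsub>?Q\<^esub>c\<in>C. fib (?f c \<odot>\<^bsub>?U\<^esub> free_gen K C c))"
      using ac gen by (intro Q.M.finsum_cong') (auto simp: Qs Q U.lm_smult_closed)
    also have "\<dots> = fib (\<Oplus>\<^bsub>?U\<^esub>c\<in>C. ?f c \<odot>\<^bsub>?U\<^esub> free_gen K C c)"
      using ac gen
      by (intro finsum_additive[OF U.M.abelian_group_axioms Q.M.abelian_group_axioms C, symmetric])
        (auto simp: Qa Q U.lm_smult_closed)
    also have "(\<Oplus>\<^bsub>?U\<^esub>c\<in>C. ?f c \<odot>\<^bsub>?U\<^esub> free_gen K C c)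
        = (\<Oplus>\<^bsub>?U\<^esub>c\<in>{c \<in> C. ?f c \<noteq> \<zero>\<^bsub>K\<^esub>}. ?f c \<odot>\<^bsub>?U\<^esub> free_gen K C c)"
      using ac gen C
      by (intro U.M.add.finprod_mono_neutral_cong_left[symmetric]) (auto simp: U.lm_smult_closed)
    also have "\<dots> = ?f" by (rule free_module_expand[OF K.ring_axioms f, symmetric])
    finally show ?thesis .
  qed
  have "Q.basis ?A"
    unfolding Q.basis_criterion[OF A]
  proof (intro allI impI)
    fix v assume "v \<in> carrier ?Q"
    then obtain u where u: "u \<in> carrier ?U" "v = fib u" by (auto simp: Q)
    let ?a = "\<lambda>w\<in>?A. u (the_inv_into C ?e w)"
    have tii: "the_inv_into C ?e (?e c) = c" if "c \<in> C" for c by (rule the_inv_into_f_f[OF e_inj that])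
    have ue: "(\<lambda>c\<in>C. ?a (?e c)) = u"
      using u(1) e_inj by (auto simp: fun_eq_iff free_module_simps PiE_iff extensional_def tii)
    have a: "?a \<in> ?A \<rightarrow>\<^sub>E carrier K"
      using u(1) e_inj by (auto simp: free_module_simps PiE_iff tii)
    show "\<exists>!a. a \<in> ?A \<rightarrow>\<^sub>E carrier K \<and> Q.lincomb a ?A = v"
    proof (rule ex1I[of _ ?a])
      have "?a \<in> ?A \<rightarrow> carrier K" using a by (auto simp: PiE_iff)
      from lc[OF this] show "?a \<in> ?A \<rightarrow>\<^sub>E carrier K \<and> Q.lincomb ?a ?A = v"
        using a ue u(2) by presburger
      fix b assume b: "b \<in> ?A \<rightarrow>\<^sub>E carrier K \<and> Q.lincomb b ?A = v"
      then have b': "b \<in> ?A \<rightarrow> carrier K" by auto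
      have "fib (\<lambda>c\<in>C. b (?e c)) = fib u" using lc[OF b'] b u(2) by simp
      then have "(\<lambda>c\<in>C. b (?e c)) = u"
        using b' C by (intro inj_onD[OF fib_inj _ _ u(1)]) (auto simp: free_module_simps)
      then have "b (?e c) = u c" if "c \<in> C" for c using that by (metis restrict_apply')
      then show "b = ?a" using b e_inj
        by (intro extensionalityI[of _ ?A]) (auto simp: PiE_iff tii)
    qed
  qed
  then show "Q.fin_dim" "Q.dim = card C"
    using A Q.dim_basis[OF A(1)] card_image[OF e_inj] by (auto simp: Q.fin_dim_def Q.basis_def)
qed

section \<open>The monoid algebra and its modules\<close>

lemma (in abelian_monoid) finsum_Times:
  assumes "finite S" "finite T" "\<And>x y. x \<in> S \<Longrightarrow> y \<in> T \<Longrightarrow> f (x, y) \<in> carrier G"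
  shows "finsum G f (S \<times> T) = (\<Oplus>x\<in>S. \<Oplus>y\<in>T. f (x, y))"
  using assms(1,3)
proof (induction S rule: finite_induct)
  case empty
  then show ?case by simp
next
  case (insert a S)
  have "insert a S \<times> T = Pair a ` T \<union> S \<times> T" by auto
  moreover have "finsum G f (Pair a ` T \<union> S \<times> T) = finsum G f (Pair a ` T) \<oplus> finsum G f (S \<times> T)"
    using insert assms(2) by (intro finsum_Un_disjoint) auto
  moreover have "finsum G f (Pair a ` T) = (\<Oplus>y\<in>T. f (a, y))"
    using insert by (intro finsum_reindex) (auto simp: inj_on_def)
  ultimately show ?case using insert by (subst finsum_insert) (auto intro!: finsum_closed)
qed

lemma (in abelian_monoid) finsum_finsum_addf:
  assumes "\<And>x y. x \<in> S \<Longrightarrow> y \<in> T \<Longrightarrow> f x y \<in> carrier G" "\<And>x y. x \<in> S \<Longrightarrow> y \<in> T \<Longrightarrow> g x y \<in> carrier G"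
    and "\<And>x y. x \<in> S \<Longrightarrow> y \<in> T \<Longrightarrow> h x y = f x y \<oplus> g x y"
  shows "(\<Oplus>x\<in>S. \<Oplus>y\<in>T. h x y) = (\<Oplus>x\<in>S. \<Oplus>y\<in>T. f x y) \<oplus> (\<Oplus>x\<in>S. \<Oplus>y\<in>T. g x y)"
proof -
  have "(\<Oplus>x\<in>S. \<Oplus>y\<in>T. h x y) = (\<Oplus>x\<in>S. \<Oplus>y\<in>T. f x y \<oplus> g x y)"
    using assms by (intro finsum_cong') (auto intro!: finsum_closed)
  also have "\<dots> = (\<Oplus>x\<in>S. (\<Oplus>y\<in>T. f x y) \<oplus> (\<Oplus>y\<in>T. g x y))"
    using assms(1,2) by (intro finsum_cong' finsum_addf) (auto intro!: finsum_closed a_closed)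
  also have "\<dots> = (\<Oplus>x\<in>S. \<Oplus>y\<in>T. f x y) \<oplus> (\<Oplus>x\<in>S. \<Oplus>y\<in>T. g x y)"
    using assms(1,2) by (intro finsum_addf) (auto intro!: finsum_closed)
  finally show ?thesis .
qed

locale finite_monoid_algebra = monoid B + K: cring K
  for B :: "('b, 'x) monoid_scheme" (structure) and K :: "('k, 'y) ring_scheme" +
  assumes finite_B: "finite (carrier B)"
begin

abbreviation A where "A \<equiv> monoid_algebra K B"

definition delta :: "'b \<Rightarrow> 'b \<Rightarrow> 'k" where
  "delta b = (\<lambda>c\<in>carrier B. if c = b then \<one>\<^bsub>K\<^esub> else \<zero>\<^bsub>K\<^esub>)"

lemma monoid_algebra_simps:
  "carrier A = carrier B \<rightarrow>\<^sub>E carrier K"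
  "\<zero>\<^bsub>A\<^esub> = (\<lambda>b\<in>carrier B. \<zero>\<^bsub>K\<^esub>)"
  "\<one>\<^bsub>A\<^esub> = delta \<one>"
  "f \<oplus>\<^bsub>A\<^esub> g = (\<lambda>b\<in>carrier B. f b \<oplus>\<^bsub>K\<^esub> g b)"
  "c \<odot>\<^bsub>A\<^esub> f = (\<lambda>b\<in>carrier B. c \<otimes>\<^bsub>K\<^esub> f b)"
  by (simp_all add: monoid_algebra_def delta_def)

lemma coeff_closed: "f \<in> carrier A \<Longrightarrow> b \<in> carrier B \<Longrightarrow> f b \<in> carrier K"
  by (auto simp: monoid_algebra_simps)

text \<open>With an indicator in place of the set of pairs of given product, the sums run over the
  whole monoid and can be exchanged freely.\<close>

lemma monoid_algebra_mult:
  assumes f: "f \<in> carrier A" and g: "g \<in> carrier A"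
  shows "f \<otimes>\<^bsub>A\<^esub> g = (\<lambda>c\<in>carrier B. \<Oplus>\<^bsub>K\<^esub>a\<in>carrier B. \<Oplus>\<^bsub>K\<^esub>b\<in>carrier B.
    if a \<otimes> b = c then f a \<otimes>\<^bsub>K\<^esub> g b else \<zero>\<^bsub>K\<^esub>)"
proof -
  have "(\<Oplus>\<^bsub>K\<^esub>p\<in>{p \<in> carrier B \<times> carrier B. fst p \<otimes> snd p = c}. f (fst p) \<otimes>\<^bsub>K\<^esub> g (snd p))
      = (\<Oplus>\<^bsub>K\<^esub>a\<in>carrier B. \<Oplus>\<^bsub>K\<^esub>b\<in>carrier B. if a \<otimes> b = c then f a \<otimes>\<^bsub>K\<^esub> g b else \<zero>\<^bsub>K\<^esub>)"
    (is "?l = ?r") for c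
  proof -
    have "?l = (\<Oplus>\<^bsub>K\<^esub>p\<in>carrier B \<times> carrier B.
        if fst p \<otimes> snd p = c then f (fst p) \<otimes>\<^bsub>K\<^esub> g (snd p) else \<zero>\<^bsub>K\<^esub>)"
      using f g finite_B by (intro K.add.finprod_mono_neutral_cong_left) (auto simp: coeff_closed)
    also have "\<dots> = (\<Oplus>\<^bsub>K\<^esub>a\<in>carrier B. \<Oplus>\<^bsub>K\<^esub>b\<in>carrier B.
        if fst (a, b) \<otimes> snd (a, b) = c then f (fst (a, b)) \<otimes>\<^bsub>K\<^esub> g (snd (a, b)) else \<zero>\<^bsub>K\<^esub>)"

      by (rule K.finsum_Times[OF finite_B finite_B,
            where f = "\<lambda>p. if fst p \<otimes> snd p = c then f (fst p) \<otimes>\<^bsub>K\<^esub> g (snd p) else \<zero>\<^bsub>K\<^esub>"]) (use f g in \<open>auto simp: coeff_closed\<close>)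
    also have "\<dots> = ?r" by (simp only: fst_conv snd_conv)
    finally show ?thesis .
  qed
  then show ?thesis by (simp add: monoid_algebra_def)
qed

text \<open>The grouping of pairs by their product is undone under any family of additive maps
  \<open>p c\<close>. One choice of \<open>p\<close> gives associativity of the algebra, another the
  multiplicativity of the action in \<open>rep_module\<close>.\<close>

lemma monoid_algebra_mult_sum:
  assumes f: "f \<in> carrier A" and g: "g \<in> carrier A" and V: "abelian_group V"
    and p: "\<And>c x. c \<in> carrier B \<Longrightarrow> x \<in> carrier K \<Longrightarrow> p c x \<in> carrier V"
    and pa: "\<And>c x y. c \<in> carrier B \<Longrightarrow> x \<in> carrier K \<Longrightarrow> y \<in> carrier K \<Longrightarrow>
      p c (x \<oplus>\<^bsub>K\<^esub> y) = p c x \<oplus>\<^bsub>V\<^esub> p c y"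
  shows "(\<Oplus>\<^bsub>V\<^esub>c\<in>carrier B. p c ((f \<otimes>\<^bsub>A\<^esub> g) c))
    = (\<Oplus>\<^bsub>V\<^esub>a\<in>carrier B. \<Oplus>\<^bsub>V\<^esub>b\<in>carrier B. p (a \<otimes> b) (f a \<otimes>\<^bsub>K\<^esub> g b))"
proof -
  interpret V: abelian_group V by fact
  let ?B = "carrier B"
  have p0: "p c \<zero>\<^bsub>K\<^esub> = \<zero>\<^bsub>V\<^esub>" if "c \<in> ?B" for c
    using pa[OF that, of "\<zero>\<^bsub>K\<^esub>" "\<zero>\<^bsub>K\<^esub>"] p[OF that, of "\<zero>\<^bsub>K\<^esub>"] by simp
  let ?t = "\<lambda>c a b. if a \<otimes> b = c then p c (f a \<otimes>\<^bsub>K\<^esub> g b) else \<zero>\<^bsub>V\<^esub>"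
  have t: "?t c a b \<in> carrier V" if "c \<in> ?B" "a \<in> ?B" "b \<in> ?B" for a b c
    using that f g p by (simp add: coeff_closed)
  have "p c ((f \<otimes>\<^bsub>A\<^esub> g) c) = (\<Oplus>\<^bsub>V\<^esub>a\<in>?B. \<Oplus>\<^bsub>V\<^esub>b\<in>?B. ?t c a b)" if c: "c \<in> ?B" for c
  proof -
    let ?s = "\<lambda>a b. if a \<otimes> b = c then f a \<otimes>\<^bsub>K\<^esub> g b else \<zero>\<^bsub>K\<^esub>"
    have s: "?s a b \<in> carrier K" if "a \<in> ?B" "b \<in> ?B" for a b using that f g by (simp add: coeff_closed)
    have "p c ((f \<otimes>\<^bsub>A\<^esub> g) c) = p c (\<Oplus>\<^bsub>K\<^esub>a\<in>?B. \<Oplus>\<^bsub>K\<^esub>b\<in>?B. ?s a b)"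
      using c f g by (simp add: monoid_algebra_mult)
    also have "\<dots> = (\<Oplus>\<^bsub>V\<^esub>a\<in>?B. p c (\<Oplus>\<^bsub>K\<^esub>b\<in>?B. ?s a b))"
      by (rule finsum_additive[OF K.is_abelian_group V finite_B])
        (use s p[OF c] pa[OF c] in \<open>auto intro!: K.finsum_closed\<close>)
    also have "\<dots> = (\<Oplus>\<^bsub>V\<^esub>a\<in>?B. \<Oplus>\<^bsub>V\<^esub>b\<in>?B. p c (?s a b))"
      by (intro V.finsum_cong' finsum_additive[OF K.is_abelian_group V finite_B])
        (use s p[OF c] pa[OF c] in \<open>auto intro!: V.finsum_closed\<close>)
    also have "\<dots> = (\<Oplus>\<^bsub>V\<^esub>a\<in>?B. \<Oplus>\<^bsub>V\<^esub>b\<in>?B. ?t c a b)"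
      by (intro V.finsum_cong') (use t[OF c] c p0 in \<open>auto intro!: V.finsum_closed\<close>)
    finally show ?thesis .
  qed
  then have "(\<Oplus>\<^bsub>V\<^esub>c\<in>?B. p c ((f \<otimes>\<^bsub>A\<^esub> g) c)) = (\<Oplus>\<^bsub>V\<^esub>c\<in>?B. \<Oplus>\<^bsub>V\<^esub>a\<in>?B. \<Oplus>\<^bsub>V\<^esub>b\<in>?B. ?t c a b)"
    by (intro V.finsum_cong') (auto intro!: V.finsum_closed t)
  also have "\<dots> = (\<Oplus>\<^bsub>V\<^esub>a\<in>?B. \<Oplus>\<^bsub>V\<^esub>c\<in>?B. \<Oplus>\<^bsub>V\<^esub>b\<in>?B. ?t c a b)"
    by (rule V.finsum_swap[OF finite_B finite_B]) (auto intro!: V.finsum_closed t)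
  also have "\<dots> = (\<Oplus>\<^bsub>V\<^esub>a\<in>?B. \<Oplus>\<^bsub>V\<^esub>b\<in>?B. \<Oplus>\<^bsub>V\<^esub>c\<in>?B. ?t c a b)"
    by (rule V.finsum_cong'[OF refl]) (auto intro!: V.finsum_closed t V.finsum_swap[OF finite_B finite_B])
  also have "\<dots> = (\<Oplus>\<^bsub>V\<^esub>a\<in>?B. \<Oplus>\<^bsub>V\<^esub>b\<in>?B. p (a \<otimes> b) (f a \<otimes>\<^bsub>K\<^esub> g b))"
  proof -
    have eq: "(\<Oplus>\<^bsub>V\<^esub>c\<in>?B. ?t c a b) = p (a \<otimes> b) (f a \<otimes>\<^bsub>K\<^esub> g b)" if "a \<in> ?B" "b \<in> ?B" for a b
      by (rule trans[OF V.finsum_delta[OF finite_B, where c = "a \<otimes> b" and f = "\<lambda>c. ?t c a b"]]) (use that f g p in \<open>auto simp: coeff_closed\<close>)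
    have cl: "p (a \<otimes> b) (f a \<otimes>\<^bsub>K\<^esub> g b) \<in> carrier V" if "a \<in> ?B" "b \<in> ?B" for a b
      using that f g p by (simp add: coeff_closed)
    show ?thesis
    proof (rule V.finsum_cong'[OF refl])
      show "(\<Oplus>\<^bsub>V\<^esub>b\<in>?B. \<Oplus>\<^bsub>V\<^esub>c\<in>?B. ?t c a b) = (\<Oplus>\<^bsub>V\<^esub>b\<in>?B. p (a \<otimes> b) (f a \<otimes>\<^bsub>K\<^esub> g b))"
        if "a \<in> ?B" for a by (rule V.finsum_cong'[OF refl]) (use that eq cl in auto)
    qed (use cl in \<open>auto intro!: V.finsum_closed\<close>)
  qed
  finally show ?thesis .
qed

lemma delta_closed [simp]: "delta b \<in> carrier A"
  by (auto simp: delta_def monoid_algebra_simps)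

lemma mult_A_closed:
  assumes "f \<in> carrier A" "g \<in> carrier A"
  shows "f \<otimes>\<^bsub>A\<^esub> g \<in> carrier A"
  using assms by (simp add: monoid_algebra_mult)
    (auto simp: monoid_algebra_simps PiE_iff intro!: K.finsum_closed)

lemma delta_mult:
  assumes a: "a \<in> carrier B" and x: "x \<in> carrier A"
  shows "delta a \<otimes>\<^bsub>A\<^esub> x = (\<lambda>c\<in>carrier B. \<Oplus>\<^bsub>K\<^esub>b\<in>carrier B. if a \<otimes> b = c then x b else \<zero>\<^bsub>K\<^esub>)"
  unfolding monoid_algebra_mult[OF delta_closed x]
proof (intro restrict_ext)
  fix c assume c: "c \<in> carrier B"
  have "(\<Oplus>\<^bsub>K\<^esub>a'\<in>carrier B. \<Oplus>\<^bsub>K\<^esub>b\<in>carrier B. if a' \<otimes> b = c then delta a a' \<otimes>\<^bsub>K\<^esub> x b else \<zero>\<^bsub>K\<^esub>)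
    = (\<Oplus>\<^bsub>K\<^esub>b\<in>carrier B. if a \<otimes> b = c then delta a a \<otimes>\<^bsub>K\<^esub> x b else \<zero>\<^bsub>K\<^esub>)"
    using a x by (intro K.finsum_delta[OF finite_B] K.add.finprod_one_eqI)
      (auto simp: coeff_closed delta_def intro!: K.finsum_closed)
  also have "\<dots> = (\<Oplus>\<^bsub>K\<^esub>b\<in>carrier B. if a \<otimes> b = c then x b else \<zero>\<^bsub>K\<^esub>)"
    using a x by (intro K.finsum_cong') (auto simp: coeff_closed delta_def)
  finally show "(\<Oplus>\<^bsub>K\<^esub>a'\<in>carrier B. \<Oplus>\<^bsub>K\<^esub>b\<in>carrier B. if a' \<otimes> b = c then delta a a' \<otimes>\<^bsub>K\<^esub> x b else \<zero>\<^bsub>K\<^esub>)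
    = (\<Oplus>\<^bsub>K\<^esub>b\<in>carrier B. if a \<otimes> b = c then x b else \<zero>\<^bsub>K\<^esub>)" .
qed

lemma mult_delta:
  assumes b: "b \<in> carrier B" and x: "x \<in> carrier A"
  shows "x \<otimes>\<^bsub>A\<^esub> delta b = (\<lambda>c\<in>carrier B. \<Oplus>\<^bsub>K\<^esub>a\<in>carrier B. if a \<otimes> b = c then x a else \<zero>\<^bsub>K\<^esub>)"
  unfolding monoid_algebra_mult[OF x delta_closed]
proof (intro restrict_ext K.finsum_cong')
  fix a c assume a: "a \<in> carrier B" and c: "c \<in> carrier B"
  have "(\<Oplus>\<^bsub>K\<^esub>b'\<in>carrier B. if a \<otimes> b' = c then x a \<otimes>\<^bsub>K\<^esub> delta b b' else \<zero>\<^bsub>K\<^esub>)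
    = (if a \<otimes> b = c then x a \<otimes>\<^bsub>K\<^esub> delta b b else \<zero>\<^bsub>K\<^esub>)"
    using b a x by (intro K.finsum_delta[OF finite_B]) (auto simp: coeff_closed delta_def)
  then show "(\<Oplus>\<^bsub>K\<^esub>b'\<in>carrier B. if a \<otimes> b' = c then x a \<otimes>\<^bsub>K\<^esub> delta b b' else \<zero>\<^bsub>K\<^esub>)
    = (if a \<otimes> b = c then x a else \<zero>\<^bsub>K\<^esub>)"
    using b a x by (simp add: coeff_closed delta_def)
qed (use x in \<open>auto simp: coeff_closed\<close>)

lemma ring_A: "ring A"
proof (rule ringI)
  show "abelian_group A"
  proof (rule abelian_groupI)
    fix f assume f: "f \<in> carrier A"
    show "\<exists>g\<in>carrier A. g \<oplus>\<^bsub>A\<^esub> f = \<zero>\<^bsub>A\<^esub>"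
      using f by (intro bexI[of _ "\<lambda>b\<in>carrier B. \<ominus>\<^bsub>K\<^esub> f b"])
        (auto simp: monoid_algebra_simps PiE_iff K.l_neg intro!: restrict_ext)
  qed (auto simp: monoid_algebra_simps PiE_iff K.a_ac extensional_def fun_eq_iff intro!: restrict_ext)
  show "Group.monoid A"
  proof (rule monoidI)
    fix f g h assume f: "f \<in> carrier A" and g: "g \<in> carrier A" and h: "h \<in> carrier A"
    let ?B = "carrier B"
    show "f \<otimes>\<^bsub>A\<^esub> g \<otimes>\<^bsub>A\<^esub> h = f \<otimes>\<^bsub>A\<^esub> (g \<otimes>\<^bsub>A\<^esub> h)"
      unfolding monoid_algebra_mult[OF mult_A_closed[OF f g] h] monoid_algebra_mult[OF f mult_A_closed[OF g h]]
    proof (intro restrict_ext)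
      fix d assume d: "d \<in> ?B"
      let ?p = "\<lambda>c x. \<Oplus>\<^bsub>K\<^esub>e\<in>?B. if c \<otimes> e = d then x \<otimes>\<^bsub>K\<^esub> h e else \<zero>\<^bsub>K\<^esub>"
      let ?q = "\<lambda>a c x. if a \<otimes> c = d then f a \<otimes>\<^bsub>K\<^esub> x else \<zero>\<^bsub>K\<^esub>"
      have pc: "?p c x \<in> carrier K" if "c \<in> ?B" "x \<in> carrier K" for c x
        using that h by (intro K.finsum_closed) (auto simp: coeff_closed)
      have pa: "?p c (x \<oplus>\<^bsub>K\<^esub> y) = ?p c x \<oplus>\<^bsub>K\<^esub> ?p c y" if "c \<in> ?B" "x \<in> carrier K" "y \<in> carrier K" for c x y
      proof -
        have "?p c x \<oplus>\<^bsub>K\<^esub> ?p c y = (\<Oplus>\<^bsub>K\<^esub>e\<in>?B. (if c \<otimes> e = d then x \<otimes>\<^bsub>K\<^esub> h e else \<zero>\<^bsub>K\<^esub>) \<oplus>\<^bsub>K\<^esub>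
            (if c \<otimes> e = d then y \<otimes>\<^bsub>K\<^esub> h e else \<zero>\<^bsub>K\<^esub>))"
          by (rule K.finsum_addf[symmetric]) (use that h in \<open>auto simp: coeff_closed\<close>)
        also have "\<dots> = ?p c (x \<oplus>\<^bsub>K\<^esub> y)"
          by (rule K.finsum_cong') (use that h in \<open>auto simp: coeff_closed K.l_distr\<close>)
        finally show ?thesis by simp
      qed
      have q1: "?q a c x \<in> carrier K" if "a \<in> ?B" "c \<in> ?B" "x \<in> carrier K" for a c x
        using that f by (auto simp: coeff_closed)
      have q2: "?q a c (x \<oplus>\<^bsub>K\<^esub> y) = ?q a c x \<oplus>\<^bsub>K\<^esub> ?q a c y"
        if "a \<in> ?B" "c \<in> ?B" "x \<in> carrier K" "y \<in> carrier K" for a c x y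
        using that f by (auto simp: coeff_closed K.r_distr)
      have "(\<Oplus>\<^bsub>K\<^esub>c\<in>?B. ?p c ((f \<otimes>\<^bsub>A\<^esub> g) c)) = (\<Oplus>\<^bsub>K\<^esub>a\<in>?B. \<Oplus>\<^bsub>K\<^esub>b\<in>?B. ?p (a \<otimes> b) (f a \<otimes>\<^bsub>K\<^esub> g b))"
        by (rule monoid_algebra_mult_sum[OF f g K.is_abelian_group]) (fact pc pa)+
      also have "\<dots> = (\<Oplus>\<^bsub>K\<^esub>a\<in>?B. \<Oplus>\<^bsub>K\<^esub>b\<in>?B. \<Oplus>\<^bsub>K\<^esub>e\<in>?B. ?q a (b \<otimes> e) (g b \<otimes>\<^bsub>K\<^esub> h e))"
        using f g h by (intro K.finsum_cong') (auto simp: coeff_closed m_assoc K.m_assoc intro!: K.finsum_closed)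
      also have "\<dots> = (\<Oplus>\<^bsub>K\<^esub>a\<in>?B. \<Oplus>\<^bsub>K\<^esub>c\<in>?B. ?q a c ((g \<otimes>\<^bsub>A\<^esub> h) c))"
      proof (rule K.finsum_cong'[OF refl])
        fix a assume a: "a \<in> ?B"
        show "(\<Oplus>\<^bsub>K\<^esub>b\<in>?B. \<Oplus>\<^bsub>K\<^esub>e\<in>?B. ?q a (b \<otimes> e) (g b \<otimes>\<^bsub>K\<^esub> h e)) = (\<Oplus>\<^bsub>K\<^esub>c\<in>?B. ?q a c ((g \<otimes>\<^bsub>A\<^esub> h) c))"
          by (rule monoid_algebra_mult_sum[OF g h K.is_abelian_group, symmetric]) (fact q1[OF a] q2[OF a])+
      qed (use f in \<open>auto simp: coeff_closed mult_A_closed[OF g h] intro!: K.finsum_closed\<close>)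
      finally show "(\<Oplus>\<^bsub>K\<^esub>c\<in>?B. \<Oplus>\<^bsub>K\<^esub>e\<in>?B. if c \<otimes> e = d then (f \<otimes>\<^bsub>A\<^esub> g) c \<otimes>\<^bsub>K\<^esub> h e else \<zero>\<^bsub>K\<^esub>)
        = (\<Oplus>\<^bsub>K\<^esub>a\<in>?B. \<Oplus>\<^bsub>K\<^esub>c\<in>?B. if a \<otimes> c = d then f a \<otimes>\<^bsub>K\<^esub> (g \<otimes>\<^bsub>A\<^esub> h) c else \<zero>\<^bsub>K\<^esub>)" .
    qed
  next
    fix f assume f: "f \<in> carrier A"
    show "\<one>\<^bsub>A\<^esub> \<otimes>\<^bsub>A\<^esub> f = f"
    proof (rule extensionalityI[of _ "carrier B"])
      fix c assume c: "c \<in> carrier B"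
      have "(\<Oplus>\<^bsub>K\<^esub>b\<in>carrier B. if \<one> \<otimes> b = c then f b else \<zero>\<^bsub>K\<^esub>) = (if \<one> \<otimes> c = c then f c else \<zero>\<^bsub>K\<^esub>)"
        using f c by (intro K.finsum_delta[OF finite_B]) (auto simp: coeff_closed)
      then show "(\<one>\<^bsub>A\<^esub> \<otimes>\<^bsub>A\<^esub> f) c = f c" using c f by (simp add: monoid_algebra_simps(3) delta_mult)
    qed (use f in \<open>auto simp: monoid_algebra_simps(3) delta_mult\<close>, simp add: monoid_algebra_simps PiE_iff)
    show "f \<otimes>\<^bsub>A\<^esub> \<one>\<^bsub>A\<^esub> = f"
    proof (rule extensionalityI[of _ "carrier B"])
      fix c assume c: "c \<in> carrier B"
      have "(\<Oplus>\<^bsub>K\<^esub>b\<in>carrier B. if b \<otimes> \<one> = c then f b else \<zero>\<^bsub>K\<^esub>) = (if c \<otimes> \<one> = c then f c else \<zero>\<^bsub>K\<^esub>)"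
        using f c by (intro K.finsum_delta[OF finite_B]) (auto simp: coeff_closed)
      then show "(f \<otimes>\<^bsub>A\<^esub> \<one>\<^bsub>A\<^esub>) c = f c" using c f by (simp add: monoid_algebra_simps(3) mult_delta)
    qed (use f in \<open>auto simp: monoid_algebra_simps(3) mult_delta\<close>, simp add: monoid_algebra_simps PiE_iff)
  qed (simp_all add: mult_A_closed monoid_algebra_simps(3))
next
  fix f g h assume f: "f \<in> carrier A" and g: "g \<in> carrier A" and h: "h \<in> carrier A"
  have fg: "f \<oplus>\<^bsub>A\<^esub> g \<in> carrier A" using f g by (auto simp: monoid_algebra_simps PiE_iff)
  let ?B = "carrier B"
  have fh: "f \<otimes>\<^bsub>A\<^esub> h \<in> carrier A" "g \<otimes>\<^bsub>A\<^esub> h \<in> carrier A" "h \<otimes>\<^bsub>A\<^esub> f \<in> carrier A" "h \<otimes>\<^bsub>A\<^esub> g \<in> carrier A"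
    using f g h by (simp_all add: mult_A_closed)
  show "(f \<oplus>\<^bsub>A\<^esub> g) \<otimes>\<^bsub>A\<^esub> h = f \<otimes>\<^bsub>A\<^esub> h \<oplus>\<^bsub>A\<^esub> g \<otimes>\<^bsub>A\<^esub> h"
    unfolding monoid_algebra_mult[OF fg h] monoid_algebra_simps(4)[of "f \<otimes>\<^bsub>A\<^esub> h"]
  proof (rule restrict_ext)
    fix c assume c: "c \<in> ?B"
    show "(\<Oplus>\<^bsub>K\<^esub>a\<in>?B. \<Oplus>\<^bsub>K\<^esub>b\<in>?B. if a \<otimes> b = c then (f \<oplus>\<^bsub>A\<^esub> g) a \<otimes>\<^bsub>K\<^esub> h b else \<zero>\<^bsub>K\<^esub>)
      = (f \<otimes>\<^bsub>A\<^esub> h) c \<oplus>\<^bsub>K\<^esub> (g \<otimes>\<^bsub>A\<^esub> h) c"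
      unfolding monoid_algebra_mult[OF f h] monoid_algebra_mult[OF g h] restrict_apply'[OF c]
      by (rule K.finsum_finsum_addf)
        (use f g h in \<open>auto simp: monoid_algebra_simps(4) coeff_closed K.l_distr\<close>)
  qed
  show "h \<otimes>\<^bsub>A\<^esub> (f \<oplus>\<^bsub>A\<^esub> g) = h \<otimes>\<^bsub>A\<^esub> f \<oplus>\<^bsub>A\<^esub> h \<otimes>\<^bsub>A\<^esub> g"
    unfolding monoid_algebra_mult[OF h fg] monoid_algebra_simps(4)[of "h \<otimes>\<^bsub>A\<^esub> f"]
  proof (rule restrict_ext)
    fix c assume c: "c \<in> ?B"
    show "(\<Oplus>\<^bsub>K\<^esub>a\<in>?B. \<Oplus>\<^bsub>K\<^esub>b\<in>?B. if a \<otimes> b = c then h a \<otimes>\<^bsub>K\<^esub> (f \<oplus>\<^bsub>A\<^esub> g) b else \<zero>\<^bsub>K\<^esub>)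
      = (h \<otimes>\<^bsub>A\<^esub> f) c \<oplus>\<^bsub>K\<^esub> (h \<otimes>\<^bsub>A\<^esub> g) c"
      unfolding monoid_algebra_mult[OF h f] monoid_algebra_mult[OF h g] restrict_apply'[OF c]
      by (rule K.finsum_finsum_addf)
        (use f g h in \<open>auto simp: monoid_algebra_simps(4) coeff_closed K.r_distr\<close>)
  qed
qed

sublocale A: ring A by (rule ring_A)

lemma delta_delta:
  assumes ab: "a \<in> carrier B" "b \<in> carrier B"
  shows "delta a \<otimes>\<^bsub>A\<^esub> delta b = delta (a \<otimes> b)"
proof (rule extensionalityI[of _ "carrier B"])
  fix c assume c: "c \<in> carrier B"
  have "(\<Oplus>\<^bsub>K\<^esub>b'\<in>carrier B. if a \<otimes> b' = c then delta b b' else \<zero>\<^bsub>K\<^esub>)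
    = (if a \<otimes> b = c then delta b b else \<zero>\<^bsub>K\<^esub>)"
    using ab by (intro K.finsum_delta[OF finite_B]) (auto simp: delta_def)
  then show "(delta a \<otimes>\<^bsub>A\<^esub> delta b) c = delta (a \<otimes> b) c"
    using ab c by (simp add: delta_mult) (auto simp: delta_def)
qed (simp add: delta_mult[OF ab(1) delta_closed], simp add: delta_def)

lemma smult_A_closed: "c \<in> carrier K \<Longrightarrow> f \<in> carrier A \<Longrightarrow> c \<odot>\<^bsub>A\<^esub> f \<in> carrier A"
  by (auto simp: monoid_algebra_simps)

lemma smult_A_mult:
  assumes c: "c \<in> carrier K" and f: "f \<in> carrier A" and g: "g \<in> carrier A"
  shows "(c \<odot>\<^bsub>A\<^esub> f) \<otimes>\<^bsub>A\<^esub> g = c \<odot>\<^bsub>A\<^esub> (f \<otimes>\<^bsub>A\<^esub> g)" "f \<otimes>\<^bsub>A\<^esub> (c \<odot>\<^bsub>A\<^esub> g) = c \<odot>\<^bsub>A\<^esub> (f \<otimes>\<^bsub>A\<^esub> g)"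
proof -
  have m: "c \<odot>\<^bsub>A\<^esub> (f \<otimes>\<^bsub>A\<^esub> g) = (\<lambda>d\<in>carrier B. \<Oplus>\<^bsub>K\<^esub>a\<in>carrier B. \<Oplus>\<^bsub>K\<^esub>b\<in>carrier B.
     if a \<otimes> b = d then c \<otimes>\<^bsub>K\<^esub> (f a \<otimes>\<^bsub>K\<^esub> g b) else \<zero>\<^bsub>K\<^esub>)"
    unfolding monoid_algebra_mult[OF f g] monoid_algebra_simps(5)
  proof (rule restrict_ext)
    fix d assume d: "d \<in> carrier B"
    let ?t = "\<lambda>a b. if a \<otimes> b = d then f a \<otimes>\<^bsub>K\<^esub> g b else \<zero>\<^bsub>K\<^esub>"
    have t: "?t a b \<in> carrier K" if "a \<in> carrier B" "b \<in> carrier B" for a b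
      using that f g by (simp add: coeff_closed)
    have "c \<otimes>\<^bsub>K\<^esub> (\<Oplus>\<^bsub>K\<^esub>a\<in>carrier B. \<Oplus>\<^bsub>K\<^esub>b\<in>carrier B. ?t a b)
        = (\<Oplus>\<^bsub>K\<^esub>a\<in>carrier B. c \<otimes>\<^bsub>K\<^esub> (\<Oplus>\<^bsub>K\<^esub>b\<in>carrier B. ?t a b))"
      by (rule K.finsum_rdistr[OF finite_B c]) (use t in \<open>auto intro!: K.finsum_closed\<close>)
    also have "\<dots> = (\<Oplus>\<^bsub>K\<^esub>a\<in>carrier B. \<Oplus>\<^bsub>K\<^esub>b\<in>carrier B. c \<otimes>\<^bsub>K\<^esub> ?t a b)"
      by (intro K.finsum_cong' K.finsum_rdistr[OF finite_B c]) (use t c in \<open>auto intro!: K.finsum_closed\<close>)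
    also have "\<dots> = (\<Oplus>\<^bsub>K\<^esub>a\<in>carrier B. \<Oplus>\<^bsub>K\<^esub>b\<in>carrier B.
        if a \<otimes> b = d then c \<otimes>\<^bsub>K\<^esub> (f a \<otimes>\<^bsub>K\<^esub> g b) else \<zero>\<^bsub>K\<^esub>)"
      by (intro K.finsum_cong') (use c f g in \<open>auto simp: coeff_closed intro!: K.finsum_closed\<close>)
    finally show "c \<otimes>\<^bsub>K\<^esub> (\<lambda>d\<in>carrier B. \<Oplus>\<^bsub>K\<^esub>a\<in>carrier B. \<Oplus>\<^bsub>K\<^esub>b\<in>carrier B.
          if a \<otimes> b = d then f a \<otimes>\<^bsub>K\<^esub> g b else \<zero>\<^bsub>K\<^esub>) d
        = (\<Oplus>\<^bsub>K\<^esub>a\<in>carrier B. \<Oplus>\<^bsub>K\<^esub>b\<in>carrier B.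
          if a \<otimes> b = d then c \<otimes>\<^bsub>K\<^esub> (f a \<otimes>\<^bsub>K\<^esub> g b) else \<zero>\<^bsub>K\<^esub>)"
      using d by simp
  qed
  show "(c \<odot>\<^bsub>A\<^esub> f) \<otimes>\<^bsub>A\<^esub> g = c \<odot>\<^bsub>A\<^esub> (f \<otimes>\<^bsub>A\<^esub> g)"
    unfolding m monoid_algebra_mult[OF smult_A_closed[OF c f] g]
    using c f g by (intro restrict_ext K.finsum_cong')
      (auto simp: coeff_closed monoid_algebra_simps(5) K.m_assoc intro!: K.finsum_closed)
  show "f \<otimes>\<^bsub>A\<^esub> (c \<odot>\<^bsub>A\<^esub> g) = c \<odot>\<^bsub>A\<^esub> (f \<otimes>\<^bsub>A\<^esub> g)"
    unfolding m monoid_algebra_mult[OF f smult_A_closed[OF c g]]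
    using c f g by (intro restrict_ext K.finsum_cong')
      (auto simp: coeff_closed monoid_algebra_simps(5) K.m_lcomm intro!: K.finsum_closed)
qed

lemma A_expand:
  assumes x: "x \<in> carrier A"
  shows "x = (\<Oplus>\<^bsub>A\<^esub>b\<in>carrier B. x b \<odot>\<^bsub>A\<^esub> delta b)"
proof (rule extensionalityI[of _ "carrier B"])
  let ?u = "\<lambda>b. x b \<odot>\<^bsub>A\<^esub> delta b"
  have u: "?u b \<in> carrier A" if "b \<in> carrier B" for b using x that by (simp add: smult_A_closed coeff_closed)
  have c: "(\<Oplus>\<^bsub>A\<^esub>b\<in>carrier B. ?u b) \<in> carrier A" using u by (auto intro!: A.finsum_closed)
  then show "(\<Oplus>\<^bsub>A\<^esub>b\<in>carrier B. ?u b) \<in> extensional (carrier B)" by (simp add: monoid_algebra_simps(1) PiE_iff)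
  fix d assume d: "d \<in> carrier B"
  have "(\<Oplus>\<^bsub>A\<^esub>b\<in>carrier B. ?u b) d = (\<Oplus>\<^bsub>K\<^esub>b\<in>carrier B. ?u b d)"
    by (rule finsum_additive[OF A.is_abelian_group K.is_abelian_group finite_B, where h = "\<lambda>f. f d"])
      (use d u in \<open>auto simp: coeff_closed monoid_algebra_simps(4)\<close>)
  also have "\<dots> = ?u d d"
    using d x by (intro K.finsum_delta[OF finite_B]) (auto simp: coeff_closed monoid_algebra_simps(5) delta_def)
  also have "\<dots> = x d" using d x by (simp add: coeff_closed monoid_algebra_simps(5) delta_def)
  finally show "x d = (\<Oplus>\<^bsub>A\<^esub>b\<in>carrier B. ?u b) d" by simp
qed (use x in \<open>simp add: monoid_algebra_simps PiE_iff\<close>)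

section \<open>Modules over the algebra as vector spaces with a linear action of the monoid\<close>

definition kact :: "('b \<Rightarrow> 'k, 'm) module \<Rightarrow> 'k \<Rightarrow> 'm \<Rightarrow> 'm" where
  "kact M c x = (c \<odot>\<^bsub>A\<^esub> \<one>\<^bsub>A\<^esub>) \<odot>\<^bsub>M\<^esub> x"

definition bact :: "('b \<Rightarrow> 'k, 'm) module \<Rightarrow> 'b \<Rightarrow> 'm \<Rightarrow> 'm" where
  "bact M b x = delta b \<odot>\<^bsub>M\<^esub> x"

definition rep_module :: "('k, 'v) module \<Rightarrow> ('b \<Rightarrow> 'v \<Rightarrow> 'v) \<Rightarrow> ('b \<Rightarrow> 'k, 'v) module" where
  "rep_module V \<beta> = \<lparr>carrier = carrier V, monoid.mult = monoid.mult V, one = \<one>\<^bsub>V\<^esub>, ring.zero = \<zero>\<^bsub>V\<^esub>,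
     add = add V, smult = (\<lambda>f v. \<Oplus>\<^bsub>V\<^esub>b\<in>carrier B. f b \<odot>\<^bsub>V\<^esub> \<beta> b v)\<rparr>"

definition kmod :: "('b \<Rightarrow> 'k, 'm) module \<Rightarrow> ('k, 'm) module" where
  "kmod M = \<lparr>carrier = carrier M, monoid.mult = monoid.mult M, one = \<one>\<^bsub>M\<^esub>, ring.zero = \<zero>\<^bsub>M\<^esub>,
     add = add M, smult = kact M\<rparr>"

lemma scalar_closed: "c \<in> carrier K \<Longrightarrow> c \<odot>\<^bsub>A\<^esub> \<one>\<^bsub>A\<^esub> \<in> carrier A"
  by (rule smult_A_closed) auto

lemma scalar_mult: "c \<in> carrier K \<Longrightarrow> f \<in> carrier A \<Longrightarrow> (c \<odot>\<^bsub>A\<^esub> \<one>\<^bsub>A\<^esub>) \<otimes>\<^bsub>A\<^esub> f = c \<odot>\<^bsub>A\<^esub> f"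
  by (simp add: smult_A_mult)

lemma mult_scalar: "c \<in> carrier K \<Longrightarrow> f \<in> carrier A \<Longrightarrow> f \<otimes>\<^bsub>A\<^esub> (c \<odot>\<^bsub>A\<^esub> \<one>\<^bsub>A\<^esub>) = c \<odot>\<^bsub>A\<^esub> f"
  by (simp add: smult_A_mult)

lemma smult_A_add: "c \<in> carrier K \<Longrightarrow> d \<in> carrier K \<Longrightarrow> f \<in> carrier A \<Longrightarrow>
    (c \<oplus>\<^bsub>K\<^esub> d) \<odot>\<^bsub>A\<^esub> f = c \<odot>\<^bsub>A\<^esub> f \<oplus>\<^bsub>A\<^esub> d \<odot>\<^bsub>A\<^esub> f"
  by (auto simp: monoid_algebra_simps(4,5) coeff_closed K.l_distr intro!: restrict_ext)

lemma smult_A_assoc: "c \<in> carrier K \<Longrightarrow> d \<in> carrier K \<Longrightarrow> f \<in> carrier A \<Longrightarrow>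
    (c \<otimes>\<^bsub>K\<^esub> d) \<odot>\<^bsub>A\<^esub> f = c \<odot>\<^bsub>A\<^esub> (d \<odot>\<^bsub>A\<^esub> f)"
  by (auto simp: monoid_algebra_simps(4,5) coeff_closed K.m_assoc intro!: restrict_ext)

lemma smult_A_one: "f \<in> carrier A \<Longrightarrow> \<one>\<^bsub>K\<^esub> \<odot>\<^bsub>A\<^esub> f = f"
  by (rule extensionalityI[of _ "carrier B"])
    (auto simp: monoid_algebra_simps(5) coeff_closed, simp add: monoid_algebra_simps(1) PiE_iff)

lemma smult_A_zero: "f \<in> carrier A \<Longrightarrow> \<zero>\<^bsub>K\<^esub> \<odot>\<^bsub>A\<^esub> f = \<zero>\<^bsub>A\<^esub>"
  by (auto simp: monoid_algebra_simps(2,5) coeff_closed intro!: restrict_ext)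

end

locale monoid_algebra_module = finite_monoid_algebra B K + M: left_module "monoid_algebra K B" M
  for B :: "('b, 'x) monoid_scheme" (structure) and K :: "('k, 'y) ring_scheme"
    and M :: "('b \<Rightarrow> 'k, 'm) module"
begin

lemma kact_closed [simp]: "c \<in> carrier K \<Longrightarrow> x \<in> carrier M \<Longrightarrow> kact M c x \<in> carrier M"
  unfolding kact_def by (intro M.lm_smult_closed scalar_closed)

lemma bact_closed [simp]: "x \<in> carrier M \<Longrightarrow> bact M b x \<in> carrier M"
  unfolding bact_def by (intro M.lm_smult_closed delta_closed)

lemma kact_add_r: "c \<in> carrier K \<Longrightarrow> x \<in> carrier M \<Longrightarrow> y \<in> carrier M \<Longrightarrow>
    kact M c (x \<oplus>\<^bsub>M\<^esub> y) = kact M c x \<oplus>\<^bsub>M\<^esub> kact M c y"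
  unfolding kact_def by (intro M.lm_smult_r_distr scalar_closed)

lemma kact_add_l: "c \<in> carrier K \<Longrightarrow> d \<in> carrier K \<Longrightarrow> x \<in> carrier M \<Longrightarrow>
    kact M (c \<oplus>\<^bsub>K\<^esub> d) x = kact M c x \<oplus>\<^bsub>M\<^esub> kact M d x"
  by (simp add: kact_def smult_A_add M.lm_smult_l_distr scalar_closed)

lemma kact_assoc: "c \<in> carrier K \<Longrightarrow> d \<in> carrier K \<Longrightarrow> x \<in> carrier M \<Longrightarrow>
    kact M (c \<otimes>\<^bsub>K\<^esub> d) x = kact M c (kact M d x)"
  by (simp add: kact_def smult_A_assoc M.lm_smult_assoc[symmetric] scalar_closed scalar_mult)

lemma kact_one [simp]: "x \<in> carrier M \<Longrightarrow> kact M \<one>\<^bsub>K\<^esub> x = x"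
  by (simp add: kact_def smult_A_one M.lm_smult_one)

lemma kact_zero_l [simp]: "x \<in> carrier M \<Longrightarrow> kact M \<zero>\<^bsub>K\<^esub> x = \<zero>\<^bsub>M\<^esub>"
  by (simp add: kact_def smult_A_zero)

lemma kact_zero_r [simp]: "c \<in> carrier K \<Longrightarrow> kact M c \<zero>\<^bsub>M\<^esub> = \<zero>\<^bsub>M\<^esub>"
  by (simp add: kact_def scalar_closed)

lemma kact_diff_r: "c \<in> carrier K \<Longrightarrow> x \<in> carrier M \<Longrightarrow> y \<in> carrier M \<Longrightarrow>
    kact M c (x \<ominus>\<^bsub>M\<^esub> y) = kact M c x \<ominus>\<^bsub>M\<^esub> kact M c y"
  unfolding kact_def by (intro M.lm_diff_r scalar_closed)

lemma kact_finsum: "finite S \<Longrightarrow> c \<in> carrier K \<Longrightarrow> (\<And>i. i \<in> S \<Longrightarrow> f i \<in> carrier M) \<Longrightarrow>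
    kact M c (\<Oplus>\<^bsub>M\<^esub>i\<in>S. f i) = (\<Oplus>\<^bsub>M\<^esub>i\<in>S. kact M c (f i))"
  unfolding kact_def by (intro M.lm_finsum_r scalar_closed)

lemma bact_add: "x \<in> carrier M \<Longrightarrow> y \<in> carrier M \<Longrightarrow>
    bact M b (x \<oplus>\<^bsub>M\<^esub> y) = bact M b x \<oplus>\<^bsub>M\<^esub> bact M b y"
  unfolding bact_def by (intro M.lm_smult_r_distr delta_closed)

lemma bact_diff: "x \<in> carrier M \<Longrightarrow> y \<in> carrier M \<Longrightarrow>
    bact M b (x \<ominus>\<^bsub>M\<^esub> y) = bact M b x \<ominus>\<^bsub>M\<^esub> bact M b y"
  unfolding bact_def by (intro M.lm_diff_r delta_closed)

lemma bact_zero [simp]: "bact M b \<zero>\<^bsub>M\<^esub> = \<zero>\<^bsub>M\<^esub>"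
  by (simp add: bact_def)

lemma bact_finsum: "finite S \<Longrightarrow> (\<And>i. i \<in> S \<Longrightarrow> f i \<in> carrier M) \<Longrightarrow>
    bact M b (\<Oplus>\<^bsub>M\<^esub>i\<in>S. f i) = (\<Oplus>\<^bsub>M\<^esub>i\<in>S. bact M b (f i))"
  unfolding bact_def by (intro M.lm_finsum_r delta_closed)

lemma bact_mult: "a \<in> carrier B \<Longrightarrow> b \<in> carrier B \<Longrightarrow> x \<in> carrier M \<Longrightarrow>
    bact M a (bact M b x) = bact M (a \<otimes> b) x"
  by (simp add: bact_def M.lm_smult_assoc[symmetric] delta_delta)

lemma bact_one [simp]: "x \<in> carrier M \<Longrightarrow> bact M \<one> x = x"
  by (simp add: bact_def monoid_algebra_simps(3)[symmetric] M.lm_smult_one)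

lemma bact_kact: "c \<in> carrier K \<Longrightarrow> x \<in> carrier M \<Longrightarrow> bact M b (kact M c x) = kact M c (bact M b x)"
  by (simp add: bact_def kact_def M.lm_smult_assoc[symmetric] scalar_closed scalar_mult mult_scalar)

lemma smult_kact: "c \<in> carrier K \<Longrightarrow> f \<in> carrier A \<Longrightarrow> x \<in> carrier M \<Longrightarrow> (c \<odot>\<^bsub>A\<^esub> f) \<odot>\<^bsub>M\<^esub> x = kact M c (f \<odot>\<^bsub>M\<^esub> x)"
  by (simp add: kact_def M.lm_smult_assoc[symmetric] scalar_closed scalar_mult)

lemma smult_expand:
  assumes f: "f \<in> carrier A" and x: "x \<in> carrier M"
  shows "f \<odot>\<^bsub>M\<^esub> x = (\<Oplus>\<^bsub>M\<^esub>b\<in>carrier B. kact M (f b) (bact M b x))"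
proof -
  have "f \<odot>\<^bsub>M\<^esub> x = (\<Oplus>\<^bsub>A\<^esub>b\<in>carrier B. f b \<odot>\<^bsub>A\<^esub> delta b) \<odot>\<^bsub>M\<^esub> x"
    using A_expand[OF f] by simp
  also have "\<dots> = (\<Oplus>\<^bsub>M\<^esub>b\<in>carrier B. (f b \<odot>\<^bsub>A\<^esub> delta b) \<odot>\<^bsub>M\<^esub> x)"
    by (rule M.lm_finsum_l[OF finite_B x]) (simp add: f coeff_closed smult_A_closed)
  also have "\<dots> = (\<Oplus>\<^bsub>M\<^esub>b\<in>carrier B. kact M (f b) (bact M b x))"
    by (rule M.M.finsum_cong'[OF refl]) (use f x in \<open>auto simp: smult_kact bact_def[symmetric] coeff_closed\<close>)
  finally show ?thesis .
qed

lemma left_module_kmod: "left_module K (kmod M)"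
  by (rule left_moduleI)
    (auto simp: kmod_def K.ring_axioms M.M.a_ac kact_add_r kact_add_l kact_assoc)

end

context finite_monoid_algebra
begin

lemma monoid_algebra_moduleI: "left_module A M \<Longrightarrow> monoid_algebra_module B K M"
  by (intro monoid_algebra_module.intro finite_monoid_algebra_axioms)

lemma lmod_hom_actions:
  assumes M: "left_module A M" and N: "left_module A N" and f: "f \<in> lmod_hom A M N" and x: "x \<in> carrier M"
  shows "c \<in> carrier K \<Longrightarrow> f (kact M c x) = kact N c (f x)" "f (bact M b x) = bact N b (f x)"
  using lmod_homD[OF f] x by (auto simp: kact_def bact_def scalar_closed)

text \<open>By \<open>smult_expand\<close> an algebra element acts as a sum of monoid elements
  composed with scalars, so linearity and compatibility with the monoid suffice.\<close>

lemma lmod_hom_actionsI: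
  assumes M: "left_module A M" and N: "left_module A N"
    and cl: "\<And>x. x \<in> carrier M \<Longrightarrow> f x \<in> carrier N"
    and add: "\<And>x y. x \<in> carrier M \<Longrightarrow> y \<in> carrier M \<Longrightarrow> f (x \<oplus>\<^bsub>M\<^esub> y) = f x \<oplus>\<^bsub>N\<^esub> f y"
    and k: "\<And>c x. c \<in> carrier K \<Longrightarrow> x \<in> carrier M \<Longrightarrow> f (kact M c x) = kact N c (f x)"
    and b: "\<And>b x. b \<in> carrier B \<Longrightarrow> x \<in> carrier M \<Longrightarrow> f (bact M b x) = bact N b (f x)"
    and ext: "f \<in> extensional (carrier M)"
  shows "f \<in> lmod_hom A M N"
proof (rule lmod_homI[OF cl add _ ext])
  interpret M: monoid_algebra_module B K M by (rule monoid_algebra_moduleI[OF M])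
  interpret N: monoid_algebra_module B K N by (rule monoid_algebra_moduleI[OF N])
  fix \<alpha> x assume a: "\<alpha> \<in> carrier A" and x: "x \<in> carrier M"
  have "f (\<alpha> \<odot>\<^bsub>M\<^esub> x) = f (\<Oplus>\<^bsub>M\<^esub>b\<in>carrier B. kact M (\<alpha> b) (bact M b x))"
    by (simp add: M.smult_expand[OF a x])
  also have "\<dots> = (\<Oplus>\<^bsub>N\<^esub>b\<in>carrier B. f (kact M (\<alpha> b) (bact M b x)))"
    by (rule finsum_additive[OF M.M.M.abelian_group_axioms N.M.M.abelian_group_axioms finite_B])
      (use a x cl add in \<open>auto simp: coeff_closed\<close>)
  also have "\<dots> = (\<Oplus>\<^bsub>N\<^esub>b\<in>carrier B. kact N (\<alpha> b) (bact N b (f x)))"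
    by (rule N.M.M.finsum_cong'[OF refl]) (use a x cl in \<open>auto simp: coeff_closed k b\<close>)
  also have "\<dots> = \<alpha> \<odot>\<^bsub>N\<^esub> f x" by (simp add: N.smult_expand[OF a cl[OF x]])
  finally show "f (\<alpha> \<odot>\<^bsub>M\<^esub> x) = \<alpha> \<odot>\<^bsub>N\<^esub> f x" .
qed

lemma rep_module_simps:
  "carrier (rep_module V \<beta>) = carrier V" "\<zero>\<^bsub>rep_module V \<beta>\<^esub> = \<zero>\<^bsub>V\<^esub>"
  "x \<oplus>\<^bsub>rep_module V \<beta>\<^esub> y = x \<oplus>\<^bsub>V\<^esub> y"
  "f \<odot>\<^bsub>rep_module V \<beta>\<^esub> v = (\<Oplus>\<^bsub>V\<^esub>b\<in>carrier B. f b \<odot>\<^bsub>V\<^esub> \<beta> b v)"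
  by (simp_all add: rep_module_def)

text \<open>The last two conclusions recover the given operators and scalars, so that from here on
  modules are handled through \<open>bact\<close> and \<open>kact\<close> and no longer through
  convolution sums.\<close>

lemma rep_module:
  fixes V :: "('k, 'v) module"
  assumes V: "left_module K V"
    and cl: "\<And>b x. b \<in> carrier B \<Longrightarrow> x \<in> carrier V \<Longrightarrow> \<beta> b x \<in> carrier V"
    and add: "\<And>b x y. b \<in> carrier B \<Longrightarrow> x \<in> carrier V \<Longrightarrow> y \<in> carrier V \<Longrightarrow>
      \<beta> b (x \<oplus>\<^bsub>V\<^esub> y) = \<beta> b x \<oplus>\<^bsub>V\<^esub> \<beta> b y"
    and k: "\<And>b c x. b \<in> carrier B \<Longrightarrow> c \<in> carrier K \<Longrightarrow> x \<in> carrier V \<Longrightarrow> \<beta> b (c \<odot>\<^bsub>V\<^esub> x) = c \<odot>\<^bsub>V\<^esub> \<beta> b x"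
    and mult: "\<And>a b x. a \<in> carrier B \<Longrightarrow> b \<in> carrier B \<Longrightarrow> x \<in> carrier V \<Longrightarrow> \<beta> (a \<otimes> b) x = \<beta> a (\<beta> b x)"
    and one: "\<And>x. x \<in> carrier V \<Longrightarrow> \<beta> \<one> x = x"
  shows "left_module A (rep_module V \<beta>)"
    and "\<And>b x. b \<in> carrier B \<Longrightarrow> x \<in> carrier V \<Longrightarrow> bact (rep_module V \<beta>) b x = \<beta> b x"
    and "\<And>c x. c \<in> carrier K \<Longrightarrow> x \<in> carrier V \<Longrightarrow> kact (rep_module V \<beta>) c x = c \<odot>\<^bsub>V\<^esub> x"
proof -
  interpret V: left_module K V by fact
  let ?B = "carrier B"
  have t: "f b \<odot>\<^bsub>V\<^esub> \<beta> b x \<in> carrier V" if "f \<in> carrier A" "b \<in> ?B" "x \<in> carrier V" for f b x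
    using that by (simp add: coeff_closed V.lm_smult_closed cl)
  have d: "delta a \<odot>\<^bsub>rep_module V \<beta>\<^esub> x = \<beta> a x" if "a \<in> ?B" "x \<in> carrier V" for a x
  proof -
    have "(\<Oplus>\<^bsub>V\<^esub>b\<in>?B. delta a b \<odot>\<^bsub>V\<^esub> \<beta> b x) = delta a a \<odot>\<^bsub>V\<^esub> \<beta> a x"
      using that by (intro V.M.finsum_delta[OF finite_B]) (auto simp: cl t, auto simp: delta_def cl)
    then show ?thesis using that by (simp add: rep_module_simps delta_def V.lm_smult_one cl)
  qed
  show "left_module A (rep_module V \<beta>)"
  proof (rule left_moduleI, unfold rep_module_simps(1-3))
    fix f g x assume f: "f \<in> carrier A" and g: "g \<in> carrier A" and x: "x \<in> carrier V"
    show "f \<odot>\<^bsub>rep_module V \<beta>\<^esub> x \<in> carrier V"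
      using t[OF f _ x] by (auto simp: rep_module_simps intro!: V.M.finsum_closed)
    have "(\<Oplus>\<^bsub>V\<^esub>b\<in>?B. (f \<oplus>\<^bsub>A\<^esub> g) b \<odot>\<^bsub>V\<^esub> \<beta> b x) = (\<Oplus>\<^bsub>V\<^esub>b\<in>?B. f b \<odot>\<^bsub>V\<^esub> \<beta> b x \<oplus>\<^bsub>V\<^esub> g b \<odot>\<^bsub>V\<^esub> \<beta> b x)"
      by (rule V.M.finsum_cong'[OF refl])
        (use f g x t in \<open>auto simp: monoid_algebra_simps(4) coeff_closed V.lm_smult_l_distr cl\<close>)
    also have "\<dots> = (\<Oplus>\<^bsub>V\<^esub>b\<in>?B. f b \<odot>\<^bsub>V\<^esub> \<beta> b x) \<oplus>\<^bsub>V\<^esub> (\<Oplus>\<^bsub>V\<^esub>b\<in>?B. g b \<odot>\<^bsub>V\<^esub> \<beta> b x)"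
      using t[OF f _ x] t[OF g _ x] by (intro V.M.finsum_addf) auto
    finally show "(f \<oplus>\<^bsub>A\<^esub> g) \<odot>\<^bsub>rep_module V \<beta>\<^esub> x = f \<odot>\<^bsub>rep_module V \<beta>\<^esub> x \<oplus>\<^bsub>V\<^esub> g \<odot>\<^bsub>rep_module V \<beta>\<^esub> x"
      by (simp add: rep_module_simps)
    have "(\<Oplus>\<^bsub>V\<^esub>c\<in>?B. (f \<otimes>\<^bsub>A\<^esub> g) c \<odot>\<^bsub>V\<^esub> \<beta> c x)
        = (\<Oplus>\<^bsub>V\<^esub>a\<in>?B. \<Oplus>\<^bsub>V\<^esub>b\<in>?B. (f a \<otimes>\<^bsub>K\<^esub> g b) \<odot>\<^bsub>V\<^esub> \<beta> (a \<otimes> b) x)"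
      by (rule monoid_algebra_mult_sum[OF f g V.M.abelian_group_axioms, where p = "\<lambda>c y. y \<odot>\<^bsub>V\<^esub> \<beta> c x"])
        (use x in \<open>auto simp: V.lm_smult_closed V.lm_smult_l_distr cl\<close>)
    also have "\<dots> = (\<Oplus>\<^bsub>V\<^esub>a\<in>?B. f a \<odot>\<^bsub>V\<^esub> \<beta> a (\<Oplus>\<^bsub>V\<^esub>b\<in>?B. g b \<odot>\<^bsub>V\<^esub> \<beta> b x))"
    proof (rule V.M.finsum_cong'[OF refl])
      fix a assume a: "a \<in> ?B"
      have "f a \<odot>\<^bsub>V\<^esub> \<beta> a (\<Oplus>\<^bsub>V\<^esub>b\<in>?B. g b \<odot>\<^bsub>V\<^esub> \<beta> b x) = (\<Oplus>\<^bsub>V\<^esub>b\<in>?B. f a \<odot>\<^bsub>V\<^esub> \<beta> a (g b \<odot>\<^bsub>V\<^esub> \<beta> b x))"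
        by (rule finsum_additive[OF V.M.abelian_group_axioms V.M.abelian_group_axioms finite_B])
          (use a f t[OF g _ x] in \<open>auto simp: add cl coeff_closed V.lm_smult_closed V.lm_smult_r_distr\<close>)
      also have "\<dots> = (\<Oplus>\<^bsub>V\<^esub>b\<in>?B. (f a \<otimes>\<^bsub>K\<^esub> g b) \<odot>\<^bsub>V\<^esub> \<beta> (a \<otimes> b) x)"
        by (rule V.M.finsum_cong'[OF refl])
          (use a f g x in \<open>auto simp: k cl coeff_closed V.lm_smult_assoc V.lm_smult_closed mult\<close>)
      finally show "(\<Oplus>\<^bsub>V\<^esub>b\<in>?B. (f a \<otimes>\<^bsub>K\<^esub> g b) \<odot>\<^bsub>V\<^esub> \<beta> (a \<otimes> b) x)
        = f a \<odot>\<^bsub>V\<^esub> \<beta> a (\<Oplus>\<^bsub>V\<^esub>b\<in>?B. g b \<odot>\<^bsub>V\<^esub> \<beta> b x)" by simp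
    qed (use f g x t in \<open>auto simp: cl coeff_closed intro!: V.lm_smult_closed V.M.finsum_closed\<close>)
    finally show "(f \<otimes>\<^bsub>A\<^esub> g) \<odot>\<^bsub>rep_module V \<beta>\<^esub> x = f \<odot>\<^bsub>rep_module V \<beta>\<^esub> (g \<odot>\<^bsub>rep_module V \<beta>\<^esub> x)"
      by (simp add: rep_module_simps)
  next
    fix f x y assume f: "f \<in> carrier A" and x: "x \<in> carrier V" and y: "y \<in> carrier V"
    have "(\<Oplus>\<^bsub>V\<^esub>b\<in>?B. f b \<odot>\<^bsub>V\<^esub> \<beta> b (x \<oplus>\<^bsub>V\<^esub> y)) = (\<Oplus>\<^bsub>V\<^esub>b\<in>?B. f b \<odot>\<^bsub>V\<^esub> \<beta> b x \<oplus>\<^bsub>V\<^esub> f b \<odot>\<^bsub>V\<^esub> \<beta> b y)"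
      by (rule V.M.finsum_cong'[OF refl])
        (use f x y t in \<open>auto simp: coeff_closed V.lm_smult_r_distr cl add\<close>)
    also have "\<dots> = (\<Oplus>\<^bsub>V\<^esub>b\<in>?B. f b \<odot>\<^bsub>V\<^esub> \<beta> b x) \<oplus>\<^bsub>V\<^esub> (\<Oplus>\<^bsub>V\<^esub>b\<in>?B. f b \<odot>\<^bsub>V\<^esub> \<beta> b y)"
      using t[OF f _ x] t[OF f _ y] by (intro V.M.finsum_addf) auto
    finally show "f \<odot>\<^bsub>rep_module V \<beta>\<^esub> (x \<oplus>\<^bsub>V\<^esub> y) = f \<odot>\<^bsub>rep_module V \<beta>\<^esub> x \<oplus>\<^bsub>V\<^esub> f \<odot>\<^bsub>rep_module V \<beta>\<^esub> y"
      by (simp add: rep_module_simps)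
  next
    fix x assume x: "x \<in> carrier V"
    show "\<one>\<^bsub>A\<^esub> \<odot>\<^bsub>rep_module V \<beta>\<^esub> x = x" using d[OF one_closed x] one[OF x] by (simp add: monoid_algebra_simps(3))
    show "\<zero>\<^bsub>A\<^esub> \<odot>\<^bsub>rep_module V \<beta>\<^esub> x = \<zero>\<^bsub>V\<^esub>"
      using x by (auto simp: rep_module_simps monoid_algebra_simps(2) cl intro!: V.M.add.finprod_one_eqI)
  qed (auto simp: A.ring_axioms V.M.a_ac)
  show "bact (rep_module V \<beta>) b x = \<beta> b x" if "b \<in> carrier B" "x \<in> carrier V" for b x
    using d[OF that] by (simp add: bact_def)
  show "kact (rep_module V \<beta>) c x = c \<odot>\<^bsub>V\<^esub> x" if "c \<in> carrier K" "x \<in> carrier V" for c x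
  proof -
    have "(\<Oplus>\<^bsub>V\<^esub>b\<in>?B. (c \<odot>\<^bsub>A\<^esub> delta \<one>) b \<odot>\<^bsub>V\<^esub> \<beta> b x) = (c \<odot>\<^bsub>A\<^esub> delta \<one>) \<one> \<odot>\<^bsub>V\<^esub> \<beta> \<one> x"
      using that by (intro V.M.finsum_delta[OF finite_B])
        (auto simp: t smult_A_closed, auto simp: delta_def cl monoid_algebra_simps(5))
    then show ?thesis using that by (simp add: kact_def rep_module_simps monoid_algebra_simps(3,5) delta_def one)
  qed
qed

end

section \<open>Left regular bands and their algebras\<close>

context left_regular_band_monoid
begin

text \<open>Since \<open>a\<close> lies in \<open>B a\<close>, containment writes \<open>a\<close>
  as \<open>c b\<close>, and idempotence of \<open>b\<close> gives \<open>a b = a\<close>.\<close>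

lemma supp_subset_iff:
  assumes "a \<in> carrier B" "b \<in> carrier B"
  shows "supp B a \<subseteq> supp B b \<longleftrightarrow> a \<otimes> b = a"
proof
  assume "supp B a \<subseteq> supp B b"
  moreover have "a \<in> supp B a" using assms by (force simp: supp_def intro!: image_eqI[of _ _ \<one>])
  ultimately obtain c where "c \<in> carrier B" "a = c \<otimes> b" by (auto simp: supp_def)
  then show "a \<otimes> b = a" using assms by (simp add: m_assoc idem)
next
  assume ab: "a \<otimes> b = a"
  show "supp B a \<subseteq> supp B b"
  proof
    fix x assume "x \<in> supp B a"
    then obtain c where c: "c \<in> carrier B" "x = c \<otimes> a" by (auto simp: supp_def)
    then have "x = (c \<otimes> a) \<otimes> b" using assms ab by (simp add: m_assoc)
    then show "x \<in> supp B b" using c assms by (auto simp: supp_def)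
  qed
qed

lemma supp_mult_subset:
  assumes "a \<in> carrier B" "b \<in> carrier B"
  shows "supp B (a \<otimes> b) \<subseteq> supp B a" "supp B (a \<otimes> b) \<subseteq> supp B b"
  using assms by (simp_all add: supp_subset_iff left_regular m_assoc idem)

text \<open>The support of a product is the meet of the supports; this makes \<open>chi U\<close>
  multiplicative.\<close>

lemma subset_supp_mult:
  assumes "a \<in> carrier B" "b \<in> carrier B" "c \<in> carrier B"
  shows "supp B c \<subseteq> supp B (a \<otimes> b) \<longleftrightarrow> supp B c \<subseteq> supp B a \<and> supp B c \<subseteq> supp B b"
proof
  assume "supp B c \<subseteq> supp B a \<and> supp B c \<subseteq> supp B b"
  then show "supp B c \<subseteq> supp B (a \<otimes> b)"
    using assms by (simp add: supp_subset_iff m_assoc[symmetric])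
qed (use supp_mult_subset[OF assms(1,2)] in blast)

lemma R_le_refl: "a \<in> carrier B \<Longrightarrow> R_le B a a"
  by (simp add: R_le_def idem)

lemma R_le_trans:
  "a \<in> carrier B \<Longrightarrow> b \<in> carrier B \<Longrightarrow> c \<in> carrier B \<Longrightarrow> R_le B a b \<Longrightarrow> R_le B b c \<Longrightarrow> R_le B a c"
  unfolding R_le_def by (metis m_assoc)

lemma R_le_antisym: "a \<in> carrier B \<Longrightarrow> b \<in> carrier B \<Longrightarrow> R_le B a b \<Longrightarrow> R_le B b a \<Longrightarrow> a = b"
  unfolding R_le_def by (metis left_regular)

lemma R_le_mult: "a \<in> carrier B \<Longrightarrow> b \<in> carrier B \<Longrightarrow> R_le B (a \<otimes> b) a"
  by (simp add: R_le_def m_assoc[symmetric] idem)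

text \<open>Left regularity gives \<open>c b c = c b\<close>, hence
  \<open>(c b) (c a) = c (b a) = c a\<close>.\<close>

lemma R_le_mult_mono: "a \<in> carrier B \<Longrightarrow> b \<in> carrier B \<Longrightarrow> c \<in> carrier B \<Longrightarrow>
    R_le B a b \<Longrightarrow> R_le B (c \<otimes> a) (c \<otimes> b)"
  unfolding R_le_def by (metis left_regular m_assoc m_closed)

lemma R_le_one: "a \<in> carrier B \<Longrightarrow> R_le B a \<one>"
  by (simp add: R_le_def)

lemma R_le_supp: "a \<in> carrier B \<Longrightarrow> b \<in> carrier B \<Longrightarrow> R_le B a b \<Longrightarrow> supp B a \<subseteq> supp B b"
  unfolding R_le_def by (metis supp_mult_subset(1))

text \<open>If the supports agreed, \<open>b a = b\<close> would hold next to
  \<open>b a = a\<close>. Thus the size of the support is a strictly monotone rank for the order, on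
  which the later inductions run.\<close>

lemma R_less_supp: "a \<in> carrier B \<Longrightarrow> b \<in> carrier B \<Longrightarrow> R_less B a b \<Longrightarrow> supp B a \<subset> supp B b"
  unfolding R_less_def R_le_def by (metis psubsetI supp_mult_subset(1) supp_subset_iff equalityE)

lemma R_le_less_trans: "a \<in> carrier B \<Longrightarrow> b \<in> carrier B \<Longrightarrow> c \<in> carrier B \<Longrightarrow>
    R_le B a b \<Longrightarrow> R_less B b c \<Longrightarrow> R_less B a c"
  unfolding R_less_def by (metis R_le_trans R_le_antisym)

lemma supp_subset_carrier: "a \<in> carrier B \<Longrightarrow> supp B a \<subseteq> carrier B"
  by (auto simp: supp_def)

end

locale lrb_algebra = finite_monoid_algebra B K + left_regular_band_monoid B + K: field K
  for B :: "('b, 'x) monoid_scheme" (structure) and K :: "('k, 'y) ring_scheme"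
begin

lemma finite_supp: "a \<in> carrier B \<Longrightarrow> finite (supp B a)"
  using finite_subset[OF supp_subset_carrier finite_B] .

lemma mult_delta_absorb:
  assumes q: "q \<in> carrier A" and b: "b \<in> carrier B"
    and absorb: "\<And>c. c \<in> carrier B \<Longrightarrow> q c \<noteq> \<zero>\<^bsub>K\<^esub> \<Longrightarrow> c \<otimes> b = c"
  shows "q \<otimes>\<^bsub>A\<^esub> delta b = q"
proof (rule extensionalityI[of _ "carrier B"])
  fix d assume d: "d \<in> carrier B"
  have "(\<Oplus>\<^bsub>K\<^esub>a\<in>carrier B. if a \<otimes> b = d then q a else \<zero>\<^bsub>K\<^esub>)
      = (\<Oplus>\<^bsub>K\<^esub>a\<in>carrier B. if a = d then q a else \<zero>\<^bsub>K\<^esub>)"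
  proof (rule K.finsum_cong'[OF refl])
    fix a assume a: "a \<in> carrier B"
    show "(if a \<otimes> b = d then q a else \<zero>\<^bsub>K\<^esub>) = (if a = d then q a else \<zero>\<^bsub>K\<^esub>)"
      using absorb[OF a] by (cases "q a = \<zero>\<^bsub>K\<^esub>") auto
  qed (use q in \<open>auto simp: coeff_closed\<close>)
  also have "\<dots> = (if d = d then q d else \<zero>\<^bsub>K\<^esub>)"
    by (rule K.finsum_delta[OF finite_B d]) (use q d in \<open>auto simp: coeff_closed\<close>)
  finally show "(q \<otimes>\<^bsub>A\<^esub> delta b) d = q d" using d by (simp add: mult_delta[OF b q])
qed (use q b in \<open>simp_all add: mult_delta\<close>, simp add: monoid_algebra_simps(1) PiE_iff)

lemma delta_mult_nonzero:
  assumes "a \<in> carrier B" "x \<in> carrier A" "d \<in> carrier B" "(delta a \<otimes>\<^bsub>A\<^esub> x) d \<noteq> \<zero>\<^bsub>K\<^esub>"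
  obtains c where "c \<in> carrier B" "x c \<noteq> \<zero>\<^bsub>K\<^esub>" "d = a \<otimes> c"
proof -
  have "(\<Oplus>\<^bsub>K\<^esub>b\<in>carrier B. if a \<otimes> b = d then x b else \<zero>\<^bsub>K\<^esub>) \<noteq> \<zero>\<^bsub>K\<^esub>"
    using assms by (simp add: delta_mult)
  moreover have "(\<Oplus>\<^bsub>K\<^esub>b\<in>carrier B. if a \<otimes> b = d then x b else \<zero>\<^bsub>K\<^esub>) = \<zero>\<^bsub>K\<^esub>"
    if "\<And>b. b \<in> carrier B \<Longrightarrow> (if a \<otimes> b = d then x b else \<zero>\<^bsub>K\<^esub>) = \<zero>\<^bsub>K\<^esub>"
    by (rule K.add.finprod_one_eqI) (rule that)
  ultimately obtain b where "b \<in> carrier B" "(if a \<otimes> b = d then x b else \<zero>\<^bsub>K\<^esub>) \<noteq> \<zero>\<^bsub>K\<^esub>"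
    by blast
  then show thesis using that by (auto split: if_splits)
qed

lemma mult_delta_nonzero:
  assumes "b \<in> carrier B" "x \<in> carrier A" "d \<in> carrier B" "(x \<otimes>\<^bsub>A\<^esub> delta b) d \<noteq> \<zero>\<^bsub>K\<^esub>"
  obtains c where "c \<in> carrier B" "x c \<noteq> \<zero>\<^bsub>K\<^esub>" "d = c \<otimes> b"
proof -
  have "(\<Oplus>\<^bsub>K\<^esub>a\<in>carrier B. if a \<otimes> b = d then x a else \<zero>\<^bsub>K\<^esub>) \<noteq> \<zero>\<^bsub>K\<^esub>"
    using assms by (simp add: mult_delta)
  moreover have "(\<Oplus>\<^bsub>K\<^esub>a\<in>carrier B. if a \<otimes> b = d then x a else \<zero>\<^bsub>K\<^esub>) = \<zero>\<^bsub>K\<^esub>"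
    if "\<And>a. a \<in> carrier B \<Longrightarrow> (if a \<otimes> b = d then x a else \<zero>\<^bsub>K\<^esub>) = \<zero>\<^bsub>K\<^esub>"
    by (rule K.add.finprod_one_eqI) (rule that)
  ultimately obtain a where "a \<in> carrier B" "(if a \<otimes> b = d then x a else \<zero>\<^bsub>K\<^esub>) \<noteq> \<zero>\<^bsub>K\<^esub>"
    by blast
  then show thesis using that by (auto split: if_splits)
qed

text \<open>\<open>\<delta>\<^sub>y - q\<close> is the product of the factors \<open>\<delta>\<^sub>y - \<delta>\<^sub>a\<close> over all \<open>a < y\<close>, in any order.\<close>

lemma annihilating_element_exists:
  assumes y: "y \<in> carrier B"
  obtains q where "q \<in> carrier A" "\<And>c. c \<in> carrier B \<Longrightarrow> q c \<noteq> \<zero>\<^bsub>K\<^esub> \<Longrightarrow> R_less B c y"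
    "\<And>a. a \<in> carrier B \<Longrightarrow> R_less B a y \<Longrightarrow> delta a \<otimes>\<^bsub>A\<^esub> (delta y \<ominus>\<^bsub>A\<^esub> q) = \<zero>\<^bsub>A\<^esub>"
proof -
  let ?Q = "{q \<in> carrier A. \<forall>c\<in>carrier B. q c \<noteq> \<zero>\<^bsub>K\<^esub> \<longrightarrow> R_less B c y}"
  have Q_iff: "q \<in> ?Q \<longleftrightarrow> q \<in> carrier A \<and> (\<forall>c\<in>carrier B. \<not> R_less B c y \<longrightarrow> q c = \<zero>\<^bsub>K\<^esub>)" for q
    by blast
  have Q_add: "q \<oplus>\<^bsub>A\<^esub> r \<in> ?Q" if "q \<in> ?Q" "r \<in> ?Q" for q r
    using that A.a_closed[of q r] unfolding Q_iff by (simp add: monoid_algebra_simps(4))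
  have Q_minus: "\<ominus>\<^bsub>A\<^esub> q \<in> ?Q" if q: "q \<in> ?Q" for q
  proof -
    have qc: "q \<in> carrier A" using q by simp
    have "(\<ominus>\<^bsub>A\<^esub> q) c = \<zero>\<^bsub>K\<^esub>" if c: "c \<in> carrier B" and qz: "q c = \<zero>\<^bsub>K\<^esub>" for c
    proof -
      have "(\<ominus>\<^bsub>A\<^esub> q \<oplus>\<^bsub>A\<^esub> q) c = \<zero>\<^bsub>K\<^esub>" unfolding A.l_neg[OF qc] using c by (simp add: monoid_algebra_simps(2))
      then show ?thesis using c qz coeff_closed[OF A.a_inv_closed[OF qc] c] by (simp add: monoid_algebra_simps(4))
    qed
    then show ?thesis using q A.a_inv_closed[OF qc] unfolding Q_iff by blast
  qed
  have Q_delta: "delta a \<in> ?Q" if "a \<in> carrier B" "R_less B a y" for a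
  proof -
    have "delta a c = \<zero>\<^bsub>K\<^esub>" if "c \<in> carrier B" "\<not> R_less B c y" for c
      using that \<open>R_less B a y\<close> by (auto simp: delta_def)
    then show ?thesis unfolding Q_iff using delta_closed by blast
  qed
  have Q_mult: "q \<otimes>\<^bsub>A\<^esub> delta a \<in> ?Q" if q: "q \<in> ?Q" and a: "a \<in> carrier B" for q a
  proof -
    have qc: "q \<in> carrier A" using q by simp
    have *: "R_less B d y" if d: "d \<in> carrier B" "(q \<otimes>\<^bsub>A\<^esub> delta a) d \<noteq> \<zero>\<^bsub>K\<^esub>" for d
    proof -
      obtain c where c: "c \<in> carrier B" "q c \<noteq> \<zero>\<^bsub>K\<^esub>" "d = c \<otimes> a"
        using mult_delta_nonzero[OF a qc d] .
      then have "R_less B c y" using q by blast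
      then show ?thesis using R_le_less_trans[OF d(1) c(1) y] R_le_mult[OF c(1) a] c(3) by blast
    qed
    have "q \<otimes>\<^bsub>A\<^esub> delta a \<in> carrier A" using qc by simp
    then show ?thesis by (intro CollectI conjI ballI impI *)
  qed
  have "\<exists>q\<in>?Q. \<forall>a\<in>S. delta a \<otimes>\<^bsub>A\<^esub> (delta y \<ominus>\<^bsub>A\<^esub> q) = \<zero>\<^bsub>A\<^esub>"
    if "finite S" "S \<subseteq> {a \<in> carrier B. R_less B a y}" for S
    using that
  proof (induction S rule: finite_induct)
    case empty
    have "\<zero>\<^bsub>A\<^esub> \<in> ?Q" unfolding Q_iff using A.zero_closed by (simp add: monoid_algebra_simps(2))
    then show ?case by blast
  next
    case (insert a S)
    then obtain q where q: "q \<in> ?Q" and S: "\<And>b. b \<in> S \<Longrightarrow> delta b \<otimes>\<^bsub>A\<^esub> (delta y \<ominus>\<^bsub>A\<^esub> q) = \<zero>\<^bsub>A\<^esub>" by blast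
    from insert have a: "a \<in> carrier B" "R_less B a y" and Sc: "\<And>b. b \<in> S \<Longrightarrow> b \<in> carrier B" by auto
    \<comment> \<open>Multiplying \<open>?h\<close> on the right by \<open>1 - delta a\<close> adds
      \<open>?h delta a\<close> to \<open>q\<close>. By \<open>y a = a\<close> this is
      \<open>delta a - q delta a\<close>, again supported strictly below \<open>y\<close>.
      Annihilation by the elements of \<open>S\<close> is not affected by a factor on the
      right.\<close>
    let ?h = "delta y \<ominus>\<^bsub>A\<^esub> q" and ?q = "q \<oplus>\<^bsub>A\<^esub> (delta a \<oplus>\<^bsub>A\<^esub> \<ominus>\<^bsub>A\<^esub> (q \<otimes>\<^bsub>A\<^esub> delta a))"
    have qc: "q \<in> carrier A" using q by blast
    then have h: "?h \<in> carrier A" by (intro A.minus_closed delta_closed)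
    have qQ: "?q \<in> ?Q" by (intro Q_add q Q_delta[OF a] Q_minus Q_mult a(1))
    have ha: "?h \<otimes>\<^bsub>A\<^esub> delta a = delta a \<oplus>\<^bsub>A\<^esub> \<ominus>\<^bsub>A\<^esub> (q \<otimes>\<^bsub>A\<^esub> delta a)"
      using a qc y by (simp add: A.minus_eq A.l_distr A.l_minus delta_delta) (simp add: R_less_def R_le_def)
    have hq: "delta y \<ominus>\<^bsub>A\<^esub> ?q = ?h \<ominus>\<^bsub>A\<^esub> ?h \<otimes>\<^bsub>A\<^esub> delta a"
      unfolding ha using qc by (simp add: A.minus_eq A.minus_add A.a_assoc)
    have "delta b \<otimes>\<^bsub>A\<^esub> (delta y \<ominus>\<^bsub>A\<^esub> ?q) = delta b \<otimes>\<^bsub>A\<^esub> ?h \<ominus>\<^bsub>A\<^esub> (delta b \<otimes>\<^bsub>A\<^esub> ?h) \<otimes>\<^bsub>A\<^esub> delta a" for b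
      unfolding hq using h by (simp add: A.minus_eq A.r_distr A.r_minus A.m_assoc)
    \<comment> \<open>For \<open>a\<close> itself: every monoid element occurring in
      \<open>delta a ?h\<close> has the form \<open>a c\<close>, and
      \<open>a c a = a c\<close>.\<close>
    moreover have "(delta a \<otimes>\<^bsub>A\<^esub> ?h) \<otimes>\<^bsub>A\<^esub> delta a = delta a \<otimes>\<^bsub>A\<^esub> ?h"
    proof (rule mult_delta_absorb)
      fix d assume d: "d \<in> carrier B" "(delta a \<otimes>\<^bsub>A\<^esub> ?h) d \<noteq> \<zero>\<^bsub>K\<^esub>"
      obtain c where "c \<in> carrier B" "d = a \<otimes> c" using delta_mult_nonzero[OF a(1) h d] by blast
      then show "d \<otimes> a = d" using a left_regular by simp
    qed (use a h in auto)
    ultimately have "delta b \<otimes>\<^bsub>A\<^esub> (delta y \<ominus>\<^bsub>A\<^esub> ?q) = \<zero>\<^bsub>A\<^esub>" if "b \<in> insert a S" for b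
      using that S h by (cases "b = a") (auto simp: A.minus_eq A.r_neg)
    then show ?case using qQ by blast
  qed
  note step = this
  have "finite {a \<in> carrier B. R_less B a y}" using finite_B by simp
  from step[OF this subset_refl] obtain q where q: "q \<in> ?Q"
    "\<forall>a\<in>{a \<in> carrier B. R_less B a y}. delta a \<otimes>\<^bsub>A\<^esub> (delta y \<ominus>\<^bsub>A\<^esub> q) = \<zero>\<^bsub>A\<^esub>" by (rule bexE)
  show thesis by (rule that[of q]) (use q in simp_all)
qed

text \<open>The free module stands for the tensor product over \<open>K\<close> of \<open>A\<close>
  with a vector space that contains \<open>N\<close> as a retract, and \<open>T h x\<close> for
  \<open>h \<otimes> x\<close>. Here \<open>s\<close> and \<open>r\<close> are the linear section
  and retraction for a free \<open>K\<close>-module on \<open>I\<close>; the entries of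
  \<open>T h x\<close> are the coordinates of \<open>s x\<close> times \<open>h\<close>, and
  \<open>\<pi>\<close> sends the \<open>i\<close>-th generator to its image under
  \<open>r\<close>.\<close>

lemma free_tensor_exists:
  fixes N :: "('b \<Rightarrow> 'k, 'n) module"
  assumes N: "left_module A N"
  obtains I :: "'n set" and \<pi> T where
    "\<pi> \<in> lmod_hom A (free_module A I) N"
    "\<And>h x. h \<in> carrier A \<Longrightarrow> x \<in> carrier N \<Longrightarrow> T h x \<in> carrier (free_module A I)"
    "\<And>h x y. h \<in> carrier A \<Longrightarrow> x \<in> carrier N \<Longrightarrow> y \<in> carrier N \<Longrightarrow>
      T h (x \<oplus>\<^bsub>N\<^esub> y) = T h x \<oplus>\<^bsub>free_module A I\<^esub> T h y"
    "\<And>h c x. h \<in> carrier A \<Longrightarrow> c \<in> carrier K \<Longrightarrow> x \<in> carrier N \<Longrightarrow>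
      T h (kact N c x) = kact (free_module A I) c (T h x)"
    "\<And>g h x. g \<in> carrier A \<Longrightarrow> h \<in> carrier A \<Longrightarrow> x \<in> carrier N \<Longrightarrow>
      g \<odot>\<^bsub>free_module A I\<^esub> T h x = T (g \<otimes>\<^bsub>A\<^esub> h) x"
    "\<And>x. x \<in> carrier N \<Longrightarrow> T \<zero>\<^bsub>A\<^esub> x = \<zero>\<^bsub>free_module A I\<^esub>"
    "\<And>h x. h \<in> carrier A \<Longrightarrow> x \<in> carrier N \<Longrightarrow> \<pi> (T h x) = h \<odot>\<^bsub>N\<^esub> x"
proof -
  interpret N: monoid_algebra_module B K N by (rule monoid_algebra_moduleI[OF N])
  have KN: "left_module K (kmod N)" by (rule N.left_module_kmod)
  have "vectorspace K (kmod N)"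
    by (intro vectorspace.intro left_module_imp_module KN K.is_cring K.field_axioms)
  then have "projective_module K (kmod N)" by (rule vectorspace_projective_module)
  then obtain I :: "'n set" and s r where s: "s \<in> lmod_hom K (kmod N) (free_module K I)"
    and r: "r \<in> lmod_hom K (free_module K I) (kmod N)" and rs: "\<forall>x\<in>carrier (kmod N). r (s x) = x"
    unfolding projective_module_def by blast
  let ?F = "free_module A I"
  have F: "left_module A ?F" by (rule left_module_free_module[OF ring_A])
  interpret F: monoid_algebra_module B K ?F by (rule monoid_algebra_moduleI[OF F])
  define g where "g i = r (free_gen K I i)" for i
  have g: "g i \<in> carrier N" for i
    using lmod_homD(1)[OF r free_gen_closed[OF K.ring_axioms]] by (simp add: g_def kmod_def)
  have r_eq: "r f = (\<Oplus>\<^bsub>N\<^esub>i\<in>{i \<in> I. f i \<noteq> \<zero>\<^bsub>K\<^esub>}. kact N (f i) (g i))"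
    if f: "f \<in> carrier (free_module K I)" for f
  proof -
    have "r f = free_ext K (kmod N) I g f"
    proof (rule free_hom_eqI[OF KN r _ _ f])
      show "free_ext K (kmod N) I g \<in> lmod_hom K (free_module K I) (kmod N)"
        by (rule free_ext_hom[OF KN]) (simp add: g kmod_def)
      show "r (free_gen K I i) = free_ext K (kmod N) I g (free_gen K I i)" if "i \<in> I" for i
        using free_ext_gen[OF KN _ that, of g] g by (simp add: kmod_def g_def)
    qed
    also have "\<dots> = (\<Oplus>\<^bsub>N\<^esub>i\<in>{i \<in> I. f i \<noteq> \<zero>\<^bsub>K\<^esub>}. kact N (f i) (g i))"
    proof -
      interpret L: left_module K "kmod N" by (rule KN)
      have fc: "f i \<in> carrier K" if "i \<in> I" for i using f that by (auto simp: free_module_simps)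
      have "(\<lambda>x. x) (finsum (kmod N) (\<lambda>i. kact N (f i) (g i)) {i \<in> I. f i \<noteq> \<zero>\<^bsub>K\<^esub>})
          = finsum N (\<lambda>i. (\<lambda>x. x) (kact N (f i) (g i))) {i \<in> I. f i \<noteq> \<zero>\<^bsub>K\<^esub>}"
        by (rule finsum_additive[OF L.M.abelian_group_axioms N.M.M.abelian_group_axioms])
          (use f fc g in \<open>auto simp: kmod_def free_module_simps\<close>)
      then show ?thesis using f by (simp add: free_ext_def) (simp add: kmod_def)
    qed
    finally show ?thesis .
  qed
  have sx: "s x \<in> carrier (free_module K I)" if "x \<in> carrier N" for x
    using lmod_homD(1)[OF s, of x] that by (simp add: kmod_def)
  have sxi: "s x i \<in> carrier K" if "x \<in> carrier N" "i \<in> I" for x i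
    using sx[OF that(1)] that(2) by (auto simp: free_module_simps)
  have sfin: "finite {i \<in> I. s x i \<noteq> \<zero>\<^bsub>K\<^esub>}" if "x \<in> carrier N" for x
    using sx[OF that] by (auto simp: free_module_simps)
  define T where "T h x = (\<lambda>i\<in>I. s x i \<odot>\<^bsub>A\<^esub> h)" for h x
  have T: "T h x \<in> carrier ?F" and Ts: "{i \<in> I. T h x i \<noteq> \<zero>\<^bsub>A\<^esub>} \<subseteq> {i \<in> I. s x i \<noteq> \<zero>\<^bsub>K\<^esub>}"
    if h: "h \<in> carrier A" and x: "x \<in> carrier N" for h x
  proof -
    show Ts: "{i \<in> I. T h x i \<noteq> \<zero>\<^bsub>A\<^esub>} \<subseteq> {i \<in> I. s x i \<noteq> \<zero>\<^bsub>K\<^esub>}"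
      using h by (auto simp: T_def smult_A_zero)
    show "T h x \<in> carrier ?F"
      using finite_subset[OF Ts sfin[OF x]] sxi[OF x] h unfolding free_module_simps
      by (auto simp: T_def smult_A_closed)
  qed
  show thesis
  proof (rule that)
    let ?\<pi> = "free_ext A N I g"
    show "?\<pi> \<in> lmod_hom A ?F N" by (rule free_ext_hom[OF N g])
    show "T h x \<in> carrier ?F" if "h \<in> carrier A" "x \<in> carrier N" for h x by (rule T[OF that])
    show "T h (x \<oplus>\<^bsub>N\<^esub> y) = T h x \<oplus>\<^bsub>?F\<^esub> T h y"
      if "h \<in> carrier A" "x \<in> carrier N" "y \<in> carrier N" for h x y
      using that sxi lmod_homD(2)[OF s, of x y]
      by (auto simp: T_def free_module_simps kmod_def smult_A_add intro!: restrict_ext)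
    show "T h (kact N c x) = kact ?F c (T h x)"
      if "h \<in> carrier A" "c \<in> carrier K" "x \<in> carrier N" for h c x
      using that sxi lmod_homD(3)[OF s, of c x]
      by (auto simp: T_def kact_def[of ?F] free_module_simps kmod_def smult_A_assoc scalar_mult smult_A_closed
          intro!: restrict_ext)
    show "a \<odot>\<^bsub>?F\<^esub> T h x = T (a \<otimes>\<^bsub>A\<^esub> h) x"
      if "a \<in> carrier A" "h \<in> carrier A" "x \<in> carrier N" for a h x
      using that sxi by (auto simp: T_def free_module_simps smult_A_mult intro!: restrict_ext)
    show "T \<zero>\<^bsub>A\<^esub> x = \<zero>\<^bsub>?F\<^esub>" if "x \<in> carrier N" for x
      using that sxi by (auto simp: T_def free_module_simps monoid_algebra_simps(2,5) intro!: restrict_ext)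
    show "?\<pi> (T h x) = h \<odot>\<^bsub>N\<^esub> x" if h: "h \<in> carrier A" and x: "x \<in> carrier N" for h x
    proof -
      let ?S = "{i \<in> I. s x i \<noteq> \<zero>\<^bsub>K\<^esub>}"
      have "?\<pi> (T h x) = (\<Oplus>\<^bsub>N\<^esub>i\<in>?S. T h x i \<odot>\<^bsub>N\<^esub> g i)"
        by (rule free_ext_superset[OF N T[OF h x] g sfin[OF x] Ts[OF h x]]) auto
      also have "\<dots> = (\<Oplus>\<^bsub>N\<^esub>i\<in>?S. h \<odot>\<^bsub>N\<^esub> kact N (s x i) (g i))"
      proof (rule N.M.M.finsum_cong'[OF refl])
        fix i assume i: "i \<in> ?S"
        then have "s x i \<odot>\<^bsub>A\<^esub> h = h \<otimes>\<^bsub>A\<^esub> (s x i \<odot>\<^bsub>A\<^esub> \<one>\<^bsub>A\<^esub>)"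
          using h sxi[OF x] by (simp add: mult_scalar)
        then show "T h x i \<odot>\<^bsub>N\<^esub> g i = h \<odot>\<^bsub>N\<^esub> kact N (s x i) (g i)"
          using i h g sxi[OF x] by (simp add: T_def kact_def N.M.lm_smult_assoc scalar_closed)
      qed (use h g sxi[OF x] in \<open>auto intro!: N.M.lm_smult_closed\<close>)
      also have "\<dots> = h \<odot>\<^bsub>N\<^esub> (\<Oplus>\<^bsub>N\<^esub>i\<in>?S. kact N (s x i) (g i))"
        by (rule N.M.lm_finsum_r[OF sfin[OF x] h, symmetric]) (use g sxi[OF x] in auto)
      also have "\<dots> = h \<odot>\<^bsub>N\<^esub> x" using r_eq[OF sx[OF x]] rs x by (simp add: kmod_def)
      finally show ?thesis .
    qed
  qed
qed

section \<open>A projectivity criterion\<close>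

text \<open>The operators \<open>e j\<close> split \<open>N\<close> into summands \<open>N\<^sub>j\<close>, and \<open>low\<close> says that the action of the monoid is
  triangular for the supports of the \<open>p j\<close>.  Let \<open>y\<close> be the chosen representative of the support of \<open>p j\<close>,
  and \<open>h y = y - q y\<close> an element annihilated by all \<open>a < y\<close> from the left.  A section \<open>N \<rightarrow> A \<otimes>\<^sub>K N\<close> of the action
  is built by recursion on the rank of the support: on \<open>n \<in> N\<^sub>j\<close> it is \<open>p j \<cdot> (h y \<otimes> y n + t (q y \<cdot> n))\<close>,
  where \<open>q y \<cdot> n\<close> lies in summands of smaller rank, on which \<open>t\<close> is already a section.\<close>

lemma projective_criterion:
  fixes N :: "('b \<Rightarrow> 'k, 'n) module" and e :: "'j \<Rightarrow> 'n \<Rightarrow> 'n"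
  assumes N: "left_module A N" and J: "finite J"
    and p: "\<And>j. j \<in> J \<Longrightarrow> p j \<in> carrier B"
    and ec: "\<And>j n. j \<in> J \<Longrightarrow> n \<in> carrier N \<Longrightarrow> e j n \<in> carrier N"
    and ea: "\<And>j m n. j \<in> J \<Longrightarrow> m \<in> carrier N \<Longrightarrow> n \<in> carrier N \<Longrightarrow>
      e j (m \<oplus>\<^bsub>N\<^esub> n) = e j m \<oplus>\<^bsub>N\<^esub> e j n"
    and ek: "\<And>j c n. j \<in> J \<Longrightarrow> c \<in> carrier K \<Longrightarrow> n \<in> carrier N \<Longrightarrow> e j (kact N c n) = kact N c (e j n)"
    and es: "\<And>n. n \<in> carrier N \<Longrightarrow> (\<Oplus>\<^bsub>N\<^esub>j\<in>J. e j n) = n"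
    and ei: "\<And>j n. j \<in> J \<Longrightarrow> n \<in> carrier N \<Longrightarrow> e j (e j n) = e j n"
    and eo: "\<And>i j n. i \<in> J \<Longrightarrow> j \<in> J \<Longrightarrow> i \<noteq> j \<Longrightarrow> n \<in> carrier N \<Longrightarrow> e i (e j n) = \<zero>\<^bsub>N\<^esub>"
    and ep: "\<And>j n. j \<in> J \<Longrightarrow> n \<in> carrier N \<Longrightarrow> bact N (p j) (e j n) = e j n"
    and low: "\<And>a i j n. a \<in> carrier B \<Longrightarrow> i \<in> J \<Longrightarrow> j \<in> J \<Longrightarrow> n \<in> carrier N \<Longrightarrow>
      e i (bact N a (e j n)) \<noteq> \<zero>\<^bsub>N\<^esub> \<Longrightarrow> supp B (p i) \<subseteq> supp B (a \<otimes> p j)"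
    and iso: "\<And>a j. a \<in> carrier B \<Longrightarrow> j \<in> J \<Longrightarrow> p j \<otimes> a = p j \<Longrightarrow>
      \<exists>i\<in>J. p i = a \<otimes> p j \<and> (\<forall>n\<in>carrier N. e i (bact N a (e j n)) = bact N a (e j n))"
  shows "projective_module A N"
proof -
  interpret N: monoid_algebra_module B K N by (rule monoid_algebra_moduleI[OF N])
  obtain I :: "'n set" and \<pi> T where pi: "\<pi> \<in> lmod_hom A (free_module A I) N"
    and Tc: "\<And>h x. h \<in> carrier A \<Longrightarrow> x \<in> carrier N \<Longrightarrow> T h x \<in> carrier (free_module A I)"
    and Ta: "\<And>h x y. h \<in> carrier A \<Longrightarrow> x \<in> carrier N \<Longrightarrow> y \<in> carrier N \<Longrightarrow>
      T h (x \<oplus>\<^bsub>N\<^esub> y) = T h x \<oplus>\<^bsub>free_module A I\<^esub> T h y"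
    and Tk: "\<And>h c x. h \<in> carrier A \<Longrightarrow> c \<in> carrier K \<Longrightarrow> x \<in> carrier N \<Longrightarrow>
      T h (kact N c x) = kact (free_module A I) c (T h x)"
    and Ts: "\<And>g h x. g \<in> carrier A \<Longrightarrow> h \<in> carrier A \<Longrightarrow> x \<in> carrier N \<Longrightarrow>
      g \<odot>\<^bsub>free_module A I\<^esub> T h x = T (g \<otimes>\<^bsub>A\<^esub> h) x"
    and T0: "\<And>x. x \<in> carrier N \<Longrightarrow> T \<zero>\<^bsub>A\<^esub> x = \<zero>\<^bsub>free_module A I\<^esub>"
    and piT: "\<And>h x. h \<in> carrier A \<Longrightarrow> x \<in> carrier N \<Longrightarrow> \<pi> (T h x) = h \<odot>\<^bsub>N\<^esub> x"
    by (rule free_tensor_exists[OF N], rule that; (assumption | simp))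
  let ?F = "free_module A I"
  have F: "left_module A ?F" by (rule left_module_free_module[OF ring_A])
  interpret F: monoid_algebra_module B K ?F by (rule monoid_algebra_moduleI[OF F])
  note pi' = lmod_homD(1,2)[OF pi] lmod_hom_actions[OF F N pi]
  let ?B = "carrier B"

  \<comment> \<open>The elements \<open>h y\<close> may differ for different \<open>y\<close> of the
    same support. A section that commutes with the monoid must use the same one for a piece and for
    its translates, so one \<open>y\<close> is fixed per support.\<close>
  define rep where "rep b = (SOME y. y \<in> ?B \<and> supp B y = supp B b)" for b
  have rep: "rep b \<in> ?B" "supp B (rep b) = supp B b" if "b \<in> ?B" for b
    using someI[of "\<lambda>y. y \<in> ?B \<and> supp B y = supp B b" b] that unfolding rep_def by auto
  have rep_eq: "rep a = rep b" if "supp B a = supp B b" for a b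
    unfolding rep_def that ..
  define annih where "annih y q \<longleftrightarrow> q \<in> carrier A \<and> (\<forall>c\<in>?B. q c \<noteq> \<zero>\<^bsub>K\<^esub> \<longrightarrow> R_less B c y) \<and>
      (\<forall>a\<in>?B. R_less B a y \<longrightarrow> delta a \<otimes>\<^bsub>A\<^esub> (delta y \<ominus>\<^bsub>A\<^esub> q) = \<zero>\<^bsub>A\<^esub>)" for y q
  have "\<forall>y\<in>?B. \<exists>q. annih y q"
  proof
    fix y assume "y \<in> ?B"
    then show "\<exists>q. annih y q" by (rule annihilating_element_exists) (auto simp: annih_def)
  qed
  then have "\<exists>q. \<forall>y\<in>?B. annih y (q y)" by (rule bchoice)
  then obtain q where qq: "\<forall>y\<in>?B. annih y (q y)" by (rule exE)
  have q: "q y \<in> carrier A" if "y \<in> ?B" for y using qq that unfolding annih_def by blast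
  have q_less: "R_less B c y" if "y \<in> ?B" "c \<in> ?B" "q y c \<noteq> \<zero>\<^bsub>K\<^esub>" for y c
    using qq that unfolding annih_def by blast
  have q_ann: "delta a \<otimes>\<^bsub>A\<^esub> (delta y \<ominus>\<^bsub>A\<^esub> q y) = \<zero>\<^bsub>A\<^esub>" if "y \<in> ?B" "a \<in> ?B" "R_less B a y" for y a
    using qq that unfolding annih_def by blast
  define h where "h y = delta y \<ominus>\<^bsub>A\<^esub> q y" for y
  have h: "h y \<in> carrier A" if "y \<in> ?B" for y using q[OF that] by (simp add: h_def)

  \<comment> \<open>The inequality in \<open>Nk\<close> is strict, so that \<open>Nk 0\<close>
    contains only zero and the induction starts trivially.\<close>
  define rk where "rk j = card (supp B (p j))" for j
  define Nk where "Nk k = {n \<in> carrier N. \<forall>j\<in>J. e j n \<noteq> \<zero>\<^bsub>N\<^esub> \<longrightarrow> rk j < k}" for k :: nat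
  have e0: "e j \<zero>\<^bsub>N\<^esub> = \<zero>\<^bsub>N\<^esub>" if "j \<in> J" for j
    using ea[OF that, of "\<zero>\<^bsub>N\<^esub>" "\<zero>\<^bsub>N\<^esub>"] ec[OF that, of "\<zero>\<^bsub>N\<^esub>"] by simp
  have Nk_c: "n \<in> carrier N" if "n \<in> Nk k" for n k using that by (simp add: Nk_def)
  have Nk_0: "\<zero>\<^bsub>N\<^esub> \<in> Nk k" for k by (simp add: Nk_def e0)
  have Nk_add: "m \<oplus>\<^bsub>N\<^esub> n \<in> Nk k" if "m \<in> Nk k" "n \<in> Nk k" for m n k
    using that unfolding Nk_def by (auto simp: ea) (metis N.M.M.l_zero N.M.M.zero_closed)
  have Nk_kact: "kact N c n \<in> Nk k" if "n \<in> Nk k" "c \<in> carrier K" for n c k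
    using that unfolding Nk_def by (auto simp: ek)
  have Nk_sum: "(\<Oplus>\<^bsub>N\<^esub>i\<in>S. f i) \<in> Nk k" if "finite S" "\<And>i. i \<in> S \<Longrightarrow> f i \<in> Nk k" for S and f :: "'z \<Rightarrow> 'n" and k
    using that
  proof (induction S rule: finite_induct)
    case (insert i S)
    then show ?case using Nk_c by (subst N.M.M.finsum_insert) (auto intro!: Nk_add)
  qed (simp add: Nk_0)
  have Nk_mono: "n \<in> Nk l" if "n \<in> Nk k" "k \<le> l" for n k l using that by (force simp: Nk_def)
  have e_bact: "supp B (p i) \<subseteq> supp B (a \<otimes> p j)"
    if "a \<in> ?B" "i \<in> J" "j \<in> J" "x \<in> carrier N" "e j x = x" "e i (bact N a x) \<noteq> \<zero>\<^bsub>N\<^esub>" for a i j x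
    using low[OF that(1-4)] that(5,6) by simp
  \<comment> \<open>By \<open>low\<close> the surviving pieces have support inside that of
    \<open>a (p j)\<close>, which is a proper subset of the support of \<open>p j\<close> when
    \<open>a\<close> is not above \<open>p j\<close>.\<close>
  have drop: "bact N a x \<in> Nk (rk j)"
    if "a \<in> ?B" "j \<in> J" "x \<in> carrier N" "e j x = x" "\<not> supp B (p j) \<subseteq> supp B a" for a j x
  proof -
    have "rk i < rk j" if i: "i \<in> J" "e i (bact N a x) \<noteq> \<zero>\<^bsub>N\<^esub>" for i
    proof -
      have "supp B (p i) \<subseteq> supp B (a \<otimes> p j)" by (rule e_bact) fact+
      then have "supp B (p i) \<subset> supp B (p j)"
        using supp_mult_subset[of a "p j"] \<open>a \<in> ?B\<close> p[OF \<open>j \<in> J\<close>] \<open>\<not> supp B (p j) \<subseteq> supp B a\<close> by blast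
      then show ?thesis unfolding rk_def using finite_supp[OF p[OF \<open>j \<in> J\<close>]] by (rule psubset_card_mono[rotated])
    qed
    then show ?thesis using \<open>x \<in> carrier N\<close> by (simp add: Nk_def)
  qed
  have drop_q: "q y \<odot>\<^bsub>N\<^esub> x \<in> Nk (rk j)"
    if j: "j \<in> J" and x: "x \<in> carrier N" "e j x = x" and y: "y = rep (p j)" for j x y
  proof -
    have yB: "y \<in> ?B" "supp B y = supp B (p j)" using rep p j y by auto
    have "kact N (q y c) (bact N c x) \<in> Nk (rk j)" if c: "c \<in> ?B" for c
    proof (cases "q y c = \<zero>\<^bsub>K\<^esub>")
      case True
      then show ?thesis using x Nk_0 by simp
    next
      case False
      then have "supp B c \<subset> supp B y" using q_less[OF yB(1) c] R_less_supp[OF c yB(1)] by blast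
      then have "bact N c x \<in> Nk (rk j)" using drop[OF c j x] yB(2) by auto
      then show ?thesis using Nk_kact coeff_closed[OF q[OF yB(1)] c] by blast
    qed
    then show ?thesis unfolding N.smult_expand[OF q[OF yB(1)] x(1)] by (intro Nk_sum finite_B)
  qed
  have Nk_bact: "bact N a n \<in> Nk k" if a: "a \<in> ?B" and n: "n \<in> Nk k" for a n k
  proof -
    have nc: "n \<in> carrier N" by (rule Nk_c[OF n])
    have "bact N a n = bact N a (\<Oplus>\<^bsub>N\<^esub>j\<in>J. e j n)" using es[OF nc] by simp
    also have "\<dots> = (\<Oplus>\<^bsub>N\<^esub>j\<in>J. bact N a (e j n))" by (rule N.bact_finsum[OF J ec[OF _ nc]])
    finally have eq: "bact N a n = (\<Oplus>\<^bsub>N\<^esub>j\<in>J. bact N a (e j n))" .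
    have "bact N a (e j n) \<in> Nk k" if j: "j \<in> J" for j
    proof (cases "e j n = \<zero>\<^bsub>N\<^esub>")
      case True
      then show ?thesis by (simp add: Nk_0)
    next
      case False
      then have jk: "rk j < k" using n j by (auto simp: Nk_def)
      have "rk i < k" if i: "i \<in> J" "e i (bact N a (e j n)) \<noteq> \<zero>\<^bsub>N\<^esub>" for i
      proof -
        have "supp B (p i) \<subseteq> supp B (p j)"
          using low[OF a i(1) j nc i(2)] supp_mult_subset(2)[OF a p[OF j]] by blast
        then have "rk i \<le> rk j" unfolding rk_def by (rule card_mono[OF finite_supp[OF p[OF j]]])
        then show ?thesis using jk by simp
      qed
      then show ?thesis using ec[OF j nc] by (simp add: Nk_def)
    qed
    then show ?thesis unfolding eq by (intro Nk_sum J)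
  qed

  \<comment> \<open>\<open>T\<close> is only \<open>K\<close>-linear in its second argument.
    Inserting \<open>y x\<close> instead of \<open>x\<close> makes the first summand insensitive to
    replacing \<open>x\<close> by \<open>a x\<close> whenever \<open>y a = y\<close>. The factor
    \<open>p j\<close> in front removes \<open>y\<close> again, as
    \<open>p j y = p j\<close>.\<close>
  define trm where "trm t j x = bact ?F (p j) (T (h (rep (p j))) (bact N (rep (p j)) x)
      \<oplus>\<^bsub>?F\<^esub> t (q (rep (p j)) \<odot>\<^bsub>N\<^esub> x))" for t j x
  \<comment> \<open>The recursion on the rank becomes an iteration of total functions: every
    \<open>t k\<close> is linear on all of \<open>N\<close>, but only on \<open>Nk k\<close> is it a
    section.\<close>
  define \<Theta> where "\<Theta> t n = (\<Oplus>\<^bsub>?F\<^esub>j\<in>J. trm t j (e j n))" for t n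
  define t where "t k = (\<Theta> ^^ k) (\<lambda>_. \<zero>\<^bsub>?F\<^esub>)" for k
  have t_0: "t 0 = (\<lambda>_. \<zero>\<^bsub>?F\<^esub>)" and t_Suc: "t (Suc k) = \<Theta> (t k)" for k by (simp_all add: t_def)

  define lin where "lin u \<longleftrightarrow> (\<forall>x\<in>carrier N. u x \<in> carrier ?F) \<and>
      (\<forall>x\<in>carrier N. \<forall>y\<in>carrier N. u (x \<oplus>\<^bsub>N\<^esub> y) = u x \<oplus>\<^bsub>?F\<^esub> u y) \<and>
      (\<forall>c\<in>carrier K. \<forall>x\<in>carrier N. u (kact N c x) = kact ?F c (u x))" for u
  have linD: "x \<in> carrier N \<Longrightarrow> u x \<in> carrier ?F"
    "x \<in> carrier N \<Longrightarrow> y \<in> carrier N \<Longrightarrow> u (x \<oplus>\<^bsub>N\<^esub> y) = u x \<oplus>\<^bsub>?F\<^esub> u y"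
    "c \<in> carrier K \<Longrightarrow> x \<in> carrier N \<Longrightarrow> u (kact N c x) = kact ?F c (u x)" if "lin u" for u x y c
    using that by (auto simp: lin_def)
  have lin0: "u \<zero>\<^bsub>N\<^esub> = \<zero>\<^bsub>?F\<^esub>" if "lin u" for u
    using linD(2)[OF that, of "\<zero>\<^bsub>N\<^esub>" "\<zero>\<^bsub>N\<^esub>"] linD(1)[OF that, of "\<zero>\<^bsub>N\<^esub>"] by simp
  have linsum: "u (\<Oplus>\<^bsub>N\<^esub>i\<in>S. f i) = (\<Oplus>\<^bsub>?F\<^esub>i\<in>S. u (f i))"
    if "lin u" "finite S" "\<And>i. i \<in> S \<Longrightarrow> f i \<in> carrier N" for u S and f :: "'z \<Rightarrow> 'n"
    by (rule finsum_additive[OF N.M.M.abelian_group_axioms F.M.M.abelian_group_axioms that(2)])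
      (use that(3) linD[OF that(1)] in auto)
  have yB: "rep (p j) \<in> ?B" "supp B (rep (p j)) = supp B (p j)" if "j \<in> J" for j
    using rep[OF p[OF that]] by auto
  note qB = q[OF yB(1)] and hB = h[OF yB(1)]
  have lin_trm: "lin (trm u j)" if u: "lin u" and j: "j \<in> J" for u j
    unfolding lin_def trm_def
  proof (intro conjI ballI)
    let ?y = "rep (p j)"
    have qx: "q ?y \<odot>\<^bsub>N\<^esub> x \<in> carrier N" if "x \<in> carrier N" for x by (rule N.M.lm_smult_closed[OF qB[OF j] that])
    have cl: "T (h ?y) (bact N ?y x) \<in> carrier ?F" "u (q ?y \<odot>\<^bsub>N\<^esub> x) \<in> carrier ?F" if "x \<in> carrier N" for x
      using that Tc[OF hB[OF j]] linD(1)[OF u qx] by auto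
    fix x assume x: "x \<in> carrier N"
    show "bact ?F (p j) (T (h ?y) (bact N ?y x) \<oplus>\<^bsub>?F\<^esub> u (q ?y \<odot>\<^bsub>N\<^esub> x)) \<in> carrier ?F"
      using cl[OF x] by simp
    show "bact ?F (p j) (T (h ?y) (bact N ?y (x \<oplus>\<^bsub>N\<^esub> y)) \<oplus>\<^bsub>?F\<^esub> u (q ?y \<odot>\<^bsub>N\<^esub> (x \<oplus>\<^bsub>N\<^esub> y))) =
        bact ?F (p j) (T (h ?y) (bact N ?y x) \<oplus>\<^bsub>?F\<^esub> u (q ?y \<odot>\<^bsub>N\<^esub> x)) \<oplus>\<^bsub>?F\<^esub>
        bact ?F (p j) (T (h ?y) (bact N ?y y) \<oplus>\<^bsub>?F\<^esub> u (q ?y \<odot>\<^bsub>N\<^esub> y))" if y: "y \<in> carrier N" for y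
      using x y cl[OF x] cl[OF y] qx
      by (simp add: N.bact_add N.M.lm_smult_r_distr qB[OF j] Ta[OF hB[OF j]] linD(2)[OF u] F.bact_add F.M.M.a_ac)
    show "bact ?F (p j) (T (h ?y) (bact N ?y (kact N c x)) \<oplus>\<^bsub>?F\<^esub> u (q ?y \<odot>\<^bsub>N\<^esub> (kact N c x))) =
        kact ?F c (bact ?F (p j) (T (h ?y) (bact N ?y x) \<oplus>\<^bsub>?F\<^esub> u (q ?y \<odot>\<^bsub>N\<^esub> x)))" if c: "c \<in> carrier K" for c
    proof -
      have "q ?y \<odot>\<^bsub>N\<^esub> (kact N c x) = kact N c (q ?y \<odot>\<^bsub>N\<^esub> x)"
        using c x qB[OF j] by (simp add: kact_def N.M.lm_smult_assoc[symmetric] scalar_closed scalar_mult mult_scalar)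
      then show ?thesis
        using x c cl[OF x] qx
        by (simp add: N.bact_kact Tk[OF hB[OF j]] linD(3)[OF u] F.kact_add_r[symmetric] F.bact_kact)
    qed
  qed
  have lin_Theta: "lin (\<Theta> u)" if u: "lin u" for u
  proof -
    note tm = linD[OF lin_trm[OF u]]
    have "\<Theta> u (x \<oplus>\<^bsub>N\<^esub> y) = \<Theta> u x \<oplus>\<^bsub>?F\<^esub> \<Theta> u y" if x: "x \<in> carrier N" and y: "y \<in> carrier N" for x y
    proof -
      have "\<Theta> u (x \<oplus>\<^bsub>N\<^esub> y) = (\<Oplus>\<^bsub>?F\<^esub>j\<in>J. trm u j (e j x) \<oplus>\<^bsub>?F\<^esub> trm u j (e j y))"
        unfolding \<Theta>_def by (rule F.M.M.finsum_cong'[OF refl]) (use x y in \<open>auto simp: ea ec tm\<close>)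
      also have "\<dots> = \<Theta> u x \<oplus>\<^bsub>?F\<^esub> \<Theta> u y"
        unfolding \<Theta>_def by (rule F.M.M.finsum_addf) (use x y in \<open>auto simp: ec tm\<close>)
      finally show ?thesis .
    qed
    moreover have "\<Theta> u (kact N c x) = kact ?F c (\<Theta> u x)" if c: "c \<in> carrier K" and x: "x \<in> carrier N" for c x
    proof -
      have "\<Theta> u (kact N c x) = (\<Oplus>\<^bsub>?F\<^esub>j\<in>J. kact ?F c (trm u j (e j x)))"
        unfolding \<Theta>_def by (rule F.M.M.finsum_cong'[OF refl]) (use c x in \<open>auto simp: ek ec tm\<close>)
      also have "\<dots> = kact ?F c (\<Theta> u x)"
        unfolding \<Theta>_def by (rule F.kact_finsum[OF J c, symmetric]) (use x in \<open>auto simp: ec tm\<close>)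
      finally show ?thesis .
    qed
    moreover have "\<Theta> u x \<in> carrier ?F" if "x \<in> carrier N" for x
      unfolding \<Theta>_def by (rule F.M.M.finsum_closed) (use that in \<open>auto simp: ec tm\<close>)
    ultimately show ?thesis by (auto simp: lin_def)
  qed
  have lin_t: "lin (t k)" for k
  proof (induction k)
    case 0
    show ?case by (simp add: t_0 lin_def)
  next
    case (Suc k)
    then show ?case by (simp add: t_Suc lin_Theta)
  qed

  have trm_0: "trm u j \<zero>\<^bsub>N\<^esub> = \<zero>\<^bsub>?F\<^esub>" if "lin u" "j \<in> J" for u j
    by (rule lin0[OF lin_trm[OF that]])
  have Theta_e: "\<Theta> u x = trm u j x" if u: "lin u" and j: "j \<in> J" and x: "x \<in> carrier N" "e j x = x" for u j x
  proof -
    have "(\<Oplus>\<^bsub>?F\<^esub>i\<in>J. trm u i (e i x)) = trm u j (e j x)"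
    proof (rule F.M.M.finsum_delta[OF J j])
      show "trm u j (e j x) \<in> carrier ?F" using linD(1)[OF lin_trm[OF u j]] x by simp
      show "trm u i (e i x) = \<zero>\<^bsub>?F\<^esub>" if "i \<in> J" "i \<noteq> j" for i
        using eo[OF that(1) j that(2) x(1)] x(2) trm_0[OF u that(1)] by simp
    qed
    then show ?thesis by (simp add: \<Theta>_def x)
  qed

  \<comment> \<open>On \<open>Nk (Suc k)\<close> the map \<open>t (Suc k)\<close> evaluates
    \<open>t k\<close> inside \<open>Nk k\<close> only, since \<open>q y\<close> lowers the rank.
    Stability is needed when \<open>a x\<close> drops to lower rank, where an earlier iterate
    governs it.\<close>
  have stable: "t (Suc k) n = t k n" if "n \<in> Nk k" for k n
    using that
  proof (induction k arbitrary: n)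
    case 0
    then have n: "n \<in> carrier N" "\<And>j. j \<in> J \<Longrightarrow> e j n = \<zero>\<^bsub>N\<^esub>" by (auto simp: Nk_def)
    have "n = (\<Oplus>\<^bsub>N\<^esub>j\<in>J. e j n)" using es[OF n(1)] by simp
    also have "\<dots> = \<zero>\<^bsub>N\<^esub>" using n(2) by (rule N.M.M.add.finprod_one_eqI)
    finally have "n = \<zero>\<^bsub>N\<^esub>" .
    then show ?case using lin0[OF lin_t, of "Suc 0"] by (simp add: t_0)
  next
    case (Suc k)
    have n: "n \<in> carrier N" by (rule Nk_c[OF Suc.prems])
    have "trm (t (Suc k)) j (e j n) = trm (t k) j (e j n)" if j: "j \<in> J" for j
    proof -
      have "q (rep (p j)) \<odot>\<^bsub>N\<^esub> e j n \<in> Nk k"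
      proof (cases "e j n = \<zero>\<^bsub>N\<^esub>")
        case True
        then show ?thesis using qB[OF j] by (simp add: Nk_0)
      next
        case False
        then have "rk j \<le> k" using Suc.prems j by (auto simp: Nk_def)
        then show ?thesis using drop_q[OF j ec[OF j n] ei[OF j n] refl] Nk_mono by blast
      qed
      then show ?thesis by (simp add: trm_def Suc.IH)
    qed
    then show ?case unfolding t_Suc[of "Suc k"] t_Suc[of k] \<Theta>_def
      by (intro F.M.M.finsum_cong'[OF refl]) (use linD(1)[OF lin_trm[OF lin_t]] ec[OF _ n] in \<open>auto simp: t_Suc[symmetric]\<close>)
  qed

  have main: "\<pi> (t k n) = n \<and> (\<forall>a\<in>?B. t k (bact N a n) = bact ?F a (t k n))" if "n \<in> Nk k" for k n
    using that
  proof (induction k arbitrary: n)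
    case 0
    then have n: "n \<in> carrier N" "\<And>j. j \<in> J \<Longrightarrow> e j n = \<zero>\<^bsub>N\<^esub>" by (auto simp: Nk_def)
    have "n = (\<Oplus>\<^bsub>N\<^esub>j\<in>J. e j n)" using es[OF n(1)] by simp
    also have "\<dots> = \<zero>\<^bsub>N\<^esub>" using n(2) by (rule N.M.M.add.finprod_one_eqI)
    finally have "n = \<zero>\<^bsub>N\<^esub>" .
    then show ?case using lmod_hom_zero[OF F N pi] by (simp add: t_0)
  next
    case (Suc k)
    have n: "n \<in> carrier N" by (rule Nk_c[OF Suc.prems])
    let ?u = "t k"
    note u = lin_t[of k]
    have tn: "t (Suc k) m = (\<Oplus>\<^bsub>?F\<^esub>j\<in>J. trm ?u j (e j m))" for m by (simp add: t_Suc \<Theta>_def)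
    have piece: "\<pi> (trm ?u j x) = x \<and> (\<forall>a\<in>?B. t (Suc k) (bact N a x) = bact ?F a (trm ?u j x))"
      if j: "j \<in> J" and x: "x \<in> carrier N" "e j x = x" and jk: "rk j \<le> k" for j x
    proof -
      let ?b = "p j" and ?y = "rep (p j)"
      have bB: "?b \<in> ?B" and y: "?y \<in> ?B" "supp B ?y = supp B ?b" using p j yB by auto
      have hy: "h ?y \<in> carrier A" and qy: "q ?y \<in> carrier A" using hB qB j by auto
      have yb: "?y \<otimes> ?b = ?y" and by': "?b \<otimes> ?y = ?b"
        using supp_subset_iff[OF y(1) bB] supp_subset_iff[OF bB y(1)] y(2) by auto
      have bx: "bact N ?b x = x" using ep[OF j x(1)] x(2) by simp
      have qx: "q ?y \<odot>\<^bsub>N\<^esub> x \<in> carrier N" by (rule N.M.lm_smult_closed[OF qy x(1)])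
      have qxN: "q ?y \<odot>\<^bsub>N\<^esub> x \<in> Nk k" using drop_q[OF j x refl] Nk_mono jk by blast
      let ?Z = "T (h ?y) (bact N ?y x) \<oplus>\<^bsub>?F\<^esub> ?u (q ?y \<odot>\<^bsub>N\<^esub> x)"
      have Zc: "T (h ?y) (bact N ?y x) \<in> carrier ?F" "?u (q ?y \<odot>\<^bsub>N\<^esub> x) \<in> carrier ?F"
        using Tc[OF hy] linD(1)[OF u qx] x by auto
      have Z: "trm ?u j x = bact ?F ?b ?Z" by (simp add: trm_def)
      have hdy: "h ?y \<otimes>\<^bsub>A\<^esub> delta ?y = h ?y"
      proof -
        have "q ?y \<otimes>\<^bsub>A\<^esub> delta ?y = q ?y"
        proof (rule mult_delta_absorb[OF qy y(1)])
          fix c assume c: "c \<in> ?B" "q ?y c \<noteq> \<zero>\<^bsub>K\<^esub>"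
          show "c \<otimes> ?y = c" using R_less_supp[OF c(1) y(1) q_less[OF y(1) c]] supp_subset_iff[OF c(1) y(1)] by blast
        qed
        then show ?thesis unfolding h_def using qy y(1)
          by (simp add: A.minus_eq A.l_distr A.l_minus delta_delta idem)
      qed
      have h_smult: "h ?y \<odot>\<^bsub>N\<^esub> m = bact N ?y m \<ominus>\<^bsub>N\<^esub> q ?y \<odot>\<^bsub>N\<^esub> m" if "m \<in> carrier N" for m
        unfolding h_def bact_def using qy that by (intro N.M.lm_diff_l) auto
      \<comment> \<open>The bracket maps to \<open>h y x + q y x = y x\<close> because
        \<open>h y = y - q y\<close>; then \<open>p j y x = p j x = x\<close>.\<close>
      have "\<pi> (trm ?u j x) = bact N ?b (\<pi> ?Z)"
        unfolding Z using Zc by (intro pi'(4)) auto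
      also have "\<pi> ?Z = h ?y \<odot>\<^bsub>N\<^esub> (bact N ?y x) \<oplus>\<^bsub>N\<^esub> q ?y \<odot>\<^bsub>N\<^esub> x"
        using Zc x hy Suc.IH[OF qxN] by (simp add: pi'(2) piT)
      also have "h ?y \<odot>\<^bsub>N\<^esub> (bact N ?y x) = h ?y \<odot>\<^bsub>N\<^esub> x"
        using hdy hy x by (simp add: bact_def N.M.lm_smult_assoc[symmetric])
      also have "h ?y \<odot>\<^bsub>N\<^esub> x \<oplus>\<^bsub>N\<^esub> q ?y \<odot>\<^bsub>N\<^esub> x = bact N ?y x"
        using x qx by (simp add: h_smult N.M.M.minus_eq N.M.M.a_assoc N.M.M.l_neg)
      also have "bact N ?b (bact N ?y x) = x" using x bB y bx by' by (simp add: N.bact_mult)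
      finally have 1: "\<pi> (trm ?u j x) = x" .
      have 2: "t (Suc k) (bact N a x) = bact ?F a (trm ?u j x)" if a: "a \<in> ?B" for a
      proof (cases "supp B ?b \<subseteq> supp B a")
        \<comment> \<open>The element \<open>a\<close> carries the piece to one of the same support,
          so the representative \<open>y\<close> is the same. Both \<open>y\<close> and
          \<open>q y\<close> absorb \<open>a (p j)\<close> on the right; the bracket
          \<open>?Z\<close> does not change, and only its left factor turns from \<open>p j\<close>
          into \<open>a (p j)\<close>.\<close>
        case True
        then have ba: "?b \<otimes> a = ?b" using supp_subset_iff[OF bB a] by simp
        from iso[OF a j ba] obtain i where i: "i \<in> J" "p i = a \<otimes> ?b"
          and ei': "\<forall>n\<in>carrier N. e i (bact N a (e j n)) = bact N a (e j n)" by blast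
        have ax: "bact N a x \<in> carrier N" "e i (bact N a x) = bact N a x"
          using ei' x by auto
        have abB: "a \<otimes> ?b \<in> ?B" using a bB by simp
        have sab: "supp B (a \<otimes> ?b) = supp B ?b"
          using supp_mult_subset(2)[OF a bB] subset_supp_mult[OF a bB bB] True by blast
        have abx: "bact N a x = bact N (a \<otimes> ?b) x" using N.bact_mult[OF a bB x(1)] bx by simp
        have yab: "?y \<otimes> (a \<otimes> ?b) = ?y" using supp_subset_iff[OF y(1) abB] sab y(2) by simp
        have yax: "bact N ?y (bact N a x) = bact N ?y x"
          unfolding abx using N.bact_mult[OF y(1) abB x(1)] yab by simp
        have "q ?y \<otimes>\<^bsub>A\<^esub> delta (a \<otimes> ?b) = q ?y"
        proof (rule mult_delta_absorb[OF qy abB])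
          fix c assume c: "c \<in> ?B" "q ?y c \<noteq> \<zero>\<^bsub>K\<^esub>"
          show "c \<otimes> (a \<otimes> ?b) = c"
            using R_less_supp[OF c(1) y(1) q_less[OF y(1) c]] supp_subset_iff[OF c(1) abB] sab y(2) by blast
        qed
        then have qax: "q ?y \<odot>\<^bsub>N\<^esub> bact N a x = q ?y \<odot>\<^bsub>N\<^esub> x"
          unfolding abx using qy x by (simp add: bact_def N.M.lm_smult_assoc[symmetric])
        have "t (Suc k) (bact N a x) = trm ?u i (bact N a x)"
          unfolding t_Suc by (rule Theta_e[OF u i(1) ax])
        also have "\<dots> = bact ?F (a \<otimes> ?b) ?Z"
          unfolding trm_def i(2) rep_eq[OF sab] yax qax ..
        also have "\<dots> = bact ?F a (trm ?u j x)" unfolding Z using Zc a bB by (simp add: F.bact_mult)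
        finally show ?thesis .
      next
        case False
        \<comment> \<open>This element lies strictly below \<open>y\<close>, so it kills
          \<open>h y\<close> from the left, and \<open>a (p j) = a (p j) ?a\<close>. Hence in
          \<open>a (p j) ?Z\<close> only the recursive summand survives, where the induction
          hypothesis lets the monoid pass through \<open>t k\<close>.\<close>
        let ?a = "?y \<otimes> (a \<otimes> ?b)"
        have abB: "a \<otimes> ?b \<in> ?B" and a'B: "?a \<in> ?B" using a bB y by auto
        have a'_supp: "supp B ?a \<subseteq> supp B a"
          using supp_mult_subset(2)[OF y(1) abB] supp_mult_subset(1)[OF a bB] by blast
        have "R_less B ?a ?y"
          unfolding R_less_def using R_le_mult[OF y(1) abB] a'_supp False y(2) by auto
        then have ann: "delta ?a \<otimes>\<^bsub>A\<^esub> h ?y = \<zero>\<^bsub>A\<^esub>" unfolding h_def by (rule q_ann[OF y(1) a'B])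
        have aba: "(a \<otimes> ?b) \<otimes> ?a = a \<otimes> ?b"
        proof -
          have "(a \<otimes> ?b) \<otimes> ?a = a \<otimes> (?b \<otimes> ?y) \<otimes> (a \<otimes> ?b)"
            using a bB y(1) by (simp add: m_assoc)
          also have "\<dots> = a \<otimes> ?b" unfolding by' by (rule idem[OF abB])
          finally show ?thesis .
        qed
        have aZ: "bact ?F ?a ?Z = ?u (bact N ?a (q ?y \<odot>\<^bsub>N\<^esub> x))"
        proof -
          have "bact ?F ?a (T (h ?y) (bact N ?y x)) = \<zero>\<^bsub>?F\<^esub>"
            using hy x by (simp add: bact_def[of ?F] Ts ann T0)
          then have "bact ?F ?a ?Z = bact ?F ?a (?u (q ?y \<odot>\<^bsub>N\<^esub> x))" using Zc by (simp add: F.bact_add)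
          then show ?thesis using Suc.IH[OF qxN] a'B by simp
        qed
        \<comment> \<open>The same annihilation, now in \<open>N\<close>: after multiplication by
          \<open>?a\<close> the element \<open>q y x\<close> equals \<open>y x\<close>, so that the
          recursive summand reproduces \<open>a x\<close>.\<close>
        have "delta ?a \<odot>\<^bsub>N\<^esub> (h ?y \<odot>\<^bsub>N\<^esub> x) = \<zero>\<^bsub>N\<^esub>"
          using hy x by (simp add: N.M.lm_smult_assoc[symmetric] ann)
        then have "bact N ?a (bact N ?y x \<ominus>\<^bsub>N\<^esub> q ?y \<odot>\<^bsub>N\<^esub> x) = \<zero>\<^bsub>N\<^esub>"
          using h_smult[OF x(1)] by (simp add: bact_def)
        then have aq: "bact N ?a (q ?y \<odot>\<^bsub>N\<^esub> x) = bact N ?a (bact N ?y x)"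
          using x qx N.M.M.diff_zero_imp_eq[of "bact N ?a (bact N ?y x)" "bact N ?a (q ?y \<odot>\<^bsub>N\<^esub> x)"]
          by (simp add: N.bact_diff)
        have aqN: "bact N ?a (q ?y \<odot>\<^bsub>N\<^esub> x) \<in> Nk k" by (rule Nk_bact[OF a'B qxN])
        have ax: "bact N (a \<otimes> ?b) (bact N ?a (q ?y \<odot>\<^bsub>N\<^esub> x)) = bact N a x"
        proof -
          have "bact N (a \<otimes> ?b) (bact N ?a (q ?y \<odot>\<^bsub>N\<^esub> x)) = bact N ((a \<otimes> ?b) \<otimes> ?a) (bact N ?y x)"
            unfolding aq by (rule N.bact_mult[OF abB a'B]) (use x in simp)
          also have "\<dots> = bact N (a \<otimes> ?b \<otimes> ?y) x" unfolding aba by (rule N.bact_mult[OF abB y(1) x(1)])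
          also have "a \<otimes> ?b \<otimes> ?y = a \<otimes> ?b" using a bB y(1) by' by (simp add: m_assoc)
          also have "bact N (a \<otimes> ?b) x = bact N a x" using N.bact_mult[OF a bB x(1)] bx by simp
          finally show ?thesis .
        qed
        have axN: "bact N a x \<in> Nk k" unfolding ax[symmetric] by (rule Nk_bact[OF abB aqN])
        have "bact ?F a (trm ?u j x) = bact ?F (a \<otimes> ?b) ?Z"
          unfolding Z using Zc a bB by (simp add: F.bact_mult)
        also have "\<dots> = bact ?F (a \<otimes> ?b) (bact ?F ?a ?Z)"
          using F.bact_mult[OF abB a'B, of ?Z] Zc aba by simp
        also have "\<dots> = ?u (bact N (a \<otimes> ?b) (bact N ?a (q ?y \<odot>\<^bsub>N\<^esub> x)))"
          unfolding aZ using Suc.IH[OF aqN] abB by simp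
        also have "\<dots> = t (Suc k) (bact N a x)" unfolding ax by (rule stable[OF axN, symmetric])
        finally show ?thesis by simp
      qed
      from 1 2 show ?thesis by blast
    qed
    have piece0: "\<pi> (trm ?u j (e j n)) = e j n \<and>
        (\<forall>a\<in>?B. t (Suc k) (bact N a (e j n)) = bact ?F a (trm ?u j (e j n)))" if j: "j \<in> J" for j
    proof (cases "e j n = \<zero>\<^bsub>N\<^esub>")
      case True
      then show ?thesis using trm_0[OF u j] lmod_hom_zero[OF F N pi] lin0[OF lin_t] by simp
    next
      case False
      then have "rk j \<le> k" using Suc.prems j by (auto simp: Nk_def)
      then show ?thesis using piece[OF j ec[OF j n] ei[OF j n]] by blast
    qed
    have tc: "trm ?u j (e j n) \<in> carrier ?F" if "j \<in> J" for j
      using linD(1)[OF lin_trm[OF u that]] ec[OF that n] by simp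
    have "\<pi> (t (Suc k) n) = (\<Oplus>\<^bsub>N\<^esub>j\<in>J. \<pi> (trm ?u j (e j n)))"
      unfolding tn by (rule lmod_hom_finsum[OF F N pi J tc])
    also have "\<dots> = (\<Oplus>\<^bsub>N\<^esub>j\<in>J. e j n)"
      by (rule N.M.M.finsum_cong'[OF refl]) (use piece0 ec n in auto)
    finally have 1: "\<pi> (t (Suc k) n) = n" using es[OF n] by simp
    have 2: "t (Suc k) (bact N a n) = bact ?F a (t (Suc k) n)" if a: "a \<in> ?B" for a
    proof -
      have "bact N a n = (\<Oplus>\<^bsub>N\<^esub>j\<in>J. bact N a (e j n))"
        using N.bact_finsum[where b = a and f = "\<lambda>j. e j n", OF J] ec n es[OF n] by simp
      then have "t (Suc k) (bact N a n) = (\<Oplus>\<^bsub>?F\<^esub>j\<in>J. t (Suc k) (bact N a (e j n)))"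
        using linsum[OF lin_t J, of "\<lambda>j. bact N a (e j n)"] ec n by simp
      also have "\<dots> = (\<Oplus>\<^bsub>?F\<^esub>j\<in>J. bact ?F a (trm ?u j (e j n)))"
        by (rule F.M.M.finsum_cong'[OF refl]) (use piece0 tc a in auto)
      also have "\<dots> = bact ?F a (t (Suc k) n)" unfolding tn by (rule F.bact_finsum[OF J tc, symmetric])
      finally show ?thesis .
    qed
    from 1 2 show ?case by blast
  qed

  \<comment> \<open>Ranks are at most the size of the monoid; with one more, the strict bound in
    \<open>Nk\<close> holds for every piece.\<close>
  let ?k = "Suc (card ?B)"
  have all: "n \<in> Nk ?k" if "n \<in> carrier N" for n
    using that card_mono[OF finite_B supp_subset_carrier[OF p]] by (auto simp: Nk_def rk_def less_Suc_eq_le)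
  note tk = linD[OF lin_t[of ?k]] and mk = main[OF all]
  have s: "restrict (t ?k) (carrier N) \<in> lmod_hom A N ?F"
    by (rule lmod_hom_actionsI[OF N F]) (use tk mk in auto)
  show ?thesis
    by (rule projective_module_free_retract[of A N "restrict (t ?k) (carrier N)" I \<pi>, OF N s pi]) (use mk in simp)
qed

end

section \<open>The Hasse tree\<close>

context left_regular_band_monoid
begin

lemma childrenD:
  assumes "z \<in> children B y"
  shows "z \<in> carrier B" "R_less B z y"
  using assms by (auto simp: children_def)

lemma children_between:
  "z \<in> children B y \<Longrightarrow> w \<in> carrier B \<Longrightarrow> R_less B z w \<Longrightarrow> R_less B w y \<Longrightarrow> False"
  by (auto simp: children_def)

lemma R_less_le_trans: "a \<in> carrier B \<Longrightarrow> b \<in> carrier B \<Longrightarrow> c \<in> carrier B \<Longrightarrow>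
    R_less B a b \<Longrightarrow> R_le B b c \<Longrightarrow> R_less B a c"
  unfolding R_less_def by (metis R_le_trans R_le_antisym)

lemma R_less_card_supp:
  "finite (carrier B) \<Longrightarrow> a \<in> carrier B \<Longrightarrow> b \<in> carrier B \<Longrightarrow> R_less B a b \<Longrightarrow> card (supp B a) < card (supp B b)"
  using R_less_supp psubset_card_mono finite_subset[OF supp_subset_carrier] by metis

text \<open>An element of smallest support among those strictly above \<open>z\<close> and below
  \<open>y\<close> covers \<open>z\<close>, because supports shrink strictly along the
  order.\<close>

lemma exists_cover_above:
  assumes fin: "finite (carrier B)" and z: "z \<in> carrier B" and y: "y \<in> carrier B" and zy: "R_less B z y"
  obtains w where "w \<in> carrier B" "z \<in> children B w" "R_le B w y"
proof -
  let ?P = "\<lambda>w. w \<in> carrier B \<and> R_less B z w \<and> R_le B w y"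
  have "?P y" using y zy R_le_refl by blast
  then obtain w where w: "?P w" and min: "\<And>v. ?P v \<Longrightarrow> card (supp B w) \<le> card (supp B v)"
    using ex_has_least_nat[of ?P y "\<lambda>w. card (supp B w)"] by blast
  have "\<not> (R_less B z v \<and> R_less B v w)" if v: "v \<in> carrier B" for v
  proof
    assume a: "R_less B z v \<and> R_less B v w"
    then have "?P v" using v w y R_le_trans[of v w y] by (auto simp: R_less_def)
    then show False using min R_less_card_supp[OF fin v _ conjunct2[OF a]] w by force
  qed
  then show thesis using that[of w] w z by (auto simp: children_def)
qed

lemma exists_child_above:
  assumes fin: "finite (carrier B)" and z: "z \<in> carrier B" and y: "y \<in> carrier B" and zy: "R_less B z y"
  obtains w where "w \<in> children B y" "R_le B z w"
proof -
  let ?P = "\<lambda>w. w \<in> carrier B \<and> R_le B z w \<and> R_less B w y"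
  have Pz: "?P z" using z zy R_le_refl by blast
  have "card (supp B w) \<le> card (carrier B)" if "?P w" for w
    using that card_mono[OF fin supp_subset_carrier] by blast
  then have "\<forall>w. ?P w \<longrightarrow> card (supp B w) < Suc (card (carrier B))" by (simp add: less_Suc_eq_le)
  then obtain w where w: "?P w" and max: "\<And>v. ?P v \<Longrightarrow> card (supp B v) \<le> card (supp B w)"
    using ex_has_greatest_nat[of ?P z "\<lambda>w. card (supp B w)", OF Pz] by blast
  have "\<not> (R_less B w v \<and> R_less B v y)" if v: "v \<in> carrier B" for v
  proof
    assume a: "R_less B w v \<and> R_less B v y"
    then have "?P v" using v w z R_le_trans[of z w v] by (auto simp: R_less_def)
    then show False using max R_less_card_supp[OF fin _ v conjunct1[OF a]] w by force
  qed
  then show thesis using that[of w] w by (auto simp: children_def)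
qed

lemma covering_chain_exists:
  assumes fin: "finite (carrier B)" and y: "y \<in> carrier B"
  shows "\<exists>xs. xs \<noteq> [] \<and> hd xs = y \<and> last xs = \<one> \<and> set xs \<subseteq> carrier B \<and> successively (\<lambda>a b. a \<in> children B b) xs"
  using y
proof (induction "card (carrier B) - card (supp B y)" arbitrary: y rule: less_induct)
  case less
  show ?case
  proof (cases "y = \<one>")
    case True
    then show ?thesis by (intro exI[of _ "[\<one>]"]) auto
  next
    case False
    then have "R_less B y \<one>" using less.prems R_le_one by (simp add: R_less_def)
    then obtain w where w: "w \<in> carrier B" "y \<in> children B w"
      using exists_cover_above[OF fin less.prems one_closed] by blast
    have "card (supp B y) < card (supp B w)"
      by (rule R_less_card_supp[OF fin less.prems w(1) childrenD(2)[OF w(2)]])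
    moreover have "card (supp B w) \<le> card (carrier B)" by (rule card_mono[OF fin supp_subset_carrier[OF w(1)]])
    ultimately have "card (carrier B) - card (supp B w) < card (carrier B) - card (supp B y)" by linarith
    from less.hyps[OF this w(1)] obtain xs where
      "xs \<noteq> []" "hd xs = w" "last xs = \<one>" "set xs \<subseteq> carrier B" "successively (\<lambda>a b. a \<in> children B b) xs" by blast
    then show ?thesis using w less.prems by (intro exI[of _ "y # xs"]) (auto simp: successively_Cons)
  qed
qed

lemma covering_chain_ascending:
  assumes c: "set (x # xs) \<subseteq> carrier B" "successively (\<lambda>a b. a \<in> children B b) (x # xs)"
  shows "\<forall>w\<in>set xs. R_less B x w" "distinct (x # xs)"
  using assms
proof (induction xs arbitrary: x)
  case (Cons a xs)
  { case 1
    then have xa: "R_less B x a" using childrenD by auto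
    have "R_less B x w" if "w \<in> set xs" for w
      using Cons.IH(1)[of a] 1 that R_less_le_trans[of x a w] xa by (auto simp: R_less_def)
    then show ?case using xa by auto }
  note asc = this
  { case 2
    then have "\<forall>w\<in>set (a # xs). R_less B x w" by (intro asc)
    then have "x \<notin> set (a # xs)" by (auto simp: R_less_def)
    then show ?case using Cons.IH(2)[of a] 2 by auto }
qed auto

text \<open>Index arithmetic modulo the length is replaced by consecutive edges and one closing
  edge.\<close>

lemma hasse_cycleI:
  assumes E: "successively (\<lambda>a b. (a, b) \<in> hasse_edges B) vs" "(last vs, hd vs) \<in> hasse_edges B"
    and "3 \<le> length vs" "distinct vs" "set vs \<subseteq> carrier B"
  shows "\<not> right_hereditary B"
proof -
  have "(vs ! i, vs ! (Suc i mod length vs)) \<in> hasse_edges B" if i: "i < length vs" for i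
  proof (cases "Suc i < length vs")
    case True
    then show ?thesis using E(1) by (simp add: successively_conv_nth)
  next
    case False
    then have "Suc i = length vs" using i by simp
    moreover from this have "vs ! i = last vs" by (metis diff_Suc_1 last_conv_nth list.size(3) nat.distinct(1))
    moreover have "vs ! 0 = hd vs" using i by (metis hd_conv_nth length_0_conv less_nat_zero_code)
    ultimately show ?thesis using E(2) by simp
  qed
  then show ?thesis using assms(3-5) unfolding right_hereditary_def is_tree_def by blast
qed

text \<open>Two parents \<open>y\<close>, \<open>y'\<close> of \<open>z\<close> start two ascending
  chains to \<open>\<one>\<close>. The second is cut at its first element \<open>m\<close> that lies
  on the first; going up from \<open>z\<close> to \<open>m\<close> along one chain and back down
  along the other is a cycle.\<close>

lemma unique_parent:
  assumes fin: "finite (carrier B)" and rh: "right_hereditary B"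
    and y: "y \<in> carrier B" "z \<in> children B y" and y': "y' \<in> carrier B" "z \<in> children B y'"
  shows "y = y'"
proof (rule ccontr)
  assume ne: "y \<noteq> y'"
  let ?C = "\<lambda>a b. a \<in> children B b" and ?E = "\<lambda>a b. (a, b) \<in> hasse_edges B"
  obtain us where us: "us \<noteq> []" "hd us = y" "last us = \<one>" "set us \<subseteq> carrier B" "successively ?C us"
    using covering_chain_exists[OF fin y(1)] by blast
  obtain ws where ws: "ws \<noteq> []" "hd ws = y'" "last ws = \<one>" "set ws \<subseteq> carrier B" "successively ?C ws"
    using covering_chain_exists[OF fin y'(1)] by blast
  have z: "z \<in> carrier B" by (rule childrenD(1)[OF y(2)])
  have "\<one> \<in> set us" "\<one> \<in> set ws" using us ws last_in_set by metis+
  then have "\<exists>x\<in>set ws. x \<in> set us" by blast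
  then obtain ws1 m ws2 where w: "ws = ws1 @ m # ws2" "m \<in> set us" "\<forall>x\<in>set ws1. x \<notin> set us"
    using split_list_first_prop[of ws "\<lambda>x. x \<in> set us"] by blast
  obtain us1 us2 where u: "us = us1 @ m # us2" using split_list[OF w(2)] by blast
  let ?vs = "z # us1 @ m # rev ws1"
  have zu: "successively ?C (z # us)" and zw: "successively ?C (z # ws)"
    using us ws y(2) y'(2) by (auto simp: successively_Cons)
  have du: "distinct (z # us)" and dw: "distinct (z # ws)"
    using covering_chain_ascending(2)[OF _ zu] covering_chain_ascending(2)[OF _ zw] us ws z by auto
  have "distinct ?vs" using du dw u w by auto
  moreover have "set ?vs \<subseteq> carrier B" using us ws u w z by auto
  \<comment> \<open>If both segments below \<open>m\<close> were empty, \<open>m\<close> would be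
    \<open>y\<close> as well as \<open>y'\<close>.\<close>
  moreover have "3 \<le> length ?vs"
  proof (cases "us1 = [] \<and> ws1 = []")
    case True
    then show ?thesis using u w us ws ne by simp
  next
    case False
    then show ?thesis by (cases us1; cases ws1) auto
  qed
  moreover have "successively ?E ?vs"
  proof -
    have CE: "?E a b" "?E b a" if "?C a b" "b \<in> carrier B" for a b
      using that childrenD(1) by (auto simp: hasse_edges_def)
    have "successively ?C ((z # us1 @ [m]) @ us2)" using zu u by simp
    then have "successively ?C (z # us1 @ [m])" by (subst (asm) successively_append_iff) simp
    then have 1: "successively ?E (z # us1 @ [m])"
      by (rule successively_mono) (use CE us u z in auto)
    have "successively ?C ((ws1 @ [m]) @ ws2)" using ws w by simp
    then have "successively ?C (ws1 @ [m])" by (subst (asm) successively_append_iff) simp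
    then have "successively (\<lambda>a b. ?E b a) (ws1 @ [m])"
      by (rule successively_mono) (use CE ws w in auto)
    then have "successively ?E (rev (ws1 @ [m]))" by (subst successively_rev)
    then have 2: "successively ?E (m # rev ws1)" by simp
    from 1 have "successively ?E ((z # us1) @ [m])" by simp
    then have "successively ?E ((z # us1) @ (m # rev ws1))"
      using 2 unfolding successively_append_iff[of _ "z # us1"] by simp
    then show ?thesis by simp
  qed
  moreover have "(last ?vs, hd ?vs) \<in> hasse_edges B"
  proof -
    have "last ?vs = y'" using w(1) ws(2) by (cases ws1) auto
    then show ?thesis using y' z by (simp add: hasse_edges_def)
  qed
  ultimately have "\<not> right_hereditary B" by (intro hasse_cycleI)
  then show False using rh by blast
qed

text \<open>From \<open>c\<close> there is only one way up: \<open>w\<close> and \<open>v\<close>,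
  if different from \<open>c\<close>, both lie above the unique parent of \<open>c\<close>, to which
  the induction hypothesis applies.\<close>

lemma R_le_comparable:
  assumes fin: "finite (carrier B)" and rh: "right_hereditary B"
    and c: "c \<in> carrier B" and w: "w \<in> carrier B" and v: "v \<in> carrier B" and "R_le B c w" "R_le B c v"
  shows "R_le B w v \<or> R_le B v w"
  using c assms(6,7)
proof (induction "card (carrier B) - card (supp B c)" arbitrary: c rule: less_induct)
  case less
  show ?case
  proof (cases "c = w \<or> c = v")
    case True
    then show ?thesis using less.prems by blast
  next
    case False
    then have cw: "R_less B c w" and cv: "R_less B c v" using less.prems by (auto simp: R_less_def)
    obtain p where p: "p \<in> carrier B" "c \<in> children B p" "R_le B p w"
      by (rule exists_cover_above[OF fin less.prems(1) w cw])
    obtain p' where p': "p' \<in> carrier B" "c \<in> children B p'" "R_le B p' v"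
      by (rule exists_cover_above[OF fin less.prems(1) v cv])
    have "p = p'" by (rule unique_parent[OF fin rh p(1,2) p'(1,2)])
    then have pv: "R_le B p v" using p' by simp
    have "card (supp B c) < card (supp B p)"
      by (rule R_less_card_supp[OF fin less.prems(1) p(1) childrenD(2)[OF p(2)]])
    moreover have "card (supp B p) \<le> card (carrier B)" by (rule card_mono[OF fin supp_subset_carrier[OF p(1)]])
    ultimately have "card (carrier B) - card (supp B p) < card (carrier B) - card (supp B c)" by linarith
    from less.hyps[OF this p(1) p(3) pv] show ?thesis .
  qed
qed

lemma unique_child_above:
  assumes fin: "finite (carrier B)" and rh: "right_hereditary B"
    and c: "c \<in> carrier B" "R_le B c z" "R_le B c w" and z: "z \<in> children B y" and w: "w \<in> children B y"
  shows "z = w"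
  using R_le_comparable[OF fin rh c(1) childrenD(1)[OF z] childrenD(1)[OF w] c(2,3)]
    children_between[OF z childrenD(1)[OF w]] children_between[OF w childrenD(1)[OF z]]
    childrenD(2)[OF z] childrenD(2)[OF w] by (auto simp: R_less_def)

text \<open>In any finite left regular band monoid each element other than \<open>\<one>\<close> has
  a cover above it; the tree property makes the choice unique, see \<open>parent_eq\<close>.\<close>

definition parent :: "'a \<Rightarrow> 'a" where
  "parent z = (SOME y. y \<in> carrier B \<and> z \<in> children B y)"

lemma parent:
  assumes fin: "finite (carrier B)" and z: "z \<in> carrier B" "z \<noteq> \<one>"
  shows "parent z \<in> carrier B" "z \<in> children B (parent z)"
proof -
  have "R_less B z \<one>" using z R_le_one by (simp add: R_less_def)
  then have "\<exists>y. y \<in> carrier B \<and> z \<in> children B y"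
    using exists_cover_above[OF fin z(1) one_closed] by metis
  from someI_ex[OF this] show "parent z \<in> carrier B" "z \<in> children B (parent z)"
    unfolding parent_def by auto
qed

lemma parent_eq:
  assumes fin: "finite (carrier B)" and rh: "right_hereditary B" and y: "y \<in> carrier B" "z \<in> children B y"
  shows "parent z = y"
proof -
  have "\<exists>y. y \<in> carrier B \<and> z \<in> children B y" using y by blast
  from someI_ex[OF this] show ?thesis
    unfolding parent_def using unique_parent[OF fin rh _ _ y] by blast
qed

lemma parent_le:
  assumes fin: "finite (carrier B)" and rh: "right_hereditary B"
    and z: "z \<in> carrier B" and w: "w \<in> carrier B" and zw: "R_less B z w"
  shows "R_le B (parent z) w"
proof -
  obtain p where p: "p \<in> carrier B" "z \<in> children B p" "R_le B p w"
    by (rule exists_cover_above[OF fin z w zw])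
  then show ?thesis using parent_eq[OF fin rh p(1,2)] by simp
qed

end

section \<open>The resolution of length one\<close>

text \<open>Transport of structure along an injection. It moves \<open>G\<close> from a type of
  functions into the list type in which \<open>proj_dim\<close> looks for resolutions.\<close>

definition image_module :: "('n \<Rightarrow> 'p) \<Rightarrow> ('a, 'n) module \<Rightarrow> ('a, 'p) module" where
  "image_module \<phi> N = (let \<psi> = inv_into (carrier N) \<phi> in
     \<lparr>carrier = \<phi> ` carrier N, monoid.mult = (\<lambda>_ _. \<phi> \<zero>\<^bsub>N\<^esub>), one = \<phi> \<zero>\<^bsub>N\<^esub>, ring.zero = \<phi> \<zero>\<^bsub>N\<^esub>,
      add = (\<lambda>x y. \<phi> (\<psi> x \<oplus>\<^bsub>N\<^esub> \<psi> y)), smult = (\<lambda>a x. \<phi> (a \<odot>\<^bsub>N\<^esub> \<psi> x))\<rparr>)"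

lemma image_module:
  assumes N: "left_module R N" and inj: "inj_on \<phi> (carrier N)"
  shows "left_module R (image_module \<phi> N)"
    and "restrict \<phi> (carrier N) \<in> lmod_hom R N (image_module \<phi> N)"
    and "restrict (inv_into (carrier N) \<phi>) (\<phi> ` carrier N) \<in> lmod_hom R (image_module \<phi> N) N"
    and "carrier (image_module \<phi> N) = \<phi> ` carrier N" "\<zero>\<^bsub>image_module \<phi> N\<^esub> = \<phi> \<zero>\<^bsub>N\<^esub>"
proof -
  interpret N: left_module R N by fact
  let ?P = "image_module \<phi> N"
  have s: "carrier ?P = \<phi> ` carrier N" "\<zero>\<^bsub>?P\<^esub> = \<phi> \<zero>\<^bsub>N\<^esub>"
    "x \<in> carrier N \<Longrightarrow> y \<in> carrier N \<Longrightarrow> \<phi> x \<oplus>\<^bsub>?P\<^esub> \<phi> y = \<phi> (x \<oplus>\<^bsub>N\<^esub> y)"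
    "x \<in> carrier N \<Longrightarrow> a \<odot>\<^bsub>?P\<^esub> \<phi> x = \<phi> (a \<odot>\<^bsub>N\<^esub> x)" for a x y
    by (simp_all add: image_module_def Let_def inv_into_f_f[OF inj])
  show P: "left_module R ?P"
    by (rule left_moduleI)
      (auto simp: s N.lm_smult_closed N.lm_smult_l_distr N.lm_smult_r_distr N.lm_smult_assoc
        N.lm_smult_one N.M.a_ac N.R.ring_axioms)
  show "restrict \<phi> (carrier N) \<in> lmod_hom R N ?P"
    by (rule lmod_hom_restrictI[OF N]) (auto simp: s)
  have "restrict (inv_into (carrier N) \<phi>) (carrier ?P) \<in> lmod_hom R ?P N"
    by (rule lmod_hom_restrictI[OF P]) (auto simp: s inv_into_f_f[OF inj] N.lm_smult_closed)
  then show "restrict (inv_into (carrier N) \<phi>) (\<phi> ` carrier N) \<in> lmod_hom R ?P N" by (simp add: s)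
  show "carrier ?P = \<phi> ` carrier N" "\<zero>\<^bsub>?P\<^esub> = \<phi> \<zero>\<^bsub>N\<^esub>" by (simp_all add: s)
qed

text \<open>All modules of the resolution are submodules of the transported copy \<open>P0\<close>
  of \<open>G\<close>: the kernel of the augmentation in degree 1, with its inclusion as
  differential, and zero above. Projectivity of the kernel is carried over along the restriction of
  \<open>\<phi>\<close>.\<close>

lemma length_one_resolution_exists:
  fixes M :: "('a, 'm) module" and G :: "('a, 'g) module" and \<phi> :: "'g \<Rightarrow> 'p"
  assumes M: "left_module R M" and G: "projective_module R G"
    and \<epsilon>: "\<epsilon> \<in> lmod_hom R G M" "\<epsilon> ` carrier G = carrier M"
    and E: "projective_module R (G\<lparr>carrier := {x \<in> carrier G. \<epsilon> x = \<zero>\<^bsub>M\<^esub>}\<rparr>)"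
    and \<phi>: "inj_on \<phi> (carrier G)"
  shows "\<exists>(P :: nat \<Rightarrow> ('a, 'p) module) d e. projective_resolution R M P d e \<and>
    (\<forall>i>1. carrier (P i) = {\<zero>\<^bsub>P i\<^esub>})"
proof -
  have LG: "left_module R G" using G by (simp add: projective_module_def)
  let ?E = "G\<lparr>carrier := {x \<in> carrier G. \<epsilon> x = \<zero>\<^bsub>M\<^esub>}\<rparr>"
  let ?\<psi> = "restrict (inv_into (carrier G) \<phi>) (\<phi> ` carrier G)"
  let ?\<phi> = "restrict \<phi> (carrier G)"
  define P0 where "P0 = image_module \<phi> G"
  note im = image_module[OF LG \<phi>, folded P0_def]
  have \<psi>\<phi>: "?\<psi> (\<phi> x) = x" if "x \<in> carrier G" for x using that by (simp add: inv_into_f_f[OF \<phi>])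
  interpret P0: left_module R P0 by (rule im(1))
  have pP0: "projective_module R P0"
    by (rule projective_module_retract[OF G im(1) im(3,2)]) (auto simp: im(4) inv_into_f_f[OF \<phi>])
  define e where "e = compose (carrier P0) \<epsilon> ?\<psi>"
  have e: "e \<in> lmod_hom R P0 M" unfolding e_def by (rule lmod_hom_compose[OF im(1) im(3) \<epsilon>(1)])
  have e\<phi>: "e (\<phi> x) = \<epsilon> x" if "x \<in> carrier G" for x
    using that \<psi>\<phi>[OF that] by (simp add: e_def compose_def im(4))
  have e_surj: "e ` carrier P0 = carrier M"
    unfolding im(4) \<epsilon>(2)[symmetric] image_image by (rule image_cong) (auto simp: e\<phi>)
  define P1 where "P1 = P0\<lparr>carrier := {x \<in> carrier P0. e x = \<zero>\<^bsub>M\<^esub>}\<rparr>"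
  have c1: "carrier P1 = \<phi> ` carrier ?E" unfolding P1_def by (auto simp: im(4) e\<phi>)
  have LP1: "left_module R P1" unfolding P1_def
    by (rule left_submodule_left_module[OF im(1) lmod_hom_kernel[OF im(1) M e]])
  have LE: "left_module R ?E"
    by (rule left_submodule_left_module[OF LG lmod_hom_kernel[OF LG M \<epsilon>(1)]])
  have pP1: "projective_module R P1"
  proof (rule projective_module_retract[of R ?E P1 "restrict ?\<psi> (carrier P1)" "restrict ?\<phi> (carrier ?E)", OF E LP1])
    show "restrict ?\<psi> (carrier P1) \<in> lmod_hom R P1 ?E"
    proof (rule lmod_hom_restrictI[OF LP1])
      show "?\<psi> x \<in> carrier ?E" if x: "x \<in> carrier P1" for x
      proof -
        obtain y where "x = \<phi> y" "y \<in> carrier ?E" using x unfolding c1 by blast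
        then show ?thesis by (simp add: inv_into_f_f[OF \<phi>])
      qed
    qed (use lmod_homD[OF im(3)] in \<open>auto simp: P1_def\<close>)
    show "restrict ?\<phi> (carrier ?E) \<in> lmod_hom R ?E P1"
    proof (rule lmod_hom_restrictI[OF LE])
      show "?\<phi> x \<in> carrier P1" if "x \<in> carrier ?E" for x
        using that unfolding c1 by auto
    qed (use lmod_homD[OF im(2)] in \<open>auto simp: P1_def\<close>)
    show "restrict ?\<phi> (carrier ?E) (restrict ?\<psi> (carrier P1) x) = x" if x: "x \<in> carrier P1" for x
    proof -
      obtain y where "x = \<phi> y" "y \<in> carrier ?E" using x unfolding c1 by blast
      then show ?thesis using x by (simp add: inv_into_f_f[OF \<phi>])
    qed
  qed
  define Z where "Z = P0\<lparr>carrier := {\<zero>\<^bsub>P0\<^esub>}\<rparr>"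
  have LZ: "left_module R Z" unfolding Z_def
    by (rule left_submodule_left_module[OF im(1)]) (rule left_submoduleI[OF im(1)], auto)
  have pZ: "projective_module R Z" by (rule projective_module_zero[OF LZ]) (simp add: Z_def)
  let ?P = "\<lambda>n :: nat. if n = 0 then P0 else if n = 1 then P1 else Z"
  let ?d = "\<lambda>n :: nat. if n = 0 then restrict (\<lambda>x. x) (carrier P1) else restrict (\<lambda>_. \<zero>\<^bsub>P0\<^esub>) (carrier (?P (Suc n)))"
  have z: "\<zero>\<^bsub>?P n\<^esub> = \<zero>\<^bsub>P0\<^esub>" for n by (simp add: P1_def Z_def)
  have e0: "e \<zero>\<^bsub>P0\<^esub> = \<zero>\<^bsub>M\<^esub>" by (rule lmod_hom_zero[OF im(1) M e])
  have dh: "?d n \<in> lmod_hom R (?P (Suc n)) (?P n)" for n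
  proof (cases "n = 0")
    case True
    have "restrict (\<lambda>x. x) (carrier P1) \<in> lmod_hom R P1 P0"
      by (rule lmod_hom_restrictI[OF LP1]) (auto simp: P1_def)
    then show ?thesis using True by simp
  next
    case False
    have "restrict (\<lambda>_. \<zero>\<^bsub>P0\<^esub>) (carrier Z) \<in> lmod_hom R Z (?P n)"
      using False e0 by (intro lmod_hom_restrictI[OF LZ]) (auto simp: P1_def Z_def)
    then show ?thesis using False by simp
  qed
  have "projective_resolution R M ?P ?d e"
    unfolding projective_resolution_def
  proof (intro conjI allI)
    show "projective_module R (?P n)" for n using pP0 pP1 pZ by simp
    show "e \<in> lmod_hom R (?P 0) M" using e by simp
    show "?d n \<in> lmod_hom R (?P (Suc n)) (?P n)" for n by (rule dh)
    show "e ` carrier (?P 0) = carrier M" using e_surj by simp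
    show "?d 0 ` carrier (?P 1) = {x \<in> carrier (?P 0). e x = \<zero>\<^bsub>M\<^esub>}" by (simp add: P1_def)
    show "?d (Suc n) ` carrier (?P (Suc (Suc n))) = {x \<in> carrier (?P (Suc n)). ?d n x = \<zero>\<^bsub>?P n\<^esub>}" for n
    proof -
      have "?d (Suc n) ` carrier (?P (Suc (Suc n))) = {\<zero>\<^bsub>P0\<^esub>}" by (auto simp: Z_def)
      moreover have "{x \<in> carrier (?P (Suc n)). ?d n x = \<zero>\<^bsub>?P n\<^esub>} = {\<zero>\<^bsub>P0\<^esub>}"
      proof (cases "n = 0")
        case True
        then show ?thesis using e0 by (auto simp: P1_def)
      next
        case False
        then have "{x \<in> carrier (?P (Suc n)). ?d n x = \<zero>\<^bsub>?P n\<^esub>} = {x \<in> carrier Z. ?d n x = \<zero>\<^bsub>P0\<^esub>}"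
          unfolding z by simp
        also have "\<dots> = {\<zero>\<^bsub>P0\<^esub>}" using False by (auto simp: Z_def)
        finally show ?thesis .
      qed
      ultimately show ?thesis by (rule trans[OF _ sym])
    qed
  qed
  moreover have "\<forall>i>1. carrier (?P i) = {\<zero>\<^bsub>?P i\<^esub>}" by (simp add: Z_def)
  ultimately show ?thesis by blast
qed

section \<open>The modules \<open>G\<close> and \<open>E\<close> and their projectivity\<close>

locale rh_lrb_algebra = lrb_algebra B K
  for B :: "('b, 'x) monoid_scheme" (structure) and K :: "('k, 'y) ring_scheme" +
  assumes rh: "right_hereditary B"

locale rh_lrb_module = rh_lrb_algebra B K + monoid_algebra_module B K M
  for B :: "('b, 'x) monoid_scheme" (structure) and K :: "('k, 'y) ring_scheme"
    and M :: "('b \<Rightarrow> 'k, 'm) module"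
begin

text \<open>\<open>G\<close> is the direct sum of the spaces \<open>b M\<close>, where \<open>a \<in> B\<close> carries the copy of \<open>m\<close> in \<open>b M\<close> to the copy
  of \<open>a m\<close> in \<open>a b M\<close>; \<open>GV\<close> is the underlying vector space.\<close>

definition GV :: "('k, 'b \<Rightarrow> 'm) module" where
  "GV = \<lparr>carrier = {F \<in> carrier B \<rightarrow>\<^sub>E carrier M. \<forall>b\<in>carrier B. bact M b (F b) = F b},
     monoid.mult = (\<lambda>_ _. \<lambda>b\<in>carrier B. \<zero>\<^bsub>M\<^esub>), one = (\<lambda>b\<in>carrier B. \<zero>\<^bsub>M\<^esub>),
     ring.zero = (\<lambda>b\<in>carrier B. \<zero>\<^bsub>M\<^esub>), add = (\<lambda>F H. \<lambda>b\<in>carrier B. F b \<oplus>\<^bsub>M\<^esub> H b),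
     smult = (\<lambda>c F. \<lambda>b\<in>carrier B. kact M c (F b))\<rparr>"

definition gact :: "'b \<Rightarrow> ('b \<Rightarrow> 'm) \<Rightarrow> 'b \<Rightarrow> 'm" where
  "gact a F = (\<lambda>c\<in>carrier B. \<Oplus>\<^bsub>M\<^esub>b\<in>carrier B. if a \<otimes> b = c then bact M a (F b) else \<zero>\<^bsub>M\<^esub>)"

definition G :: "('b \<Rightarrow> 'k, 'b \<Rightarrow> 'm) module" where "G = rep_module GV gact"

lemma GV_simps:
  "carrier GV = {F \<in> carrier B \<rightarrow>\<^sub>E carrier M. \<forall>b\<in>carrier B. bact M b (F b) = F b}"
  "\<zero>\<^bsub>GV\<^esub> = (\<lambda>b\<in>carrier B. \<zero>\<^bsub>M\<^esub>)" "F \<oplus>\<^bsub>GV\<^esub> H = (\<lambda>b\<in>carrier B. F b \<oplus>\<^bsub>M\<^esub> H b)"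
  "c \<odot>\<^bsub>GV\<^esub> F = (\<lambda>b\<in>carrier B. kact M c (F b))"
  by (simp_all add: GV_def)

lemma GV_D:
  assumes "F \<in> carrier GV" "b \<in> carrier B"
  shows "F b \<in> carrier M" "bact M b (F b) = F b"
  using assms by (auto simp: GV_simps)

lemma GV_ext: "F \<in> carrier GV \<Longrightarrow> F \<in> extensional (carrier B)"
  by (simp add: GV_simps PiE_iff)

lemma GV_eqI:
  assumes "F \<in> carrier GV" "H \<in> carrier GV" "\<And>b. b \<in> carrier B \<Longrightarrow> F b = H b"
  shows "F = H"
  by (rule extensionalityI[OF GV_ext[OF assms(1)] GV_ext[OF assms(2)] assms(3)])

lemma left_module_GV: "left_module K GV"
proof (rule left_moduleI)
  fix F assume F: "F \<in> carrier GV"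
  show "\<zero>\<^bsub>GV\<^esub> \<oplus>\<^bsub>GV\<^esub> F = F" "\<one>\<^bsub>K\<^esub> \<odot>\<^bsub>GV\<^esub> F = F"
    using F by (auto simp: GV_simps PiE_iff extensional_def fun_eq_iff)
qed (auto simp: GV_simps PiE_iff M.M.a_ac bact_add bact_kact kact_add_r kact_add_l kact_assoc K.ring_axioms
    intro!: restrict_ext)

lemma gact_summand_closed:
  "F \<in> carrier GV \<Longrightarrow> b \<in> carrier B \<Longrightarrow> (if P then bact M a (F b) else \<zero>\<^bsub>M\<^esub>) \<in> carrier M"
  by (simp add: GV_D)

lemma gact_closed:
  assumes a: "a \<in> carrier B" and F: "F \<in> carrier GV"
  shows "gact a F \<in> carrier GV"
proof -
  have c: "gact a F c \<in> carrier M" if "c \<in> carrier B" for c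
    using that F by (auto simp: gact_def GV_D intro!: M.M.finsum_closed)
  have "bact M c (gact a F c) = gact a F c" if c: "c \<in> carrier B" for c
  proof -
    have "bact M c (\<Oplus>\<^bsub>M\<^esub>b\<in>carrier B. if a \<otimes> b = c then bact M a (F b) else \<zero>\<^bsub>M\<^esub>)
      = (\<Oplus>\<^bsub>M\<^esub>b\<in>carrier B. bact M c (if a \<otimes> b = c then bact M a (F b) else \<zero>\<^bsub>M\<^esub>))"
      by (rule bact_finsum[OF finite_B gact_summand_closed[OF F]])
    also have "\<dots> = (\<Oplus>\<^bsub>M\<^esub>b\<in>carrier B. if a \<otimes> b = c then bact M a (F b) else \<zero>\<^bsub>M\<^esub>)"
    proof (rule M.M.finsum_cong'[OF refl])
      fix b assume b: "b \<in> carrier B"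
      \<comment> \<open>Here left regularity makes the action land in the right summand: for
        \<open>m\<close> in \<open>b M\<close>, \<open>a b a = a b\<close> shows that
        \<open>a m\<close> is fixed by \<open>a b\<close>.\<close>
      have "bact M (a \<otimes> b) (bact M a (F b)) = bact M a (F b)"
        using a b GV_D[OF F b] by (simp add: bact_mult left_regular)
          (simp add: bact_mult[symmetric])
      then show "bact M c (if a \<otimes> b = c then bact M a (F b) else \<zero>\<^bsub>M\<^esub>)
        = (if a \<otimes> b = c then bact M a (F b) else \<zero>\<^bsub>M\<^esub>)" by auto
    qed (use F in \<open>auto simp: GV_D\<close>)
    finally show ?thesis using c by (simp add: gact_def)
  qed
  then show ?thesis using c by (auto simp: GV_simps gact_def)
qed

lemma gact_mult:
  assumes a: "a \<in> carrier B" and b: "b \<in> carrier B" and F: "F \<in> carrier GV"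
  shows "gact (a \<otimes> b) F = gact a (gact b F)"
proof (rule GV_eqI)
  fix c assume c: "c \<in> carrier B"
  let ?B = "carrier B"
  let ?t = "\<lambda>e d. if b \<otimes> d = e then if a \<otimes> e = c then bact M (a \<otimes> b) (F d) else \<zero>\<^bsub>M\<^esub> else \<zero>\<^bsub>M\<^esub>"
  have t: "?t e d \<in> carrier M" if "d \<in> ?B" for e d using GV_D[OF F that] by simp
  have "gact a (gact b F) c = (\<Oplus>\<^bsub>M\<^esub>e\<in>?B. \<Oplus>\<^bsub>M\<^esub>d\<in>?B. ?t e d)"
    unfolding gact_def[of a] restrict_apply'[OF c]
  proof (rule M.M.finsum_cong'[OF refl])
    fix e assume e: "e \<in> ?B"
    have "bact M a (gact b F e) = (\<Oplus>\<^bsub>M\<^esub>d\<in>?B. bact M a (if b \<otimes> d = e then bact M b (F d) else \<zero>\<^bsub>M\<^esub>))"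
      unfolding gact_def restrict_apply'[OF e] by (rule bact_finsum[OF finite_B gact_summand_closed[OF F]])
    also have "\<dots> = (\<Oplus>\<^bsub>M\<^esub>d\<in>?B. if b \<otimes> d = e then bact M (a \<otimes> b) (F d) else \<zero>\<^bsub>M\<^esub>)"
      by (rule M.M.finsum_cong'[OF refl]) (use F a b in \<open>auto simp: GV_D bact_mult\<close>)
    finally have eq: "bact M a (gact b F e) = (\<Oplus>\<^bsub>M\<^esub>d\<in>?B. if b \<otimes> d = e then bact M (a \<otimes> b) (F d) else \<zero>\<^bsub>M\<^esub>)" .
    show "(if a \<otimes> e = c then bact M a (gact b F e) else \<zero>\<^bsub>M\<^esub>) = (\<Oplus>\<^bsub>M\<^esub>d\<in>?B. ?t e d)"
    proof (cases "a \<otimes> e = c")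
      case True
      show ?thesis unfolding eq if_P[OF True] ..
    next
      case False
      show ?thesis unfolding if_not_P[OF False] by (rule M.M.add.finprod_one_eqI[symmetric]) simp
    qed
  qed (use t in \<open>auto intro!: M.M.finsum_closed\<close>)
  also have "\<dots> = (\<Oplus>\<^bsub>M\<^esub>d\<in>?B. \<Oplus>\<^bsub>M\<^esub>e\<in>?B. ?t e d)"
    by (rule M.M.finsum_swap[OF finite_B finite_B t])
  also have "\<dots> = (\<Oplus>\<^bsub>M\<^esub>d\<in>?B. if (a \<otimes> b) \<otimes> d = c then bact M (a \<otimes> b) (F d) else \<zero>\<^bsub>M\<^esub>)"
  proof (rule M.M.finsum_cong'[OF refl])
    fix d assume d: "d \<in> ?B"
    have "(\<Oplus>\<^bsub>M\<^esub>e\<in>?B. ?t e d) = ?t (b \<otimes> d) d"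
      by (rule M.M.finsum_delta[OF finite_B]) (use b d GV_D[OF F d] in auto)
    then show "(\<Oplus>\<^bsub>M\<^esub>e\<in>?B. ?t e d) = (if (a \<otimes> b) \<otimes> d = c then bact M (a \<otimes> b) (F d) else \<zero>\<^bsub>M\<^esub>)"
      using a b d by (simp add: m_assoc)
  qed (use F in \<open>auto simp: GV_D\<close>)
  finally show "gact (a \<otimes> b) F c = gact a (gact b F) c" using c by (simp add: gact_def[of "a \<otimes> b"])
qed (use a b F gact_closed in auto)

lemma gact_one:
  assumes F: "F \<in> carrier GV"
  shows "gact \<one> F = F"
proof (rule GV_eqI)
  fix c assume c: "c \<in> carrier B"
  have "(\<Oplus>\<^bsub>M\<^esub>b\<in>carrier B. if \<one> \<otimes> b = c then bact M \<one> (F b) else \<zero>\<^bsub>M\<^esub>)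
    = (if \<one> \<otimes> c = c then bact M \<one> (F c) else \<zero>\<^bsub>M\<^esub>)"
    by (rule M.M.finsum_delta[OF finite_B c]) (use c F in \<open>auto simp: GV_D\<close>)
  then show "gact \<one> F c = F c" using c GV_D[OF F c] by (simp add: gact_def)
qed (use F gact_closed in auto)

lemma gact_add:
  assumes a: "a \<in> carrier B" and F: "F \<in> carrier GV" and H: "H \<in> carrier GV"
  shows "gact a (F \<oplus>\<^bsub>GV\<^esub> H) = gact a F \<oplus>\<^bsub>GV\<^esub> gact a H"
  unfolding GV_simps(3)[of "gact a F"] gact_def[of _ "F \<oplus>\<^bsub>GV\<^esub> H"]
proof (rule restrict_ext)
  fix c assume c: "c \<in> carrier B"
  have "(\<Oplus>\<^bsub>M\<^esub>b\<in>carrier B. if a \<otimes> b = c then bact M a ((F \<oplus>\<^bsub>GV\<^esub> H) b) else \<zero>\<^bsub>M\<^esub>)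
    = (\<Oplus>\<^bsub>M\<^esub>b\<in>carrier B. (if a \<otimes> b = c then bact M a (F b) else \<zero>\<^bsub>M\<^esub>)
        \<oplus>\<^bsub>M\<^esub> (if a \<otimes> b = c then bact M a (H b) else \<zero>\<^bsub>M\<^esub>))"
    by (rule M.M.finsum_cong'[OF refl]) (use F H in \<open>auto simp: GV_D GV_simps(3) bact_add\<close>)
  also have "\<dots> = gact a F c \<oplus>\<^bsub>M\<^esub> gact a H c"
    unfolding gact_def restrict_apply'[OF c]
    by (rule M.M.finsum_addf) (use F H in \<open>auto simp: GV_D\<close>)
  finally show "(\<Oplus>\<^bsub>M\<^esub>b\<in>carrier B. if a \<otimes> b = c then bact M a ((F \<oplus>\<^bsub>GV\<^esub> H) b) else \<zero>\<^bsub>M\<^esub>)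
    = gact a F c \<oplus>\<^bsub>M\<^esub> gact a H c" .
qed

lemma gact_kact:
  assumes a: "a \<in> carrier B" and k: "k \<in> carrier K" and F: "F \<in> carrier GV"
  shows "gact a (k \<odot>\<^bsub>GV\<^esub> F) = k \<odot>\<^bsub>GV\<^esub> gact a F"
  unfolding GV_simps(4)[of k "gact a F"] gact_def[of _ "k \<odot>\<^bsub>GV\<^esub> F"]
proof (rule restrict_ext)
  fix c assume c: "c \<in> carrier B"
  have "kact M k (gact a F c) = (\<Oplus>\<^bsub>M\<^esub>b\<in>carrier B. kact M k (if a \<otimes> b = c then bact M a (F b) else \<zero>\<^bsub>M\<^esub>))"
    unfolding gact_def restrict_apply'[OF c] by (rule kact_finsum[OF finite_B k gact_summand_closed[OF F]])
  also have "\<dots> = (\<Oplus>\<^bsub>M\<^esub>b\<in>carrier B. if a \<otimes> b = c then bact M a ((k \<odot>\<^bsub>GV\<^esub> F) b) else \<zero>\<^bsub>M\<^esub>)"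
    by (rule M.M.finsum_cong'[OF refl]) (use F k in \<open>auto simp: GV_D GV_simps(4) bact_kact\<close>)
  finally show "(\<Oplus>\<^bsub>M\<^esub>b\<in>carrier B. if a \<otimes> b = c then bact M a ((k \<odot>\<^bsub>GV\<^esub> F) b) else \<zero>\<^bsub>M\<^esub>)
    = kact M k (gact a F c)" by simp
qed

lemma G_simps: "carrier G = carrier GV" "\<zero>\<^bsub>G\<^esub> = \<zero>\<^bsub>GV\<^esub>" "F \<oplus>\<^bsub>G\<^esub> H = F \<oplus>\<^bsub>GV\<^esub> H"
  by (simp_all add: G_def rep_module_simps)

lemmas rep_module_G = rep_module[OF left_module_GV gact_closed gact_add gact_kact gact_mult gact_one, folded G_def]

lemma left_module_G: "left_module A G"
  by (rule rep_module_G(1)) assumption+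

lemma bact_G: "a \<in> carrier B \<Longrightarrow> F \<in> carrier G \<Longrightarrow> bact G a F = gact a F"
  unfolding G_simps by (rule rep_module_G(2))

lemma kact_G: "k \<in> carrier K \<Longrightarrow> F \<in> carrier G \<Longrightarrow> kact G k F = k \<odot>\<^bsub>GV\<^esub> F"
  unfolding G_simps by (rule rep_module_G(3))

sublocale G: monoid_algebra_module B K G by (rule monoid_algebra_moduleI[OF left_module_G])

lemma G_apply:
  assumes "b \<in> carrier B"
  shows "(F \<oplus>\<^bsub>G\<^esub> H) b = F b \<oplus>\<^bsub>M\<^esub> H b" "\<zero>\<^bsub>G\<^esub> b = \<zero>\<^bsub>M\<^esub>"
    "k \<in> carrier K \<Longrightarrow> F \<in> carrier G \<Longrightarrow> kact G k F b = kact M k (F b)"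
  using assms by (simp_all add: G_simps kact_G GV_simps)

lemma finsum_G_apply:
  assumes "finite S" "\<And>i. i \<in> S \<Longrightarrow> f i \<in> carrier G" "b \<in> carrier B"
  shows "(\<Oplus>\<^bsub>G\<^esub>i\<in>S. f i) b = (\<Oplus>\<^bsub>M\<^esub>i\<in>S. f i b)"
  by (rule finsum_additive[OF G.M.M.abelian_group_axioms M.M.abelian_group_axioms assms(1), where h = "\<lambda>F. F b"])
    (use assms G_apply in \<open>auto simp: G_simps GV_D\<close>)

definition sgl :: "'b \<Rightarrow> 'm \<Rightarrow> 'b \<Rightarrow> 'm" where
  "sgl b m = (\<lambda>c\<in>carrier B. if c = b then m else \<zero>\<^bsub>M\<^esub>)"

lemma sgl_closed: "m \<in> carrier M \<Longrightarrow> bact M b m = m \<Longrightarrow> sgl b m \<in> carrier G"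
  by (auto simp: G_simps GV_simps sgl_def)

lemma gact_sgl:
  assumes a: "a \<in> carrier B" and b: "b \<in> carrier B" and m: "m \<in> carrier M"
  shows "gact a (sgl b m) = sgl (a \<otimes> b) (bact M a m)"
  unfolding gact_def sgl_def[of "a \<otimes> b"]
proof (rule restrict_ext)
  fix c assume c: "c \<in> carrier B"
  have "(\<Oplus>\<^bsub>M\<^esub>d\<in>carrier B. if a \<otimes> d = c then bact M a (sgl b m d) else \<zero>\<^bsub>M\<^esub>)
    = (if a \<otimes> b = c then bact M a (sgl b m b) else \<zero>\<^bsub>M\<^esub>)"
    by (rule M.M.finsum_delta[OF finite_B b]) (use m b in \<open>auto simp: sgl_def\<close>)
  then show "(\<Oplus>\<^bsub>M\<^esub>d\<in>carrier B. if a \<otimes> d = c then bact M a (sgl b m d) else \<zero>\<^bsub>M\<^esub>)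
    = (if c = a \<otimes> b then bact M a m else \<zero>\<^bsub>M\<^esub>)"
    using b by (auto simp: sgl_def)
qed

definition aug :: "('b \<Rightarrow> 'm) \<Rightarrow> 'm" where
  "aug = (\<lambda>F\<in>carrier G. \<Oplus>\<^bsub>M\<^esub>b\<in>carrier B. F b)"

lemma aug_hom: "aug \<in> lmod_hom A G M"
proof (rule lmod_hom_actionsI[OF left_module_G M.left_module_axioms])
  have FM: "F b \<in> carrier M" if "F \<in> carrier G" "b \<in> carrier B" for F b
    using that GV_D(1)[of F b] unfolding G_simps by blast
  show "aug F \<in> carrier M" if "F \<in> carrier G" for F
    using that FM by (auto simp: aug_def intro!: M.M.finsum_closed)
  show "aug (F \<oplus>\<^bsub>G\<^esub> H) = aug F \<oplus>\<^bsub>M\<^esub> aug H" if F: "F \<in> carrier G" and H: "H \<in> carrier G" for F H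
  proof -
    have "(\<Oplus>\<^bsub>M\<^esub>b\<in>carrier B. (F \<oplus>\<^bsub>G\<^esub> H) b) = (\<Oplus>\<^bsub>M\<^esub>b\<in>carrier B. F b \<oplus>\<^bsub>M\<^esub> H b)"
      by (rule M.M.finsum_cong'[OF refl]) (use F H FM in \<open>auto simp: G_apply\<close>)
    also have "\<dots> = (\<Oplus>\<^bsub>M\<^esub>b\<in>carrier B. F b) \<oplus>\<^bsub>M\<^esub> (\<Oplus>\<^bsub>M\<^esub>b\<in>carrier B. H b)"
      by (rule M.M.finsum_addf) (use F H FM in auto)
    finally show ?thesis using F H by (simp add: aug_def)
  qed
  show "aug (kact G k F) = kact M k (aug F)" if k: "k \<in> carrier K" and F: "F \<in> carrier G" for k F
  proof -
    have "(\<Oplus>\<^bsub>M\<^esub>b\<in>carrier B. kact G k F b) = (\<Oplus>\<^bsub>M\<^esub>b\<in>carrier B. kact M k (F b))"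
      by (rule M.M.finsum_cong'[OF refl]) (use k F FM in \<open>auto simp: G_apply\<close>)
    also have "\<dots> = kact M k (\<Oplus>\<^bsub>M\<^esub>b\<in>carrier B. F b)"
      by (rule kact_finsum[OF finite_B k FM[OF F], symmetric])
    finally show ?thesis using k F by (simp add: aug_def)
  qed
  show "aug (bact G a F) = bact M a (aug F)" if a: "a \<in> carrier B" and F: "F \<in> carrier G" for a F
  proof -
    let ?t = "\<lambda>c b. if a \<otimes> b = c then bact M a (F b) else \<zero>\<^bsub>M\<^esub>"
    have "(\<Oplus>\<^bsub>M\<^esub>c\<in>carrier B. bact G a F c) = (\<Oplus>\<^bsub>M\<^esub>c\<in>carrier B. \<Oplus>\<^bsub>M\<^esub>b\<in>carrier B. ?t c b)"
      by (rule M.M.finsum_cong'[OF refl]) (use a F FM in \<open>auto simp: bact_G gact_def intro!: M.M.finsum_closed\<close>)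
    also have "\<dots> = (\<Oplus>\<^bsub>M\<^esub>b\<in>carrier B. \<Oplus>\<^bsub>M\<^esub>c\<in>carrier B. ?t c b)"
      by (rule M.M.finsum_swap[OF finite_B finite_B]) (use F FM in auto)
    also have "\<dots> = (\<Oplus>\<^bsub>M\<^esub>b\<in>carrier B. bact M a (F b))"
    proof (rule M.M.finsum_cong'[OF refl])
      fix b assume b: "b \<in> carrier B"
      have "(\<Oplus>\<^bsub>M\<^esub>c\<in>carrier B. ?t c b) = ?t (a \<otimes> b) b"
        by (rule M.M.finsum_delta[OF finite_B]) (use a b F FM in auto)
      then show "(\<Oplus>\<^bsub>M\<^esub>c\<in>carrier B. ?t c b) = bact M a (F b)" by simp
    qed (use F FM in auto)
    also have "\<dots> = bact M a (\<Oplus>\<^bsub>M\<^esub>b\<in>carrier B. F b)"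
      by (rule bact_finsum[OF finite_B FM[OF F], symmetric])
    finally show ?thesis using a F by (simp add: aug_def)
  qed
qed (simp add: aug_def)

lemma aug_surj: "aug ` carrier G = carrier M"
proof
  show "aug ` carrier G \<subseteq> carrier M" using lmod_homD(1)[OF aug_hom] by blast
  show "carrier M \<subseteq> aug ` carrier G"
  proof
    fix m assume m: "m \<in> carrier M"
    have c: "sgl \<one> m \<in> carrier G" by (rule sgl_closed) (use m in auto)
    have "(\<Oplus>\<^bsub>M\<^esub>b\<in>carrier B. sgl \<one> m b) = sgl \<one> m \<one>"
      by (rule M.M.finsum_delta[OF finite_B one_closed]) (use m in \<open>auto simp: sgl_def\<close>)
    then have "aug (sgl \<one> m) = m" using c by (simp add: aug_def) (simp add: sgl_def)
    then show "m \<in> aug ` carrier G" using c by (metis imageI)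
  qed
qed

text \<open>The pieces are the coordinates and each \<open>b\<close> is its own label. Since
  \<open>a\<close> maps the piece at \<open>j\<close> into the piece at \<open>a j\<close>, both the
  triangularity and the isomorphism condition hold with \<open>i = a j\<close>.\<close>

lemma projective_G: "projective_module A G"
proof (rule projective_criterion[OF left_module_G finite_B, where p = "\<lambda>b. b" and e = "\<lambda>b F. sgl b (F b)"])
  have FM: "F b \<in> carrier M" "bact M b (F b) = F b" if "F \<in> carrier G" "b \<in> carrier B" for F b
    using that GV_D[of F b] unfolding G_simps by blast+
  have sc: "sgl b (F b) \<in> carrier G" if "F \<in> carrier G" "b \<in> carrier B" for F b
    by (rule sgl_closed) (use FM[OF that] in auto)
  have s: "sgl b m b = m" if "b \<in> carrier B" for b m using that by (simp add: sgl_def)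
  have s0: "sgl b \<zero>\<^bsub>M\<^esub> = \<zero>\<^bsub>G\<^esub>" for b by (auto simp: sgl_def G_simps GV_simps intro!: restrict_ext)
  fix a i j F
  show "sgl j (F j) \<in> carrier G" if "j \<in> carrier B" "F \<in> carrier G" by (rule sc[OF that(2,1)])
  show "sgl j ((F \<oplus>\<^bsub>G\<^esub> H) j) = sgl j (F j) \<oplus>\<^bsub>G\<^esub> sgl j (H j)" if "j \<in> carrier B" for H
    using that by (auto simp: G_apply G_simps(3) GV_simps(3) sgl_def[of _ "F j \<oplus>\<^bsub>M\<^esub> H j"] intro!: restrict_ext)
      (auto simp: sgl_def)
  show "sgl j (kact G c F j) = kact G c (sgl j (F j))"
    if "j \<in> carrier B" "c \<in> carrier K" "F \<in> carrier G" for c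
    using that sc[OF that(3,1)]
    by (auto simp: G_apply kact_G GV_simps(4) sgl_def[of _ "kact M c (F j)"] intro!: restrict_ext)
      (auto simp: sgl_def)
  show "(\<Oplus>\<^bsub>G\<^esub>j\<in>carrier B. sgl j (F j)) = F" if F: "F \<in> carrier G"
  proof (rule GV_eqI)
    fix b assume b: "b \<in> carrier B"
    have "(\<Oplus>\<^bsub>G\<^esub>j\<in>carrier B. sgl j (F j)) b = (\<Oplus>\<^bsub>M\<^esub>j\<in>carrier B. sgl j (F j) b)"
      by (rule finsum_G_apply[OF finite_B sc[OF F] b])
    also have "\<dots> = sgl b (F b) b"
      by (rule M.M.finsum_delta[OF finite_B b]) (use b FM[OF F] in \<open>auto simp: sgl_def\<close>)
    finally show "(\<Oplus>\<^bsub>G\<^esub>j\<in>carrier B. sgl j (F j)) b = F b" using s[OF b] by simp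
  next
    show "(\<Oplus>\<^bsub>G\<^esub>j\<in>carrier B. sgl j (F j)) \<in> carrier GV"
      unfolding G_simps(1)[symmetric] by (rule G.M.M.finsum_closed) (use sc[OF F] in auto)
  qed (use F in \<open>simp add: G_simps\<close>)
  show "sgl j (sgl j (F j) j) = sgl j (F j)" if "j \<in> carrier B" using s[OF that] by simp
  show "sgl i (sgl j (F j) i) = \<zero>\<^bsub>G\<^esub>" if "i \<in> carrier B" "i \<noteq> j"
    using that s0[of i] by (simp add: sgl_def[of j])
  show "bact G j (sgl j (F j)) = sgl j (F j)" if "j \<in> carrier B" "F \<in> carrier G"
    using that sc[OF that(2,1)] FM[OF that(2,1)] by (simp add: bact_G gact_sgl idem)
  have act: "bact G a (sgl j (F j)) = sgl (a \<otimes> j) (bact M a (F j))"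
    if "a \<in> carrier B" "j \<in> carrier B" "F \<in> carrier G" for F
    using that sc[OF that(3,2)] FM[OF that(3,2)] by (simp add: bact_G gact_sgl)
  show "supp B i \<subseteq> supp B (a \<otimes> j)"
    if "a \<in> carrier B" "i \<in> carrier B" "j \<in> carrier B" "F \<in> carrier G"
      "sgl i (bact G a (sgl j (F j)) i) \<noteq> \<zero>\<^bsub>G\<^esub>"
  proof (cases "i = a \<otimes> j")
    case False
    then have "bact G a (sgl j (F j)) i = \<zero>\<^bsub>M\<^esub>" using act that by (simp add: sgl_def)
    then show ?thesis using that s0 by simp
  qed simp
  show "\<exists>i\<in>carrier B. i = a \<otimes> j \<and>
      (\<forall>n\<in>carrier G. sgl i (bact G a (sgl j (n j)) i) = bact G a (sgl j (n j)))"
    if "a \<in> carrier B" "j \<in> carrier B"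
    using act[OF that] s that by simp
qed simp

lemma G_D:
  assumes "F \<in> carrier G" "b \<in> carrier B"
  shows "F b \<in> carrier M" "bact M b (F b) = F b"
  using assms GV_D[of F b] unfolding G_simps by blast+

lemma G_eqI:
  assumes "F \<in> carrier G" "H \<in> carrier G" "\<And>b. b \<in> carrier B \<Longrightarrow> F b = H b"
  shows "F = H"
  using assms GV_eqI unfolding G_simps by blast

text \<open>Since \<open>B\<close> is a tree, \<open>cum w\<close> is the coefficient at \<open>w\<close> with respect to the decomposition of \<open>G\<close>
  into the pieces \<open>edge w\<close> below, apart from \<open>cum \<one>\<close>, which is the augmentation.\<close>

definition cum :: "'b \<Rightarrow> ('b \<Rightarrow> 'm) \<Rightarrow> 'm" where
  "cum w F = (\<Oplus>\<^bsub>M\<^esub>v\<in>carrier B. if R_le B v w then F v else \<zero>\<^bsub>M\<^esub>)"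

lemma cum_closed: "F \<in> carrier G \<Longrightarrow> cum w F \<in> carrier M"
  unfolding cum_def by (rule M.M.finsum_closed) (auto simp: G_D)

lemma cum_add:
  assumes F: "F \<in> carrier G" and H: "H \<in> carrier G"
  shows "cum w (F \<oplus>\<^bsub>G\<^esub> H) = cum w F \<oplus>\<^bsub>M\<^esub> cum w H"
proof -
  have "cum w (F \<oplus>\<^bsub>G\<^esub> H) = (\<Oplus>\<^bsub>M\<^esub>v\<in>carrier B. (if R_le B v w then F v else \<zero>\<^bsub>M\<^esub>) \<oplus>\<^bsub>M\<^esub> (if R_le B v w then H v else \<zero>\<^bsub>M\<^esub>))"
    unfolding cum_def by (rule M.M.finsum_cong'[OF refl]) (use F H in \<open>auto simp: G_D G_apply(1)\<close>)
  also have "\<dots> = cum w F \<oplus>\<^bsub>M\<^esub> cum w H"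
    unfolding cum_def by (rule M.M.finsum_addf) (use F H in \<open>auto simp: G_D\<close>)
  finally show ?thesis .
qed

lemma cum_diff:
  assumes F: "F \<in> carrier G" and H: "H \<in> carrier G"
  shows "cum w (F \<ominus>\<^bsub>G\<^esub> H) = cum w F \<ominus>\<^bsub>M\<^esub> cum w H"
proof -
  have D: "F \<ominus>\<^bsub>G\<^esub> H \<in> carrier G" using F H by (rule G.M.M.minus_closed)
  have "F = (F \<ominus>\<^bsub>G\<^esub> H) \<oplus>\<^bsub>G\<^esub> H" using F H by (simp add: G.M.M.minus_eq G.M.M.a_assoc G.M.M.l_neg)
  then have "cum w F = cum w (F \<ominus>\<^bsub>G\<^esub> H) \<oplus>\<^bsub>M\<^esub> cum w H" using cum_add[OF D H, of w] by simp
  then show ?thesis using cum_closed[OF F, of w] cum_closed[OF H, of w] cum_closed[OF D, of w]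
    by (simp add: M.M.minus_eq M.M.a_assoc M.M.r_neg)
qed

lemma cum_kact:
  assumes k: "k \<in> carrier K" and F: "F \<in> carrier G"
  shows "cum w (kact G k F) = kact M k (cum w F)"
proof -
  have "kact M k (cum w F) = (\<Oplus>\<^bsub>M\<^esub>v\<in>carrier B. kact M k (if R_le B v w then F v else \<zero>\<^bsub>M\<^esub>))"
    unfolding cum_def by (rule kact_finsum[OF finite_B k]) (use F in \<open>simp add: G_D\<close>)
  also have "\<dots> = cum w (kact G k F)"
    unfolding cum_def by (rule M.M.finsum_cong'[OF refl]) (use F k in \<open>auto simp: G_D G_apply(3)\<close>)
  finally show ?thesis by simp
qed

lemma bact_cum:
  assumes w: "w \<in> carrier B" and F: "F \<in> carrier G"
  shows "bact M w (cum w F) = cum w F"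
proof -
  have "bact M w (cum w F) = (\<Oplus>\<^bsub>M\<^esub>v\<in>carrier B. bact M w (if R_le B v w then F v else \<zero>\<^bsub>M\<^esub>))"
    unfolding cum_def by (rule bact_finsum[OF finite_B]) (use F in \<open>simp add: G_D\<close>)
  also have "\<dots> = cum w F"
    unfolding cum_def
  proof (rule M.M.finsum_cong'[OF refl])
    fix v assume v: "v \<in> carrier B"
    have "bact M w (F v) = F v" if "R_le B v w"
    proof -
      have "bact M w (bact M v (F v)) = bact M v (F v)"
        using bact_mult[OF w v G_D(1)[OF F v]] that by (simp add: R_le_def)
      then show ?thesis using G_D(2)[OF F v] by simp
    qed
    then show "bact M w (if R_le B v w then F v else \<zero>\<^bsub>M\<^esub>) = (if R_le B v w then F v else \<zero>\<^bsub>M\<^esub>)" by simp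
  qed (use F in \<open>auto simp: G_D\<close>)
  finally show ?thesis .
qed

lemma cum_sgl:
  assumes v: "v \<in> carrier B" and m: "m \<in> carrier M"
  shows "cum w (sgl v m) = (if R_le B v w then m else \<zero>\<^bsub>M\<^esub>)"
proof -
  have "cum w (sgl v m) = (if R_le B v w then sgl v m v else \<zero>\<^bsub>M\<^esub>)"
    unfolding cum_def by (rule M.M.finsum_delta[OF finite_B v]) (use v m in \<open>auto simp: sgl_def\<close>)
  then show ?thesis using v by (simp add: sgl_def)
qed

lemma cum_one: "F \<in> carrier G \<Longrightarrow> cum \<one> F = aug F"
  by (auto simp: cum_def aug_def G_D R_le_one intro!: M.M.finsum_cong')

text \<open>The maps \<open>cum w\<close> are unitriangular in the coordinates:
  \<open>cum w F\<close> is \<open>F w\<close> plus values at elements strictly below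
  \<open>w\<close>, which have smaller support.\<close>

lemma cum_eq_zeroD:
  assumes F: "F \<in> carrier G" and z: "\<And>w. w \<in> carrier B \<Longrightarrow> cum w F = \<zero>\<^bsub>M\<^esub>"
  shows "F = \<zero>\<^bsub>G\<^esub>"
proof (rule G_eqI[OF F G.M.M.zero_closed])
  fix w assume "w \<in> carrier B"
  then have "F w = \<zero>\<^bsub>M\<^esub>"
  proof (induction "card (supp B w)" arbitrary: w rule: less_induct)
    case less
    have "F v = \<zero>\<^bsub>M\<^esub>" if v: "v \<in> carrier B" "R_le B v w" "v \<noteq> w" for v
      using less.hyps[OF _ v(1)] R_less_card_supp[OF finite_B v(1) less.prems] v by (simp add: R_less_def)
    then have "cum w F = (if R_le B w w then F w else \<zero>\<^bsub>M\<^esub>)"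
      unfolding cum_def by (intro M.M.finsum_delta[OF finite_B less.prems]) (use F less.prems in \<open>auto simp: G_D\<close>)
    then show ?case using z[OF less.prems] R_le_refl[OF less.prems] by simp
  qed
  then show "F w = \<zero>\<^bsub>G\<^esub> w" using \<open>w \<in> carrier B\<close> by (simp add: G_apply)
qed

definition edge :: "'b \<Rightarrow> 'm \<Rightarrow> 'b \<Rightarrow> 'm" where
  "edge z m = sgl z m \<ominus>\<^bsub>G\<^esub> sgl (parent z) m"

lemma parent_less:
  assumes z: "z \<in> carrier B" "z \<noteq> \<one>"
  shows "parent z \<in> carrier B" "R_le B z (parent z)" "z \<noteq> parent z" "\<not> R_le B (parent z) z" "parent z \<otimes> z = z"
proof -
  note p = parent[OF finite_B z]
  show pc: "parent z \<in> carrier B" by (rule p(1))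
  show 1: "R_le B z (parent z)" and 2: "z \<noteq> parent z" using childrenD(2)[OF p(2)] by (auto simp: R_less_def)
  show "\<not> R_le B (parent z) z" using R_le_antisym[OF z(1) pc 1] 2 by blast
  show "parent z \<otimes> z = z" using 1 by (simp add: R_le_def)
qed

lemma bact_parent:
  assumes z: "z \<in> carrier B" "z \<noteq> \<one>" and m: "m \<in> carrier M" "bact M z m = m"
  shows "bact M (parent z) m = m"
  using bact_mult[OF parent_less(1)[OF z] z(1) m(1)] m parent_less(5)[OF z] by simp

lemma sgl_edge_closed:
  assumes z: "z \<in> carrier B" "z \<noteq> \<one>" and m: "m \<in> carrier M" "bact M z m = m"
  shows "sgl z m \<in> carrier G" "sgl (parent z) m \<in> carrier G" "edge z m \<in> carrier G"
proof -
  show 1: "sgl z m \<in> carrier G" and 2: "sgl (parent z) m \<in> carrier G"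
    using sgl_closed m bact_parent[OF z m] by auto
  show "edge z m \<in> carrier G" unfolding edge_def using 1 2 by (rule G.M.M.minus_closed)
qed

text \<open>The elements strictly above \<open>z\<close> are exactly those above
  \<open>parent z\<close>. So a set of the form "below \<open>w\<close>" contains both ends of the
  edge or neither, except for \<open>w = z\<close>.\<close>

lemma cum_edge:
  assumes z: "z \<in> carrier B" "z \<noteq> \<one>" and m: "m \<in> carrier M" "bact M z m = m" and w: "w \<in> carrier B"
  shows "cum w (edge z m) = (if w = z then m else \<zero>\<^bsub>M\<^esub>)"
proof -
  note p = parent_less[OF z]
  have eq: "cum w (edge z m) = (if R_le B z w then m else \<zero>\<^bsub>M\<^esub>) \<ominus>\<^bsub>M\<^esub> (if R_le B (parent z) w then m else \<zero>\<^bsub>M\<^esub>)"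
    unfolding edge_def cum_diff[OF sgl_edge_closed(1,2)[OF z m]] cum_sgl[OF z(1) m(1)] cum_sgl[OF p(1) m(1)] ..
  show ?thesis
  proof (cases "w = z")
    case True
    then show ?thesis unfolding eq using p R_le_refl[OF z(1)] m by (simp add: M.M.minus_eq)
  next
    case False
    have "R_le B z w \<longleftrightarrow> R_le B (parent z) w"
      using False parent_le[OF finite_B rh z(1) w] R_le_trans[OF z(1) p(1) w p(2)] by (auto simp: R_less_def)
    then show ?thesis unfolding eq using False m by (simp add: M.M.minus_eq M.M.r_neg)
  qed
qed

lemma aug_edge:
  assumes z: "z \<in> carrier B" "z \<noteq> \<one>" and m: "m \<in> carrier M" "bact M z m = m"
  shows "aug (edge z m) = \<zero>\<^bsub>M\<^esub>"
  using cum_edge[OF z m one_closed] cum_one[OF sgl_edge_closed(3)[OF z m]] z by simp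

definition E :: "('b \<Rightarrow> 'k, 'b \<Rightarrow> 'm) module" where
  "E = G\<lparr>carrier := {F \<in> carrier G. aug F = \<zero>\<^bsub>M\<^esub>}\<rparr>"

lemma E_simps: "F \<in> carrier E \<longleftrightarrow> F \<in> carrier G \<and> aug F = \<zero>\<^bsub>M\<^esub>" "\<zero>\<^bsub>E\<^esub> = \<zero>\<^bsub>G\<^esub>"
  "F \<oplus>\<^bsub>E\<^esub> H = F \<oplus>\<^bsub>G\<^esub> H" "bact E = bact G" "kact E = kact G"
  by (auto simp: E_def bact_def fun_eq_iff kact_def)

lemma left_module_E: "left_module A E"
  unfolding E_def
  by (rule left_submodule_left_module[OF left_module_G])
    (rule lmod_hom_kernel[OF left_module_G M.left_module_axioms aug_hom])

lemma finsum_E: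
  assumes "finite S" "\<And>i. i \<in> S \<Longrightarrow> f i \<in> carrier E"
  shows "finsum E f S = finsum G f S"
proof -
  interpret E: left_module A E by (rule left_module_E)
  have "(\<lambda>x. x) (finsum E f S) = finsum G (\<lambda>i. (\<lambda>x. x) (f i)) S"
    by (rule finsum_additive[OF E.M.abelian_group_axioms G.M.M.abelian_group_axioms assms]) (auto simp: E_simps)
  then show ?thesis by simp
qed

lemma gact_edge:
  assumes a: "a \<in> carrier B" and z: "z \<in> carrier B" "z \<noteq> \<one>" and m: "m \<in> carrier M" "bact M z m = m"
  shows "bact G a (edge z m) = sgl (a \<otimes> z) (bact M a m) \<ominus>\<^bsub>G\<^esub> sgl (a \<otimes> parent z) (bact M a m)"
  unfolding edge_def
  using G.bact_diff[OF sgl_edge_closed(1,2)[OF z m], of a] bact_G[OF a sgl_edge_closed(1)[OF z m]]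
    bact_G[OF a sgl_edge_closed(2)[OF z m]] gact_sgl[OF a z(1) m(1)] gact_sgl[OF a parent_less(1)[OF z] m(1)]
  by simp

lemma edge_zero: "edge z \<zero>\<^bsub>M\<^esub> = \<zero>\<^bsub>G\<^esub>"
proof -
  have "sgl v \<zero>\<^bsub>M\<^esub> = \<zero>\<^bsub>G\<^esub>" for v by (auto simp: sgl_def G_simps GV_simps intro!: restrict_ext)
  then show ?thesis by (simp add: edge_def G.M.M.minus_eq)
qed

lemma projective_E: "projective_module A E"
proof (rule projective_criterion[OF left_module_E, where J = "carrier B - {\<one>}" and p = parent and e = "\<lambda>z F. edge z (cum z F)"])
  let ?J = "carrier B - {\<one>}"
  show "finite ?J" using finite_B by simp
  have cm: "cum z F \<in> carrier M" "bact M z (cum z F) = cum z F" if "F \<in> carrier G" "z \<in> ?J" for F z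
    using cum_closed[OF that(1)] bact_cum[OF _ that(1)] that(2) by auto
  have eG: "edge z (cum z F) \<in> carrier G" if "F \<in> carrier G" "z \<in> ?J" for F z
    using sgl_edge_closed(3)[OF _ _ cm[OF that]] that(2) by blast
  have eE: "edge z (cum z F) \<in> carrier E" if "F \<in> carrier G" "z \<in> ?J" for F z
    using eG[OF that] aug_edge[OF _ _ cm[OF that]] that(2) unfolding E_simps by blast
  have ce: "cum w (edge z (cum z F)) = (if w = z then cum z F else \<zero>\<^bsub>M\<^esub>)" if "F \<in> carrier G" "z \<in> ?J" "w \<in> carrier B" for F z w
    using cum_edge[OF _ _ cm[OF that(1,2)] that(3)] that(2) by blast
  fix a i j F
  show "parent j \<in> carrier B" if "j \<in> ?J" using that parent_less(1) by blast
  show "edge j (cum j F) \<in> carrier E" if "j \<in> ?J" "F \<in> carrier E" using eE that E_simps(1) by blast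
  have edge_add: "edge z (m \<oplus>\<^bsub>M\<^esub> n) = edge z m \<oplus>\<^bsub>G\<^esub> edge z n"
    if z: "z \<in> ?J" and m: "m \<in> carrier M" "bact M z m = m" and n: "n \<in> carrier M" "bact M z n = n" for z m n
  proof -
    have zz: "z \<in> carrier B" "z \<noteq> \<one>" using z by auto
    have mn: "m \<oplus>\<^bsub>M\<^esub> n \<in> carrier M" "bact M z (m \<oplus>\<^bsub>M\<^esub> n) = m \<oplus>\<^bsub>M\<^esub> n" using m n by (auto simp: bact_add)
    have "sgl v (m \<oplus>\<^bsub>M\<^esub> n) = sgl v m \<oplus>\<^bsub>G\<^esub> sgl v n" for v
      unfolding sgl_def[of v "m \<oplus>\<^bsub>M\<^esub> n"] G_simps(3) GV_simps(3)
      by (rule restrict_ext) (use m n in \<open>simp add: sgl_def\<close>)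
    then show ?thesis unfolding edge_def using sgl_edge_closed(1,2)[OF zz m] sgl_edge_closed(1,2)[OF zz n]
      by (simp add: G.M.M.minus_eq G.M.M.minus_add G.M.M.a_ac)
  qed
  show "edge j (cum j (F \<oplus>\<^bsub>E\<^esub> H)) = edge j (cum j F) \<oplus>\<^bsub>E\<^esub> edge j (cum j H)"
    if "j \<in> ?J" "F \<in> carrier E" "H \<in> carrier E" for H
  proof -
    have FG: "F \<in> carrier G" "H \<in> carrier G" using that E_simps(1) by auto
    show ?thesis unfolding E_simps cum_add[OF FG] by (rule edge_add[OF that(1) cm[OF FG(1) that(1)] cm[OF FG(2) that(1)]])
  qed
  show "edge j (cum j (kact E c F)) = kact E c (edge j (cum j F))"
    if "j \<in> ?J" "c \<in> carrier K" "F \<in> carrier E" for c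
  proof -
    have FG: "F \<in> carrier G" using that E_simps(1) by auto
    have jj: "j \<in> carrier B" "j \<noteq> \<one>" using that by auto
    let ?m = "cum j F"
    note m = cm[OF FG that(1)]
    have "sgl v (kact M c ?m) = kact G c (sgl v ?m)" if "sgl v ?m \<in> carrier G" for v
      unfolding sgl_def[of v "kact M c ?m"] kact_G[OF \<open>c \<in> carrier K\<close> that] GV_simps(4)
      by (rule restrict_ext) (use m \<open>c \<in> carrier K\<close> in \<open>simp add: sgl_def\<close>)
    then show ?thesis unfolding E_simps cum_kact[OF that(2) FG] edge_def
      using sgl_edge_closed(1,2)[OF jj m] G.kact_diff_r[OF that(2)] by simp
  qed
  show "(\<Oplus>\<^bsub>E\<^esub>j\<in>?J. edge j (cum j F)) = F" if FE: "F \<in> carrier E"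
  proof -
    have F: "F \<in> carrier G" "aug F = \<zero>\<^bsub>M\<^esub>" using FE E_simps(1) by auto
    let ?H = "\<Oplus>\<^bsub>G\<^esub>j\<in>?J. edge j (cum j F)"
    have H: "?H \<in> carrier G" by (rule G.M.M.finsum_closed) (use eG[OF F(1)] in blast)
    have cH: "cum w ?H = (\<Oplus>\<^bsub>M\<^esub>j\<in>?J. cum w (edge j (cum j F)))" for w
      by (rule finsum_additive[OF G.M.M.abelian_group_axioms M.M.abelian_group_axioms])
        (use finite_B eG[OF F(1)] cum_closed cum_add in auto)
    \<comment> \<open>An element of \<open>G\<close> is determined by all its \<open>cum w\<close>.
      At \<open>\<one>\<close> both sides vanish, one because edges have augmentation zero, the
      other because \<open>F\<close> lies in the kernel; elsewhere just the edge at \<open>w\<close>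
      contributes.\<close>
    have "cum w ?H = cum w F" if w: "w \<in> carrier B" for w
    proof (cases "w = \<one>")
      case True
      have "cum w ?H = \<zero>\<^bsub>M\<^esub>" unfolding cH
        by (rule M.M.add.finprod_one_eqI) (use ce[OF F(1) _ w] True in auto)
      then show ?thesis using True cum_one[OF F(1)] F(2) by simp
    next
      case False
      have "cum w ?H = cum w (edge w (cum w F))" unfolding cH
        by (rule M.M.finsum_delta) (use finite_B w False ce[OF F(1) _ w] cum_closed[OF F(1)] in auto)
      then show ?thesis using ce[OF F(1) _ w, of w] w False by simp
    qed
    then have "F \<ominus>\<^bsub>G\<^esub> ?H = \<zero>\<^bsub>G\<^esub>"
      by (intro cum_eq_zeroD) (use F H cum_closed[OF F(1)] in \<open>auto simp: cum_diff M.M.minus_eq M.M.r_neg intro!: G.M.M.minus_closed\<close>)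
    then have "F = ?H" using G.M.M.diff_zero_imp_eq[OF F(1) H] by simp
    then show ?thesis using finsum_E[of ?J "\<lambda>j. edge j (cum j F)"] finite_B eE[OF F(1)] by simp
  qed
  show "edge j (cum j (edge j (cum j F))) = edge j (cum j F)" if "j \<in> ?J" "F \<in> carrier E"
    using ce[of F j j] that E_simps(1) by simp
  show "edge i (cum i (edge j (cum j F))) = \<zero>\<^bsub>E\<^esub>" if "i \<in> ?J" "j \<in> ?J" "i \<noteq> j" "F \<in> carrier E"
    using ce[of F j i] that E_simps(1) by (simp add: edge_zero E_simps)
  have act: "bact G a (edge j (cum j F)) = sgl (a \<otimes> j) (bact M a (cum j F)) \<ominus>\<^bsub>G\<^esub> sgl (a \<otimes> parent j) (bact M a (cum j F))"
    if "a \<in> carrier B" "j \<in> ?J" "F \<in> carrier G" for a j F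
    using gact_edge[OF that(1) _ _ cm[OF that(3,2)]] that(2) by blast
  show "bact E (parent j) (edge j (cum j F)) = edge j (cum j F)" if j: "j \<in> ?J" and "F \<in> carrier E"
  proof -
    have F: "F \<in> carrier G" using that E_simps(1) by auto
    have jj: "j \<in> carrier B" "j \<noteq> \<one>" using j by auto
    note p = parent_less[OF jj]
    have "bact G (parent j) (edge j (cum j F)) = edge j (cum j F)"
      unfolding act[OF p(1) j F] bact_parent[OF jj cm[OF F j]] p(5) idem[OF p(1)] by (simp only: edge_def)
    then show ?thesis unfolding E_simps .
  qed
  have sgl_a: "sgl (a \<otimes> b) (bact M a m) \<in> carrier G"
    if "a \<in> carrier B" "b \<in> carrier B" "m \<in> carrier M" "bact M b m = m" for a b m
  proof (rule sgl_closed)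
    have "bact M (a \<otimes> b) (bact M a m) = bact M (a \<otimes> b) m"
      using that by (simp add: bact_mult left_regular)
    then show "bact M (a \<otimes> b) (bact M a m) = bact M a m" using bact_mult[OF that(1-3)] that(4) by simp
  qed (use that in simp)
  show "supp B (parent i) \<subseteq> supp B (a \<otimes> parent j)"
    if a: "a \<in> carrier B" and i: "i \<in> ?J" and j: "j \<in> ?J" and FE: "F \<in> carrier E"
      and ne: "edge i (cum i (bact E a (edge j (cum j F)))) \<noteq> \<zero>\<^bsub>E\<^esub>"
  proof -
    have F: "F \<in> carrier G" using FE E_simps(1) by auto
    have jj: "j \<in> carrier B" "j \<noteq> \<one>" and ii: "i \<in> carrier B" "i \<noteq> \<one>" using i j by auto
    note p = parent_less[OF jj] and m = cm[OF F j]
    have apB: "a \<otimes> parent j \<in> carrier B" and ajB: "a \<otimes> j \<in> carrier B" using a jj p by auto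
    let ?m = "bact M a (cum j F)"
    have mc: "?m \<in> carrier M" using m by simp
    \<comment> \<open>The coefficient at \<open>i\<close> can be nonzero only if \<open>i\<close>
      separates the translated ends: it is above \<open>a j\<close> but not above
      \<open>a (parent j)\<close>. Both \<open>i\<close> and \<open>a (parent j)\<close> are above
      \<open>a j\<close>, hence comparable, so \<open>i\<close> is strictly below
      \<open>a (parent j)\<close> and its parent is still below it.\<close>
    have "cum i (bact E a (edge j (cum j F))) = (if R_le B (a \<otimes> j) i then ?m else \<zero>\<^bsub>M\<^esub>)
        \<ominus>\<^bsub>M\<^esub> (if R_le B (a \<otimes> parent j) i then ?m else \<zero>\<^bsub>M\<^esub>)"
      unfolding E_simps act[OF a j F]
        cum_diff[OF sgl_a[OF a jj(1) m] sgl_a[OF a p(1) m(1) bact_parent[OF jj m]]] cum_sgl[OF ajB mc] cum_sgl[OF apB mc] ..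
    moreover have "cum i (bact E a (edge j (cum j F))) \<noteq> \<zero>\<^bsub>M\<^esub>" using ne by (auto simp: edge_zero E_simps)
    moreover have jp: "R_le B (a \<otimes> j) (a \<otimes> parent j)" by (rule R_le_mult_mono[OF jj(1) p(1) a p(2)])
    moreover have "R_le B (a \<otimes> j) i" if "R_le B (a \<otimes> parent j) i"
      by (rule R_le_trans[OF ajB apB ii(1) jp that])
    ultimately have ji: "R_le B (a \<otimes> j) i" and npi: "\<not> R_le B (a \<otimes> parent j) i"
      using mc by (auto simp: M.M.minus_eq M.M.r_neg split: if_splits)
    then have "R_le B i (a \<otimes> parent j)" using R_le_comparable[OF finite_B rh ajB ii(1) apB ji jp] by blast
    moreover have "i \<noteq> a \<otimes> parent j" using npi R_le_refl[OF apB] by auto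
    ultimately have "R_le B (parent i) (a \<otimes> parent j)"
      by (intro parent_le[OF finite_B rh ii(1) apB]) (simp add: R_less_def)
    then show ?thesis by (rule R_le_supp[OF parent_less(1)[OF ii] apB])
  qed
  show "\<exists>i\<in>?J. parent i = a \<otimes> parent j \<and>
      (\<forall>F\<in>carrier E. edge i (cum i (bact E a (edge j (cum j F)))) = bact E a (edge j (cum j F)))"
    if a: "a \<in> carrier B" and j: "j \<in> ?J" and pa: "parent j \<otimes> a = parent j"
  proof -
    have jj: "j \<in> carrier B" "j \<noteq> \<one>" using j by auto
    note p = parent_less[OF jj]
    have apB: "a \<otimes> parent j \<in> carrier B" and ajB: "a \<otimes> j \<in> carrier B" using a jj p by auto
    have jp: "R_le B (a \<otimes> j) (a \<otimes> parent j)" by (rule R_le_mult_mono[OF jj(1) p(1) a p(2)])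
    \<comment> \<open>Below \<open>a (parent j)\<close>, left multiplication by
      \<open>parent j\<close> inverts that by \<open>a\<close>. An element strictly between the
      translated ends would be pulled back to one strictly between \<open>j\<close> and its
      parent.\<close>
    have paj: "parent j \<otimes> (a \<otimes> j) = j" using a jj(1) p(1,5) pa by (simp add: m_assoc[symmetric])
    have pap: "parent j \<otimes> (a \<otimes> parent j) = parent j" using a p(1) pa by (simp add: m_assoc[symmetric] idem)
    have ne: "a \<otimes> j \<noteq> a \<otimes> parent j" using paj pap p(3) by metis
    have child: "a \<otimes> j \<in> children B (a \<otimes> parent j)"
    proof -
      have False if w: "w \<in> carrier B" "R_less B (a \<otimes> j) w" "R_less B w (a \<otimes> parent j)" for w
      proof -
        have "R_le B (parent j \<otimes> (a \<otimes> j)) (parent j \<otimes> w)" "R_le B (parent j \<otimes> w) (parent j \<otimes> (a \<otimes> parent j))"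
          using w ajB apB p(1) by (auto intro!: R_le_mult_mono simp: R_less_def)
        then have jw: "R_le B j (parent j \<otimes> w)" "R_le B (parent j \<otimes> w) (parent j)" unfolding paj pap .
        have aw: "a \<otimes> (parent j \<otimes> w) = w"
          using w a p(1) by (simp add: R_less_def R_le_def m_assoc)
        have "parent j \<otimes> w \<noteq> j" "parent j \<otimes> w \<noteq> parent j" using aw w by (auto simp: R_less_def)
        then have "R_less B j (parent j \<otimes> w)" "R_less B (parent j \<otimes> w) (parent j)" using jw by (auto simp: R_less_def)
        then show False using children_between[OF parent(2)[OF finite_B jj]] p(1) w(1) by blast
      qed
      then show ?thesis using ajB jp ne by (auto simp: children_def R_less_def)
    qed
    have aj1: "a \<otimes> j \<noteq> \<one>"
    proof
      assume "a \<otimes> j = \<one>"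
      then have "R_le B \<one> (a \<otimes> parent j)" using jp by simp
      then show False using R_le_antisym[OF one_closed apB _ R_le_one[OF apB]] ne \<open>a \<otimes> j = \<one>\<close> by simp
    qed
    have par: "parent (a \<otimes> j) = a \<otimes> parent j" by (rule parent_eq[OF finite_B rh apB child])
    have "edge (a \<otimes> j) (cum (a \<otimes> j) (bact E a (edge j (cum j F)))) = bact E a (edge j (cum j F))"
      if FE: "F \<in> carrier E" for F
    proof -
      have F: "F \<in> carrier G" using FE E_simps(1) by auto
      note m = cm[OF F j]
      have eq: "bact E a (edge j (cum j F)) = edge (a \<otimes> j) (bact M a (cum j F))"
        unfolding E_simps act[OF a j F] by (simp only: edge_def par)
      have m': "bact M a (cum j F) \<in> carrier M" "bact M (a \<otimes> j) (bact M a (cum j F)) = bact M a (cum j F)"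
        using m bact_mult[OF a jj(1) m(1)] a jj(1) by (auto simp: bact_mult idem)
      show ?thesis unfolding eq cum_edge[OF ajB aj1 m' ajB] by simp
    qed
    then show ?thesis using ajB aj1 par by (intro bexI[of _ "a \<otimes> j"]) auto
  qed
qed

end

context rh_lrb_algebra
begin

lemma length_one_resolution:
  fixes M :: "('b \<Rightarrow> 'k, 'm) module"
  assumes M: "left_module A M"
  shows "\<exists>(P :: nat \<Rightarrow> ('b \<Rightarrow> 'k, ('m \<times> ('b \<Rightarrow> 'k)) list) module) d e.
    projective_resolution A M P d e \<and> (\<forall>i>1. carrier (P i) = {\<zero>\<^bsub>P i\<^esub>})"
proof -
  interpret rh_lrb_module B K M
    by (intro rh_lrb_module.intro rh_lrb_algebra_axioms monoid_algebra_moduleI M)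
  obtain bs where bs: "set bs = carrier B" using finite_list[OF finite_B] by blast
  \<comment> \<open>An element of \<open>G\<close> is encoded as the list of its values along an
    enumeration of the monoid; \<open>undefined\<close> only fills the second component of the
    prescribed element type.\<close>
  let ?\<phi> = "\<lambda>F :: 'b \<Rightarrow> 'm. map (\<lambda>b. (F b, undefined :: 'b \<Rightarrow> 'k)) bs"
  have "inj_on ?\<phi> (carrier G)"
  proof (rule inj_onI)
    fix F H assume F: "F \<in> carrier G" and H: "H \<in> carrier G" and eq: "?\<phi> F = ?\<phi> H"
    show "F = H" by (rule G_eqI[OF F H]) (use eq bs in auto)
  qed
  then show ?thesis
    using length_one_resolution_exists[OF M projective_G aug_hom aug_surj projective_E[unfolded E_def]] by blast
qed

lemma hereditary_monoid_algebra: "hereditary TYPE('m) A"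
proof -
  have "proj_dim A M \<le> 1" if "left_module A M" for M :: "('b \<Rightarrow> 'k, 'm) module"
  proof -
    have "proj_dim A M \<le> enat 1"
      unfolding proj_dim_def using length_one_resolution[OF that] by (intro Inf_lower) blast
    then show ?thesis by (simp add: one_enat_def)
  qed
  then show ?thesis unfolding hereditary_def gl_dim_def by (intro SUP_least) simp
qed

end

section \<open>Simple modules\<close>

lemma lmod_iso_sym:
  assumes M: "left_module R M" and N: "left_module R N" and "lmod_iso R M N"
  shows "lmod_iso R N M"
proof -
  interpret M: left_module R M by fact
  interpret N: left_module R N by fact
  obtain f where f: "f \<in> lmod_hom R M N" and bij: "bij_betw f (carrier M) (carrier N)"
    using assms(3) by (auto simp: lmod_iso_def)
  define g where "g = inv_into (carrier M) f"
  have inj: "inj_on f (carrier M)" and im: "f ` carrier M = carrier N" using bij by (auto simp: bij_betw_def)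
  have g: "g y \<in> carrier M" "f (g y) = y" if "y \<in> carrier N" for y
    using that im by (auto simp: g_def inv_into_into f_inv_into_f)
  have "restrict g (carrier N) \<in> lmod_hom R N M"
  proof (rule lmod_hom_restrictI[OF N])
    show "g (x \<oplus>\<^bsub>N\<^esub> y) = g x \<oplus>\<^bsub>M\<^esub> g y" if "x \<in> carrier N" "y \<in> carrier N" for x y
      by (rule inj_onD[OF inj]) (use g that lmod_homD[OF f] in auto)
    show "g (a \<odot>\<^bsub>N\<^esub> x) = a \<odot>\<^bsub>M\<^esub> g x" if "a \<in> carrier R" "x \<in> carrier N" for a x
      by (rule inj_onD[OF inj]) (use g that lmod_homD[OF f] in \<open>auto simp: M.lm_smult_closed N.lm_smult_closed\<close>)
  qed (use g in auto)
  moreover have "bij_betw (restrict g (carrier N)) (carrier N) (carrier M)"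
    using bij_betw_inv_into[OF bij] by (simp add: g_def cong: bij_betw_cong)
  ultimately show ?thesis unfolding lmod_iso_def by blast
qed

lemma (in monoid_algebra_module) left_submodule_actionsI:
  assumes N: "N \<subseteq> carrier M" "\<zero>\<^bsub>M\<^esub> \<in> N"
    and add: "\<And>x y. x \<in> N \<Longrightarrow> y \<in> N \<Longrightarrow> x \<oplus>\<^bsub>M\<^esub> y \<in> N"
    and k: "\<And>c x. c \<in> carrier K \<Longrightarrow> x \<in> N \<Longrightarrow> kact M c x \<in> N"
    and b: "\<And>b x. b \<in> carrier B \<Longrightarrow> x \<in> N \<Longrightarrow> bact M b x \<in> N"
  shows "left_submodule A N M"
proof (rule left_submoduleI[OF M.left_module_axioms N add])
  fix f x assume f: "f \<in> carrier A" and x: "x \<in> N"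
  have sum: "(\<Oplus>\<^bsub>M\<^esub>i\<in>S. u i) \<in> N" if "finite S" "\<And>i. i \<in> S \<Longrightarrow> u i \<in> N" for S and u :: "'b \<Rightarrow> 'm"
    using that
  proof (induction S rule: finite_induct)
    case (insert i S)
    then show ?case using N add by (subst M.M.finsum_insert) auto
  qed (use N in simp)
  have "x \<in> carrier M" using x N by blast
  then show "f \<odot>\<^bsub>M\<^esub> x \<in> N"
    unfolding smult_expand[OF f \<open>x \<in> carrier M\<close>]
    using sum[OF finite_B] k b x f coeff_closed by simp
qed

context lrb_algebra
begin

text \<open>The character through which the monoid acts on \<open>S U\<close>.\<close>

definition chi :: "'b set \<Rightarrow> 'b \<Rightarrow> 'k" where
  "chi U b = (if U \<subseteq> supp B b then \<one>\<^bsub>K\<^esub> else \<zero>\<^bsub>K\<^esub>)"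

abbreviation S where "S \<equiv> support_module K B"

lemma chi_closed [simp]: "chi U b \<in> carrier K"
  by (simp add: chi_def)

lemma chi_mult:
  assumes "U \<in> support_lattice B" "a \<in> carrier B" "b \<in> carrier B"
  shows "chi U (a \<otimes> b) = chi U a \<otimes>\<^bsub>K\<^esub> chi U b"
proof -
  obtain c where "c \<in> carrier B" "U = supp B c" using assms(1) by (auto simp: support_lattice_def)
  then show ?thesis using subset_supp_mult[OF assms(2,3)] by (simp add: chi_def)
qed

lemma chi_one: "U \<in> support_lattice B \<Longrightarrow> chi U \<one> = \<one>\<^bsub>K\<^esub>"
  using supp_subset_iff[OF _ one_closed] by (auto simp: chi_def support_lattice_def)

text \<open>\<open>K\<close> as a vector space over itself, in the record form that
  \<open>rep_module\<close> takes.\<close>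

definition KV :: "('k, 'k) module" where
  "KV = \<lparr>carrier = carrier K, monoid.mult = monoid.mult K, one = \<one>\<^bsub>K\<^esub>, ring.zero = \<zero>\<^bsub>K\<^esub>,
     add = add K, smult = monoid.mult K\<rparr>"

lemma left_module_KV: "left_module K KV"
  by (rule left_moduleI) (auto simp: KV_def K.ring_axioms K.a_ac K.l_distr K.r_distr K.m_assoc)

lemma S_simps: "carrier (S U) = carrier K" "\<zero>\<^bsub>S U\<^esub> = \<zero>\<^bsub>K\<^esub>" "x \<oplus>\<^bsub>S U\<^esub> y = x \<oplus>\<^bsub>K\<^esub> y"
  by (simp_all add: support_module_def)

text \<open>The given action is compared with the one that \<open>rep_module\<close> builds from
  \<open>chi U\<close> on \<open>KV\<close>. The two agree for arguments in the carriers, which is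
  enough to carry over the module laws.\<close>

lemma support_module:
  assumes U: "U \<in> support_lattice B"
  shows left_module_S: "left_module A (S U)"
    and bact_S: "b \<in> carrier B \<Longrightarrow> v \<in> carrier K \<Longrightarrow> bact (S U) b v = chi U b \<otimes>\<^bsub>K\<^esub> v"
    and kact_S: "c \<in> carrier K \<Longrightarrow> v \<in> carrier K \<Longrightarrow> kact (S U) c v = c \<otimes>\<^bsub>K\<^esub> v"
proof -
  let ?\<beta> = "\<lambda>b v. chi U b \<otimes>\<^bsub>K\<^esub> v"
  let ?R = "rep_module KV ?\<beta>"
  have R: "left_module A ?R"
    "b \<in> carrier B \<Longrightarrow> v \<in> carrier K \<Longrightarrow> bact ?R b v = chi U b \<otimes>\<^bsub>K\<^esub> v"
    "c \<in> carrier K \<Longrightarrow> v \<in> carrier K \<Longrightarrow> kact ?R c v = c \<otimes>\<^bsub>K\<^esub> v" for b c v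
    using rep_module[OF left_module_KV, of ?\<beta>]
    by (simp_all add: KV_def chi_mult[OF U] chi_one[OF U] K.r_distr K.m_assoc K.m_lcomm)
  interpret R: left_module A ?R by (rule R(1))
  have c: "carrier ?R = carrier K" "\<zero>\<^bsub>?R\<^esub> = \<zero>\<^bsub>K\<^esub>" "x \<oplus>\<^bsub>?R\<^esub> y = x \<oplus>\<^bsub>K\<^esub> y" for x y
    by (simp_all add: rep_module_simps KV_def)
  have sm: "f \<odot>\<^bsub>S U\<^esub> v = f \<odot>\<^bsub>?R\<^esub> v" if f: "f \<in> carrier A" and v: "v \<in> carrier K" for f v
  proof -
    interpret V: left_module K KV by (rule left_module_KV)
    have "f \<odot>\<^bsub>?R\<^esub> v = (\<lambda>x. x) (\<Oplus>\<^bsub>KV\<^esub>b\<in>carrier B. f b \<otimes>\<^bsub>K\<^esub> (chi U b \<otimes>\<^bsub>K\<^esub> v))"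
      by (simp add: rep_module_simps) (simp add: KV_def)
    also have "\<dots> = (\<Oplus>\<^bsub>K\<^esub>b\<in>carrier B. (\<lambda>x. x) (f b \<otimes>\<^bsub>K\<^esub> (chi U b \<otimes>\<^bsub>K\<^esub> v)))"
      by (rule finsum_additive[OF V.M.abelian_group_axioms K.is_abelian_group finite_B])
        (use f v in \<open>auto simp: KV_def coeff_closed\<close>)
    also have "\<dots> = (\<Oplus>\<^bsub>K\<^esub>b\<in>carrier B. (f b \<otimes>\<^bsub>K\<^esub> chi U b) \<otimes>\<^bsub>K\<^esub> v)"
      by (rule K.finsum_cong'[OF refl]) (use f v in \<open>auto simp: coeff_closed K.m_assoc\<close>)
    also have "\<dots> = (\<Oplus>\<^bsub>K\<^esub>b\<in>carrier B. f b \<otimes>\<^bsub>K\<^esub> chi U b) \<otimes>\<^bsub>K\<^esub> v"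
      by (rule K.finsum_ldistr[OF finite_B v, symmetric]) (use f in \<open>auto simp: coeff_closed\<close>)
    finally show ?thesis by (simp add: support_module_def chi_def)
  qed
  show L: "left_module A (S U)"
  proof (rule left_moduleI, unfold S_simps)
    fix f g v w assume f: "f \<in> carrier A" and g: "g \<in> carrier A" and v: "v \<in> carrier K" and w: "w \<in> carrier K"
    have cl: "f \<odot>\<^bsub>?R\<^esub> v \<in> carrier K" if "f \<in> carrier A" "v \<in> carrier K" for f v
      using R.lm_smult_closed[of f v] that by (simp add: c)
    show "f \<odot>\<^bsub>S U\<^esub> v \<in> carrier K" using cl[OF f v] by (simp add: sm f v)
    show "(f \<oplus>\<^bsub>A\<^esub> g) \<odot>\<^bsub>S U\<^esub> v = f \<odot>\<^bsub>S U\<^esub> v \<oplus>\<^bsub>K\<^esub> g \<odot>\<^bsub>S U\<^esub> v"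
      using R.lm_smult_l_distr[of f g v] f g v by (simp add: sm c)
    show "f \<odot>\<^bsub>S U\<^esub> (v \<oplus>\<^bsub>K\<^esub> w) = f \<odot>\<^bsub>S U\<^esub> v \<oplus>\<^bsub>K\<^esub> f \<odot>\<^bsub>S U\<^esub> w"
      using R.lm_smult_r_distr[of f v w] f v w by (simp add: sm c)
    show "(f \<otimes>\<^bsub>A\<^esub> g) \<odot>\<^bsub>S U\<^esub> v = f \<odot>\<^bsub>S U\<^esub> (g \<odot>\<^bsub>S U\<^esub> v)"
      using R.lm_smult_assoc[of f g v] f g v cl by (simp add: sm c)
  next
    fix v assume v: "v \<in> carrier K"
    show "\<one>\<^bsub>A\<^esub> \<odot>\<^bsub>S U\<^esub> v = v" using R.lm_smult_one[of v] v by (simp add: sm c)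
    show "\<zero>\<^bsub>A\<^esub> \<odot>\<^bsub>S U\<^esub> v = \<zero>\<^bsub>K\<^esub>" using R.lm_zero_l[of v] v by (simp add: sm c)
  qed (auto simp: A.ring_axioms K.a_ac)
  show "bact (S U) b v = chi U b \<otimes>\<^bsub>K\<^esub> v" if "b \<in> carrier B" "v \<in> carrier K"
    using R(2)[OF that] that by (simp add: bact_def sm)
  show "kact (S U) c v = c \<otimes>\<^bsub>K\<^esub> v" if "c \<in> carrier K" "v \<in> carrier K"
    using R(3)[OF that] that by (simp add: kact_def sm scalar_closed)
qed

lemma K_inverse:
  assumes "v \<in> carrier K" "v \<noteq> \<zero>\<^bsub>K\<^esub>"
  obtains u where "u \<in> carrier K" "u \<otimes>\<^bsub>K\<^esub> v = \<one>\<^bsub>K\<^esub>"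
  using assms K.field_Units K.Units_inv_closed K.Units_l_inv by blast

lemma simple_S:
  assumes U: "U \<in> support_lattice B"
  shows "simple_module A (S U)"
proof -
  interpret S: monoid_algebra_module B K "S U" by (rule monoid_algebra_moduleI[OF left_module_S[OF U]])
  have "N = {\<zero>\<^bsub>S U\<^esub>} \<or> N = carrier (S U)" if N: "left_submodule A N (S U)" for N
  proof (cases "N \<subseteq> {\<zero>\<^bsub>K\<^esub>}")
    case True
    interpret N: additive_subgroup N "S U" using N by (simp add: left_submodule_def)
    show ?thesis using True N.zero_closed by (auto simp: S_simps)
  next
    case False
    interpret N: additive_subgroup N "S U" using N by (simp add: left_submodule_def)
    have sub: "N \<subseteq> carrier K" using N.a_subset by (simp add: S_simps)
    obtain v where v: "v \<in> N" "v \<noteq> \<zero>\<^bsub>K\<^esub>" using False by blast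
    then have vc: "v \<in> carrier K" using sub by blast
    obtain u where u: "u \<in> carrier K" "u \<otimes>\<^bsub>K\<^esub> v = \<one>\<^bsub>K\<^esub>" using K_inverse[OF vc v(2)] .
    have "w \<in> N" if w: "w \<in> carrier K" for w
    proof -
      have "kact (S U) (w \<otimes>\<^bsub>K\<^esub> u) v \<in> N"
        using N v w u by (simp add: left_submodule_def kact_def scalar_closed)
      moreover have "kact (S U) (w \<otimes>\<^bsub>K\<^esub> u) v = w" using w u vc by (simp add: kact_S[OF U] K.m_assoc)
      ultimately show ?thesis by simp
    qed
    then show ?thesis using sub by (auto simp: S_simps)
  qed
  moreover have "carrier (S U) \<noteq> {\<zero>\<^bsub>S U\<^esub>}"
  proof
    assume "carrier (S U) = {\<zero>\<^bsub>S U\<^esub>}"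
    then have "\<one>\<^bsub>K\<^esub> \<in> {\<zero>\<^bsub>K\<^esub>}" using K.one_closed by (simp add: S_simps)
    then show False using K.one_not_zero by simp
  qed
  ultimately show ?thesis using left_module_S[OF U] unfolding simple_module_def by blast
qed

text \<open>An element whose support is \<open>U\<close> acts as the identity on \<open>S U\<close>,
  hence also on \<open>S W\<close>, and this forces \<open>W\<close> to lie in its support.\<close>

lemma S_iso_subset:
  assumes U: "U \<in> support_lattice B" and W: "W \<in> support_lattice B" and "lmod_iso A (S U) (S W)"
  shows "W \<subseteq> U"
proof -
  obtain f where f: "f \<in> lmod_hom A (S U) (S W)" and bij: "bij_betw f (carrier K) (carrier K)"
    using assms(3) by (auto simp: lmod_iso_def S_simps)
  obtain b where b: "b \<in> carrier B" "U = supp B b" using U by (auto simp: support_lattice_def)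
  have fc: "f \<one>\<^bsub>K\<^esub> \<in> carrier K" using bij by (auto simp: bij_betw_def)
  have f0: "f \<zero>\<^bsub>K\<^esub> = \<zero>\<^bsub>K\<^esub>" using lmod_hom_zero[OF left_module_S[OF U] left_module_S[OF W] f] by (simp add: S_simps)
  have "f \<one>\<^bsub>K\<^esub> \<noteq> \<zero>\<^bsub>K\<^esub>"
    using f0 bij inj_onD[of f "carrier K" "\<one>\<^bsub>K\<^esub>" "\<zero>\<^bsub>K\<^esub>"] K.one_not_zero by (auto simp: bij_betw_def)
  moreover have "f (bact (S U) b \<one>\<^bsub>K\<^esub>) = bact (S W) b (f \<one>\<^bsub>K\<^esub>)"
    by (rule lmod_hom_actions(2)[OF left_module_S[OF U] left_module_S[OF W] f]) (simp add: S_simps)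
  moreover have "bact (S U) b \<one>\<^bsub>K\<^esub> = \<one>\<^bsub>K\<^esub>"
    unfolding bact_S[OF U b(1) K.one_closed] using b(2) by (simp add: chi_def)
  ultimately have "f \<one>\<^bsub>K\<^esub> \<noteq> \<zero>\<^bsub>K\<^esub>" "f \<one>\<^bsub>K\<^esub> = chi W b \<otimes>\<^bsub>K\<^esub> f \<one>\<^bsub>K\<^esub>"
    using b fc by (simp_all add: bact_S[OF W])
  then show ?thesis using fc b by (auto simp: chi_def split: if_splits)
qed

lemma simple_module_iso_S:
  fixes M :: "('b \<Rightarrow> 'k, 's) module"
  assumes M: "simple_module A M"
  shows "\<exists>U\<in>support_lattice B. lmod_iso A M (S U)"
proof -
  have LM: "left_module A M" and ne: "carrier M \<noteq> {\<zero>\<^bsub>M\<^esub>}"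
    and sub: "\<And>N. left_submodule A N M \<Longrightarrow> N = {\<zero>\<^bsub>M\<^esub>} \<or> N = carrier M"
    using M by (auto simp: simple_module_def)
  interpret M: monoid_algebra_module B K M by (rule monoid_algebra_moduleI[OF LM])
  obtain v where v: "v \<in> carrier M" "v \<noteq> \<zero>\<^bsub>M\<^esub>" using ne M.M.M.zero_closed by blast
  let ?P = "\<lambda>b. b \<in> carrier B \<and> (\<exists>v\<in>carrier M. bact M b v \<noteq> \<zero>\<^bsub>M\<^esub>)"
  have "?P \<one>" using v by (auto intro!: bexI[of _ v])
  then obtain b where b: "?P b" and min: "\<And>a. ?P a \<Longrightarrow> card (supp B b) \<le> card (supp B a)"
    using ex_has_least_nat[of ?P \<one> "\<lambda>b. card (supp B b)"] by blast
  have bB: "b \<in> carrier B" using b by blast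
  let ?N = "{x \<in> carrier M. bact M b x = \<zero>\<^bsub>M\<^esub>}"
  \<comment> \<open>The kernel of \<open>b\<close> is stable because \<open>b a = b a b\<close>. By
    simplicity it is zero, and it contains every \<open>x - b x\<close>, so \<open>b\<close> acts as
    the identity.\<close>
  have "left_submodule A ?N M"
  proof (rule M.left_submodule_actionsI)
    show "bact M a x \<in> ?N" if "a \<in> carrier B" "x \<in> ?N" for a x
    proof -
      have "bact M b (bact M a x) = bact M (b \<otimes> a \<otimes> b) x" using that bB by (simp add: M.bact_mult left_regular)
      also have "\<dots> = bact M (b \<otimes> a) (bact M b x)" by (rule M.bact_mult[symmetric]) (use that bB in auto)
      also have "\<dots> = \<zero>\<^bsub>M\<^esub>" using that by simp
      finally show ?thesis using that by simp
    qed
  qed (auto simp: M.bact_add M.bact_kact)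
  then have N: "?N = {\<zero>\<^bsub>M\<^esub>}" using sub b by blast
  have id: "bact M b x = x" if x: "x \<in> carrier M" for x
  proof -
    have "bact M b (x \<ominus>\<^bsub>M\<^esub> bact M b x) = bact M b x \<ominus>\<^bsub>M\<^esub> bact M b x"
      using x bB by (simp add: M.bact_diff M.bact_mult idem)
    also have "\<dots> = \<zero>\<^bsub>M\<^esub>" using x by (simp add: M.M.M.minus_eq M.M.M.r_neg)
    finally have "x \<ominus>\<^bsub>M\<^esub> bact M b x \<in> ?N" using x by (simp add: M.M.M.minus_closed)
    then have "x \<ominus>\<^bsub>M\<^esub> bact M b x = \<zero>\<^bsub>M\<^esub>" using N by blast
    then show ?thesis using x M.M.M.diff_zero_imp_eq[of x "bact M b x"] by simp
  qed
  let ?U = "supp B b"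
  have U: "?U \<in> support_lattice B" using bB by (simp add: support_lattice_def)
  \<comment> \<open>If \<open>a\<close> is above \<open>b\<close> in support, then
    \<open>b a = b\<close> and \<open>a x = b a x = b x = x\<close>. Otherwise \<open>a b\<close>
    has smaller support than \<open>b\<close>, so it acts as zero by minimality, while
    \<open>a x = a b x\<close>.\<close>
  have act: "bact M a x = kact M (chi ?U a) x" if a: "a \<in> carrier B" and x: "x \<in> carrier M" for a x
  proof (cases "?U \<subseteq> supp B a")
    case True
    have "bact M a x = bact M b (bact M a x)" using id[of "bact M a x"] x by simp
    also have "\<dots> = bact M (b \<otimes> a) x" by (rule M.bact_mult[OF bB a x])
    also have "b \<otimes> a = b" using supp_subset_iff[OF bB a] True by simp
    finally show ?thesis using True x id[OF x] by (simp add: chi_def)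
  next
    case False
    have "supp B (a \<otimes> b) \<subset> ?U" using supp_mult_subset[OF a bB] False by blast
    then have "card (supp B (a \<otimes> b)) < card ?U" by (rule psubset_card_mono[OF finite_supp[OF bB]])
    then have "\<not> ?P (a \<otimes> b)" using min[of "a \<otimes> b"] by auto
    then have "bact M (a \<otimes> b) x = \<zero>\<^bsub>M\<^esub>" using a bB x by auto
    then show ?thesis using False x M.bact_mult[OF a bB x] id[OF x] by (simp add: chi_def)
  qed
  let ?g = "\<lambda>c\<in>carrier (S ?U). kact M c v"
  have g: "?g \<in> lmod_hom A (S ?U) M"
    by (rule lmod_hom_actionsI[OF left_module_S[OF U] LM])
      (use v in \<open>auto simp: S_simps M.kact_add_l kact_S[OF U] bact_S[OF U] M.kact_assoc act\<close>)
  \<comment> \<open>Now the monoid acts by scalars, so the line through \<open>v\<close> is a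
    submodule and therefore all of \<open>M\<close>.\<close>
  have "left_submodule A ((\<lambda>c. kact M c v) ` carrier K) M"
  proof (rule M.left_submodule_actionsI)
    show "\<zero>\<^bsub>M\<^esub> \<in> (\<lambda>c. kact M c v) ` carrier K" using v by (intro image_eqI[of _ _ "\<zero>\<^bsub>K\<^esub>"]) auto
    show "x \<oplus>\<^bsub>M\<^esub> y \<in> (\<lambda>c. kact M c v) ` carrier K"
      if x: "x \<in> (\<lambda>c. kact M c v) ` carrier K" and y: "y \<in> (\<lambda>c. kact M c v) ` carrier K" for x y
      using x y M.kact_add_l[OF _ _ v(1), symmetric] by auto
    have ks: "kact M d x \<in> (\<lambda>c. kact M c v) ` carrier K" if "d \<in> carrier K" "x \<in> (\<lambda>c. kact M c v) ` carrier K" for d x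
      using that M.kact_assoc[OF _ _ v(1), symmetric] by auto
    then show "kact M d x \<in> (\<lambda>c. kact M c v) ` carrier K" if "d \<in> carrier K" "x \<in> (\<lambda>c. kact M c v) ` carrier K" for d x
      using that by blast
    show "bact M a x \<in> (\<lambda>c. kact M c v) ` carrier K" if "a \<in> carrier B" "x \<in> (\<lambda>c. kact M c v) ` carrier K" for a x
    proof -
      have "x \<in> carrier M" using that v by auto
      then show ?thesis unfolding act[OF that(1) \<open>x \<in> carrier M\<close>] using ks that by simp
    qed
  qed (use v in auto)
  moreover have "v \<in> (\<lambda>c. kact M c v) ` carrier K" using v by (intro image_eqI[of _ _ "\<one>\<^bsub>K\<^esub>"]) auto
  ultimately have im: "(\<lambda>c. kact M c v) ` carrier K = carrier M" using sub v(2) by blast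
  have inj: "inj_on (\<lambda>c. kact M c v) (carrier K)"
  proof (rule inj_onI)
    fix c d assume cd: "c \<in> carrier K" "d \<in> carrier K" "kact M c v = kact M d v"
    let ?e = "c \<ominus>\<^bsub>K\<^esub> d"
    have e: "?e \<in> carrier K" using cd by simp
    have "kact M ?e v \<oplus>\<^bsub>M\<^esub> kact M d v = kact M c v"
      using cd v by (simp add: M.kact_add_l[symmetric] K.minus_eq K.a_assoc K.l_neg)
    then have z: "kact M ?e v = \<zero>\<^bsub>M\<^esub>" using cd v e by (metis M.M.M.add.r_cancel_one M.kact_closed)
    have "?e = \<zero>\<^bsub>K\<^esub>"
    proof (rule ccontr)
      assume "?e \<noteq> \<zero>\<^bsub>K\<^esub>"
      then obtain u where u: "u \<in> carrier K" "u \<otimes>\<^bsub>K\<^esub> ?e = \<one>\<^bsub>K\<^esub>" using K_inverse[OF e] by blast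
      have "v = kact M (u \<otimes>\<^bsub>K\<^esub> ?e) v" using u v by simp
      also have "\<dots> = \<zero>\<^bsub>M\<^esub>" using M.kact_assoc[OF u(1) e v(1)] z u by simp
      finally show False using v by simp
    qed
    then show "c = d" using cd by simp
  qed
  have "bij_betw ?g (carrier (S ?U)) (carrier M)"
    using inj im by (simp add: bij_betw_def S_simps inj_on_def)
  then have "lmod_iso A (S ?U) M" using g unfolding lmod_iso_def by blast
  then show ?thesis using lmod_iso_sym[OF left_module_S[OF U] LM] U by blast
qed

section \<open>Derivations between simple modules\<close>

text \<open>The product rule says that the upper triangular matrices with diagonal
  \<open>chi W b\<close>, \<open>chi U b\<close> and corner \<open>\<delta> b\<close> multiply like
  the monoid; it describes extensions of \<open>S U\<close> by \<open>S W\<close>.\<close>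

definition derivation :: "'b set \<Rightarrow> 'b set \<Rightarrow> ('b \<Rightarrow> 'k) \<Rightarrow> bool" where
  "derivation U W \<delta> \<longleftrightarrow> (\<forall>b\<in>carrier B. \<delta> b \<in> carrier K) \<and>
     (\<forall>a\<in>carrier B. \<forall>b\<in>carrier B. \<delta> (a \<otimes> b) = chi W a \<otimes>\<^bsub>K\<^esub> \<delta> b \<oplus>\<^bsub>K\<^esub> \<delta> a \<otimes>\<^bsub>K\<^esub> chi U b)"

text \<open>Such a term is added to \<open>\<delta>\<close> when, in the extension given by
  \<open>\<delta>\<close>, the basis vector \<open>(0, 1)\<close> over \<open>S U\<close> is
  replaced by \<open>(l, 1)\<close>.\<close>

definition inner_derivation :: "'b set \<Rightarrow> 'b set \<Rightarrow> ('b \<Rightarrow> 'k) \<Rightarrow> bool" where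
  "inner_derivation U W \<delta> \<longleftrightarrow> (\<exists>l\<in>carrier K. \<forall>b\<in>carrier B. \<delta> b = (chi W b \<ominus>\<^bsub>K\<^esub> chi U b) \<otimes>\<^bsub>K\<^esub> l)"

lemma derivation_closed: "derivation U W \<delta> \<Longrightarrow> b \<in> carrier B \<Longrightarrow> \<delta> b \<in> carrier K"
  by (simp add: derivation_def)

lemma derivation_mult:
  assumes d: "derivation U W \<delta>" and a: "a \<in> carrier B" and b: "b \<in> carrier B"
  shows "W \<subseteq> supp B a \<Longrightarrow> U \<subseteq> supp B b \<Longrightarrow> \<delta> (a \<otimes> b) = \<delta> b \<oplus>\<^bsub>K\<^esub> \<delta> a"
    and "W \<subseteq> supp B a \<Longrightarrow> \<not> U \<subseteq> supp B b \<Longrightarrow> \<delta> (a \<otimes> b) = \<delta> b"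
    and "\<not> W \<subseteq> supp B a \<Longrightarrow> U \<subseteq> supp B b \<Longrightarrow> \<delta> (a \<otimes> b) = \<delta> a"
    and "\<not> W \<subseteq> supp B a \<Longrightarrow> \<not> U \<subseteq> supp B b \<Longrightarrow> \<delta> (a \<otimes> b) = \<zero>\<^bsub>K\<^esub>"
proof -
  have "\<delta> (a \<otimes> b) = chi W a \<otimes>\<^bsub>K\<^esub> \<delta> b \<oplus>\<^bsub>K\<^esub> \<delta> a \<otimes>\<^bsub>K\<^esub> chi U b"
    using d a b by (simp add: derivation_def)
  then show "W \<subseteq> supp B a \<Longrightarrow> U \<subseteq> supp B b \<Longrightarrow> \<delta> (a \<otimes> b) = \<delta> b \<oplus>\<^bsub>K\<^esub> \<delta> a"
    "W \<subseteq> supp B a \<Longrightarrow> \<not> U \<subseteq> supp B b \<Longrightarrow> \<delta> (a \<otimes> b) = \<delta> b"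
    "\<not> W \<subseteq> supp B a \<Longrightarrow> U \<subseteq> supp B b \<Longrightarrow> \<delta> (a \<otimes> b) = \<delta> a"
    "\<not> W \<subseteq> supp B a \<Longrightarrow> \<not> U \<subseteq> supp B b \<Longrightarrow> \<delta> (a \<otimes> b) = \<zero>\<^bsub>K\<^esub>"
    using derivation_closed[OF d a] derivation_closed[OF d b] by (simp_all add: chi_def)
qed

text \<open>Expand \<open>\<delta> (b b)\<close>: if both characters are one at \<open>b\<close>,
  then \<open>\<delta> b = \<delta> b + \<delta> b\<close>; if both are zero, the right side
  vanishes.\<close>

lemma derivation_zero:
  assumes d: "derivation U W \<delta>" and b: "b \<in> carrier B" and eq: "U \<subseteq> supp B b \<longleftrightarrow> W \<subseteq> supp B b"
  shows "\<delta> b = \<zero>\<^bsub>K\<^esub>"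
proof (cases "U \<subseteq> supp B b")
  case True
  then have "\<delta> b = \<delta> b \<oplus>\<^bsub>K\<^esub> \<delta> b" using derivation_mult(1)[OF d b b] idem[OF b] eq by simp
  then show ?thesis using derivation_closed[OF d b] by (metis K.add.l_cancel_one')
next
  case False
  then show ?thesis using derivation_mult(4)[OF d b b] idem[OF b] eq by simp
qed

text \<open>Where both characters agree, both sides vanish by \<open>derivation_zero\<close>; only
  the two mixed cases are left to check.\<close>

lemma inner_derivationI:
  assumes d: "derivation U W \<delta>" and l: "l \<in> carrier K"
    and 1: "\<And>b. b \<in> carrier B \<Longrightarrow> W \<subseteq> supp B b \<Longrightarrow> \<not> U \<subseteq> supp B b \<Longrightarrow> \<delta> b = l"
    and 2: "\<And>b. b \<in> carrier B \<Longrightarrow> \<not> W \<subseteq> supp B b \<Longrightarrow> U \<subseteq> supp B b \<Longrightarrow> \<delta> b = \<ominus>\<^bsub>K\<^esub> l"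
  shows "inner_derivation U W \<delta>"
  unfolding inner_derivation_def
proof (intro bexI[of _ l] ballI l)
  fix b assume b: "b \<in> carrier B"
  show "\<delta> b = (chi W b \<ominus>\<^bsub>K\<^esub> chi U b) \<otimes>\<^bsub>K\<^esub> l"
    using 1[OF b] 2[OF b] derivation_zero[OF d b] l
    by (cases "W \<subseteq> supp B b"; cases "U \<subseteq> supp B b")
      (simp_all add: chi_def K.minus_eq K.r_neg K.l_minus)
qed

text \<open>If \<open>U\<close> is not contained in \<open>W\<close>, an element \<open>y\<close> of
  support \<open>W\<close> is above \<open>W\<close> but not above \<open>U\<close>, so
  \<open>\<delta> y\<close> is the only candidate for the scalar. The remaining case
  \<open>U = W\<close> has no mixed elements.\<close>

lemma derivation_inner:
  assumes d: "derivation U W \<delta>" and U: "U \<in> support_lattice B" and W: "W \<in> support_lattice B" and UW: "\<not> U \<subset> W"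
  shows "inner_derivation U W \<delta>"
proof (cases "U = W")
  case True
  show ?thesis by (rule inner_derivationI[OF d K.zero_closed]) (use True in auto)
next
  case False
  then have nUW: "\<not> U \<subseteq> W" using UW by blast
  obtain y where y: "y \<in> carrier B" "W = supp B y" using W by (auto simp: support_lattice_def)
  obtain x where x: "x \<in> carrier B" "U = supp B x" using U by (auto simp: support_lattice_def)
  have mU: "U \<subseteq> supp B (a \<otimes> b) \<longleftrightarrow> U \<subseteq> supp B a \<and> U \<subseteq> supp B b"
    and mW: "W \<subseteq> supp B (a \<otimes> b) \<longleftrightarrow> W \<subseteq> supp B a \<and> W \<subseteq> supp B b"
    if "a \<in> carrier B" "b \<in> carrier B" for a b
    using subset_supp_mult[OF that x(1)] subset_supp_mult[OF that y(1)] x y by auto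
  have yy: "W \<subseteq> supp B y" "\<not> U \<subseteq> supp B y" using y nUW by auto
  have yc: "\<delta> y \<in> carrier K" by (rule derivation_closed[OF d y(1)])
  have same: "\<delta> b = \<delta> y" if b: "b \<in> carrier B" "W \<subseteq> supp B b" "\<not> U \<subseteq> supp B b" for b
  proof -
    have by': "b \<otimes> y \<in> carrier B" "W \<subseteq> supp B (b \<otimes> y)" using b y mW[OF b(1) y(1)] by auto
    \<comment> \<open>Evaluate \<open>\<delta> (b y) = \<delta> (b y b)\<close> in two ways: with
      last factor \<open>y\<close> it is \<open>\<delta> y\<close>, with last factor
      \<open>b\<close> it is \<open>\<delta> b\<close>.\<close>
    have "\<delta> y = \<delta> (b \<otimes> y)" using derivation_mult(2)[OF d b(1) y(1) b(2) yy(2)] by simp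
    also have "\<dots> = \<delta> (b \<otimes> y \<otimes> b)" using b y by (simp add: left_regular)
    also have "\<dots> = \<delta> b" by (rule derivation_mult(2)[OF d by'(1) b(1) by'(2) b(3)])
    finally show ?thesis by simp
  qed
  have opp: "\<delta> c = \<ominus>\<^bsub>K\<^esub> \<delta> y" if c: "c \<in> carrier B" "\<not> W \<subseteq> supp B c" "U \<subseteq> supp B c" for c
  proof -
    \<comment> \<open>The product \<open>y c\<close> is above neither \<open>U\<close> nor
      \<open>W\<close>, so \<open>\<delta>\<close> vanishes there.\<close>
    have "\<delta> c \<oplus>\<^bsub>K\<^esub> \<delta> y = \<delta> (y \<otimes> c)" using derivation_mult(1)[OF d y(1) c(1) yy(1) c(3)] by simp
    also have "\<dots> = \<zero>\<^bsub>K\<^esub>" by (rule derivation_zero[OF d]) (use c y yy mU[OF y(1) c(1)] mW[OF y(1) c(1)] in auto)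
    finally show ?thesis using K.minus_equality[of "\<delta> c" "\<delta> y"] yc derivation_closed[OF d c(1)] by simp
  qed
  show ?thesis by (rule inner_derivationI[OF d yc]) (use same opp in auto)
qed

end

section \<open>Derivations and the children of an element\<close>

context rh_lrb_algebra
begin

abbreviation children_above :: "'b \<Rightarrow> 'b set \<Rightarrow> 'b set" where
  "children_above y U \<equiv> {z \<in> children B y. U \<subseteq> supp B z}"

lemma child_above_exists:
  assumes U: "U \<in> support_lattice B" and y: "y \<in> carrier B" "U \<subset> supp B y"
    and b: "b \<in> carrier B" "U \<subseteq> supp B b" "\<not> supp B y \<subseteq> supp B b"
  obtains z where "z \<in> children_above y U" "R_le B (y \<otimes> b) z"
proof -
  obtain x where x: "x \<in> carrier B" "U = supp B x" using U by (auto simp: support_lattice_def)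
  have yb: "y \<otimes> b \<in> carrier B" using y b by simp
  have "y \<otimes> b \<noteq> y" using b supp_subset_iff[OF y(1) b(1)] by simp
  then have "R_less B (y \<otimes> b) y" using R_le_mult[OF y(1) b(1)] by (simp add: R_less_def)
  then obtain z where z: "z \<in> children B y" "R_le B (y \<otimes> b) z" by (rule exists_child_above[OF finite_B yb y(1)])
  have "U \<subseteq> supp B (y \<otimes> b)" using subset_supp_mult[OF y(1) b(1) x(1)] x y b by blast
  also have "\<dots> \<subseteq> supp B z" by (rule R_le_supp[OF yb childrenD(1)[OF z(1)] z(2)])
  finally show thesis using that z by blast
qed

lemma child_supp:
  assumes "y \<in> carrier B" "z \<in> children B y"
  shows "\<not> supp B y \<subseteq> supp B z"
  using R_less_supp[OF childrenD(1)[OF assms(2)] assms(1) childrenD(2)[OF assms(2)]] by blast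

lemma children_above_nonempty:
  assumes U: "U \<in> support_lattice B" and y: "y \<in> carrier B" "U \<subset> supp B y"
  shows "children_above y U \<noteq> {}"
proof -
  obtain x where x: "x \<in> carrier B" "U = supp B x" using U by (auto simp: support_lattice_def)
  show ?thesis using child_above_exists[OF U y x(1)] x(2) y(2) by blast
qed

lemma finite_children_above: "finite (children_above y U)"
  using finite_B by (rule finite_subset[rotated]) (auto simp: children_def)

text \<open>Since \<open>U \<subset> W\<close>, the only mixed elements \<open>b\<close> are above
  \<open>U\<close> and not above \<open>W\<close>. For these
  \<open>\<delta> b = \<delta> (y b)\<close> because \<open>\<delta> y\<close> is zero. With a child
  \<open>z\<close> above \<open>y b\<close>, the identity \<open>z (y b) = y b\<close> gives
  \<open>\<delta> (y b) = \<delta> z\<close>. The scalar is \<open>- \<delta> z0\<close>, as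
  \<open>chi W - chi U\<close> is \<open>-1\<close> at \<open>b\<close>.\<close>

lemma derivation_constant_inner:
  assumes d: "derivation U (supp B y) \<delta>" and U: "U \<in> support_lattice B"
    and y: "y \<in> carrier B" "U \<subset> supp B y" and z0: "z0 \<in> children_above y U"
    and const: "\<And>z. z \<in> children_above y U \<Longrightarrow> \<delta> z = \<delta> z0"
  shows "inner_derivation U (supp B y) \<delta>"
proof (rule inner_derivationI[OF d])
  have c: "\<delta> z0 \<in> carrier K" using derivation_closed[OF d] z0 childrenD(1) by blast
  then show "\<ominus>\<^bsub>K\<^esub> \<delta> z0 \<in> carrier K" by simp
  fix b assume b: "b \<in> carrier B"
  show "\<delta> b = \<ominus>\<^bsub>K\<^esub> \<delta> z0" if "supp B y \<subseteq> supp B b" "\<not> U \<subseteq> supp B b" using that y by blast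
  assume nb: "\<not> supp B y \<subseteq> supp B b" and ub: "U \<subseteq> supp B b"
  obtain z where z: "z \<in> children_above y U" "R_le B (y \<otimes> b) z" by (rule child_above_exists[OF U y b ub nb])
  have zB: "z \<in> carrier B" and zy: "\<not> supp B y \<subseteq> supp B z"
    using z childrenD(1) child_supp[OF y(1)] by auto
  have dy: "\<delta> y = \<zero>\<^bsub>K\<^esub>" by (rule derivation_zero[OF d y(1)]) (use y in blast)
  have yb: "y \<otimes> b \<in> carrier B" using y b by simp
  have "\<delta> (y \<otimes> b) = \<delta> b"
    using derivation_mult(1)[OF d y(1) b subset_refl ub] dy derivation_closed[OF d b] by simp
  moreover have "U \<subseteq> supp B (y \<otimes> b)"
    using U subset_supp_mult[OF y(1) b] y ub by (auto simp: support_lattice_def)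
  then have "\<delta> (z \<otimes> (y \<otimes> b)) = \<delta> z" by (rule derivation_mult(3)[OF d zB yb zy])
  moreover have "z \<otimes> (y \<otimes> b) = y \<otimes> b" using z(2) by (simp add: R_le_def)
  ultimately have "\<delta> b = \<delta> z0" using const[OF z(1)] by simp
  then show "\<delta> b = \<ominus>\<^bsub>K\<^esub> (\<ominus>\<^bsub>K\<^esub> \<delta> z0)" using c by simp
qed

text \<open>By the preceding computation the value at a mixed element \<open>b\<close> can only be
  that of the child above \<open>y b\<close>. In a tree this child is unique, so the rule defines
  \<open>\<delta>\<close>.\<close>

lemma derivation_extends:
  assumes U: "U \<in> support_lattice B" and y: "y \<in> carrier B" "U \<subset> supp B y"
    and f: "\<And>z. z \<in> children_above y U \<Longrightarrow> f z \<in> carrier K"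
  shows "\<exists>\<delta>. derivation U (supp B y) \<delta> \<and> (\<forall>z\<in>children_above y U. \<delta> z = f z)"
proof -
  let ?W = "supp B y" and ?C = "children_above y U"
  obtain x where x: "x \<in> carrier B" "U = supp B x" using U by (auto simp: support_lattice_def)
  have mU: "U \<subseteq> supp B (a \<otimes> b) \<longleftrightarrow> U \<subseteq> supp B a \<and> U \<subseteq> supp B b"
    and mW: "?W \<subseteq> supp B (a \<otimes> b) \<longleftrightarrow> ?W \<subseteq> supp B a \<and> ?W \<subseteq> supp B b"
    if "a \<in> carrier B" "b \<in> carrier B" for a b
    using subset_supp_mult[OF that x(1)] subset_supp_mult[OF that y(1)] x by auto
  define ch where "ch c = (SOME z. z \<in> children B y \<and> R_le B c z)" for c
  have ch_eq: "ch c = z" if "c \<in> carrier B" "z \<in> children B y" "R_le B c z" for c z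
    unfolding ch_def
    by (rule some_equality) (use that unique_child_above[OF finite_B rh that(1)] in auto)
  let ?S = "\<lambda>b. U \<subseteq> supp B b \<and> \<not> ?W \<subseteq> supp B b"
  have chC: "ch (y \<otimes> b) \<in> ?C \<and> R_le B (y \<otimes> b) (ch (y \<otimes> b))" if b: "b \<in> carrier B" "?S b" for b
  proof -
    obtain z where z: "z \<in> ?C" "R_le B (y \<otimes> b) z" by (rule child_above_exists[OF U y b(1)]) (use b in auto)
    then have "ch (y \<otimes> b) = z" using ch_eq[of "y \<otimes> b" z] y b by simp
    then show ?thesis using z by simp
  qed
  define \<delta> where "\<delta> b = (if ?S b then f (ch (y \<otimes> b)) else \<zero>\<^bsub>K\<^esub>)" for b
  have dc: "\<delta> b \<in> carrier K" if "b \<in> carrier B" for b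
    using f chC[OF that] by (simp add: \<delta>_def)
  have "\<delta> (a \<otimes> b) = chi ?W a \<otimes>\<^bsub>K\<^esub> \<delta> b \<oplus>\<^bsub>K\<^esub> \<delta> a \<otimes>\<^bsub>K\<^esub> chi U b" if a: "a \<in> carrier B" and b: "b \<in> carrier B" for a b
  proof -
    \<comment> \<open>In cases 1 and 3 the product is again mixed. In case 1,
      \<open>y a = y\<close>, so \<open>y a b = y b\<close>; in case 3, \<open>y a b\<close> is
      below \<open>y a\<close> and therefore under the same child. In cases 2 and 4 both sides
      vanish.\<close>
    consider (1) "?W \<subseteq> supp B a" "?S b" | (2) "?W \<subseteq> supp B a" "\<not> ?S b" | (3) "?S a" "U \<subseteq> supp B b"
      | (4) "\<not> ?W \<subseteq> supp B a" "\<not> (?S a \<and> U \<subseteq> supp B b)" by blast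
    then show ?thesis
    proof cases
      case 1
      have "y \<otimes> a = y" using supp_subset_iff[OF y(1) a] 1 by simp
      then have "y \<otimes> (a \<otimes> b) = y \<otimes> b" using y a b by (simp add: m_assoc[symmetric])
      moreover have "?S (a \<otimes> b)" using 1 y mU[OF a b] mW[OF a b] by blast
      ultimately have "\<delta> (a \<otimes> b) = \<delta> b" using 1 by (simp add: \<delta>_def)
      moreover have "\<delta> a = \<zero>\<^bsub>K\<^esub>" using 1 by (simp add: \<delta>_def)
      ultimately show ?thesis using 1 dc[OF b] by (simp add: chi_def)
    next
      case 2
      then have "\<delta> (a \<otimes> b) = \<zero>\<^bsub>K\<^esub>" "\<delta> a = \<zero>\<^bsub>K\<^esub>" "\<delta> b = \<zero>\<^bsub>K\<^esub>"
        using mU[OF a b] mW[OF a b] by (auto simp: \<delta>_def)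
      then show ?thesis by simp
    next
      case 3
      have S: "?S (a \<otimes> b)" using 3 mU[OF a b] mW[OF a b] by blast
      have ca: "ch (y \<otimes> a) \<in> children B y" "R_le B (y \<otimes> a) (ch (y \<otimes> a))" using chC[OF a 3(1)] by auto
      have "R_le B (y \<otimes> (a \<otimes> b)) (y \<otimes> a)" using R_le_mult[of "y \<otimes> a" b] y a b by (simp add: m_assoc)
      then have "R_le B (y \<otimes> (a \<otimes> b)) (ch (y \<otimes> a))"
        using R_le_trans[OF _ _ childrenD(1)[OF ca(1)] _ ca(2)] y a b by simp
      then have "ch (y \<otimes> (a \<otimes> b)) = ch (y \<otimes> a)" using ch_eq[OF _ ca(1)] y a b by simp
      then have "\<delta> (a \<otimes> b) = \<delta> a" using S 3 by (simp add: \<delta>_def)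
      then show ?thesis using 3 dc[OF a] dc[OF b] by (simp add: chi_def)
    next
      case 4
      then have ab: "\<delta> (a \<otimes> b) = \<zero>\<^bsub>K\<^esub>" using mU[OF a b] by (auto simp: \<delta>_def)
      have "\<delta> a \<otimes>\<^bsub>K\<^esub> chi U b = \<zero>\<^bsub>K\<^esub>" using 4 dc[OF a] by (cases "?S a") (auto simp: \<delta>_def chi_def)
      then show ?thesis using 4 ab dc[OF b] by (simp add: chi_def)
    qed
  qed
  then have "derivation U ?W \<delta>" using dc by (simp add: derivation_def)
  moreover have "\<delta> z = f z" if z: "z \<in> ?C" for z
  proof -
    have zB: "z \<in> carrier B" and zc: "z \<in> children B y" using z childrenD(1) by auto
    have "y \<otimes> z = z" using childrenD(2)[OF zc] by (simp add: R_less_def R_le_def)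
    then show ?thesis using z child_supp[OF y(1) zc] ch_eq[OF zB zc R_le_refl[OF zB]] by (simp add: \<delta>_def)
  qed
  ultimately show ?thesis by blast
qed

end

section \<open>The first extension groups\<close>

context lrb_algebra
begin

text \<open>The equation between extensional functions that defines cocycles is replaced by
  pointwise vanishing; for simple modules all values lie in \<open>K\<close>.\<close>

lemma left_module_hom_cocycles:
  fixes P :: "nat \<Rightarrow> ('b \<Rightarrow> 'k, 'p) module"
  assumes P: "\<And>n. left_module A (P n)" and d: "\<And>n. d n \<in> lmod_hom A (P (Suc n)) (P n)"
    and W: "W \<in> support_lattice B"
  shows "left_module K ((hom_space A (P n) (S W))\<lparr>carrier := cocycles A P d (S W) n\<rparr>)"
    and "f \<in> cocycles A P d (S W) n \<longleftrightarrow>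
      f \<in> lmod_hom A (P n) (S W) \<and> (\<forall>x\<in>carrier (P (Suc n)). f (d n x) = \<zero>\<^bsub>K\<^esub>)"
proof -
  let ?V = "(hom_space A (P n) (S W))\<lparr>carrier := cocycles A P d (S W) n\<rparr>"
  interpret P: monoid_algebra_module B K "P n" by (rule monoid_algebra_moduleI[OF P])
  interpret P': monoid_algebra_module B K "P (Suc n)" by (rule monoid_algebra_moduleI[OF P])
  note L = left_module_S[OF W]
  have iff: "f \<in> cocycles A P d (S W) n \<longleftrightarrow>
      f \<in> lmod_hom A (P n) (S W) \<and> (\<forall>x\<in>carrier (P (Suc n)). f (d n x) = \<zero>\<^bsub>K\<^esub>)" for f
    unfolding cocycles_def by (auto simp: hom_space_def compose_def S_simps fun_eq_iff)
  then show "f \<in> cocycles A P d (S W) n \<longleftrightarrow>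
      f \<in> lmod_hom A (P n) (S W) \<and> (\<forall>x\<in>carrier (P (Suc n)). f (d n x) = \<zero>\<^bsub>K\<^esub>)" .
  have s: "carrier ?V = cocycles A P d (S W) n" "\<zero>\<^bsub>?V\<^esub> = (\<lambda>x\<in>carrier (P n). \<zero>\<^bsub>K\<^esub>)"
    "f \<oplus>\<^bsub>?V\<^esub> g = (\<lambda>x\<in>carrier (P n). f x \<oplus>\<^bsub>K\<^esub> g x)"
    "c \<odot>\<^bsub>?V\<^esub> f = (\<lambda>x\<in>carrier (P n). kact (S W) c (f x))" for f g c
    by (simp_all add: hom_space_def S_simps kact_def)
  have fc: "f x \<in> carrier K" if "f \<in> cocycles A P d (S W) n" "x \<in> carrier (P n)" for f x
    using that lmod_homD(1)[of f A "P n" "S W" x] by (simp add: iff S_simps)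
  have fe: "f \<in> extensional (carrier (P n))" if "f \<in> cocycles A P d (S W) n" for f
    using that lmod_homD(4) by (auto simp: iff)
  have dc: "d n x \<in> carrier (P n)" if "x \<in> carrier (P (Suc n))" for x using lmod_homD(1)[OF d that] .
  have fl: "f \<in> lmod_hom A (P n) (S W)" if "f \<in> cocycles A P d (S W) n" for f using that iff by blast
  have fh1: "f (x \<oplus>\<^bsub>P n\<^esub> y) = f x \<oplus>\<^bsub>K\<^esub> f y"
    if "f \<in> cocycles A P d (S W) n" "x \<in> carrier (P n)" "y \<in> carrier (P n)" for f x y
    using lmod_homD(2)[OF fl[OF that(1)] that(2,3)] by (simp add: S_simps)
  have fh2: "f (kact (P n) c x) = c \<otimes>\<^bsub>K\<^esub> f x"
    if "f \<in> cocycles A P d (S W) n" "x \<in> carrier (P n)" "c \<in> carrier K" for f x c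
    using lmod_hom_actions(1)[OF P L fl[OF that(1)] that(2,3)] kact_S[OF W that(3) fc[OF that(1,2)]] by simp
  have fh3: "f (bact (P n) b x) = chi W b \<otimes>\<^bsub>K\<^esub> f x"
    if "f \<in> cocycles A P d (S W) n" "x \<in> carrier (P n)" "b \<in> carrier B" for f x b
    using lmod_hom_actions(2)[OF P L fl[OF that(1)] that(2)] bact_S[OF W that(3) fc[OF that(1,2)]] by simp
  note fh = fh1 fh2 fh3
  have I: "f \<in> cocycles A P d (S W) n"
    if "f \<in> extensional (carrier (P n))" "\<And>x. x \<in> carrier (P n) \<Longrightarrow> f x \<in> carrier K"
      "\<And>x y. x \<in> carrier (P n) \<Longrightarrow> y \<in> carrier (P n) \<Longrightarrow> f (x \<oplus>\<^bsub>P n\<^esub> y) = f x \<oplus>\<^bsub>K\<^esub> f y"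
      "\<And>c x. c \<in> carrier K \<Longrightarrow> x \<in> carrier (P n) \<Longrightarrow> f (kact (P n) c x) = c \<otimes>\<^bsub>K\<^esub> f x"
      "\<And>b x. b \<in> carrier B \<Longrightarrow> x \<in> carrier (P n) \<Longrightarrow> f (bact (P n) b x) = chi W b \<otimes>\<^bsub>K\<^esub> f x"
      "\<And>x. x \<in> carrier (P (Suc n)) \<Longrightarrow> f (d n x) = \<zero>\<^bsub>K\<^esub>" for f
    unfolding iff
    by (intro conjI ballI lmod_hom_actionsI[OF P L]) (use that in \<open>auto simp: S_simps kact_S[OF W] bact_S[OF W]\<close>)
  show "left_module K ?V"
  proof (rule left_moduleI, unfold s(1))
    show "ring K" by (rule K.ring_axioms)
    show "\<zero>\<^bsub>?V\<^esub> \<in> cocycles A P d (S W) n" unfolding s by (rule I) (auto simp: dc)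
    fix f g h assume f: "f \<in> cocycles A P d (S W) n" and g: "g \<in> cocycles A P d (S W) n" and h: "h \<in> cocycles A P d (S W) n"
    have fd: "f (d n x) = \<zero>\<^bsub>K\<^esub>" "g (d n x) = \<zero>\<^bsub>K\<^esub>" if "x \<in> carrier (P (Suc n))" for x
      using that f g by (simp_all add: iff)
    show "f \<oplus>\<^bsub>?V\<^esub> g \<in> cocycles A P d (S W) n" unfolding s
      by (rule I) (auto simp: fc[OF f] fc[OF g] fh[OF f] fh[OF g] fd dc K.a_ac K.r_distr K.zero_closed)
    show "f \<oplus>\<^bsub>?V\<^esub> g \<oplus>\<^bsub>?V\<^esub> h = f \<oplus>\<^bsub>?V\<^esub> (g \<oplus>\<^bsub>?V\<^esub> h)" unfolding s
      by (rule restrict_ext) (simp add: fc[OF f] fc[OF g] fc[OF h] K.a_assoc)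
    show "f \<oplus>\<^bsub>?V\<^esub> g = g \<oplus>\<^bsub>?V\<^esub> f" unfolding s
      by (rule restrict_ext) (simp add: fc[OF f] fc[OF g] K.a_comm)
  next
    fix f assume f: "f \<in> cocycles A P d (S W) n"
    have fd: "f (d n x) = \<zero>\<^bsub>K\<^esub>" if "x \<in> carrier (P (Suc n))" for x
      using that f by (simp add: iff)
    show "\<zero>\<^bsub>?V\<^esub> \<oplus>\<^bsub>?V\<^esub> f = f" unfolding s
      by (rule extensionalityI[OF _ fe[OF f]]) (auto simp: fc[OF f])
    show "\<one>\<^bsub>K\<^esub> \<odot>\<^bsub>?V\<^esub> f = f" unfolding s
      by (rule extensionalityI[OF _ fe[OF f]]) (auto simp: fc[OF f] kact_S[OF W])
    show "\<zero>\<^bsub>K\<^esub> \<odot>\<^bsub>?V\<^esub> f = \<zero>\<^bsub>?V\<^esub>" unfolding s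
      by (rule restrict_ext) (auto simp: fc[OF f] kact_S[OF W])
    fix c assume c: "c \<in> carrier K"
    show "c \<odot>\<^bsub>?V\<^esub> f \<in> cocycles A P d (S W) n" unfolding s
      by (rule I) (auto simp: c fc[OF f] fh[OF f] fd dc kact_S[OF W] K.r_distr K.m_lcomm)
    show "(c \<oplus>\<^bsub>K\<^esub> b) \<odot>\<^bsub>?V\<^esub> f = c \<odot>\<^bsub>?V\<^esub> f \<oplus>\<^bsub>?V\<^esub> b \<odot>\<^bsub>?V\<^esub> f" if "b \<in> carrier K" for b unfolding s
      by (rule restrict_ext) (simp add: that c fc[OF f] kact_S[OF W] K.l_distr)
    show "(c \<otimes>\<^bsub>K\<^esub> b) \<odot>\<^bsub>?V\<^esub> f = c \<odot>\<^bsub>?V\<^esub> (b \<odot>\<^bsub>?V\<^esub> f)" if "b \<in> carrier K" for b unfolding s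
      by (rule restrict_ext) (simp add: that c fc[OF f] kact_S[OF W] K.m_assoc)
    show "c \<odot>\<^bsub>?V\<^esub> (f \<oplus>\<^bsub>?V\<^esub> g) = c \<odot>\<^bsub>?V\<^esub> f \<oplus>\<^bsub>?V\<^esub> c \<odot>\<^bsub>?V\<^esub> g" if g: "g \<in> cocycles A P d (S W) n" for g unfolding s
      by (rule restrict_ext) (simp add: c fc[OF f] fc[OF g] kact_S[OF W] K.r_distr)
  qed
qed

text \<open>The module structure on \<open>K \<times> K\<close> that makes a derivation into an extension of \<open>S U\<close> by \<open>S W\<close>.\<close>

lemma derivation_extension:
  assumes U: "U \<in> support_lattice B" and W: "W \<in> support_lattice B" and \<delta>: "derivation U W \<delta>"
  obtains Y :: "('b \<Rightarrow> 'k, 'k \<times> 'k) module" where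
    "left_module A Y" "snd ` carrier Y = carrier (S U)" "restrict snd (carrier Y) \<in> lmod_hom A Y (S U)"
    "carrier Y = carrier K \<times> carrier K"
    "\<And>m n. m \<oplus>\<^bsub>Y\<^esub> n = (fst m \<oplus>\<^bsub>K\<^esub> fst n, snd m \<oplus>\<^bsub>K\<^esub> snd n)"
    "\<And>c m. c \<in> carrier K \<Longrightarrow> m \<in> carrier Y \<Longrightarrow> kact Y c m = (c \<otimes>\<^bsub>K\<^esub> fst m, c \<otimes>\<^bsub>K\<^esub> snd m)"
    "\<And>b m. b \<in> carrier B \<Longrightarrow> m \<in> carrier Y \<Longrightarrow>
      bact Y b m = (chi W b \<otimes>\<^bsub>K\<^esub> fst m \<oplus>\<^bsub>K\<^esub> \<delta> b \<otimes>\<^bsub>K\<^esub> snd m, chi U b \<otimes>\<^bsub>K\<^esub> snd m)"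
proof -
  define V :: "('k, 'k \<times> 'k) module" where
    "V = \<lparr>carrier = carrier K \<times> carrier K, monoid.mult = (\<lambda>_ _. (\<zero>\<^bsub>K\<^esub>, \<zero>\<^bsub>K\<^esub>)), one = (\<zero>\<^bsub>K\<^esub>, \<zero>\<^bsub>K\<^esub>),
      ring.zero = (\<zero>\<^bsub>K\<^esub>, \<zero>\<^bsub>K\<^esub>), add = (\<lambda>m n. (fst m \<oplus>\<^bsub>K\<^esub> fst n, snd m \<oplus>\<^bsub>K\<^esub> snd n)),
      smult = (\<lambda>c m. (c \<otimes>\<^bsub>K\<^esub> fst m, c \<otimes>\<^bsub>K\<^esub> snd m))\<rparr>"
  have V: "left_module K V"
    by (rule left_moduleI) (auto simp: V_def K.ring_axioms K.a_ac K.l_distr K.r_distr K.m_assoc)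
  let ?\<beta> = "\<lambda>b m. (chi W b \<otimes>\<^bsub>K\<^esub> fst m \<oplus>\<^bsub>K\<^esub> \<delta> b \<otimes>\<^bsub>K\<^esub> snd m, chi U b \<otimes>\<^bsub>K\<^esub> snd m)"
  note dc = derivation_closed[OF \<delta>]
  have d1: "\<delta> \<one> = \<zero>\<^bsub>K\<^esub>"
    by (rule derivation_zero[OF \<delta> one_closed]) (use chi_one[OF U] chi_one[OF W] in \<open>auto simp: chi_def split: if_splits\<close>)
  have dm: "\<delta> (a \<otimes> b) = chi W a \<otimes>\<^bsub>K\<^esub> \<delta> b \<oplus>\<^bsub>K\<^esub> \<delta> a \<otimes>\<^bsub>K\<^esub> chi U b" if "a \<in> carrier B" "b \<in> carrier B" for a b
    using \<delta> that by (simp add: derivation_def)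
  have b1: "?\<beta> b m \<in> carrier V" if "b \<in> carrier B" "m \<in> carrier V" for b m
    using that dc by (auto simp: V_def)
  have b2: "?\<beta> b (m \<oplus>\<^bsub>V\<^esub> n) = ?\<beta> b m \<oplus>\<^bsub>V\<^esub> ?\<beta> b n" if "b \<in> carrier B" "m \<in> carrier V" "n \<in> carrier V" for b m n
    using that dc by (auto simp: V_def K.r_distr K.a_ac)
  have b3: "?\<beta> b (c \<odot>\<^bsub>V\<^esub> m) = c \<odot>\<^bsub>V\<^esub> ?\<beta> b m" if "b \<in> carrier B" "c \<in> carrier K" "m \<in> carrier V" for b c m
    using that dc by (auto simp: V_def K.r_distr K.m_ac)
  have b4: "?\<beta> (a \<otimes> b) m = ?\<beta> a (?\<beta> b m)" if "a \<in> carrier B" "b \<in> carrier B" "m \<in> carrier V" for a b m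
    using that dc by (auto simp: V_def dm chi_mult[OF U] chi_mult[OF W] K.r_distr K.l_distr K.m_ac K.a_ac)
  have b5: "?\<beta> \<one> m = m" if "m \<in> carrier V" for m
    using that by (auto simp: V_def d1 chi_one[OF U] chi_one[OF W])
  define Y where "Y = rep_module V ?\<beta>"
  note R = rep_module[OF V b1 b2 b3 b4 b5, folded Y_def]
  have Y: "left_module A Y" by (rule R(1)) assumption+
  have c: "carrier Y = carrier K \<times> carrier K" "m \<oplus>\<^bsub>Y\<^esub> n = (fst m \<oplus>\<^bsub>K\<^esub> fst n, snd m \<oplus>\<^bsub>K\<^esub> snd n)" for m n
    by (simp_all add: Y_def rep_module_simps V_def)
  have cV: "carrier Y = carrier V" by (simp add: c V_def)
  have k: "kact Y c m = (c \<otimes>\<^bsub>K\<^esub> fst m, c \<otimes>\<^bsub>K\<^esub> snd m)" if "c \<in> carrier K" "m \<in> carrier Y" for c m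
  proof -
    have "kact Y c m = c \<odot>\<^bsub>V\<^esub> m" by (rule R(3)) (use that cV in auto)
    then show ?thesis by (simp add: V_def)
  qed
  have b: "bact Y b m = ?\<beta> b m" if "b \<in> carrier B" "m \<in> carrier Y" for b m
    by (rule R(2)) (use that cV in auto)
  have "restrict snd (carrier Y) \<in> lmod_hom A Y (S U)"
  proof (rule lmod_hom_actionsI[OF Y left_module_S[OF U]])
    interpret Y: monoid_algebra_module B K Y by (rule monoid_algebra_moduleI[OF Y])
    show "restrict snd (carrier Y) (kact Y k' x) = kact (S U) k' (restrict snd (carrier Y) x)"
      if "k' \<in> carrier K" "x \<in> carrier Y" for k' x
      using that k[OF that] Y.kact_closed[OF that] by (auto simp: c(1) kact_S[OF U])
    show "restrict snd (carrier Y) (bact Y b' x) = bact (S U) b' (restrict snd (carrier Y) x)"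
      if "b' \<in> carrier B" "x \<in> carrier Y" for b' x
      using that b[OF that] Y.bact_closed[OF that(2), of b'] by (auto simp: c(1) bact_S[OF U])
  qed (auto simp: c S_simps)
  moreover have "snd ` carrier Y = carrier (S U)" by (auto simp: c S_simps image_iff)
  ultimately show thesis using that[OF Y _ _ c(1) c(2) k b] by blast
qed

text \<open>A 1-cocycle \<open>f\<close> yields the derivation \<open>\<Delta> f b = f p\<close>, where \<open>d 0 p = b x - \<chi>\<^sub>U(b) x\<close> and \<open>e x = 1\<close>.  Coboundaries
  are the cocycles with inner \<open>\<Delta> f\<close>, and lifting \<open>e\<close> to the extension module of a derivation shows that every
  derivation is some \<open>\<Delta> f\<close> up to an inner one.  The differences \<open>\<Delta> f z - \<Delta> f z0\<close> are therefore coordinates on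
  the first cohomology.\<close>

lemma cohomology_dim:
  fixes P :: "nat \<Rightarrow> ('b \<Rightarrow> 'k, 'p) module"
  assumes U: "U \<in> support_lattice B" and W: "W \<in> support_lattice B"
    and res: "projective_resolution A (S U) P d e"
    and C: "finite C" "C \<subseteq> carrier B" "z0 \<in> carrier B"
    and chi_const: "\<And>z. z \<in> C \<Longrightarrow> chi W z \<ominus>\<^bsub>K\<^esub> chi U z = chi W z0 \<ominus>\<^bsub>K\<^esub> chi U z0"
    and inner: "\<And>\<delta>. derivation U W \<delta> \<Longrightarrow> (\<And>z. z \<in> C \<Longrightarrow> \<delta> z = \<delta> z0) \<Longrightarrow> inner_derivation U W \<delta>"
    and extends: "\<And>f. f \<in> C \<rightarrow> carrier K \<Longrightarrow> \<exists>\<delta>. derivation U W \<delta> \<and> (\<forall>z\<in>C. \<delta> z \<ominus>\<^bsub>K\<^esub> \<delta> z0 = f z)"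
  shows "vectorspace K (cohomology A P d (S W) 1) \<and> vectorspace.fin_dim K (cohomology A P d (S W) 1) \<and>
    vectorspace.dim K (cohomology A P d (S W) 1) = card C"
proof -
  have P: "left_module A (P n)" and d: "d n \<in> lmod_hom A (P (Suc n)) (P n)" for n
    using res by (auto simp: projective_resolution_def projective_module_def)
  have e: "e \<in> lmod_hom A (P 0) (S U)" and e_surj: "e ` carrier (P 0) = carrier K"
    and ex0: "d 0 ` carrier (P 1) = {x \<in> carrier (P 0). e x = \<zero>\<^bsub>K\<^esub>}"
    and ex1: "d 1 ` carrier (P 2) = {x \<in> carrier (P 1). d 0 x = \<zero>\<^bsub>P 0\<^esub>}"
    using res by (auto simp: projective_resolution_def S_simps numeral_2_eq_2)
  interpret P0: monoid_algebra_module B K "P 0" by (rule monoid_algebra_moduleI[OF P])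
  interpret P1: monoid_algebra_module B K "P 1" by (rule monoid_algebra_moduleI[OF P])
  note L = left_module_S[OF W] and LU = left_module_S[OF U]
  have d0: "d 0 \<in> lmod_hom A (P 1) (P 0)" using d[of 0] by simp
  note d0' = lmod_homD(1,2)[OF d0] lmod_hom_actions[OF P P d0] lmod_hom_zero[OF P P d0] lmod_hom_minus[OF P P d0]
  have e': "x \<in> carrier (P 0) \<Longrightarrow> e x \<in> carrier K"
    "x \<in> carrier (P 0) \<Longrightarrow> y \<in> carrier (P 0) \<Longrightarrow> e (x \<oplus>\<^bsub>P 0\<^esub> y) = e x \<oplus>\<^bsub>K\<^esub> e y"
    "c \<in> carrier K \<Longrightarrow> x \<in> carrier (P 0) \<Longrightarrow> e (kact (P 0) c x) = c \<otimes>\<^bsub>K\<^esub> e x"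
    "b \<in> carrier B \<Longrightarrow> x \<in> carrier (P 0) \<Longrightarrow> e (bact (P 0) b x) = chi U b \<otimes>\<^bsub>K\<^esub> e x" for x y c b
    using lmod_homD(1,2)[OF e] lmod_hom_actions[OF P LU e] by (auto simp: S_simps kact_S[OF U] bact_S[OF U])
  have e_diff: "e (x \<ominus>\<^bsub>P 0\<^esub> y) = e x \<ominus>\<^bsub>K\<^esub> e y" if x: "x \<in> carrier (P 0)" and y: "y \<in> carrier (P 0)" for x y
  proof -
    have D: "x \<ominus>\<^bsub>P 0\<^esub> y \<in> carrier (P 0)" using x y by (rule P0.M.M.minus_closed)
    have "(x \<ominus>\<^bsub>P 0\<^esub> y) \<oplus>\<^bsub>P 0\<^esub> y = x" using x y by (simp add: P0.M.M.minus_eq P0.M.M.a_assoc P0.M.M.l_neg)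
    then have "e x = e (x \<ominus>\<^bsub>P 0\<^esub> y) \<oplus>\<^bsub>K\<^esub> e y" using e'(2)[OF D y] by simp
    then show ?thesis using e'(1)[OF x] e'(1)[OF y] e'(1)[OF D] by (simp add: K.minus_eq K.a_assoc K.r_neg)
  qed
  let ?Z = "cocycles A P d (S W) 1"
  let ?V = "(hom_space A (P 1) (S W))\<lparr>carrier := ?Z\<rparr>"
  have LV: "left_module K ?V" by (rule left_module_hom_cocycles(1)[where P = P and d = d, OF P d W])
  have V_simps: "carrier ?V = ?Z" "f \<oplus>\<^bsub>?V\<^esub> g = (\<lambda>x\<in>carrier (P 1). f x \<oplus>\<^bsub>K\<^esub> g x)"
    "c \<odot>\<^bsub>?V\<^esub> f = (\<lambda>x\<in>carrier (P 1). kact (S W) c (f x))" for f g c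
    by (simp_all add: hom_space_def S_simps kact_def)
  have Z_iff: "f \<in> ?Z \<longleftrightarrow> f \<in> lmod_hom A (P 1) (S W) \<and> (\<forall>x\<in>carrier (P 2). f (d 1 x) = \<zero>\<^bsub>K\<^esub>)" for f
    using left_module_hom_cocycles(2)[where P = P and d = d and f = f and n = 1, OF P d W] by (simp add: numeral_2_eq_2)
  \<comment> \<open>Keeps \<open>P 1\<close> in this form, so that the facts collected above
    continue to match.\<close>
  note One_nat_def [simp del]
  have Z': "p \<in> carrier (P 1) \<Longrightarrow> f p \<in> carrier K"
    "p \<in> carrier (P 1) \<Longrightarrow> q \<in> carrier (P 1) \<Longrightarrow> f (p \<oplus>\<^bsub>P 1\<^esub> q) = f p \<oplus>\<^bsub>K\<^esub> f q"
    "c \<in> carrier K \<Longrightarrow> p \<in> carrier (P 1) \<Longrightarrow> f (kact (P 1) c p) = c \<otimes>\<^bsub>K\<^esub> f p"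
    "b \<in> carrier B \<Longrightarrow> p \<in> carrier (P 1) \<Longrightarrow> f (bact (P 1) b p) = chi W b \<otimes>\<^bsub>K\<^esub> f p"
    "p \<in> carrier (P 1) \<Longrightarrow> d 0 p = \<zero>\<^bsub>P 0\<^esub> \<Longrightarrow> f p = \<zero>\<^bsub>K\<^esub>" if f: "f \<in> ?Z" for f p q c b
  proof -
    have fl: "f \<in> lmod_hom A (P 1) (S W)" using f Z_iff by blast
    have cl: "f p \<in> carrier K" if "p \<in> carrier (P 1)" for p using lmod_homD(1)[OF fl that] by (simp add: S_simps)
    then show "p \<in> carrier (P 1) \<Longrightarrow> f p \<in> carrier K" .
    show "p \<in> carrier (P 1) \<Longrightarrow> q \<in> carrier (P 1) \<Longrightarrow> f (p \<oplus>\<^bsub>P 1\<^esub> q) = f p \<oplus>\<^bsub>K\<^esub> f q"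
      using lmod_homD(2)[OF fl] by (simp add: S_simps)
    show "c \<in> carrier K \<Longrightarrow> p \<in> carrier (P 1) \<Longrightarrow> f (kact (P 1) c p) = c \<otimes>\<^bsub>K\<^esub> f p"
      using lmod_hom_actions(1)[OF P L fl] kact_S[OF W] cl by simp
    show "b \<in> carrier B \<Longrightarrow> p \<in> carrier (P 1) \<Longrightarrow> f (bact (P 1) b p) = chi W b \<otimes>\<^bsub>K\<^esub> f p"
      using lmod_hom_actions(2)[OF P L fl] bact_S[OF W] cl by simp
    show "f p = \<zero>\<^bsub>K\<^esub>" if "p \<in> carrier (P 1)" "d 0 p = \<zero>\<^bsub>P 0\<^esub>"
    proof -
      have "p \<in> d 1 ` carrier (P 2)" unfolding ex1 using that by simp
      then show ?thesis using f Z_iff by auto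
    qed
  qed
  \<comment> \<open>A cocycle vanishes on the image of \<open>d 1\<close>, which is the kernel of
    \<open>d 0\<close>; so its value at \<open>p\<close> depends on \<open>d 0 p\<close> only. This
    makes \<open>\<Delta>\<close> independent of the preimages chosen by
    \<open>lift\<close>.\<close>
  have Z_eq: "f p = f q" if f: "f \<in> ?Z" and p: "p \<in> carrier (P 1)" and q: "q \<in> carrier (P 1)" and eq: "d 0 p = d 0 q" for f p q
  proof -
    have D: "p \<ominus>\<^bsub>P 1\<^esub> q \<in> carrier (P 1)" using p q by (rule P1.M.M.minus_closed)
    have "d 0 (p \<ominus>\<^bsub>P 1\<^esub> q) = \<zero>\<^bsub>P 0\<^esub>"
      using d0'(6)[OF p q] eq d0'(1)[OF q] by (simp add: P0.M.M.minus_eq P0.M.M.r_neg)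
    then have "f (p \<ominus>\<^bsub>P 1\<^esub> q) = \<zero>\<^bsub>K\<^esub>" using Z'(5)[OF f D] by simp
    moreover have "(p \<ominus>\<^bsub>P 1\<^esub> q) \<oplus>\<^bsub>P 1\<^esub> q = p" using p q by (simp add: P1.M.M.minus_eq P1.M.M.a_assoc P1.M.M.l_neg)
    ultimately show ?thesis using Z'(2)[OF f D q] Z'(1)[OF f q] by simp
  qed
  have ZI: "f \<in> ?Z" if f: "f \<in> lmod_hom A (P 1) (S W)"
    and z: "\<And>p. p \<in> carrier (P 1) \<Longrightarrow> d 0 p = \<zero>\<^bsub>P 0\<^esub> \<Longrightarrow> f p = \<zero>\<^bsub>K\<^esub>" for f
  proof -
    have "f (d 1 x) = \<zero>\<^bsub>K\<^esub>" if "x \<in> carrier (P 2)" for x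
    proof -
      have "d 1 x \<in> {x \<in> carrier (P 1). d 0 x = \<zero>\<^bsub>P 0\<^esub>}" unfolding ex1[symmetric] using that by blast
      then show ?thesis using z by simp
    qed
    then show ?thesis using f Z_iff by blast
  qed
  obtain x where x: "x \<in> carrier (P 0)" "e x = \<one>\<^bsub>K\<^esub>"
    using e_surj K.one_closed by (metis imageE)
  \<comment> \<open>The defect of \<open>x\<close> from spanning a copy of \<open>S U\<close> in
    \<open>P 0\<close>. It is killed by \<open>e\<close>, hence lies in the image of
    \<open>d 0\<close>.\<close>
  define r where "r b = bact (P 0) b x \<ominus>\<^bsub>P 0\<^esub> kact (P 0) (chi U b) x" for b
  have r: "r b \<in> carrier (P 0)" for b unfolding r_def using x by (intro P0.M.M.minus_closed) auto
  have er: "e (r b) = \<zero>\<^bsub>K\<^esub>" if "b \<in> carrier B" for b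
    unfolding r_def using x that by (simp add: e_diff e' K.minus_eq K.r_neg)
  define lift where "lift y = (SOME p. p \<in> carrier (P 1) \<and> d 0 p = y)" for y
  have lift: "lift y \<in> carrier (P 1)" "d 0 (lift y) = y" if "y \<in> carrier (P 0)" "e y = \<zero>\<^bsub>K\<^esub>" for y
  proof -
    have "y \<in> d 0 ` carrier (P 1)" unfolding ex0 using that by simp
    then have "\<exists>p. p \<in> carrier (P 1) \<and> d 0 p = y" by blast
    from someI_ex[OF this] show "lift y \<in> carrier (P 1)" "d 0 (lift y) = y" unfolding lift_def by auto
  qed
  define \<Delta> where "\<Delta> f b = f (lift (r b))" for f :: "'p \<Rightarrow> 'k" and b
  have lr: "lift (r b) \<in> carrier (P 1)" "d 0 (lift (r b)) = r b" if "b \<in> carrier B" for b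
    using lift[OF r er[OF that]] .
  have \<Delta>c: "\<Delta> f b \<in> carrier K" if "f \<in> ?Z" "b \<in> carrier B" for f b
    unfolding \<Delta>_def using Z'(1)[OF that(1) lr(1)[OF that(2)]] .
  \<comment> \<open>The product rule already holds in \<open>P 0\<close>; a cocycle turns it into
    the product rule for \<open>\<Delta> f\<close>.\<close>
  have r_mult: "r (a \<otimes> b) = bact (P 0) a (r b) \<oplus>\<^bsub>P 0\<^esub> kact (P 0) (chi U b) (r a)"
    if a: "a \<in> carrier B" and b: "b \<in> carrier B" for a b
  proof -
    let ?u = "kact (P 0) (chi U b) (bact (P 0) a x)"
    have c: "bact (P 0) (a \<otimes> b) x \<in> carrier (P 0)" "?u \<in> carrier (P 0)"
      "kact (P 0) (chi U (a \<otimes> b)) x \<in> carrier (P 0)" using x by auto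
    have 1: "bact (P 0) a (r b) = bact (P 0) (a \<otimes> b) x \<ominus>\<^bsub>P 0\<^esub> ?u"
      unfolding r_def using x a b by (simp add: P0.bact_diff P0.bact_mult P0.bact_kact)
    have "kact (P 0) (chi U b) (kact (P 0) (chi U a) x) = kact (P 0) (chi U (a \<otimes> b)) x"
      using x by (simp add: P0.kact_assoc[symmetric] chi_mult[OF U a b] K.m_comm)
    then have 2: "kact (P 0) (chi U b) (r a) = ?u \<ominus>\<^bsub>P 0\<^esub> kact (P 0) (chi U (a \<otimes> b)) x"
      unfolding r_def using x by (simp add: P0.kact_diff_r)
    have "(bact (P 0) (a \<otimes> b) x \<ominus>\<^bsub>P 0\<^esub> ?u) \<oplus>\<^bsub>P 0\<^esub> (?u \<ominus>\<^bsub>P 0\<^esub> kact (P 0) (chi U (a \<otimes> b)) x) = r (a \<otimes> b)"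
    proof -
      have "\<ominus>\<^bsub>P 0\<^esub> ?u \<oplus>\<^bsub>P 0\<^esub> (?u \<oplus>\<^bsub>P 0\<^esub> (\<ominus>\<^bsub>P 0\<^esub> kact (P 0) (chi U (a \<otimes> b)) x)) = \<ominus>\<^bsub>P 0\<^esub> kact (P 0) (chi U (a \<otimes> b)) x"
        using c by (simp add: P0.M.M.a_assoc[symmetric] P0.M.M.l_neg)
      then show ?thesis using c by (simp add: r_def P0.M.M.minus_eq P0.M.M.a_assoc)
    qed
    then show ?thesis unfolding 1 2 by simp
  qed
  have \<Delta>_der: "derivation U W (\<Delta> f)" if f: "f \<in> ?Z" for f
    unfolding derivation_def
  proof (intro conjI ballI \<Delta>c[OF f])
    fix a b assume a: "a \<in> carrier B" and b: "b \<in> carrier B"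
    let ?p = "bact (P 1) a (lift (r b)) \<oplus>\<^bsub>P 1\<^esub> kact (P 1) (chi U b) (lift (r a))"
    have ab: "a \<otimes> b \<in> carrier B" using a b by simp
    have pc: "bact (P 1) a (lift (r b)) \<in> carrier (P 1)" "kact (P 1) (chi U b) (lift (r a)) \<in> carrier (P 1)"
      using lr[OF a] lr[OF b] by auto
    have "d 0 ?p = bact (P 0) a (r b) \<oplus>\<^bsub>P 0\<^esub> kact (P 0) (chi U b) (r a)"
      using d0'(2)[OF pc] d0'(4)[OF lr(1)[OF b], of a] d0'(3)[OF lr(1)[OF a], of "chi U b"] lr(2)[OF a] lr(2)[OF b] by simp
    then have "d 0 (lift (r (a \<otimes> b))) = d 0 ?p" using lr(2)[OF ab] r_mult[OF a b] by simp
    then have "\<Delta> f (a \<otimes> b) = f ?p" unfolding \<Delta>_def using lr(1)[OF ab] pc by (intro Z_eq[OF f]) auto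
    also have "\<dots> = chi W a \<otimes>\<^bsub>K\<^esub> \<Delta> f b \<oplus>\<^bsub>K\<^esub> chi U b \<otimes>\<^bsub>K\<^esub> \<Delta> f a"
      using Z'(2)[OF f pc] Z'(4)[OF f a lr(1)[OF b]] Z'(3)[OF f _ lr(1)[OF a], of "chi U b"] by (simp add: \<Delta>_def)
    finally show "\<Delta> f (a \<otimes> b) = chi W a \<otimes>\<^bsub>K\<^esub> \<Delta> f b \<oplus>\<^bsub>K\<^esub> \<Delta> f a \<otimes>\<^bsub>K\<^esub> chi U b"
      using \<Delta>c[OF f a] by (simp add: K.m_comm)
  qed
  let ?F = "free_module K C"
  \<comment> \<open>Inner derivations are multiples of \<open>chi W - chi U\<close>, which takes the
    same value on \<open>C\<close> and at \<open>z0\<close>. Subtracting the value at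
    \<open>z0\<close> removes them.\<close>
  define T where "T = (\<lambda>f\<in>?Z. \<lambda>z\<in>C. \<Delta> f z \<ominus>\<^bsub>K\<^esub> \<Delta> f z0)"
  have Cb: "z \<in> C \<Longrightarrow> z \<in> carrier B" for z using C by blast
  have T: "T \<in> lmod_hom K ?V ?F"
  proof (rule lmod_homI)
    show "T f \<in> carrier ?F" if "f \<in> carrier ?V" for f
      using that \<Delta>c[of f] C by (auto simp: V_simps T_def free_module_simps)
    show "T (f \<oplus>\<^bsub>?V\<^esub> g) = T f \<oplus>\<^bsub>?F\<^esub> T g" if f: "f \<in> carrier ?V" and g: "g \<in> carrier ?V" for f g
    proof -
      have fz: "f \<in> ?Z" "g \<in> ?Z" "f \<oplus>\<^bsub>?V\<^esub> g \<in> ?Z"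
        using f g left_module.axioms(2)[OF LV] abelian_monoid.a_closed[of ?V f g]
        by (auto simp: V_simps(1) abelian_group_def)
      have "\<Delta> (f \<oplus>\<^bsub>?V\<^esub> g) b = \<Delta> f b \<oplus>\<^bsub>K\<^esub> \<Delta> g b" if "b \<in> carrier B" for b
        unfolding \<Delta>_def V_simps(2) using lr(1)[OF that] by simp
      then show ?thesis using fz \<Delta>c[OF fz(1)] \<Delta>c[OF fz(2)] C(3) Cb unfolding T_def free_module_simps
        by (auto simp: K.minus_eq K.minus_add K.a_ac intro!: restrict_ext)
    qed
    show "T (c \<odot>\<^bsub>?V\<^esub> f) = c \<odot>\<^bsub>?F\<^esub> T f" if c: "c \<in> carrier K" and f: "f \<in> carrier ?V" for c f
    proof -
      have fz: "f \<in> ?Z" "c \<odot>\<^bsub>?V\<^esub> f \<in> ?Z"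
        using f left_module.lm_smult_closed[OF LV c f] by (auto simp: V_simps(1))
      have "\<Delta> (c \<odot>\<^bsub>?V\<^esub> f) b = c \<otimes>\<^bsub>K\<^esub> \<Delta> f b" if "b \<in> carrier B" for b
        unfolding \<Delta>_def V_simps(3) using lr(1)[OF that] kact_S[OF W c] Z'(1)[OF fz(1)] by simp
      then show ?thesis using c fz \<Delta>c[OF fz(1)] C(3) Cb unfolding T_def free_module_simps
        by (auto simp: K.minus_eq K.r_distr K.r_minus intro!: restrict_ext)
    qed
    show "T \<in> extensional (carrier ?V)" by (simp add: T_def V_simps)
  qed
  have surj: "T ` carrier ?V = carrier ?F"
  proof
    show "T ` carrier ?V \<subseteq> carrier ?F" using lmod_homD(1)[OF T] by blast
    show "carrier ?F \<subseteq> T ` carrier ?V"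
    proof
      fix \<phi> assume \<phi>: "\<phi> \<in> carrier ?F"
      then have "\<phi> \<in> C \<rightarrow> carrier K" by (auto simp: free_module_simps)
      from extends[OF this] obtain \<delta> where \<delta>: "derivation U W \<delta>" "\<forall>z\<in>C. \<delta> z \<ominus>\<^bsub>K\<^esub> \<delta> z0 = \<phi> z" by blast
      note dc = derivation_closed[OF \<delta>(1)]
      obtain Y :: "('b \<Rightarrow> 'k, 'k \<times> 'k) module" where Y: "left_module A Y" "snd ` carrier Y = carrier (S U)"
        "restrict snd (carrier Y) \<in> lmod_hom A Y (S U)" "carrier Y = carrier K \<times> carrier K"
        and Xa: "\<And>m n. m \<oplus>\<^bsub>Y\<^esub> n = (fst m \<oplus>\<^bsub>K\<^esub> fst n, snd m \<oplus>\<^bsub>K\<^esub> snd n)"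
        and Xk: "\<And>c m. c \<in> carrier K \<Longrightarrow> m \<in> carrier Y \<Longrightarrow> kact Y c m = (c \<otimes>\<^bsub>K\<^esub> fst m, c \<otimes>\<^bsub>K\<^esub> snd m)"
        and Xb: "\<And>b m. b \<in> carrier B \<Longrightarrow> m \<in> carrier Y \<Longrightarrow>
          bact Y b m = (chi W b \<otimes>\<^bsub>K\<^esub> fst m \<oplus>\<^bsub>K\<^esub> \<delta> b \<otimes>\<^bsub>K\<^esub> snd m, chi U b \<otimes>\<^bsub>K\<^esub> snd m)"
        by (rule derivation_extension[OF U W \<delta>(1)], erule (3) that) simp_all
      have pP0: "projective_module A (P 0)" using res by (simp add: projective_resolution_def)
      have sX: "restrict snd (carrier Y) ` carrier Y = carrier (S U)" using Y(2) by (simp add: image_def)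
      obtain h where h: "h \<in> lmod_hom A (P 0) Y"
        and he: "\<And>q. q \<in> carrier (P 0) \<Longrightarrow> restrict snd (carrier Y) (h q) = e q"
        by (rule projective_module_lifting[OF pP0 Y(1) LU Y(3) sX e], erule that, drule meta_spec, drule (1) meta_mp)
      have hc: "h q \<in> carrier Y" if "q \<in> carrier (P 0)" for q by (rule lmod_homD(1)[OF h that])
      \<comment> \<open>The second component of the lift is \<open>e\<close>. The first is linear
        but commutes with the monoid only up to \<open>\<delta> b (e q)\<close>; on the kernel of
        \<open>e\<close>, and hence after \<open>d 0\<close>, it is a homomorphism into
        \<open>S W\<close>.\<close>
      define h1 where "h1 q = fst (h q)" for q
      have h1c: "h1 q \<in> carrier K" if "q \<in> carrier (P 0)" for q
        unfolding h1_def by (rule mem_Times_iff[THEN iffD1, THEN conjunct1]) (use hc[OF that] in \<open>simp only: Y(4)\<close>)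
      have h2: "snd (h q) = e q" if "q \<in> carrier (P 0)" for q using he[OF that] hc[OF that] by simp
      have h1a: "h1 (q \<oplus>\<^bsub>P 0\<^esub> q') = h1 q \<oplus>\<^bsub>K\<^esub> h1 q'" if "q \<in> carrier (P 0)" "q' \<in> carrier (P 0)" for q q'
        using lmod_homD(2)[OF h that] Xa by (simp add: h1_def)
      have h1k: "h1 (kact (P 0) c q) = c \<otimes>\<^bsub>K\<^esub> h1 q" if "c \<in> carrier K" "q \<in> carrier (P 0)" for c q
        using lmod_hom_actions(1)[OF P Y(1) h that(2,1)] Xk[OF that(1) hc[OF that(2)]] by (simp add: h1_def)
      have h1b: "h1 (bact (P 0) b q) = chi W b \<otimes>\<^bsub>K\<^esub> h1 q \<oplus>\<^bsub>K\<^esub> \<delta> b \<otimes>\<^bsub>K\<^esub> e q" if "b \<in> carrier B" "q \<in> carrier (P 0)" for b q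
        using lmod_hom_actions(2)[OF P Y(1) h that(2)] Xb[OF that(1) hc[OF that(2)]] h2[OF that(2)] by (simp add: h1_def)
      have h10: "h1 \<zero>\<^bsub>P 0\<^esub> = \<zero>\<^bsub>K\<^esub>"
        using h1a[of "\<zero>\<^bsub>P 0\<^esub>" "\<zero>\<^bsub>P 0\<^esub>"] h1c[of "\<zero>\<^bsub>P 0\<^esub>"] by simp
      define f where "f = (\<lambda>p\<in>carrier (P 1). h1 (d 0 p))"
      have ed0: "e (d 0 p) = \<zero>\<^bsub>K\<^esub>" if "p \<in> carrier (P 1)" for p
      proof -
        have "d 0 p \<in> {x \<in> carrier (P 0). e x = \<zero>\<^bsub>K\<^esub>}" unfolding ex0[symmetric] using that by blast
        then show ?thesis by simp
      qed
      have "f \<in> lmod_hom A (P 1) (S W)"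
      proof (rule lmod_hom_actionsI[OF P L])
        show "f (bact (P 1) b p) = bact (S W) b (f p)" if b: "b \<in> carrier B" and p: "p \<in> carrier (P 1)" for b p
        proof -
          have "f (bact (P 1) b p) = h1 (bact (P 0) b (d 0 p))" using p d0'(4)[OF p, of b] by (simp add: f_def)
          also have "\<dots> = chi W b \<otimes>\<^bsub>K\<^esub> h1 (d 0 p)"
            using h1b[OF b d0'(1)[OF p]] ed0[OF p] dc[OF b] h1c[OF d0'(1)[OF p]] by simp
          also have "\<dots> = bact (S W) b (f p)" using p bact_S[OF W b h1c[OF d0'(1)[OF p]]] by (simp add: f_def)
          finally show ?thesis .
        qed
        show "f (kact (P 1) c p) = kact (S W) c (f p)" if c: "c \<in> carrier K" and p: "p \<in> carrier (P 1)" for c p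
          using p c d0'(3)[OF p c] h1k[OF c d0'(1)[OF p]] kact_S[OF W c h1c[OF d0'(1)[OF p]]] by (simp add: f_def)
        show "f (p \<oplus>\<^bsub>P 1\<^esub> q) = f p \<oplus>\<^bsub>S W\<^esub> f q" if p: "p \<in> carrier (P 1)" and q: "q \<in> carrier (P 1)" for p q
          using p q d0'(2)[OF p q] h1a[OF d0'(1)[OF p] d0'(1)[OF q]] by (simp add: f_def S_simps)
      qed (use h1c d0'(1) in \<open>auto simp: f_def S_simps\<close>)
      then have fZ: "f \<in> ?Z" by (rule ZI) (use h10 in \<open>simp add: f_def\<close>)
      \<comment> \<open>The lift sends \<open>x\<close> to \<open>(h1 x, 1)\<close> and not to
        \<open>(0, 1)\<close>; this accounts for the inner term, which \<open>T\<close> does not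
        see.\<close>
      have \<Delta>f: "\<Delta> f b = \<delta> b \<oplus>\<^bsub>K\<^esub> (chi W b \<ominus>\<^bsub>K\<^esub> chi U b) \<otimes>\<^bsub>K\<^esub> h1 x" if b: "b \<in> carrier B" for b
      proof -
        have h1x: "h1 x \<in> carrier K" by (rule h1c[OF x(1)])
        have kx: "kact (P 0) (chi U b) x \<in> carrier (P 0)" using x by simp
        have "(r b) \<oplus>\<^bsub>P 0\<^esub> kact (P 0) (chi U b) x = bact (P 0) b x"
          unfolding r_def using x by (simp add: P0.M.M.minus_eq P0.M.M.a_assoc P0.M.M.l_neg)
        then have "h1 (r b) \<oplus>\<^bsub>K\<^esub> chi U b \<otimes>\<^bsub>K\<^esub> h1 x = chi W b \<otimes>\<^bsub>K\<^esub> h1 x \<oplus>\<^bsub>K\<^esub> \<delta> b"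
          using h1a[OF r[of b] kx] h1k[OF chi_closed x(1), of U b] h1b[OF b x(1)] x(2) dc[OF b] by simp
        then have "h1 (r b) = (chi W b \<otimes>\<^bsub>K\<^esub> h1 x \<oplus>\<^bsub>K\<^esub> \<delta> b) \<ominus>\<^bsub>K\<^esub> chi U b \<otimes>\<^bsub>K\<^esub> h1 x"
          using h1c[OF r[of b]] h1x by (metis K.a_closed K.add.inv_solve_right' K.m_closed K.minus_eq chi_closed dc[OF b])
        then have "h1 (r b) = \<delta> b \<oplus>\<^bsub>K\<^esub> (chi W b \<ominus>\<^bsub>K\<^esub> chi U b) \<otimes>\<^bsub>K\<^esub> h1 x"
          using h1x dc[OF b] by (simp add: K.minus_eq K.l_distr K.l_minus K.a_ac)
        then show ?thesis using lr[OF b] by (simp add: \<Delta>_def f_def)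
      qed
      have "T f z = \<phi> z" if z: "z \<in> C" for z
      proof -
        let ?k = "(chi W z0 \<ominus>\<^bsub>K\<^esub> chi U z0) \<otimes>\<^bsub>K\<^esub> h1 x"
        have k: "?k \<in> carrier K" using h1c[OF x(1)] by simp
        have "\<Delta> f z \<ominus>\<^bsub>K\<^esub> \<Delta> f z0 = (\<delta> z \<oplus>\<^bsub>K\<^esub> ?k) \<ominus>\<^bsub>K\<^esub> (\<delta> z0 \<oplus>\<^bsub>K\<^esub> ?k)"
          using \<Delta>f[OF Cb[OF z]] \<Delta>f[OF C(3)] chi_const[OF z] by simp
        also have "\<dots> = (\<delta> z \<oplus>\<^bsub>K\<^esub> \<ominus>\<^bsub>K\<^esub> \<delta> z0) \<oplus>\<^bsub>K\<^esub> (?k \<oplus>\<^bsub>K\<^esub> \<ominus>\<^bsub>K\<^esub> ?k)"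
          using k dc[OF Cb[OF z]] dc[OF C(3)] by (simp add: K.minus_eq K.minus_add K.a_ac del: K.r_neg)
        also have "\<dots> = \<delta> z \<ominus>\<^bsub>K\<^esub> \<delta> z0" using k dc[OF Cb[OF z]] dc[OF C(3)] by (simp add: K.minus_eq K.r_neg)
        finally show ?thesis using \<delta>(2) z fZ by (simp add: T_def)
      qed
      moreover have "T f \<in> extensional C" "\<phi> \<in> extensional C" using fZ \<phi> by (auto simp: T_def free_module_simps PiE_iff)
      ultimately have "T f = \<phi>" by (intro extensionalityI[of _ C]) auto
      then show "\<phi> \<in> T ` carrier ?V" using fZ unfolding V_simps(1) by blast
    qed
  qed
  have T_zero: "T f = \<zero>\<^bsub>?F\<^esub> \<longleftrightarrow> (\<forall>z\<in>C. \<Delta> f z = \<Delta> f z0)" if f: "f \<in> ?Z" for f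
  proof -
    have "T f = \<zero>\<^bsub>?F\<^esub> \<longleftrightarrow> (\<forall>z\<in>C. \<Delta> f z \<ominus>\<^bsub>K\<^esub> \<Delta> f z0 = \<zero>\<^bsub>K\<^esub>)"
      using f by (auto simp: T_def free_module_simps fun_eq_iff)
    also have "\<dots> \<longleftrightarrow> (\<forall>z\<in>C. \<Delta> f z = \<Delta> f z0)"
      using \<Delta>c[OF f Cb] \<Delta>c[OF f C(3)] K.diff_zero_imp_eq by (auto simp: K.minus_eq K.r_neg)
    finally show ?thesis .
  qed
  have cob: "coboundaries A P d (S W) 1 = {f \<in> carrier ?V. T f = \<zero>\<^bsub>?F\<^esub>}"
  proof (rule Set.equalityI; rule subsetI)
    fix f assume "f \<in> coboundaries A P d (S W) 1"
    then have "f \<in> (\<lambda>g. compose (carrier (P 1)) g (d 0)) ` lmod_hom A (P 0) (S W)" by (simp add: One_nat_def)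
    then obtain g where g: "g \<in> lmod_hom A (P 0) (S W)" and f: "f = compose (carrier (P 1)) g (d 0)" by blast
    have g0: "g \<zero>\<^bsub>P 0\<^esub> = \<zero>\<^bsub>K\<^esub>" using lmod_hom_zero[OF P L g] by (simp add: S_simps)
    have fl: "f \<in> lmod_hom A (P 1) (S W)" unfolding f by (rule lmod_hom_compose[OF P d0 g])
    then have fZ: "f \<in> ?Z" by (rule ZI) (use g0 in \<open>simp add: f compose_def\<close>)
    have gx: "g x \<in> carrier K" using lmod_homD(1)[OF g x(1)] by (simp add: S_simps)
    have "\<Delta> f b = (chi W b \<ominus>\<^bsub>K\<^esub> chi U b) \<otimes>\<^bsub>K\<^esub> g x" if b: "b \<in> carrier B" for b
    proof -
      have kx: "kact (P 0) (chi U b) x \<in> carrier (P 0)" using x by simp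
      have gr: "g (r b) \<in> carrier K" using lmod_homD(1)[OF g r] by (simp add: S_simps)
      have "(r b) \<oplus>\<^bsub>P 0\<^esub> kact (P 0) (chi U b) x = bact (P 0) b x"
        unfolding r_def using x by (simp add: P0.M.M.minus_eq P0.M.M.a_assoc P0.M.M.l_neg)
      then have "g (r b) \<oplus>\<^bsub>K\<^esub> chi U b \<otimes>\<^bsub>K\<^esub> g x = chi W b \<otimes>\<^bsub>K\<^esub> g x"
        using lmod_homD(2)[OF g r[of b] kx] lmod_hom_actions[OF P L g x(1)] kact_S[OF W chi_closed gx, of U b] bact_S[OF W b gx]
        by (simp add: S_simps)
      then have "g (r b) = chi W b \<otimes>\<^bsub>K\<^esub> g x \<ominus>\<^bsub>K\<^esub> chi U b \<otimes>\<^bsub>K\<^esub> g x"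
        using gr gx by (metis K.add.inv_solve_right' K.m_closed K.minus_eq chi_closed)
      then show ?thesis using lr[OF b] gx by (simp add: \<Delta>_def f compose_def K.minus_eq K.l_distr K.l_minus)
    qed
    then have "T f = \<zero>\<^bsub>?F\<^esub>" unfolding T_zero[OF fZ] using chi_const Cb C(3) by simp
    then show "f \<in> {f \<in> carrier ?V. T f = \<zero>\<^bsub>?F\<^esub>}" using fZ by (simp add: V_simps)
  next
    fix f assume "f \<in> {f \<in> carrier ?V. T f = \<zero>\<^bsub>?F\<^esub>}"
    then have fZ: "f \<in> ?Z" and Tf: "\<And>z. z \<in> C \<Longrightarrow> \<Delta> f z = \<Delta> f z0" using T_zero by (auto simp: V_simps)
    obtain l where l: "l \<in> carrier K" and \<Delta>f: "\<And>b. b \<in> carrier B \<Longrightarrow> \<Delta> f b = (chi W b \<ominus>\<^bsub>K\<^esub> chi U b) \<otimes>\<^bsub>K\<^esub> l"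
      using inner[OF \<Delta>_der[OF fZ] Tf] by (auto simp: inner_derivation_def)
    \<comment> \<open>As a vector space \<open>P 0\<close> is the direct sum of the kernel of
      \<open>e\<close> and the line through \<open>x\<close>; this is the projection to the
      kernel.\<close>
    define y where "y q = q \<ominus>\<^bsub>P 0\<^esub> kact (P 0) (e q) x" for q
    have y: "y q \<in> carrier (P 0)" "e (y q) = \<zero>\<^bsub>K\<^esub>" if "q \<in> carrier (P 0)" for q
      unfolding y_def using that x e'(1)[OF that] by (auto simp: e_diff e' K.minus_eq K.r_neg P0.M.M.minus_closed)
    have ly: "lift (y q) \<in> carrier (P 1)" "d 0 (lift (y q)) = y q" if "q \<in> carrier (P 0)" for q
      using lift[OF y[OF that]] .
    have qy: "y q \<oplus>\<^bsub>P 0\<^esub> kact (P 0) (e q) x = q" if "q \<in> carrier (P 0)" for q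
      unfolding y_def using that x e'(1)[OF that] by (simp add: P0.M.M.minus_eq P0.M.M.a_assoc P0.M.M.l_neg)
    have y_eqI: "y q = w" if "q \<in> carrier (P 0)" "w \<in> carrier (P 0)" "w \<oplus>\<^bsub>P 0\<^esub> kact (P 0) (e q) x = q" for q w
    proof -
      have kx: "kact (P 0) (e q) x \<in> carrier (P 0)" using that x e'(1) by simp
      then show ?thesis using that(3) qy[OF that(1)] P0.M.M.add.right_cancel[OF kx y(1)[OF that(1)] that(2)] by simp
    qed
    \<comment> \<open>On the kernel of \<open>e\<close> the map is \<open>f\<close> of a preimage
      under \<open>d 0\<close>, and at \<open>x\<close> it has the value \<open>l\<close>. It
      commutes with the monoid at \<open>x\<close> exactly because \<open>\<Delta> f\<close> is
      inner with scalar \<open>l\<close>.\<close>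
    define g where "g = (\<lambda>q\<in>carrier (P 0). f (lift (y q)) \<oplus>\<^bsub>K\<^esub> e q \<otimes>\<^bsub>K\<^esub> l)"
    have fl: "f (lift (y q)) \<in> carrier K" if "q \<in> carrier (P 0)" for q using Z'(1)[OF fZ ly(1)[OF that]] .
    have fy: "f (lift (y q)) = f p" if "q \<in> carrier (P 0)" "p \<in> carrier (P 1)" "d 0 p = y q" for q p
      by (rule Z_eq[OF fZ ly(1)[OF that(1)] that(2)]) (use ly(2)[OF that(1)] that(3) in simp)
    have "g \<in> lmod_hom A (P 0) (S W)"
    proof (rule lmod_hom_actionsI[OF P L])
      show "g q \<in> carrier (S W)" if "q \<in> carrier (P 0)" for q
        using that fl e'(1) l by (simp add: g_def S_simps)
      show "g (q \<oplus>\<^bsub>P 0\<^esub> q') = g q \<oplus>\<^bsub>S W\<^esub> g q'" if q: "q \<in> carrier (P 0)" and q': "q' \<in> carrier (P 0)" for q q'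
      proof -
        have c: "kact (P 0) (e q) x \<in> carrier (P 0)" "kact (P 0) (e q') x \<in> carrier (P 0)" using q q' e'(1) x by auto
        have "y (q \<oplus>\<^bsub>P 0\<^esub> q') = y q \<oplus>\<^bsub>P 0\<^esub> y q'"
        proof (rule y_eqI)
          have "(y q \<oplus>\<^bsub>P 0\<^esub> y q') \<oplus>\<^bsub>P 0\<^esub> (kact (P 0) (e q) x \<oplus>\<^bsub>P 0\<^esub> kact (P 0) (e q') x)
              = (y q \<oplus>\<^bsub>P 0\<^esub> kact (P 0) (e q) x) \<oplus>\<^bsub>P 0\<^esub> (y q' \<oplus>\<^bsub>P 0\<^esub> kact (P 0) (e q') x)"
            using y(1)[OF q] y(1)[OF q'] c by (simp add: P0.M.M.a_ac)
          then show "(y q \<oplus>\<^bsub>P 0\<^esub> y q') \<oplus>\<^bsub>P 0\<^esub> kact (P 0) (e (q \<oplus>\<^bsub>P 0\<^esub> q')) x = q \<oplus>\<^bsub>P 0\<^esub> q'"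
            unfolding qy[OF q] qy[OF q'] using q q' x e'(1) by (simp add: e'(2) P0.kact_add_l)
        qed (use q q' y in auto)
        then have "f (lift (y (q \<oplus>\<^bsub>P 0\<^esub> q'))) = f (lift (y q) \<oplus>\<^bsub>P 1\<^esub> lift (y q'))"
          using q q' ly by (intro fy) (auto simp: d0'(2))
        then show ?thesis using q q' ly Z'(2)[OF fZ] fl e' l by (simp add: g_def S_simps K.l_distr K.a_ac)
      qed
      show "g (kact (P 0) c q) = kact (S W) c (g q)" if c: "c \<in> carrier K" and q: "q \<in> carrier (P 0)" for c q
      proof -
        have "y (kact (P 0) c q) = kact (P 0) c (y q)"
        proof (rule y_eqI)
          have "kact (P 0) c (y q \<oplus>\<^bsub>P 0\<^esub> kact (P 0) (e q) x) = kact (P 0) c (y q) \<oplus>\<^bsub>P 0\<^esub> kact (P 0) (e (kact (P 0) c q)) x"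
            using c q x y(1)[OF q] e'(1)[OF q] by (simp add: P0.kact_add_r e'(3) P0.kact_assoc)
          then show "kact (P 0) c (y q) \<oplus>\<^bsub>P 0\<^esub> kact (P 0) (e (kact (P 0) c q)) x = kact (P 0) c q" unfolding qy[OF q] by simp
        qed (use c q y in auto)
        then have "f (lift (y (kact (P 0) c q))) = f (kact (P 1) c (lift (y q)))"
          using c q ly by (intro fy) (auto simp: d0'(3))
        then have "g (kact (P 0) c q) = c \<otimes>\<^bsub>K\<^esub> g q"
          using c q ly Z'(3)[OF fZ c] fl e' l by (simp add: g_def K.r_distr K.m_assoc)
        then show ?thesis using kact_S[OF W c, of "g q"] q fl e'(1) l by (simp add: g_def)
      qed
      show "g (bact (P 0) b q) = bact (S W) b (g q)" if b: "b \<in> carrier B" and q: "q \<in> carrier (P 0)" for b q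
      proof -
        have eq: "e q \<in> carrier K" by (rule e'(1)[OF q])
        let ?w = "bact (P 0) b (y q) \<oplus>\<^bsub>P 0\<^esub> kact (P 0) (e q) (r b)"
        let ?p = "bact (P 1) b (lift (y q)) \<oplus>\<^bsub>P 1\<^esub> kact (P 1) (e q) (lift (r b))"
        have pc: "bact (P 1) b (lift (y q)) \<in> carrier (P 1)" "kact (P 1) (e q) (lift (r b)) \<in> carrier (P 1)"
          using ly[OF q] lr[OF b] eq by auto
        have "y (bact (P 0) b q) = ?w"
        proof (rule y_eqI)
          have rb: "r b \<oplus>\<^bsub>P 0\<^esub> kact (P 0) (chi U b) x = bact (P 0) b x"
            unfolding r_def using x by (simp add: P0.M.M.minus_eq P0.M.M.a_assoc P0.M.M.l_neg)
          have "kact (P 0) (e (bact (P 0) b q)) x = kact (P 0) (e q) (kact (P 0) (chi U b) x)"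
            using b q x eq by (simp add: e'(4) P0.kact_assoc[symmetric] K.m_comm)
          then have "?w \<oplus>\<^bsub>P 0\<^esub> kact (P 0) (e (bact (P 0) b q)) x
              = bact (P 0) b (y q) \<oplus>\<^bsub>P 0\<^esub> kact (P 0) (e q) (r b \<oplus>\<^bsub>P 0\<^esub> kact (P 0) (chi U b) x)"
            using y(1)[OF q] r eq x by (simp add: P0.kact_add_r P0.M.M.a_assoc)
          also have "\<dots> = bact (P 0) b (y q \<oplus>\<^bsub>P 0\<^esub> kact (P 0) (e q) x)"
            unfolding rb using y(1)[OF q] x eq by (simp add: P0.bact_add P0.bact_kact)
          finally show "?w \<oplus>\<^bsub>P 0\<^esub> kact (P 0) (e (bact (P 0) b q)) x = bact (P 0) b q" unfolding qy[OF q] .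
        qed (use b q y r eq in auto)
        moreover have "d 0 ?p = ?w"
          using d0'(2)[OF pc] d0'(4)[OF ly(1)[OF q], of b] d0'(3)[OF lr(1)[OF b] eq] ly(2)[OF q] lr(2)[OF b] by simp
        ultimately have "f (lift (y (bact (P 0) b q))) = f ?p"
          using q pc by (intro fy) auto
        also have "\<dots> = chi W b \<otimes>\<^bsub>K\<^esub> f (lift (y q)) \<oplus>\<^bsub>K\<^esub> e q \<otimes>\<^bsub>K\<^esub> \<Delta> f b"
          using Z'(2)[OF fZ pc] Z'(4)[OF fZ b ly(1)[OF q]] Z'(3)[OF fZ eq lr(1)[OF b]] by (simp add: \<Delta>_def)
        also have "\<dots> = chi W b \<otimes>\<^bsub>K\<^esub> f (lift (y q)) \<oplus>\<^bsub>K\<^esub> e q \<otimes>\<^bsub>K\<^esub> ((chi W b \<ominus>\<^bsub>K\<^esub> chi U b) \<otimes>\<^bsub>K\<^esub> l)"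
          unfolding \<Delta>f[OF b] ..
        finally have 1: "f (lift (y (bact (P 0) b q))) = \<dots>" .
        have "g (bact (P 0) b q) = f (lift (y (bact (P 0) b q))) \<oplus>\<^bsub>K\<^esub> (chi U b \<otimes>\<^bsub>K\<^esub> e q) \<otimes>\<^bsub>K\<^esub> l"
          using b q by (simp add: g_def e'(4))
        also have "\<dots> = chi W b \<otimes>\<^bsub>K\<^esub> (f (lift (y q)) \<oplus>\<^bsub>K\<^esub> e q \<otimes>\<^bsub>K\<^esub> l)"
          unfolding 1 using fl[OF q] eq l
          by (cases "chi W b = \<one>\<^bsub>K\<^esub>"; cases "chi U b = \<one>\<^bsub>K\<^esub>")
            (auto simp: chi_def K.minus_eq K.r_neg K.l_minus K.r_minus K.a_assoc K.l_neg split: if_splits)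
        finally have "g (bact (P 0) b q) = chi W b \<otimes>\<^bsub>K\<^esub> g q" using q by (simp add: g_def)
        then show ?thesis using bact_S[OF W b, of "g q"] q fl eq l by (simp add: g_def)
      qed
    qed (simp add: g_def)
    moreover have "f = compose (carrier (P 1)) g (d 0)"
    proof (rule extensionalityI[of _ "carrier (P 1)"])
      show "f \<in> extensional (carrier (P 1))" using fZ Z_iff lmod_homD(4) by blast
      fix p assume p: "p \<in> carrier (P 1)"
      have dp: "d 0 p \<in> carrier (P 0)" by (rule d0'(1)[OF p])
      have "d 0 p \<in> {x \<in> carrier (P 0). e x = \<zero>\<^bsub>K\<^esub>}" unfolding ex0[symmetric] using p by blast
      then have e0: "e (d 0 p) = \<zero>\<^bsub>K\<^esub>" by simp
      then have "y (d 0 p) = d 0 p" using dp x by (simp add: y_def P0.M.M.minus_eq)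
      then have "f (lift (y (d 0 p))) = f p" using fy[OF dp p] by simp
      then show "f p = compose (carrier (P 1)) g (d 0) p"
        using p dp e0 l Z'(1)[OF fZ p] by (simp add: compose_def g_def)
    qed (simp add: compose_def)
    ultimately show "f \<in> coboundaries A P d (S W) 1" by (auto simp: One_nat_def)
  qed
  show ?thesis unfolding cohomology_def
    using quotient_space_free_dim[OF K.field_axioms LV C(1) T surj cob] by blast
qed

end

section \<open>Dimensions of the extension spaces and the quiver\<close>

context rh_lrb_algebra
begin

text \<open>The Hilbert choice in \<open>Ext_space\<close> yields a genuine resolution because
  \<open>length_one_resolution\<close> supplies one in the same type; nothing more is known about
  the chosen one.\<close>

lemma Ext_space_cohomology:
  assumes M: "left_module A (M :: ('b \<Rightarrow> 'k, 'm) module)"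
  obtains P d e where "projective_resolution A M P d e" "Ext_space A n M N = cohomology A P d N n"
proof -
  let ?p = "SOME (P :: nat \<Rightarrow> ('b \<Rightarrow> 'k, ('m \<times> ('b \<Rightarrow> 'k)) list) module, d, e). projective_resolution A M P d e"
  obtain P d e where p: "?p = (P, d, e)" by (metis surj_pair)
  have "\<exists>p :: (nat \<Rightarrow> ('b \<Rightarrow> 'k, ('m \<times> ('b \<Rightarrow> 'k)) list) module) \<times> _ \<times> _.
      case p of (P, d, e) \<Rightarrow> projective_resolution A M P d e"
    using length_one_resolution[OF M] by auto
  from someI_ex[OF this] have "projective_resolution A M P d e" by (simp only: p split_conv)
  moreover have "Ext_space A n M N = cohomology A P d N n"
    unfolding Ext_space_def p by (simp only: Let_def split_conv)
  ultimately show thesis by (rule that)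
qed

lemma Ext1_dim_zero:
  assumes U: "U \<in> support_lattice B" and W: "W \<in> support_lattice B" and UW: "\<not> U \<subset> W"
  shows "vectorspace K (Ext_space A 1 (S U) (S W)) \<and> vectorspace.fin_dim K (Ext_space A 1 (S U) (S W)) \<and>
    vectorspace.dim K (Ext_space A 1 (S U) (S W)) = 0"
proof -
  obtain P d e where P: "projective_resolution A (S U) P d e"
    "Ext_space A 1 (S U) (S W) = cohomology A P d (S W) 1"
    by (rule Ext_space_cohomology[OF left_module_S[OF U]])
  \<comment> \<open>With an empty set of coordinates the dimension count asks that every derivation
    be inner and that some derivation exist, for which zero serves; \<open>\<one>\<close> is an
    arbitrary base point.\<close>
  have "derivation U W (\<lambda>_. \<zero>\<^bsub>K\<^esub>)" by (simp add: derivation_def)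
  then show ?thesis unfolding P(2)
    using cohomology_dim[OF U W P(1), of "{}" \<one>] derivation_inner[OF _ U W UW] by fastforce
qed

lemma Ext1_dim_children:
  assumes U: "U \<in> support_lattice B" and y: "y \<in> carrier B" "U \<subset> supp B y"
  defines "E \<equiv> Ext_space A 1 (S U) (S (supp B y))"
  shows "vectorspace K E \<and> vectorspace.fin_dim K E \<and>
    vectorspace.dim K E = card (children_above y U) - 1"
proof -
  let ?W = "supp B y"
  have W: "?W \<in> support_lattice B" using y by (simp add: support_lattice_def)
  obtain P d e where P: "projective_resolution A (S U) P d e"
    "Ext_space A 1 (S U) (S ?W) = cohomology A P d (S ?W) 1"
    by (rule Ext_space_cohomology[OF left_module_S[OF U]])
  obtain z0 where z0: "z0 \<in> children_above y U" using children_above_nonempty[OF U y] by blast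
  \<comment> \<open>The base point \<open>z0\<close> is the child that is lost in the count:
    multiples of \<open>chi W - chi U\<close> are constant on the children, so only differences from
    the value at \<open>z0\<close> matter.\<close>
  let ?C = "children_above y U - {z0}"
  have chi: "chi U z = \<one>\<^bsub>K\<^esub>" "chi ?W z = \<zero>\<^bsub>K\<^esub>" if "z \<in> children_above y U" for z
    using that child_supp[OF y(1)] by (auto simp: chi_def)
  have "vectorspace K (cohomology A P d (S ?W) 1) \<and> vectorspace.fin_dim K (cohomology A P d (S ?W) 1) \<and>
    vectorspace.dim K (cohomology A P d (S ?W) 1) = card ?C"
  proof (rule cohomology_dim[OF U W P(1)])
    show "finite ?C" using finite_children_above by blast
    show "?C \<subseteq> carrier B" "z0 \<in> carrier B" using z0 childrenD(1) by blast+
    show "chi ?W z \<ominus>\<^bsub>K\<^esub> chi U z = chi ?W z0 \<ominus>\<^bsub>K\<^esub> chi U z0" if "z \<in> ?C" for z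
      using that chi z0 by simp
    show "inner_derivation U ?W \<delta>" if "derivation U ?W \<delta>" "\<And>z. z \<in> ?C \<Longrightarrow> \<delta> z = \<delta> z0" for \<delta>
    proof (rule derivation_constant_inner[OF that(1) U y z0])
      show "\<delta> z = \<delta> z0" if "z \<in> children_above y U" for z
        using \<open>\<And>z. z \<in> ?C \<Longrightarrow> \<delta> z = \<delta> z0\<close>[of z] that by (cases "z = z0") auto
    qed
    show "\<exists>\<delta>. derivation U ?W \<delta> \<and> (\<forall>z\<in>?C. \<delta> z \<ominus>\<^bsub>K\<^esub> \<delta> z0 = f z)" if f: "f \<in> ?C \<rightarrow> carrier K" for f
    proof -
      have fc: "f z \<in> carrier K" if "z \<in> ?C" for z using f that by blast
      \<comment> \<open>Prescribing zero at \<open>z0\<close> turns the required differences into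
        plain values.\<close>
      have "\<exists>\<delta>. derivation U ?W \<delta> \<and> (\<forall>z\<in>children_above y U. \<delta> z = (if z = z0 then \<zero>\<^bsub>K\<^esub> else f z))"
        by (rule derivation_extends[OF U y]) (use fc in auto)
      then obtain \<delta> where \<delta>: "derivation U ?W \<delta>"
        "\<And>z. z \<in> children_above y U \<Longrightarrow> \<delta> z = (if z = z0 then \<zero>\<^bsub>K\<^esub> else f z)" by blast
      have "\<delta> z \<ominus>\<^bsub>K\<^esub> \<delta> z0 = f z" if "z \<in> ?C" for z
        using that \<delta>(2)[of z] \<delta>(2)[OF z0] fc[OF that] by (simp add: K.minus_eq)
      then show ?thesis using \<delta>(1) by blast
    qed
  qed
  then show ?thesis unfolding E_def P(2) using z0 finite_children_above[of y U] by simp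
qed

text \<open>Ensures that the subtraction of one in \<open>Ext1_dim_children\<close> does not
  truncate, so that it passes to the integers.\<close>

lemma card_children_above_pos:
  assumes "U \<in> support_lattice B" "y \<in> carrier B" "U \<subset> supp B y"
  shows "1 \<le> card (children_above y U)"
  using children_above_nonempty[OF assms] finite_children_above by (simp add: Suc_le_eq card_gt_0_iff)

lemma is_quiver_monoid_algebra:
  "is_quiver TYPE('s) K A (support_lattice B) S (\<lambda>U W. vectorspace.dim K (Ext_space A 1 (S U) (S W)))"
proof -
  have "vectorspace K (Ext_space A 1 (S U) (S W)) \<and> vectorspace.fin_dim K (Ext_space A 1 (S U) (S W))"
    if U: "U \<in> support_lattice B" and W: "W \<in> support_lattice B" for U W
  proof (cases "U \<subset> W")
    case True
    obtain y where "y \<in> carrier B" "W = supp B y" using W by (auto simp: support_lattice_def)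
    then show ?thesis using Ext1_dim_children[OF U, of y] True by simp
  qed (use Ext1_dim_zero[OF U W] in simp)
  moreover have "U = W" if U: "U \<in> support_lattice B" and W: "W \<in> support_lattice B" and iso: "lmod_iso A (S U) (S W)" for U W
    using S_iso_subset[OF U W iso] S_iso_subset[OF W U lmod_iso_sym[OF left_module_S[OF U] left_module_S[OF W] iso]] by blast
  ultimately show ?thesis
    unfolding is_quiver_def using simple_S simple_module_iso_S by (auto simp: Let_def)
qed

end

theorem theorem11:
  fixes B :: "('b, 'x) monoid_scheme" and K :: "('k, 'y) ring_scheme"
  assumes "left_regular_band_monoid B" and "finite (carrier B)" and "right_hereditary B"
    and "field K"
  shows "hereditary TYPE('m) (monoid_algebra K B) \<and>
    (\<exists>q. is_quiver TYPE('s) K (monoid_algebra K B) (support_lattice B) (support_module K B) q \<and>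
           (\<forall>U\<in>support_lattice B. \<forall>W\<in>support_lattice B.
              (\<not> U \<subset> W \<longrightarrow> q U W = 0) \<and>
              (U \<subset> W \<longrightarrow> (\<forall>y\<in>carrier B. supp B y = W \<longrightarrow>
                 int (q U W) = int (card {z \<in> children B y. U \<subseteq> supp B z}) - 1))))"
proof -
  interpret left_regular_band_monoid B by fact
  interpret K: field K by fact
  interpret rh_lrb_algebra B K
    by unfold_locales (use assms in auto)
  let ?q = "\<lambda>U W. vectorspace.dim K (Ext_space A 1 (S U) (S W))"
  have "?q U W = 0" if "U \<in> support_lattice B" "W \<in> support_lattice B" "\<not> U \<subset> W" for U W
    using Ext1_dim_zero[OF that] by blast
  moreover have "int (?q U (supp B y)) = int (card (children_above y U)) - 1"
    if "U \<in> support_lattice B" "y \<in> carrier B" "U \<subset> supp B y" for U y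
    using Ext1_dim_children[OF that] card_children_above_pos[OF that] by simp
  ultimately show ?thesis
    using hereditary_monoid_algebra is_quiver_monoid_algebra by (intro conjI exI[of _ ?q]) auto
qed

end
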